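(* Let $n\ge1$ and let $Q$, $B$ be real $n\times n$ matrices with $Q$ symmetric positive semidefinite, such that $$\mathrm{Rank}\,[Q^{1/2},BQ^{1/2},\dots,B^{n-1}Q^{1/2}]=n\quad\text{and}\quad \sigma(B)\subset\mathbb{C}_-=\{z\in\mathbb{C}:\mathrm{Re}\,z<0\}.$$ Let $\mathscr{P}=\frac12\mathrm{Tr}(Q\nabla_x^2)-\langle Bx,\nabla_x\rangle-\mathrm{Tr}(B)$ be the associated Fokker-Planck operator acting on $L^2_{1/\rho}=L^2(\mathbb{R}^n,\rho(x)^{-1}dx)$. Let $T>0$ and let $\omega\subset\mathbb{R}^n$ be an open set such that $$\exists \delta,r>0,\ \forall y\in\mathbb{R}^n,\ \exists y'\in\omega,\quad B(y',r)\subset\omega \ \text{ and }\ |y-y'|<\delta .$$ Then $$\exists C_T>0,\ \forall g\in L^2_{1/\rho},\quad \|e^{T\mathscr{P}}g\|^2_{L^2(\mathbb{R}^n,\rho(x)^{-1}dx)}\le C_T\int_0^T\|e^{t\mathscr{P}}g\|^2_{L^2(\omega,\rho(x)^{-1}dx)}\,dt .$$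
   Context: $\sigma(B)$ is the spectrum of $B$; $Q^{1/2}$ is the symmetric positive semidefinite square root of $Q$; $B(y',r)$ is the Euclidean ball. $[Q^{1/2},BQ^{1/2},\dots,B^{n-1}Q^{1/2}]$ is the $n\times n^2$ matrix obtained by writing consecutively the columns of the $B^jQ^{1/2}$. The function $\rho$ is $$\rho(x)=\frac{1}{(2\pi)^{n/2}\sqrt{\det Q_\infty}}e^{-\frac12\langle Q_\infty^{-1}x,x\rangle},\qquad Q_\infty=\int_0^{+\infty}e^{sB}Qe^{sB^T}ds,$$ where $Q_\infty$ is symmetric positive definite under the assumptions. The operator $\mathscr{P}$ has domain $\{g\in L^2_{1/\rho}:\mathscr{P}g\in L^2_{1/\rho}\}$, and $(e^{t\mathscr{P}})_{t\ge0}$ is the strongly continuous semigroup on $L^2_{1/\rho}$ with infinitesimal generator $\mathscr{P}$ (i.e. solving $\partial_tf=\mathscr{P}f$). *)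

theory Defs
  imports "HOL-Analysis.Analysis"
begin

section \<open>Matrices\<close>

definition matrix_power :: "real^'n^'n \<Rightarrow> nat \<Rightarrow> real^'n^'n" where
  "matrix_power A k = (((**) A) ^^ k) (mat 1)"

definition matrix_exp :: "real^'n^'n \<Rightarrow> real^'n^'n" where
  "matrix_exp A = (\<Sum>k. (1 / fact k) *\<^sub>R matrix_power A k)"

definition sym_pos_semidef :: "real^'n^'n \<Rightarrow> bool" where
  "sym_pos_semidef A \<longleftrightarrow> transpose A = A \<and> (\<forall>x. 0 \<le> x \<bullet> (A *v x))"

definition matrix_sqrt :: "real^'n^'n \<Rightarrow> real^'n^'n" where
  "matrix_sqrt Q = (THE R. sym_pos_semidef R \<and> R ** R = Q)"

definition complex_matrix :: "real^'n^'m \<Rightarrow> complex^'n^'m" where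
  "complex_matrix A = (\<chi> i j. complex_of_real (A $ i $ j))"

definition matrix_spectrum :: "real^'n^'n \<Rightarrow> complex set" where
  "matrix_spectrum A = {z. \<not> invertible (mat z - complex_matrix A)}"

(* The n x n^2 matrix [Q^(1/2), B Q^(1/2), ..., B^(n-1) Q^(1/2)].  Its columns are indexed by
   pairs (j, k): the map to_nat_on UNIV numbers the index type 'n bijectively by
   0, ..., CARD('n) - 1, and the column (j, k) is the k-th column of the block whose exponent
   is the number of j. *)
definition kalman_matrix :: "real^'n^'n \<Rightarrow> real^'n^'n \<Rightarrow> real^('n \<times> 'n)^'n" where
  "kalman_matrix Q B =
     (\<chi> i p. (matrix_power B (to_nat_on (UNIV :: 'n set) (fst p)) ** matrix_sqrt Q) $ i $ snd p)"

lemma columns_kalman_matrix: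
  fixes Q B :: "real^'n^'n"
  shows "columns (kalman_matrix Q B) =
    (\<Union>m<CARD('n). columns (matrix_power B m ** matrix_sqrt Q))"
proof -
  have *: "{..<CARD('n)} = range (to_nat_on (UNIV :: 'n set))"
    using to_nat_on_finite[of "UNIV :: 'n set"] by (simp add: bij_betw_def)
  have c: "column (j, k) (kalman_matrix Q B) =
      column k (matrix_power B (to_nat_on (UNIV :: 'n set) j) ** matrix_sqrt Q)" for j k
    by (simp add: column_def kalman_matrix_def)
  show ?thesis
    unfolding * columns_def by (auto simp: c)
qed

section \<open>The weight\<close>

definition Q_infinity :: "real^'n^'n \<Rightarrow> real^'n^'n \<Rightarrow> real^'n^'n" where
  "Q_infinity Q B =
     (LBINT s:{0..}. matrix_exp (s *\<^sub>R B) ** Q ** matrix_exp (s *\<^sub>R transpose B))"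

definition rho :: "real^'n^'n \<Rightarrow> real^'n^'n \<Rightarrow> real^'n \<Rightarrow> real" where
  "rho Q B x =
     1 / ((2 * pi) powr (real CARD('n) / 2) * sqrt (det (Q_infinity Q B)))
       * exp (- (1/2) * ((matrix_inv (Q_infinity Q B) *v x) \<bullet> x))"

definition weighted_measure :: "real^'n^'n \<Rightarrow> real^'n^'n \<Rightarrow> (real^'n) measure" where
  "weighted_measure Q B = density lborel (\<lambda>x. ennreal (1 / rho Q B x))"

section \<open>Square-integrable functions and semigroups\<close>

(* Elements of L^2 are represented by functions, with equality almost everywhere playing the role
   of equality in L^2.  The functions are complex-valued. *)
definition L2_space :: "'a measure \<Rightarrow> ('a \<Rightarrow> complex) set" where
  "L2_space M = {f \<in> borel_measurable M. integrable M (\<lambda>x. (cmod (f x))\<^sup>2)}"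

definition L2_norm :: "'a measure \<Rightarrow> ('a \<Rightarrow> complex) \<Rightarrow> real" where
  "L2_norm M f = sqrt (LINT x|M. (cmod (f x))\<^sup>2)"

(* Linearity and boundedness together make U respect equality almost everywhere, so that U
   is a bounded operator on the space of classes. *)
definition L2_bounded_operator ::
    "'a measure \<Rightarrow> (('a \<Rightarrow> complex) \<Rightarrow> ('a \<Rightarrow> complex)) \<Rightarrow> bool" where
  "L2_bounded_operator M U \<longleftrightarrow>
     (\<forall>f\<in>L2_space M. U f \<in> L2_space M) \<and>
     (\<forall>f\<in>L2_space M. \<forall>g\<in>L2_space M.
        AE x in M. U (\<lambda>y. f y + g y) x = U f x + U g x) \<and>
     (\<forall>c. \<forall>f\<in>L2_space M. AE x in M. U (\<lambda>y. c * f y) x = c * U f x) \<and>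
     (\<exists>K. \<forall>f\<in>L2_space M. L2_norm M (U f) \<le> K * L2_norm M f)"

definition strongly_continuous_semigroup ::
    "'a measure \<Rightarrow> (real \<Rightarrow> ('a \<Rightarrow> complex) \<Rightarrow> ('a \<Rightarrow> complex)) \<Rightarrow> bool" where
  "strongly_continuous_semigroup M S \<longleftrightarrow>
     (\<forall>t\<ge>0. L2_bounded_operator M (S t)) \<and>
     (\<forall>f\<in>L2_space M. AE x in M. S 0 f x = f x) \<and>
     (\<forall>s\<ge>0. \<forall>t\<ge>0. \<forall>f\<in>L2_space M. AE x in M. S (s + t) f x = S s (S t f) x) \<and>
     (\<forall>f\<in>L2_space M. ((\<lambda>t. L2_norm M (\<lambda>x. S t f x - f x)) \<longlongrightarrow> 0) (at_right 0))"

(* Unbounded operators on L^2 are represented by their graphs. *)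
definition infinitesimal_generator ::
    "'a measure \<Rightarrow> (real \<Rightarrow> ('a \<Rightarrow> complex) \<Rightarrow> ('a \<Rightarrow> complex))
      \<Rightarrow> (('a \<Rightarrow> complex) \<times> ('a \<Rightarrow> complex)) set" where
  "infinitesimal_generator M S =
     {(f, h). f \<in> L2_space M \<and> h \<in> L2_space M \<and>
        ((\<lambda>t. L2_norm M (\<lambda>x. (S t f x - f x) / complex_of_real t - h x)) \<longlongrightarrow> 0) (at_right 0)}"

section \<open>Distributions and the Fokker-Planck operator\<close>

definition partial :: "'n \<Rightarrow> (real^'n \<Rightarrow> complex) \<Rightarrow> real^'n \<Rightarrow> complex" where
  "partial i \<phi> x = frechet_derivative \<phi> (at x) (axis i 1)"

primrec continuously_differentiable :: "nat \<Rightarrow> (real^'n \<Rightarrow> complex) \<Rightarrow> bool" where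
  "continuously_differentiable 0 \<phi> \<longleftrightarrow> continuous_on UNIV \<phi>"
| "continuously_differentiable (Suc k) \<phi> \<longleftrightarrow>
     \<phi> differentiable_on UNIV \<and> (\<forall>i. continuously_differentiable k (partial i \<phi>))"

definition test_functions :: "(real^'n \<Rightarrow> complex) set" where
  "test_functions =
     {\<phi>. (\<forall>k. continuously_differentiable k \<phi>) \<and> compact (closure {x. \<phi> x \<noteq> 0})}"

(* A distribution is represented by a functional that is only relevant on test_functions.
   Continuity need not be imposed: the functionals that occur below are obtained by
   differentiation and multiplication from locally integrable functions. *)
type_synonym 'n distribution = "(real^'n \<Rightarrow> complex) \<Rightarrow> complex"

definition regular_distribution :: "(real^'n \<Rightarrow> complex) \<Rightarrow> 'n distribution" where
  "regular_distribution g \<phi> = (LINT x|lborel. g x * \<phi> x)"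

definition dist_partial :: "'n::finite \<Rightarrow> 'n distribution \<Rightarrow> 'n distribution" where
  "dist_partial i u \<phi> = - u (partial i \<phi>)"

definition dist_mult :: "(real^'n \<Rightarrow> real) \<Rightarrow> 'n distribution \<Rightarrow> 'n distribution" where
  "dist_mult a u \<phi> = u (\<lambda>x. complex_of_real (a x) * \<phi> x)"

(* P u = 1/2 Tr(Q Hess u) - <B x, grad u> - Tr(B) u *)
definition fokker_planck_dist ::
    "real^('n::finite)^'n \<Rightarrow> real^'n^'n \<Rightarrow> 'n distribution \<Rightarrow> 'n distribution" where
  "fokker_planck_dist Q B u \<phi> =
     1/2 * trace (complex_matrix Q ** (\<chi> i j. dist_partial i (dist_partial j u) \<phi>))
     - (\<Sum>i\<in>UNIV. dist_mult (\<lambda>x. (B *v x) $ i) (dist_partial i u) \<phi>)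
     - complex_of_real (trace B) * u \<phi>"

(* The graph of P on the domain of all g in L^2 whose distributional image P g is in L^2. *)
definition fokker_planck_operator ::
    "real^'n^'n \<Rightarrow> real^'n^'n \<Rightarrow> ((real^'n \<Rightarrow> complex) \<times> (real^'n \<Rightarrow> complex)) set" where
  "fokker_planck_operator Q B =
     {(g, h). g \<in> L2_space (weighted_measure Q B) \<and> h \<in> L2_space (weighted_measure Q B) \<and>
        (\<forall>\<phi>\<in>test_functions.
           fokker_planck_dist Q B (regular_distribution g) \<phi> = regular_distribution h \<phi>)}"

end

theory Submission
  imports Defs "HOL-Probability.Probability" "HOL-Complex_Analysis.Complex_Analysis"
    "HOL-Computational_Algebra.Fundamental_Theorem_Algebra"
begin

text \<open>Write \<open>\<gamma>\<close> for the Gaussian \<open>\<rho>\<close> up to its constant.  The semigroup maps \<open>\<gamma>\<close> times a plane wave of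
  frequency \<open>w\<close> to \<open>\<gamma>\<close> times a plane wave of frequency \<open>Q\<^sub>\<infinity>\<^sup>-\<^sup>1 e\<^sup>t\<^sup>B Q\<^sub>\<infinity> w\<close>, with explicit amplitudes, so
  that on the dense set of linear combinations of such functions it is Mehler's formula.  By the rank
  condition it contracts the quadratic form of \<open>Q\<^sub>\<infinity>\<close> by a factor \<open>1 - c t\<^sup>k\<close>; hence \<open>f = e\<^sup>t\<^sup>P g / \<gamma>\<close>
  extends to an entire function and \<open>\<parallel>f(\<cdot> + i y)\<parallel> \<le> e\<^bsup>C |y|\<^sup>2 / t\<^sup>k\<^esup> \<parallel>g / \<gamma>\<parallel>\<close> in \<open>L\<^sup>2(\<gamma>)\<close>.

  Translation by a fixed vector \<open>d\<close> is not bounded on \<open>L\<^sup>2(\<gamma>)\<close>, but it is an isometry for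
  \<open>v = \<gamma>\<^sup>1\<^sup>/\<^sup>2 f\<close> in \<open>L\<^sup>2(dx)\<close>.  The thickness condition provides finitely many vectors \<open>d\<close> and sets \<open>Y\<^sub>d\<close>
  covering the space with \<open>Y\<^sub>d + s d\<close> contained in \<open>\<omega>\<close> for \<open>1 \<le> s \<le> 1 + \<eta>\<close>.  Lagrange extrapolation of the
  entire function \<open>s \<mapsto> v(x + s d)\<close> from \<open>N\<close> nodes in \<open>[1, 1 + \<eta>]\<close> to \<open>s = 0\<close> therefore gives
  \<open>\<parallel>e\<^sup>t\<^sup>P g\<parallel> \<le> C a\<^sup>N \<parallel>e\<^sup>t\<^sup>P g\<parallel>\<^sub>\<omega> + C 2\<^sup>-\<^sup>N e\<^bsup>C / t\<^sup>k\<^esup> \<parallel>g\<parallel>\<close> for every \<open>N\<close>.  Used on the intervals of a geometric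
  sequence of times with suitable \<open>N\<close>, these inequalities telescope to the observability estimate.\<close>

text \<open>The semigroup \<open>S\<close> is known only through its generator. On the waves it is
  identified by uniqueness: \<open>psi (wpath w t)\<close> is an explicit curve in the domain that
  solves the equation, and such a curve is an orbit. Dividing by \<gamma> replaces the growing
  weight 1/\<rho> by a finite measure, for which bounded trigonometric polynomials are dense; so the
  estimate at a single time is proved for finite sums of waves, with constants independent of the
  sum. The operator is in general neither self-adjoint nor elliptic, so no spectral projections are
  at hand. The number N of nodes takes the place of a frequency cut-off: the extrapolation weights
  grow like a^N, and the entire extension is controlled on a circle of fixed radius R = 4 a, chosen
  such that a^N (2/R)^N = 2^-N. The cost e^(C/t^k) of that circle may have any power k, since N can
  be taken proportional to t^-(k+1). The constraint is that the weights of the telescoping sum must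
  absorb a^N at each time, while their change from one time to the next is covered by 2^-N; this
  forces the ratio of successive times to be close to 1.\<close>

no_notation fps_nth (infixl "$" 75)


section \<open>L2 spaces\<close>

lemma L2_norm_nonneg [simp]: "0 \<le> L2_norm M f"
  by (simp add: L2_norm_def)

lemma L2_norm_sq: "(L2_norm M f)\<^sup>2 = (LINT x|M. (cmod (f x))\<^sup>2)"
  by (simp add: L2_norm_def)

lemma L2_space_measurable: "f \<in> L2_space M \<Longrightarrow> f \<in> borel_measurable M"
  by (simp add: L2_space_def)

lemma L2_space_integrable: "f \<in> L2_space M \<Longrightarrow> integrable M (\<lambda>x. (cmod (f x))\<^sup>2)"
  by (simp add: L2_space_def)

lemma L2_norm_cong_AE:
  assumes "f \<in> borel_measurable M" "g \<in> borel_measurable M" "AE x in M. f x = g x"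
  shows "L2_norm M f = L2_norm M g"
  unfolding L2_norm_def using assms by (intro arg_cong[of _ _ sqrt] integral_cong_AE) auto

lemma nn_integral_L2:
  assumes "f \<in> L2_space M"
  shows "(\<integral>\<^sup>+x. ennreal ((cmod (f x))\<^sup>2) \<partial>M) = ennreal ((L2_norm M f)\<^sup>2)"
  unfolding L2_norm_sq using assms by (intro nn_integral_eq_integral) (auto simp: L2_space_def)

lemma L2_norm_le_nn_integral:
  assumes [measurable]: "f \<in> borel_measurable M" and "c \<ge> 0"
    and le: "(\<integral>\<^sup>+x. ennreal ((cmod (f x))\<^sup>2) \<partial>M) \<le> ennreal (c\<^sup>2)"
  shows "f \<in> L2_space M" "L2_norm M f \<le> c"
proof -
  have "integrable M (\<lambda>x. (cmod (f x))\<^sup>2)"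
    by (rule integrableI_bounded) (use le_less_trans[OF le] in simp_all)
  then show 1: "f \<in> L2_space M" by (simp add: L2_space_def)
  have "(L2_norm M f)\<^sup>2 \<le> c\<^sup>2"
    using le unfolding nn_integral_L2[OF 1] by simp
  then show "L2_norm M f \<le> c"
    using \<open>c \<ge> 0\<close> by (rule power2_le_imp_le)
qed

lemma L2_norm_le_integral:
  assumes "f \<in> borel_measurable M" "integrable M w" "c \<ge> 0"
    and "AE x in M. (cmod (f x))\<^sup>2 \<le> w x" "integral\<^sup>L M w \<le> c\<^sup>2"
  shows "f \<in> L2_space M" "L2_norm M f \<le> c"
proof -
  show 1: "f \<in> L2_space M"
    unfolding L2_space_def using assms
    by (auto intro!: Bochner_Integration.integrable_bound[OF assms(2)])
  have "(L2_norm M f)\<^sup>2 \<le> integral\<^sup>L M w"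
    unfolding L2_norm_sq by (rule integral_mono_AE[OF L2_space_integrable[OF 1] assms(2,4)])
  with assms(5) have "(L2_norm M f)\<^sup>2 \<le> c\<^sup>2" by linarith
  then show "L2_norm M f \<le> c" using \<open>c \<ge> 0\<close> by (rule power2_le_imp_le)
qed

text \<open>Young's inequality with weights adapted to Minkowski: if \<open>F\<close> and
  \<open>G\<close> are the norms of the two summands, the integral of the right side is exactly (F +
  G)^2.\<close>

lemma sum_sq_le_weighted:
  fixes a b F G :: real
  assumes "F > 0" "G > 0"
  shows "(a + b)\<^sup>2 \<le> (1 + G / F) * a\<^sup>2 + (1 + F / G) * b\<^sup>2"
proof -
  have "(1 + G / F) * a\<^sup>2 + (1 + F / G) * b\<^sup>2 - (a + b)\<^sup>2 = (G * a - F * b)\<^sup>2 / (F * G)"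
    using assms by (simp add: field_simps power2_eq_square)
  also have "\<dots> \<ge> 0" using assms by simp
  finally show ?thesis by linarith
qed

lemma L2_add:
  assumes f: "f \<in> L2_space M" and g: "g \<in> L2_space M"
  shows "(\<lambda>x. f x + g x) \<in> L2_space M"
    and "L2_norm M (\<lambda>x. f x + g x) \<le> L2_norm M f + L2_norm M g"
proof -
  have [measurable]: "f \<in> borel_measurable M" "g \<in> borel_measurable M"
    using f g by (auto simp: L2_space_def)
  \<comment> \<open>\<open>F\<close> and \<open>G\<close> strictly exceed the norms, so that
    division by them is possible even for vectors of norm 0; the excess tends to 0 at the
    end.\<close>
  have *: "(\<lambda>x. f x + g x) \<in> L2_space M \<and> L2_norm M (\<lambda>x. f x + g x) \<le> F + G"
    if "F > L2_norm M f" "G > L2_norm M g" for F G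
  proof -
    have FG: "F > 0" "G > 0"
      using that by (auto intro: le_less_trans[OF L2_norm_nonneg])
    let ?w = "\<lambda>x. (1 + G / F) * (cmod (f x))\<^sup>2 + (1 + F / G) * (cmod (g x))\<^sup>2"
    have int: "integrable M ?w" using f g by (simp add: L2_space_integrable)
    have "integral\<^sup>L M ?w = (1 + G / F) * (L2_norm M f)\<^sup>2 + (1 + F / G) * (L2_norm M g)\<^sup>2"
      using f g by (simp add: L2_space_integrable L2_norm_sq)
    also have "\<dots> \<le> (1 + G / F) * F\<^sup>2 + (1 + F / G) * G\<^sup>2"
      using that FG by (intro add_mono mult_left_mono power_mono) auto
    also have "\<dots> = (F + G)\<^sup>2"
      using FG by (simp add: field_simps power2_eq_square)
    finally have le: "integral\<^sup>L M ?w \<le> (F + G)\<^sup>2" .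
    have "(cmod (f x + g x))\<^sup>2 \<le> ?w x" for x
      using order_trans[OF power_mono[OF norm_triangle_ineq] sum_sq_le_weighted[OF FG]] by simp
    then show ?thesis
      using L2_norm_le_integral[OF _ int _ _ le, of "\<lambda>x. f x + g x"] FG by auto
  qed
  show "(\<lambda>x. f x + g x) \<in> L2_space M"
    using *[of "L2_norm M f + 1" "L2_norm M g + 1"] by simp
  show "L2_norm M (\<lambda>x. f x + g x) \<le> L2_norm M f + L2_norm M g"
  proof (rule field_le_epsilon)
    fix e :: real assume "e > 0"
    then show "L2_norm M (\<lambda>x. f x + g x) \<le> L2_norm M f + L2_norm M g + e"
      using *[of "L2_norm M f + e/2" "L2_norm M g + e/2"] by simp
  qed
qed

lemma L2_scale:
  assumes "f \<in> L2_space M"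
  shows "(\<lambda>x. c * f x) \<in> L2_space M"
    and "L2_norm M (\<lambda>x. c * f x) = cmod c * L2_norm M f"
  using assms by (auto simp: L2_space_def L2_norm_def norm_mult power_mult_distrib real_sqrt_mult)

lemma L2_minus:
  assumes "f \<in> L2_space M"
  shows "(\<lambda>x. - f x) \<in> L2_space M" "L2_norm M (\<lambda>x. - f x) = L2_norm M f"
  using L2_scale[OF assms, of "-1"] by auto

lemma L2_zero: "(\<lambda>x. 0) \<in> L2_space M" "L2_norm M (\<lambda>x. 0) = 0"
  by (auto simp: L2_space_def L2_norm_def)

lemma L2_diff:
  assumes "f \<in> L2_space M" "g \<in> L2_space M"
  shows "(\<lambda>x. f x - g x) \<in> L2_space M"
    and "L2_norm M (\<lambda>x. f x - g x) \<le> L2_norm M f + L2_norm M g"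
  using L2_add[OF assms(1) L2_minus(1)[OF assms(2)]] L2_minus(2)[OF assms(2)] by auto

lemma L2_norm_minus_commute:
  "L2_norm M (\<lambda>x. f x - g x) = L2_norm M (\<lambda>x. g x - f x)"
  by (simp add: L2_norm_def norm_minus_commute)

lemma L2_triangle:
  assumes "f \<in> L2_space M" "g \<in> L2_space M" "h \<in> L2_space M"
  shows "L2_norm M (\<lambda>x. f x - h x) \<le> L2_norm M (\<lambda>x. f x - g x) + L2_norm M (\<lambda>x. g x - h x)"
  using L2_add(2)[OF L2_diff(1)[OF assms(1,2)] L2_diff(1)[OF assms(2,3)]] by simp

lemma L2_norm_le_add_diff:
  assumes "f \<in> L2_space M" "g \<in> L2_space M"
  shows "L2_norm M f \<le> L2_norm M g + L2_norm M (\<lambda>x. f x - g x)"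
  using L2_add(2)[OF assms(2) L2_diff(1)[OF assms]] by simp

lemma L2_norm_diff_triangle:
  assumes "f \<in> L2_space M" "g \<in> L2_space M"
  shows "\<bar>L2_norm M f - L2_norm M g\<bar> \<le> L2_norm M (\<lambda>x. f x - g x)"
  using L2_norm_le_add_diff[OF assms] L2_norm_le_add_diff[OF assms(2,1)]
    L2_norm_minus_commute[of M f g] by linarith

lemma L2_sum:
  assumes "finite I" "\<And>i. i \<in> I \<Longrightarrow> f i \<in> L2_space M"
  shows "(\<lambda>x. \<Sum>i\<in>I. f i x) \<in> L2_space M"
    and "L2_norm M (\<lambda>x. \<Sum>i\<in>I. f i x) \<le> (\<Sum>i\<in>I. L2_norm M (f i))"
proof -
  have "(\<lambda>x. \<Sum>i\<in>I. f i x) \<in> L2_space M \<and> L2_norm M (\<lambda>x. \<Sum>i\<in>I. f i x) \<le> (\<Sum>i\<in>I. L2_norm M (f i))"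
    using assms
  proof (induction I)
    case empty
    then show ?case by (simp add: L2_zero)
  next
    case (insert i I)
    then have "f i \<in> L2_space M" "(\<lambda>x. \<Sum>i\<in>I. f i x) \<in> L2_space M" by auto
    from L2_add[OF this] insert show ?case by auto
  qed
  then show "(\<lambda>x. \<Sum>i\<in>I. f i x) \<in> L2_space M"
    and "L2_norm M (\<lambda>x. \<Sum>i\<in>I. f i x) \<le> (\<Sum>i\<in>I. L2_norm M (f i))" by auto
qed

lemma L2_tendsto_dominated:
  fixes f :: "nat \<Rightarrow> 'a \<Rightarrow> complex"
  assumes [measurable]: "\<And>n. f n \<in> borel_measurable M" "g \<in> borel_measurable M"
    and w: "integrable M (\<lambda>x. (w x)\<^sup>2)"
    and bound: "\<And>n x. x \<in> space M \<Longrightarrow> cmod (f n x - g x) \<le> w x"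
    and lim: "\<And>x. x \<in> space M \<Longrightarrow> (\<lambda>n. f n x) \<longlonglongrightarrow> g x"
  shows "(\<lambda>n. L2_norm M (\<lambda>x. f n x - g x)) \<longlonglongrightarrow> 0"
proof -
  have "(\<lambda>n. LINT x|M. (cmod (f n x - g x))\<^sup>2) \<longlonglongrightarrow> (LINT x|M. 0)"
  proof (rule integral_dominated_convergence[OF _ _ w])
    show "AE x in M. (\<lambda>n. (cmod (f n x - g x))\<^sup>2) \<longlonglongrightarrow> 0"
    proof (rule AE_I2)
      fix x assume "x \<in> space M"
      from lim[OF this] have "(\<lambda>n. (cmod (f n x - g x))\<^sup>2) \<longlonglongrightarrow> (cmod (g x - g x))\<^sup>2"
        by (intro tendsto_intros)
      then show "(\<lambda>n. (cmod (f n x - g x))\<^sup>2) \<longlonglongrightarrow> 0" by simp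
    qed
    show "AE x in M. norm ((cmod (f n x - g x))\<^sup>2) \<le> (w x)\<^sup>2" for n
      using bound by (auto intro!: power_mono)
  qed auto
  then have "(\<lambda>n. sqrt (LINT x|M. (cmod (f n x - g x))\<^sup>2)) \<longlonglongrightarrow> sqrt 0"
    by (intro tendsto_real_sqrt) simp
  then show ?thesis by (simp add: L2_norm_def)
qed

text \<open>Riesz-Fischer for series: the sums of the moduli are bounded in L2 by the sums of
  \<open>a\<close>, so the series converges absolutely almost everywhere. The explicit tail bound is
  what the hump argument below uses.\<close>

lemma L2_series_complete:
  fixes f :: "nat \<Rightarrow> 'a \<Rightarrow> complex"
  assumes f: "\<And>n. f n \<in> L2_space M" and a: "\<And>n. L2_norm M (f n) \<le> a n" and sa: "summable a"
  obtains g where "g \<in> L2_space M"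
    "\<And>n. L2_norm M (\<lambda>x. g x - (\<Sum>k<n. f k x)) \<le> (\<Sum>k. a (k + n))"
proof -
  have fm [measurable]: "f n \<in> borel_measurable M" for n using f by (auto simp: L2_space_def)
  have a0: "0 \<le> a n" for n using order_trans[OF L2_norm_nonneg a] .
  have nf: "(\<lambda>x. complex_of_real (cmod (f n x))) \<in> L2_space M"
    "L2_norm M (\<lambda>x. complex_of_real (cmod (f n x))) = L2_norm M (f n)" for n
    using f[of n] by (auto simp: L2_space_def L2_norm_def)
  have fin: "(\<integral>\<^sup>+x. (ennreal (\<Sum>k<m. cmod (f (k + n) x)))\<^sup>2 \<partial>M) \<le> ennreal ((\<Sum>k. a (k + n))\<^sup>2)" for n m
  proof -
    note S = L2_sum[of "{..<m}" "\<lambda>k x. complex_of_real (cmod (f (k + n) x))" M, OF _ nf(1)]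
    have "L2_norm M (\<lambda>x. \<Sum>k<m. complex_of_real (cmod (f (k + n) x))) \<le> (\<Sum>k<m. a (k + n))"
      using S(2) by (rule order_trans) (auto simp: nf(2) intro!: sum_mono a)
    also have "\<dots> \<le> (\<Sum>k. a (k + n))"
      using summable_ignore_initial_segment[OF sa] a0 by (intro sum_le_suminf) simp_all
    finally have *: "(L2_norm M (\<lambda>x. \<Sum>k<m. complex_of_real (cmod (f (k + n) x))))\<^sup>2 \<le> (\<Sum>k. a (k + n))\<^sup>2"
      by (intro power_mono) auto
    have "(\<integral>\<^sup>+x. (ennreal (\<Sum>k<m. cmod (f (k + n) x)))\<^sup>2 \<partial>M)
       = (\<integral>\<^sup>+x. ennreal ((cmod (\<Sum>k<m. complex_of_real (cmod (f (k + n) x))))\<^sup>2) \<partial>M)"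
      by (intro nn_integral_cong)
         (simp add: ennreal_power sum_nonneg del: of_real_sum flip: of_real_sum)
    also have "\<dots> = ennreal ((L2_norm M (\<lambda>x. \<Sum>k<m. complex_of_real (cmod (f (k + n) x))))\<^sup>2)"
      by (rule nn_integral_L2) (use S(1) in auto)
    also have "\<dots> \<le> ennreal ((\<Sum>k. a (k + n))\<^sup>2)" by (intro ennreal_leI *)
    finally show ?thesis .
  qed
  \<comment> \<open>Monotone convergence in \<open>ennreal\<close>, where the value \<infinity> is
    still allowed; finiteness almost everywhere is the consequence drawn in
    \<open>ae\<close>.\<close>
  have tail: "(\<integral>\<^sup>+x. (\<Sum>k. ennreal (cmod (f (k + n) x)))\<^sup>2 \<partial>M) \<le> ennreal ((\<Sum>k. a (k + n))\<^sup>2)" for n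
  proof -
    have "(\<lambda>m. (ennreal (\<Sum>k<m. cmod (f (k + n) x)))\<^sup>2) \<longlonglongrightarrow> (\<Sum>k. ennreal (cmod (f (k + n) x)))\<^sup>2" for x
    proof -
      have L: "(\<lambda>m. \<Sum>k<m. ennreal (cmod (f (k + n) x))) \<longlonglongrightarrow> (\<Sum>k. ennreal (cmod (f (k + n) x)))"
        by (rule summable_LIMSEQ[OF summableI])
      have N: "\<not> (l = 0 \<and> l = \<infinity> \<or> l = \<infinity> \<and> l = 0)" for l :: ennreal
        by (cases l) auto
      have "ennreal (\<Sum>k<m. cmod (f (k + n) x)) = (\<Sum>k<m. ennreal (cmod (f (k + n) x)))" for m
        by (rule sum_ennreal[symmetric]) simp
      then show ?thesis
        unfolding power2_eq_square using tendsto_mult_ennreal[OF L L N] by (simp only:)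
    qed note lim = this
    have "(\<lambda>m. \<integral>\<^sup>+x. (ennreal (\<Sum>k<m. cmod (f (k + n) x)))\<^sup>2 \<partial>M) \<longlonglongrightarrow> (\<integral>\<^sup>+x. (\<Sum>k. ennreal (cmod (f (k + n) x)))\<^sup>2 \<partial>M)"
      by (rule nn_integral_LIMSEQ[OF _ _ lim])
        (auto simp: incseq_def le_fun_def intro!: power_mono ennreal_leI sum_mono2)
    then show ?thesis by (rule LIMSEQ_le_const2) (use fin in auto)
  qed
  \<comment> \<open>Where the series diverges, \<open>suminf\<close> has an unspecified value; by
    \<open>ae\<close> this happens only on a null set.\<close>
  define g where "g x = (\<Sum>k. f k x)" for x
  have gm [measurable]: "g \<in> borel_measurable M" unfolding g_def by measurable
  have ae: "AE x in M. summable (\<lambda>k. cmod (f k x))"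
  proof -
    have "(\<integral>\<^sup>+x. (\<Sum>k. ennreal (cmod (f k x)))\<^sup>2 \<partial>M) \<noteq> \<infinity>"
      using tail[of 0] by (auto simp: top_unique)
    then have "AE x in M. (\<Sum>k. ennreal (cmod (f k x)))\<^sup>2 \<noteq> \<infinity>"
      by (intro nn_integral_PInf_AE) auto
    then show ?thesis
    proof eventually_elim
      case (elim x)
      then have "(\<Sum>k. ennreal (cmod (f k x))) \<noteq> \<top>" by (auto simp: power2_eq_square)
      then show ?case by (intro summable_suminf_not_top) auto
    qed
  qed
  have bd: "(\<lambda>x. g x - (\<Sum>k<n. f k x)) \<in> L2_space M \<and> L2_norm M (\<lambda>x. g x - (\<Sum>k<n. f k x)) \<le> (\<Sum>k. a (k + n))" for n
  proof -
    have "(\<integral>\<^sup>+x. ennreal ((cmod (g x - (\<Sum>k<n. f k x)))\<^sup>2) \<partial>M) \<le> (\<integral>\<^sup>+x. (\<Sum>k. ennreal (cmod (f (k + n) x)))\<^sup>2 \<partial>M)"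
    proof (rule nn_integral_mono_AE, use ae in eventually_elim)
      case (elim x)
      then have s: "summable (\<lambda>k. cmod (f (k + n) x))" by (rule summable_ignore_initial_segment)
      have "g x - (\<Sum>k<n. f k x) = (\<Sum>k. f (k + n) x)"
        unfolding g_def using suminf_split_initial_segment[OF summable_norm_cancel[OF elim], of n] by simp
      then have "cmod (g x - (\<Sum>k<n. f k x)) \<le> (\<Sum>k. cmod (f (k + n) x))"
        using summable_norm[OF s] by simp
      then have "ennreal ((cmod (g x - (\<Sum>k<n. f k x)))\<^sup>2) \<le> (ennreal (\<Sum>k. cmod (f (k + n) x)))\<^sup>2"
        using suminf_nonneg[OF s] by (simp add: ennreal_power ennreal_leI power_mono)
      then show ?case by (simp only: suminf_ennreal2[OF norm_ge_zero s])
    qed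
    also note tail[of n]
    finally have le: "(\<integral>\<^sup>+x. ennreal ((cmod (g x - (\<Sum>k<n. f k x)))\<^sup>2) \<partial>M) \<le> ennreal ((\<Sum>k. a (k + n))\<^sup>2)" .
    have "0 \<le> (\<Sum>k. a (k + n))"
      by (rule suminf_nonneg) (use summable_ignore_initial_segment[OF sa] a0 in simp_all)
    from L2_norm_le_nn_integral[OF _ this le] show ?thesis by simp
  qed
  show thesis
    by (rule that[of g]) (use bd[of 0] bd in simp_all)
qed

section \<open>Bounded operators and semigroups\<close>

lemma L2_bounded_operatorD:
  assumes "L2_bounded_operator M U"
  shows "f \<in> L2_space M \<Longrightarrow> U f \<in> L2_space M"
    and "f \<in> L2_space M \<Longrightarrow> g \<in> L2_space M \<Longrightarrow> AE x in M. U (\<lambda>y. f y + g y) x = U f x + U g x"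
    and "f \<in> L2_space M \<Longrightarrow> AE x in M. U (\<lambda>y. c * f y) x = c * U f x"
    and "\<exists>K\<ge>0. \<forall>f\<in>L2_space M. L2_norm M (U f) \<le> K * L2_norm M f"
proof -
  from assms obtain K where K: "\<forall>f\<in>L2_space M. L2_norm M (U f) \<le> K * L2_norm M f"
    unfolding L2_bounded_operator_def by blast
  have "L2_norm M (U f) \<le> max K 0 * L2_norm M f" if "f \<in> L2_space M" for f
    using K that by (meson L2_norm_nonneg max.cobounded1 mult_right_mono order_trans)
  then show "\<exists>K\<ge>0. \<forall>f\<in>L2_space M. L2_norm M (U f) \<le> K * L2_norm M f"
    by (intro exI[of _ "max K 0"]) auto
qed (use assms in \<open>auto simp: L2_bounded_operator_def\<close>)

lemma L2_bounded_operator_lincomb: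
  assumes U: "L2_bounded_operator M U" and f: "f \<in> L2_space M" and g: "g \<in> L2_space M"
  shows "AE x in M. U (\<lambda>y. a * f y + b * g y) x = a * U f x + b * U g x"
proof -
  note L = L2_bounded_operatorD[OF U]
  from L(2)[OF L2_scale(1)[OF f, of a] L2_scale(1)[OF g, of b]] L(3)[OF f, of a] L(3)[OF g, of b]
  show ?thesis by eventually_elim simp
qed

lemma L2_bounded_operator_diff:
  assumes U: "L2_bounded_operator M U" and f: "f \<in> L2_space M" and g: "g \<in> L2_space M"
  shows "AE x in M. U (\<lambda>y. f y - g y) x = U f x - U g x"
  using L2_bounded_operator_lincomb[OF U f g, of 1 "-1"] by simp

lemma L2_bounded_operator_norm_diff:
  assumes U: "L2_bounded_operator M U" and f: "f \<in> L2_space M" and g: "g \<in> L2_space M"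
  shows "L2_norm M (\<lambda>x. U f x - U g x) = L2_norm M (U (\<lambda>y. f y - g y))"
proof (rule L2_norm_cong_AE)
  note L = L2_bounded_operatorD[OF U]
  show "(\<lambda>x. U f x - U g x) \<in> borel_measurable M" "U (\<lambda>y. f y - g y) \<in> borel_measurable M"
    using L2_diff(1)[OF L(1)[OF f] L(1)[OF g]] L(1)[OF L2_diff(1)[OF f g]]
    by (auto simp: L2_space_def)
  show "AE x in M. U f x - U g x = U (\<lambda>y. f y - g y) x"
    using L2_bounded_operator_diff[OF assms] by eventually_elim simp
qed

lemma L2_bounded_operator_sum:
  assumes U: "L2_bounded_operator M U" and f: "\<And>i. i < n \<Longrightarrow> f i \<in> L2_space M"
  shows "AE x in M. U (\<lambda>y. \<Sum>i<n. c i * f i y) x = (\<Sum>i<(n::nat). c i * U (f i) x)"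
  using f
proof (induction n)
  case 0
  show ?case using L2_bounded_operatorD(3)[OF U L2_zero(1), of 0] by simp
next
  case (Suc n)
  have "(\<lambda>y. \<Sum>i<n. c i * f i y) \<in> L2_space M"
    using Suc.prems by (intro L2_sum L2_scale) auto
  from L2_bounded_operator_lincomb[OF U this Suc.prems[of n, OF lessI], of 1 "c n"]
  have "AE x in M. U (\<lambda>y. (\<Sum>i<n. c i * f i y) + c n * f n y) x = U (\<lambda>y. \<Sum>i<n. c i * f i y) x + c n * U (f n) x"
    by simp
  moreover have "AE x in M. U (\<lambda>y. \<Sum>i<n. c i * f i y) x = (\<Sum>i<n. c i * U (f i) x)"
    using Suc by simp
  ultimately show ?case by eventually_elim simp
qed

text \<open>\<open>K\<close> is the operator norm, the supremum over the unit ball. The fraction 2/3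
  leaves room for the hump argument, which loses 1/2 of \<open>K\<close> to the tail of its
  series.\<close>

lemma L2_near_optimal_vector:
  assumes U: "L2_bounded_operator M U" and f0: "f0 \<in> L2_space M" "L2_norm M (U f0) > c * L2_norm M f0"
    and c: "c > 0"
  obtains K f where "K \<ge> c" "f \<in> L2_space M" "L2_norm M f \<le> 1"
    "\<And>g. g \<in> L2_space M \<Longrightarrow> L2_norm M (U g) \<le> K * L2_norm M g" "L2_norm M (U f) \<ge> 2 / 3 * K"
proof -
  note L = L2_bounded_operatorD[OF U]
  obtain K0 where K0: "K0 \<ge> 0" "\<And>f. f \<in> L2_space M \<Longrightarrow> L2_norm M (U f) \<le> K0 * L2_norm M f"
    using L(4) by blast
  define A where "A = {L2_norm M (U f) |f. f \<in> L2_space M \<and> L2_norm M f \<le> 1}"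
  define K where "K = Sup A"
  have Ub: "a \<le> K0" if a: "a \<in> A" for a
  proof -
    obtain f where f: "a = L2_norm M (U f)" "f \<in> L2_space M" "L2_norm M f \<le> 1"
      using a unfolding A_def by blast
    have "K0 * L2_norm M f \<le> K0" using f(3) K0(1) by (simp add: mult_left_le)
    with K0(2)[OF f(2)] f(1) show ?thesis by linarith
  qed
  then have bdd: "bdd_above A" by (rule bdd_aboveI)
  have bound: "L2_norm M (U g) \<le> K * L2_norm M g" if g: "g \<in> L2_space M" for g
  proof (cases "L2_norm M g = 0")
    case True
    then show ?thesis using K0(2)[OF g] by simp
  next
    case False
    then have pos: "L2_norm M g > 0" using L2_norm_nonneg[of M g] by linarith
    let ?s = "complex_of_real (1 / L2_norm M g)"
    have s: "(\<lambda>y. ?s * g y) \<in> L2_space M" "L2_norm M (\<lambda>y. ?s * g y) = 1"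
      using L2_scale[OF g, of ?s] pos by (auto simp: norm_divide)
    have "L2_norm M (U (\<lambda>y. ?s * g y)) = L2_norm M (\<lambda>x. ?s * U g x)"
      by (intro L2_norm_cong_AE L2_space_measurable L(1) s L2_scale(1) g L(3))
    also have "\<dots> = L2_norm M (U g) / L2_norm M g"
      using L2_scale(2)[OF L(1)[OF g], of ?s] pos by (simp add: norm_divide)
    finally have "L2_norm M (U g) / L2_norm M g \<in> A"
      unfolding A_def using s by (metis (mono_tags, lifting) mem_Collect_eq order_refl)
    then have "L2_norm M (U g) / L2_norm M g \<le> K"
      unfolding K_def using bdd by (rule cSup_upper)
    then show ?thesis using pos by (simp add: field_simps)
  qed
  have Kc: "K \<ge> c"
  proof (rule ccontr)
    assume "\<not> K \<ge> c"
    then have "K * L2_norm M f0 \<le> c * L2_norm M f0" by (intro mult_right_mono) auto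
    with bound[OF f0(1)] f0(2) show False by linarith
  qed
  have "2 / 3 * K < Sup A" using Kc c unfolding K_def[symmetric] by linarith
  moreover have "A \<noteq> {}" unfolding A_def using L2_zero[of M] by force
  ultimately obtain a where "a \<in> A" "2 / 3 * K < a"
    using less_cSup_iff[OF _ bdd] by blast
  then obtain f where "f \<in> L2_space M" "L2_norm M f \<le> 1" "2 / 3 * K \<le> L2_norm M (U f)"
    unfolding A_def by (blast intro: less_imp_le)
  with Kc bound show thesis by (intro that[of K f])
qed

text \<open>Sokal's version of the gliding hump: at each step the sign is chosen such that the image
  of the partial sum is at least as large as the image of the new summand.\<close>

lemma L2_uniform_boundedness:
  fixes U :: "nat \<Rightarrow> ('a \<Rightarrow> complex) \<Rightarrow> 'a \<Rightarrow> complex"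
  assumes U: "\<And>n. L2_bounded_operator M (U n)"
    and pw: "\<And>f. f \<in> L2_space M \<Longrightarrow> \<exists>C N. \<forall>n\<ge>N. L2_norm M (U n f) \<le> C"
  shows "\<exists>K N. \<forall>n\<ge>N. \<forall>f\<in>L2_space M. L2_norm M (U n f) \<le> K * L2_norm M f"
proof (rule ccontr)
  assume neg: "\<not> ?thesis"
  note L = L2_bounded_operatorD[OF U]
  have "\<exists>n K f. n \<ge> j \<and> K \<ge> 4 ^ j \<and> f \<in> L2_space M \<and> L2_norm M f \<le> 1 \<and>
    (\<forall>g\<in>L2_space M. L2_norm M (U n g) \<le> K * L2_norm M g) \<and> L2_norm M (U n f) \<ge> 2 / 3 * K" for j
  proof -
    obtain n f0 where n: "n \<ge> j" "f0 \<in> L2_space M" "L2_norm M (U n f0) > 4 ^ j * L2_norm M f0"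
      using neg by (meson not_le)
    obtain K f where "K \<ge> 4 ^ j" "f \<in> L2_space M" "L2_norm M f \<le> 1"
      "\<And>g. g \<in> L2_space M \<Longrightarrow> L2_norm M (U n g) \<le> K * L2_norm M g" "L2_norm M (U n f) \<ge> 2 / 3 * K"
      using L2_near_optimal_vector[OF U n(2,3)] by (metis zero_less_numeral zero_less_power)
    with n(1) show ?thesis by blast
  qed
  then obtain n K f where nKf: "\<And>j. n j \<ge> j" "\<And>j. K j \<ge> (4::real) ^ j"
      "\<And>j. f j \<in> L2_space M" "\<And>j. L2_norm M (f j) \<le> 1"
    and Kb: "\<And>j g. g \<in> L2_space M \<Longrightarrow> L2_norm M (U (n j) g) \<le> K j * L2_norm M g"
    and Kf: "\<And>j. L2_norm M (U (n j) (f j)) \<ge> 2 / 3 * K j"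
    by metis
  \<comment> \<open>With ratio 1/3 the tail after index j is half of the j-th weight, less than the
    2/3 guaranteed by \<open>Kf\<close>; and the norms 4^j still diverge after multiplication by
    3^-j.\<close>
  define e :: "nat \<Rightarrow> complex" where "e j = complex_of_real ((1/3) ^ j)" for j
  have e: "cmod (e j) = (1/3) ^ j" for j unfolding e_def by (simp add: norm_power)
  define x :: "nat \<Rightarrow> 'a \<Rightarrow> complex" where "x = rec_nat (\<lambda>_. 0) (\<lambda>j y.
     if L2_norm M (U (n j) (\<lambda>z. y z + e j * f j z)) \<ge> cmod (e j) * L2_norm M (U (n j) (f j))
     then (\<lambda>z. y z + e j * f j z) else (\<lambda>z. y z - e j * f j z))"
  define h where "h j z = x (Suc j) z - x j z" for j z
  have xS: "x (Suc j) = (\<lambda>z. x j z + e j * f j z) \<or> x (Suc j) = (\<lambda>z. x j z - e j * f j z)" for j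
    by (simp add: x_def)
  have xL: "x j \<in> L2_space M" for j
  proof (induction j)
    case 0
    then show ?case by (simp add: x_def L2_zero)
  next
    case (Suc j)
    then show ?case using xS[of j] L2_add(1)[OF Suc L2_scale(1)[OF nKf(3)]]
      L2_diff(1)[OF Suc L2_scale(1)[OF nKf(3)]] by metis
  qed
  have big: "L2_norm M (U (n j) (x (Suc j))) \<ge> (1/3) ^ j * L2_norm M (U (n j) (f j))" for j
  proof (cases "L2_norm M (U (n j) (\<lambda>z. x j z + e j * f j z)) \<ge> cmod (e j) * L2_norm M (U (n j) (f j))")
    case True
    then have "x (Suc j) = (\<lambda>z. x j z + e j * f j z)" by (simp add: x_def)
    with True show ?thesis by (simp add: e)
  next
    case False
    then have xs: "x (Suc j) = (\<lambda>z. x j z - e j * f j z)" by (simp add: x_def)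
    let ?p = "\<lambda>z. x j z + e j * f j z" and ?m = "\<lambda>z. x j z - e j * f j z"
    have pm: "?p \<in> L2_space M" "?m \<in> L2_space M"
      using xL nKf(3) by (auto intro!: L2_add L2_diff L2_scale)
    \<comment> \<open>The two candidates differ by 2 e_j f_j, so their images cannot both be shorter
      than e_j times the image of f_j.\<close>
    have "L2_norm M (U (n j) (\<lambda>y. ?p y - ?m y)) = L2_norm M (\<lambda>z. (2 * e j) * U (n j) (f j) z)"
    proof -
      have "(\<lambda>y. ?p y - ?m y) = (\<lambda>y. (2 * e j) * f j y)" by auto
      then show ?thesis
        by (simp only:) (intro L2_norm_cong_AE L2_space_measurable L(1) L2_scale(1) nKf(3) L(3))
    qed
    also have "\<dots> = 2 * (1/3) ^ j * L2_norm M (U (n j) (f j))"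
      using L2_scale(2)[OF L(1)[OF nKf(3)], of "2 * e j"] by (simp add: norm_mult e)
    finally have "2 * (1/3) ^ j * L2_norm M (U (n j) (f j)) \<le> L2_norm M (U (n j) ?p) + L2_norm M (U (n j) ?m)"
      using L2_bounded_operator_norm_diff[OF U pm, of "n j"]
        L2_diff(2)[OF L(1)[OF pm(1), of "n j"] L(1)[OF pm(2), of "n j"]] by linarith
    with False show ?thesis unfolding xs by (simp add: e)
  qed
  have hL: "h j \<in> L2_space M" and hn: "L2_norm M (h j) \<le> (1/3) ^ j" for j
  proof -
    have "h j = (\<lambda>z. e j * f j z) \<or> h j = (\<lambda>z. - (e j * f j z))"
      using xS[of j] by (auto simp: h_def fun_eq_iff)
    moreover have "L2_norm M (\<lambda>z. e j * f j z) \<le> (1/3) ^ j"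
      using nKf(4)[of j] by (simp add: L2_scale(2)[OF nKf(3)] e mult_left_le)
    ultimately show "h j \<in> L2_space M" "L2_norm M (h j) \<le> (1/3) ^ j"
      using L2_scale(1)[OF nKf(3)] L2_minus[OF L2_scale(1)[OF nKf(3)]] by metis+
  qed
  have xsum: "x j z = (\<Sum>k<j. h k z)" for j z
    by (induction j) (auto simp: h_def x_def)
  obtain g where g: "g \<in> L2_space M"
    "\<And>j. L2_norm M (\<lambda>z. g z - (\<Sum>k<j. h k z)) \<le> (\<Sum>k. (1/3) ^ (k + j))"
    using L2_series_complete[of h M "\<lambda>k. (1/3) ^ k", OF hL hn] by (auto simp: summable_geometric)
  have gx: "L2_norm M (\<lambda>z. g z - x (Suc j) z) \<le> (1/3) ^ j / 2" for j
  proof -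
    have "(\<Sum>k. (1/3::real) ^ (k + Suc j)) = (\<Sum>k. (1/3) ^ Suc j * (1/3) ^ k)"
      by (simp only: power_add mult.commute)
    also have "\<dots> = (1/3) ^ Suc j * (\<Sum>k. (1/3) ^ k)"
      by (intro suminf_mult summable_geometric) simp
    also have "(\<Sum>k. (1/3::real) ^ k) = 3/2" by (subst suminf_geometric) auto
    finally show ?thesis using g(2)[of "Suc j"] unfolding xsum by simp
  qed
  obtain C N where C: "\<And>m. m \<ge> N \<Longrightarrow> L2_norm M (U m g) \<le> C" using pw[OF g(1)] by blast
  \<comment> \<open>The factor 1/6 is 2/3 - 1/2.\<close>
  have low: "(4/3) ^ j / 6 \<le> L2_norm M (U (n j) g)" for j
  proof -
    have "2/3 * (1/3)^j * K j \<le> (1/3) ^ j * L2_norm M (U (n j) (f j))"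
      using mult_left_mono[OF Kf[of j], of "(1/3)^j"] by simp
    also have "\<dots> \<le> L2_norm M (U (n j) (x (Suc j)))" by (rule big)
    also have "\<dots> \<le> L2_norm M (U (n j) g) + L2_norm M (\<lambda>z. U (n j) (x (Suc j)) z - U (n j) g z)"
      by (intro L2_norm_le_add_diff L(1) xL g(1))
    also have "L2_norm M (\<lambda>z. U (n j) (x (Suc j)) z - U (n j) g z) = L2_norm M (\<lambda>z. U (n j) g z - U (n j) (x (Suc j)) z)"
      by (rule L2_norm_minus_commute)
    also have "\<dots> = L2_norm M (U (n j) (\<lambda>z. g z - x (Suc j) z))"
      by (rule L2_bounded_operator_norm_diff[OF U g(1) xL])
    also have "\<dots> \<le> K j * ((1/3) ^ j / 2)"
      by (rule order_trans[OF Kb mult_left_mono[OF gx]])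
        (use L2_diff(1)[OF g(1) xL] nKf(2)[of j] order_trans[of 0 "4^j" "K j"] in auto)
    finally have "(1/3)^j * K j / 6 \<le> L2_norm M (U (n j) g)" by (simp add: field_simps)
    moreover have "(4/3) ^ j \<le> (1/3)^j * K j"
      using mult_left_mono[OF nKf(2)[of j], of "(1/3)^j"] by (simp add: power_divide)
    ultimately show ?thesis by linarith
  qed
  obtain j0 where j0: "6 * C < (4/3) ^ j0" using real_arch_pow[of "4/3" "6 * C"] by auto
  let ?j = "max j0 N"
  have "(4/3::real) ^ j0 \<le> (4/3) ^ ?j" by (intro power_increasing) auto
  moreover have "L2_norm M (U (n ?j) g) \<le> C" using nKf(1)[of ?j] by (intro C) auto
  ultimately show False using low[of ?j] j0 by linarith
qed

lemma strongly_continuous_semigroupD: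
  assumes "strongly_continuous_semigroup M S"
  shows "t \<ge> 0 \<Longrightarrow> L2_bounded_operator M (S t)"
    and "f \<in> L2_space M \<Longrightarrow> AE x in M. S 0 f x = f x"
    and "s \<ge> 0 \<Longrightarrow> t \<ge> 0 \<Longrightarrow> f \<in> L2_space M \<Longrightarrow> AE x in M. S (s + t) f x = S s (S t f) x"
    and "f \<in> L2_space M \<Longrightarrow> ((\<lambda>t. L2_norm M (\<lambda>x. S t f x - f x)) \<longlongrightarrow> 0) (at_right 0)"
    and "t \<ge> 0 \<Longrightarrow> f \<in> L2_space M \<Longrightarrow> S t f \<in> L2_space M"
  using assms L2_bounded_operatorD(1) by (auto simp: strongly_continuous_semigroup_def)

text \<open>Otherwise some sequence of times tending to 0 has operator norms above n, against
  uniform boundedness. Strong continuity at 0 bounds each orbit only from some index on, which is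
  why the boundedness principle is stated with \<open>N\<close>.\<close>

lemma semigroup_bounded_near_0:
  assumes S: "strongly_continuous_semigroup M S"
  shows "\<exists>\<delta>>0. \<exists>K. \<forall>t. 0 \<le> t \<and> t \<le> \<delta> \<longrightarrow> (\<forall>f\<in>L2_space M. L2_norm M (S t f) \<le> K * L2_norm M f)"
proof (rule ccontr)
  note D = strongly_continuous_semigroupD[OF S]
  assume "\<not> ?thesis"
  then have "\<exists>t. 0 \<le> t \<and> t \<le> 1 / Suc n \<and> (\<exists>f\<in>L2_space M. L2_norm M (S t f) > real n * L2_norm M f)" for n
    by (metis (no_types, opaque_lifting) not_le of_nat_0_less_iff zero_less_Suc zero_less_divide_1_iff)
  then obtain t where t: "\<And>n. 0 \<le> t n" "\<And>n. t n \<le> 1 / Suc n"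
    "\<And>n. \<exists>f\<in>L2_space M. L2_norm M (S (t n) f) > real n * L2_norm M f" by metis
  have "\<exists>K N. \<forall>n\<ge>N. \<forall>f\<in>L2_space M. L2_norm M (S (t n) f) \<le> K * L2_norm M f"
  proof (rule L2_uniform_boundedness)
    fix f assume f: "f \<in> L2_space M"
    have "eventually (\<lambda>t. L2_norm M (\<lambda>x. S t f x - f x) < 1) (at_right 0)"
      using order_tendstoD(2)[OF D(4)[OF f], of 1] by simp
    then obtain b where b: "b > 0" "\<And>t. 0 < t \<Longrightarrow> t < b \<Longrightarrow> L2_norm M (\<lambda>x. S t f x - f x) < 1"
      by (auto simp: eventually_at_right_field)
    obtain N where N: "1 / Suc N < b" using b(1) nat_approx_posE by blast
    have "L2_norm M (S (t n) f) \<le> L2_norm M f + 1" if "n \<ge> N" for n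
    proof (cases "t n = 0")
      case True
      have "L2_norm M (S 0 f) = L2_norm M f"
        by (intro L2_norm_cong_AE D(2) f L2_space_measurable D(5)) auto
      then show ?thesis using True by simp
    next
      case False
      have "1 / Suc n \<le> 1 / Suc N" using that by (intro divide_left_mono) auto
      then have "L2_norm M (\<lambda>x. S (t n) f x - f x) < 1"
        using t(1,2)[of n] False N by (intro b) auto
      then show ?thesis using L2_norm_le_add_diff[OF D(5)[OF t(1) f] f, of n] by simp
    qed
    then show "\<exists>C N. \<forall>n\<ge>N. L2_norm M (S (t n) f) \<le> C" by blast
  qed (use D(1) t(1) in auto)
  then obtain K N where KN: "\<And>n f. n \<ge> N \<Longrightarrow> f \<in> L2_space M \<Longrightarrow> L2_norm M (S (t n) f) \<le> K * L2_norm M f"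
    by blast
  obtain m where m: "real m \<ge> K" using real_arch_simple by blast
  obtain f where f: "f \<in> L2_space M" "L2_norm M (S (t (max m N)) f) > real (max m N) * L2_norm M f"
    using t(3) by blast
  have "K * L2_norm M f \<le> real (max m N) * L2_norm M f"
    using m by (intro mult_right_mono) auto
  then show False using f(2) KN[of "max m N" f] f(1) by simp
qed

text \<open>The bound near 0 is iterated \<open>m\<close> times with the step \<open>t / m\<close>,
  where \<open>m\<close> depends on \<open>T\<close> and \<open>\<delta>\<close> but not on
  \<open>t\<close>.\<close>

lemma semigroup_locally_bounded:
  assumes S: "strongly_continuous_semigroup M S"
  obtains K where "K \<ge> 1"
    "\<And>t f. 0 \<le> t \<Longrightarrow> t \<le> T \<Longrightarrow> f \<in> L2_space M \<Longrightarrow> L2_norm M (S t f) \<le> K * L2_norm M f"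
proof -
  note D = strongly_continuous_semigroupD[OF S]
  obtain \<delta> K0 where d: "\<delta> > 0" "\<And>t f. 0 \<le> t \<Longrightarrow> t \<le> \<delta> \<Longrightarrow> f \<in> L2_space M \<Longrightarrow> L2_norm M (S t f) \<le> K0 * L2_norm M f"
    using semigroup_bounded_near_0[OF S] by metis
  define K where "K = max K0 1"
  have dK: "L2_norm M (S t f) \<le> K * L2_norm M f" if "0 \<le> t" "t \<le> \<delta>" "f \<in> L2_space M" for t f
    using d(2)[OF that] mult_right_mono[of K0 K "L2_norm M f"] by (auto simp: K_def)
  obtain m :: nat where m: "real m * \<delta> \<ge> \<bar>T\<bar>" "m > 0"
  proof -
    obtain m where "real m \<ge> \<bar>T\<bar> / \<delta>" using real_arch_simple by blast
    then have "real (Suc m) * \<delta> \<ge> \<bar>T\<bar>" using d(1) by (auto simp: field_simps intro: add_increasing2)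
    then show ?thesis using that[of "Suc m"] by simp
  qed
  have step: "L2_norm M (S (real k * s) f) \<le> K ^ k * L2_norm M f"
    if "0 \<le> s" "s \<le> \<delta>" "f \<in> L2_space M" for k s f
  proof (induction k)
    case 0
    have "L2_norm M (S 0 f) = L2_norm M f"
      by (intro L2_norm_cong_AE D(2) that L2_space_measurable D(5)) auto
    then show ?case by simp
  next
    case (Suc k)
    have "L2_norm M (S (real (Suc k) * s) f) = L2_norm M (S s (S (real k * s) f))"
      using D(3)[of s "real k * s" f] that
      by (intro L2_norm_cong_AE L2_space_measurable D(5)) (auto simp: algebra_simps)
    also have "\<dots> \<le> K * L2_norm M (S (real k * s) f)" using that by (intro dK D(5)) auto
    also have "\<dots> \<le> K * (K ^ k * L2_norm M f)" using Suc by (intro mult_left_mono) (auto simp: K_def)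
    finally show ?case by simp
  qed
  have "L2_norm M (S t f) \<le> K ^ m * L2_norm M f" if "0 \<le> t" "t \<le> T" "f \<in> L2_space M" for t f
  proof -
    have "t / m \<le> \<delta>" using m that by (auto simp: field_simps)
    from step[OF _ this that(3), of m] show ?thesis using m that by simp
  qed
  moreover have "K ^ m \<ge> 1" by (simp add: K_def one_le_power)
  ultimately show thesis using that by blast
qed

section \<open>The matrix exponential\<close>

lemma matrix_power_0 [simp]: "matrix_power A 0 = mat 1"
  by (simp add: matrix_power_def)

lemma matrix_power_Suc: "matrix_power A (Suc k) = A ** matrix_power A k"
  by (simp add: matrix_power_def)

lemma matrix_power_Suc2: "matrix_power A (Suc k) = matrix_power A k ** A"
  by (induction k) (simp add: matrix_power_Suc, metis matrix_mul_assoc matrix_power_Suc)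

lemma transpose_matrix_power: "transpose (matrix_power A k) = matrix_power (transpose A) k"
proof (induction k)
  case 0
  then show ?case by (simp add: transpose_mat)
next
  case (Suc k)
  then show ?case by (subst matrix_power_Suc, subst matrix_power_Suc2) (simp add: matrix_transpose_mul)
qed

lemma matrix_mul_scaleR [simp]:
  fixes A B :: "real^'n^'n"
  shows "(c *\<^sub>R A) ** B = c *\<^sub>R (A ** B)" "A ** (c *\<^sub>R B) = c *\<^sub>R (A ** B)"
  by (auto simp: matrix_matrix_mult_def vec_eq_iff sum_distrib_left mult_ac)

lemma matrix_power_scaleR: "matrix_power (c *\<^sub>R A) k = c ^ k *\<^sub>R matrix_power A k"
  by (induction k) (simp_all add: matrix_power_Suc)

lemma bilinear_matrix_mul: "bilinear ((**) :: real^'n^'n \<Rightarrow> real^'n^'n \<Rightarrow> real^'n^'n)"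
  by (auto simp: bilinear_def matrix_matrix_mult_def vec_eq_iff algebra_simps sum.distrib sum_distrib_left
      intro!: linearI)

lemmas bounded_bilinear_matrix_mul = bilinear_conv_bounded_bilinear[THEN iffD1, OF bilinear_matrix_mul]

lemma bilinear_matrix_vector_mul: "bilinear ((*v) :: real^'n^'m \<Rightarrow> real^'n \<Rightarrow> real^'m)"
  by (auto simp: bilinear_def intro!: linearI
    simp: matrix_vector_right_distrib matrix_vector_mult_add_rdistrib matrix_vector_mult_scaleR scaleR_matrix_vector_assoc)

lemmas bounded_bilinear_matrix_vector_mul = bilinear_conv_bounded_bilinear[THEN iffD1, OF bilinear_matrix_vector_mul]

text \<open>The sum of all absolute entries serves as a submultiplicative bound. With it each entry
  of \<open>matrix_exp (t *\<^sub>R B)\<close> is an everywhere convergent real power series in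
  \<open>t\<close>, which can be differentiated term by term.\<close>

lemma matrix_power_entry_bound:
  fixes B :: "real^'n^'n"
  shows "\<bar>matrix_power B k $ i $ j\<bar> \<le> (\<Sum>i\<in>UNIV. \<Sum>l\<in>UNIV. \<bar>B $ i $ l\<bar>) ^ k"
proof (induction k arbitrary: i)
  case 0
  then show ?case by (simp add: mat_def)
next
  case (Suc k)
  let ?L = "\<Sum>i\<in>UNIV. \<Sum>l\<in>UNIV. \<bar>B $ i $ l\<bar>"
  have "\<bar>matrix_power B (Suc k) $ i $ j\<bar> = \<bar>\<Sum>l\<in>UNIV. B $ i $ l * matrix_power B k $ l $ j\<bar>"
    by (simp add: matrix_power_Suc matrix_matrix_mult_def)
  also have "\<dots> \<le> (\<Sum>l\<in>UNIV. \<bar>B $ i $ l\<bar> * ?L ^ k)"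
    by (rule order_trans[OF sum_abs]) (auto simp: abs_mult intro!: sum_mono mult_left_mono Suc)
  also have "\<dots> \<le> ?L * ?L ^ k"
    unfolding sum_distrib_right[symmetric]
    by (intro mult_right_mono member_le_sum[of i UNIV "\<lambda>i. \<Sum>l\<in>UNIV. \<bar>B $ i $ l\<bar>"]) (auto intro!: sum_nonneg zero_le_power)
  finally show ?case by simp
qed

lemma summable_matrix_exp_entry:
  fixes B :: "real^'n^'n"
  shows "summable (\<lambda>k. matrix_power B k $ i $ j / fact k * t ^ k)"
proof (rule summable_comparison_test)
  let ?L = "\<Sum>i\<in>UNIV. \<Sum>l\<in>UNIV. \<bar>B $ i $ l\<bar>"
  show "\<exists>N. \<forall>n\<ge>N. norm (matrix_power B n $ i $ j / fact n * t ^ n) \<le> inverse (fact n) * (?L * \<bar>t\<bar>) ^ n"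
    by (intro exI[of _ 0])
      (auto simp: abs_mult power_abs power_mult_distrib field_simps intro!: mult_mono divide_right_mono matrix_power_entry_bound)
  show "summable (\<lambda>n. inverse (fact n) * (?L * \<bar>t\<bar>) ^ n)" by (rule summable_exp)
qed

lemma matrix_exp_entry:
  fixes B :: "real^'n^'n"
  shows "matrix_exp (t *\<^sub>R B) $ i $ j = (\<Sum>k. matrix_power B k $ i $ j / fact k * t ^ k)"
proof -
  let ?G = "\<chi> i j. (\<Sum>k. matrix_power B k $ i $ j / fact k * t ^ k)"
  have "(\<lambda>k. (1 / fact k) *\<^sub>R matrix_power (t *\<^sub>R B) k) sums ?G"
    unfolding sums_def
  proof (intro vec_tendstoI)
    fix i j
    have "(\<lambda>k. matrix_power B k $ i $ j / fact k * t ^ k) sums (?G $ i $ j)"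
      using summable_sums[OF summable_matrix_exp_entry] by simp
    then show "(\<lambda>n. (\<Sum>k<n. (1 / fact k) *\<^sub>R matrix_power (t *\<^sub>R B) k) $ i $ j) \<longlonglongrightarrow> ?G $ i $ j"
      by (simp add: sums_def matrix_power_scaleR mult_ac)
  qed
  then have "matrix_exp (t *\<^sub>R B) = ?G" unfolding matrix_exp_def by (rule sums_unique[symmetric])
  then show ?thesis by simp
qed

lemma matrix_exp_entry_deriv:
  fixes B :: "real^'n^'n"
  shows "((\<lambda>t. matrix_exp (t *\<^sub>R B) $ i $ j) has_field_derivative
     (\<Sum>k. matrix_power B (Suc k) $ i $ j / fact k * t ^ k)) (at t)"
proof -
  have "((\<lambda>t. \<Sum>k. matrix_power B k $ i $ j / fact k * t ^ k) has_field_derivative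
     (\<Sum>k. diffs (\<lambda>k. matrix_power B k $ i $ j / fact k) k * t ^ k)) (at t)"
    by (rule termdiffs_strong_converges_everywhere) (rule summable_matrix_exp_entry)
  moreover have "diffs (\<lambda>k. matrix_power B k $ i $ j / fact k) k = matrix_power B (Suc k) $ i $ j / fact k" for k
    by (simp add: diffs_def field_simps del: of_nat_Suc)
  ultimately show ?thesis by (simp add: matrix_exp_entry)
qed

lemma has_vector_derivative_matrixI:
  assumes "\<And>i j. ((\<lambda>t. F t $ i $ j) has_field_derivative (D $ i $ j)) (at t)"
  shows "(F has_vector_derivative (D::real^'n^'m)) (at t)"
  unfolding has_vector_derivative_def
  by (subst has_derivative_componentwise_within)
    (use assms in \<open>auto simp: Basis_vec_def inner_axis has_field_derivative_def mult_commute_abs\<close>)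

lemma matrix_exp_deriv_left:
  fixes B :: "real^'n^'n"
  shows "((\<lambda>t. matrix_exp (t *\<^sub>R B)) has_vector_derivative B ** matrix_exp (t *\<^sub>R B)) (at t)"
proof (rule has_vector_derivative_matrixI)
  fix i j
  have "(\<Sum>k. matrix_power B (Suc k) $ i $ j / fact k * t ^ k)
     = (\<Sum>k. \<Sum>l\<in>UNIV. B $ i $ l * (matrix_power B k $ l $ j / fact k * t ^ k))"
    unfolding matrix_power_Suc matrix_matrix_mult_def vec_lambda_beta sum_divide_distrib sum_distrib_right
    by (intro suminf_cong sum.cong refl) simp
  also have "\<dots> = (\<Sum>l\<in>UNIV. \<Sum>k. B $ i $ l * (matrix_power B k $ l $ j / fact k * t ^ k))"
    by (rule suminf_sum) (intro summable_mult summable_matrix_exp_entry)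
  also have "\<dots> = (B ** matrix_exp (t *\<^sub>R B)) $ i $ j"
    by (simp only: matrix_matrix_mult_def vec_lambda_beta matrix_exp_entry suminf_mult[OF summable_matrix_exp_entry])
  finally show "((\<lambda>t. matrix_exp (t *\<^sub>R B) $ i $ j) has_field_derivative (B ** matrix_exp (t *\<^sub>R B)) $ i $ j) (at t)"
    using matrix_exp_entry_deriv[of B i j t] by simp
qed

lemma matrix_exp_deriv_right:
  fixes B :: "real^'n^'n"
  shows "((\<lambda>t. matrix_exp (t *\<^sub>R B)) has_vector_derivative matrix_exp (t *\<^sub>R B) ** B) (at t)"
proof (rule has_vector_derivative_matrixI)
  fix i j
  have "(\<Sum>k. matrix_power B (Suc k) $ i $ j / fact k * t ^ k)
     = (\<Sum>k. \<Sum>l\<in>UNIV. B $ l $ j * (matrix_power B k $ i $ l / fact k * t ^ k))"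
    unfolding matrix_power_Suc2 matrix_matrix_mult_def vec_lambda_beta sum_divide_distrib sum_distrib_right
    by (intro suminf_cong sum.cong refl) simp
  also have "\<dots> = (\<Sum>l\<in>UNIV. \<Sum>k. B $ l $ j * (matrix_power B k $ i $ l / fact k * t ^ k))"
    by (rule suminf_sum) (intro summable_mult summable_matrix_exp_entry)
  also have "\<dots> = (matrix_exp (t *\<^sub>R B) ** B) $ i $ j"
    by (simp only: matrix_matrix_mult_def vec_lambda_beta matrix_exp_entry suminf_mult[OF summable_matrix_exp_entry]
        mult.commute[of "suminf _"])
  finally show "((\<lambda>t. matrix_exp (t *\<^sub>R B) $ i $ j) has_field_derivative (matrix_exp (t *\<^sub>R B) ** B) $ i $ j) (at t)"
    using matrix_exp_entry_deriv[of B i j t] by simp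
qed

text \<open>The left and the right form of the derivative of the same curve agree.\<close>

lemma matrix_exp_commute: "B ** matrix_exp (t *\<^sub>R B) = matrix_exp (t *\<^sub>R B) ** (B::real^'n^'n)"
  using vector_derivative_unique_at[OF matrix_exp_deriv_left matrix_exp_deriv_right] by blast

lemma matrix_exp_0: "matrix_exp (0 *\<^sub>R B) = (mat 1 :: real^'n^'n)"
proof -
  have "matrix_exp (0 *\<^sub>R B) $ i $ j = mat 1 $ i $ j" for i j
    unfolding matrix_exp_entry
    using powser_zero[of "\<lambda>k. matrix_power B k $ i $ j / fact k"] by simp
  then show ?thesis by (simp add: vec_eq_iff)
qed

lemma transpose_matrix_exp:
  "transpose (matrix_exp (t *\<^sub>R B)) = matrix_exp (t *\<^sub>R transpose (B::real^'n^'n))"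
proof -
  have "matrix_power B k $ j $ i = matrix_power (transpose B) k $ i $ j" for k i j
    unfolding transpose_matrix_power[symmetric] by (simp add: transpose_def)
  then show ?thesis by (simp add: vec_eq_iff transpose_def[of "matrix_exp _"] matrix_exp_entry)
qed

lemma matrix_exp_vector_deriv:
  fixes B :: "real^'n^'n"
  shows "((\<lambda>t. matrix_exp (t *\<^sub>R B) *v w) has_vector_derivative B *v (matrix_exp (t *\<^sub>R B) *v w)) (at t)"
proof -
  have "bounded_linear (\<lambda>A::real^'n^'n. A *v w)"
    by (rule bounded_bilinear.bounded_linear_left[OF bounded_bilinear_matrix_vector_mul])
  from bounded_linear.has_vector_derivative[OF this matrix_exp_deriv_left]
  show ?thesis by (simp add: matrix_vector_mul_assoc)
qed

section \<open>Symmetric matrices: eigenbases and square roots\<close>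

lemma symmetric_matrix_inner:
  fixes D :: "real^'n^'n"
  assumes "transpose D = D"
  shows "(D *v x) \<bullet> y = x \<bullet> (D *v y)"
  using dot_lmul_matrix[of x D y] assms by (metis inner_commute transpose_matrix_vector)

text \<open>A maximiser v of the quadratic form on the unit sphere of \<open>V\<close> is an
  eigenvector, because the first variation in the direction of the residual u = D v - l v must
  vanish. Working inside an invariant subspace prepares the induction on the dimension.\<close>

lemma symmetric_matrix_eigenvector:
  fixes D :: "real^'n^'n"
  assumes sym: "transpose D = D" and V: "subspace V" "V \<noteq> {0}" and inv: "\<And>x. x \<in> V \<Longrightarrow> D *v x \<in> V"
  obtains v l where "v \<in> V" "norm v = 1" "D *v v = l *\<^sub>R v"
proof -
  let ?K = "V \<inter> sphere 0 1"
  have "compact ?K" using closed_subspace[OF V(1)] by (intro closed_Int_compact) auto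
  moreover have "?K \<noteq> {}"
  proof -
    obtain x where x: "x \<in> V" "x \<noteq> 0" using V subspace_0[OF V(1)] by auto
    then have "(1 / norm x) *\<^sub>R x \<in> ?K" using subspace_scale[OF V(1)] by auto
    then show ?thesis by blast
  qed
  moreover have "continuous_on ?K (\<lambda>x. x \<bullet> (D *v x))"
    by (intro continuous_intros matrix_vector_mult_linear_continuous_on)
  ultimately obtain v where v: "v \<in> ?K" "\<And>x. x \<in> ?K \<Longrightarrow> x \<bullet> (D *v x) \<le> v \<bullet> (D *v v)"
    using continuous_attains_sup[of ?K "\<lambda>x. x \<bullet> (D *v x)"] by blast
  define l where "l = v \<bullet> (D *v v)"
  have le: "x \<bullet> (D *v x) \<le> l * (norm x)\<^sup>2" if "x \<in> V" for x
  proof (cases "x = 0")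
    case False
    then have "(1 / norm x) *\<^sub>R x \<in> ?K" using subspace_scale[OF V(1)] that by auto
    from v(2)[OF this] False show ?thesis
      by (simp add: l_def matrix_vector_mult_scaleR divide_simps power2_eq_square split: if_splits)
  qed simp
  define u where "u = D *v v - l *\<^sub>R v"
  have uV: "u \<in> V" unfolding u_def using v(1) inv V(1) by (intro subspace_diff subspace_scale) auto
  have nv: "v \<bullet> v = 1" using v(1) by (simp add: norm_eq_1)
  have uv: "u \<bullet> v = 0" by (simp add: u_def inner_diff_left l_def nv inner_commute[of "D *v v" v])
  have Dvu: "(D *v v) \<bullet> u = u \<bullet> u"
    unfolding u_def[symmetric] using uv by (simp add: u_def inner_diff_left inner_diff_right inner_commute)
  \<comment> \<open>Maximality at v is tested at v + s u, whose squared length is 1 + s^2 |u|^2; the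
    linear term in s is 2 s |u|^2.\<close>
  have quad: "2 * s * (u \<bullet> u) \<le> s\<^sup>2 * (l * (u \<bullet> u) - u \<bullet> (D *v u))" for s
  proof -
    have vu: "v \<bullet> u = 0" using uv by (simp add: inner_commute)
    have "(v + s *\<^sub>R u) \<bullet> (D *v (v + s *\<^sub>R u)) = l + 2 * s * (u \<bullet> u) + s\<^sup>2 * (u \<bullet> (D *v u))"
      using Dvu symmetric_matrix_inner[OF sym, of v u]
      by (simp add: matrix_vector_right_distrib matrix_vector_mult_scaleR inner_add_left inner_add_right
          l_def power2_eq_square algebra_simps inner_commute)
    moreover have "(norm (v + s *\<^sub>R u))\<^sup>2 = 1 + s\<^sup>2 * (u \<bullet> u)"
      unfolding power2_norm_eq_inner
      by (simp add: inner_add_left inner_add_right nv uv vu power2_eq_square)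
    moreover have "v + s *\<^sub>R u \<in> V" using v(1) uV V(1) by (intro subspace_add subspace_scale) auto
    ultimately show ?thesis using le[of "v + s *\<^sub>R u"] by (simp add: algebra_simps)
  qed
  have "u \<bullet> u = 0"
  proof (rule ccontr)
    assume "u \<bullet> u \<noteq> 0"
    then have pos: "u \<bullet> u > 0" using inner_ge_zero[of u] by linarith
    \<comment> \<open>A positive majorant of the quadratic coefficient, so that s = |u|^2 / c turns
      \<open>quad\<close> into 2 s |u|^2 \<le> s |u|^2.\<close>
    define c where "c = \<bar>l * (u \<bullet> u) - u \<bullet> (D *v u)\<bar> + u \<bullet> u"
    have c: "c > 0" "l * (u \<bullet> u) - u \<bullet> (D *v u) \<le> c" unfolding c_def using pos by linarith+
    define s where "s = (u \<bullet> u) / c"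
    have s: "s > 0" using pos c by (simp add: s_def)
    have "2 * s * (u \<bullet> u) \<le> s\<^sup>2 * c"
      by (rule order_trans[OF quad]) (use c in \<open>auto intro: mult_left_mono\<close>)
    also have "\<dots> = s * (u \<bullet> u)" using c by (simp add: s_def power2_eq_square)
    finally show False using s pos by simp
  qed
  then have "D *v v = l *\<^sub>R v" by (simp add: u_def)
  then show thesis using that v(1) by auto
qed

text \<open>Split off one eigenvector; its orthogonal complement in \<open>V\<close> is again
  invariant because \<open>D\<close> is symmetric.\<close>

lemma symmetric_matrix_eigenbasis:
  fixes D :: "real^'n^'n"
  assumes sym: "transpose D = D" and V: "subspace V" and inv: "\<And>x. x \<in> V \<Longrightarrow> D *v x \<in> V"
  shows "\<exists>E \<mu>. finite E \<and> (\<forall>e\<in>E. norm e = 1 \<and> D *v e = \<mu> e *\<^sub>R e) \<and> pairwise orthogonal E \<and> span E = V"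
  using V inv
proof (induction "dim V" arbitrary: V rule: less_induct)
  case less
  show ?case
  proof (cases "V = {0}")
    case True
    then show ?thesis by (intro exI[of _ "{}"]) auto
  next
    case False
    obtain v l where v: "v \<in> V" "norm v = 1" "D *v v = l *\<^sub>R v"
      using symmetric_matrix_eigenvector[OF sym less.prems(1) False less.prems(2)] by metis
    define W where "W = {x \<in> V. x \<bullet> v = 0}"
    have W: "subspace W"
      using less.prems(1) unfolding W_def subspace_def by (auto simp: inner_add_left)
    have "v \<notin> W" using v by (auto simp: W_def)
    then have "W \<noteq> V" using v(1) by metis
    then have "W \<subset> V" by (auto simp: W_def)
    then have "dim W < dim V"
      by (intro dim_psubset) (use W less.prems(1) in \<open>simp add: span_eq_iff[THEN iffD2]\<close>)
    moreover have "D *v x \<in> W" if "x \<in> W" for x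
      using that less.prems(2) by (auto simp: W_def symmetric_matrix_inner[OF sym] v)
    ultimately obtain E \<mu> where E: "finite E" "\<And>e. e \<in> E \<Longrightarrow> norm e = 1 \<and> D *v e = \<mu> e *\<^sub>R e"
      "pairwise orthogonal E" "span E = W"
      using less.hyps[OF _ W] by metis
    have EW: "E \<subseteq> W" using E(4) span_superset by blast
    have vE: "v \<notin> E" using EW \<open>v \<notin> W\<close> by blast
    have "span (insert v E) = V"
    proof
      show "span (insert v E) \<subseteq> V"
        using EW v(1) less.prems(1) by (intro span_minimal) (auto simp: W_def)
      show "V \<subseteq> span (insert v E)"
      proof
        fix x assume x: "x \<in> V"
        have "x - (x \<bullet> v) *\<^sub>R v \<in> W"
          using x v less.prems(1) by (auto simp: W_def inner_diff_left norm_eq_1 intro!: subspace_diff subspace_scale)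
        then show "x \<in> span (insert v E)"
          unfolding span_insert E(4) by blast
      qed
    qed
    moreover have "pairwise orthogonal (insert v E)"
      using E(3) EW by (auto simp: pairwise_insert orthogonal_def W_def inner_commute)
    moreover have "norm e = 1 \<and> D *v e = (\<mu>(v := l)) e *\<^sub>R e" if "e \<in> insert v E" for e
      using that v E(2) vE by auto
    ultimately show ?thesis using E(1) by (intro exI[of _ "insert v E"] exI[of _ "\<mu>(v := l)"]) blast
  qed
qed

lemma orthonormal_expansion:
  fixes E :: "(real^'n) set"
  assumes "finite E" "\<And>e. e \<in> E \<Longrightarrow> norm e = 1" "pairwise orthogonal E" "x \<in> span E"
  shows "x = (\<Sum>e\<in>E. (e \<bullet> x) *\<^sub>R e)"
proof -
  have on: "e \<bullet> e' = (if e = e' then 1 else 0)" if "e \<in> E" "e' \<in> E" for e e'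
    using assms(2,3) that by (auto simp: norm_eq_1 pairwise_def orthogonal_def)
  obtain c where c: "x = (\<Sum>e\<in>E. c e *\<^sub>R e)" using assms(1,4) by (auto simp: span_finite)
  have "e \<bullet> x = c e" if "e \<in> E" for e
    using that assms(1) by (simp add: c inner_sum_right on sum.delta if_distrib[of "\<lambda>x. _ * x"] cong: sum.cong if_cong)
  then show ?thesis using c by simp
qed

text \<open>The square roots of the eigenvalues, used in an orthonormal eigenbasis of
  \<open>Q\<close>. Together with uniqueness this justifies the definite description in
  \<open>matrix_sqrt\<close>.\<close>

lemma matrix_sqrt_exists:
  fixes Q :: "real^'n^'n"
  assumes "sym_pos_semidef Q"
  shows "\<exists>R. sym_pos_semidef R \<and> R ** R = Q"
proof -
  have sym: "transpose Q = Q" and pos: "\<And>x. 0 \<le> x \<bullet> (Q *v x)"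
    using assms by (auto simp: sym_pos_semidef_def)
  obtain E \<mu> where E: "finite E" "\<And>e. e \<in> E \<Longrightarrow> norm e = 1" "\<And>e. e \<in> E \<Longrightarrow> Q *v e = \<mu> e *\<^sub>R e"
      "pairwise orthogonal E" "span E = UNIV"
    using symmetric_matrix_eigenbasis[OF sym, of UNIV] by auto
  have on: "e \<bullet> e' = (if e = e' then 1 else 0)" if "e \<in> E" "e' \<in> E" for e e'
    using E(2,4) that by (auto simp: norm_eq_1 pairwise_def orthogonal_def)
  have mu: "\<mu> e \<ge> 0" if "e \<in> E" for e
    using pos[of e] E(2,3)[OF that] by (simp add: norm_eq_1)
  define f where "f x = (\<Sum>e\<in>E. (sqrt (\<mu> e) * (e \<bullet> x)) *\<^sub>R e)" for x
  have lin: "linear f"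
    by (rule linearI) (auto simp: f_def inner_add_right algebra_simps sum.distrib scaleR_sum_right)
  have mf: "matrix f *v x = f x" for x using matrix_works[of f x] lin by simp
  have fe: "f e = sqrt (\<mu> e) *\<^sub>R e" if "e \<in> E" for e
    using that E(1) by (simp add: f_def on if_distrib[of "\<lambda>x. _ * x"] if_distrib[of "\<lambda>x. x *\<^sub>R _"] sum.delta cong: sum.cong if_cong)
  have fi: "x \<bullet> f y = (\<Sum>e\<in>E. sqrt (\<mu> e) * (e \<bullet> x) * (e \<bullet> y))" for x y
    by (simp add: f_def inner_sum_right mult_ac inner_commute)
  have "transpose (matrix f) = matrix f"
  proof -
    have "x \<bullet> (transpose (matrix f) *v y) = x \<bullet> (matrix f *v y)" for x y
    proof -
      have "x \<bullet> (transpose (matrix f) *v y) = (matrix f *v x) \<bullet> y"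
        by (metis dot_lmul_matrix inner_commute transpose_matrix_vector transpose_transpose)
      also have "\<dots> = x \<bullet> (matrix f *v y)"
        unfolding mf by (subst inner_commute) (simp add: fi mult_ac)
      finally show ?thesis .
    qed
    then show ?thesis by (metis matrix_eq vector_eq_ldot)
  qed
  moreover have "0 \<le> x \<bullet> (matrix f *v x)" for x
    unfolding mf fi using mu by (intro sum_nonneg) (auto simp: mult.assoc)
  moreover have "(matrix f ** matrix f) *v x = Q *v x" for x
  proof -
    have x: "x = (\<Sum>e\<in>E. (e \<bullet> x) *\<^sub>R e)"
      using orthonormal_expansion[of E x] E by auto
    have "f (f x) = (\<Sum>e\<in>E. (sqrt (\<mu> e) * (e \<bullet> x)) *\<^sub>R f e)"
      unfolding f_def[of x] using lin by (simp add: linear_sum linear_scale)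
    also have "\<dots> = (\<Sum>e\<in>E. (e \<bullet> x) *\<^sub>R (Q *v e))"
      using mu by (intro sum.cong) (auto simp: fe E(3))
    also have "\<dots> = Q *v (\<Sum>e\<in>E. (e \<bullet> x) *\<^sub>R e)"
      using matrix_vector_mul_linear[of Q] by (simp add: linear_sum matrix_vector_mult_scaleR)
    finally show ?thesis using x by (simp add: matrix_vector_mul_assoc[symmetric] mf)
  qed
  ultimately show ?thesis by (metis matrix_eq sym_pos_semidef_def)
qed

text \<open>If \<open>D = R - R'\<close>, then \<open>D R + R' D = 0\<close>; pairing this with an eigenvector of the symmetric
  matrix \<open>D\<close> shows that its eigenvalue vanishes.\<close>

lemma matrix_sqrt_unique:
  fixes R R' :: "real^'n^'n"
  assumes R: "sym_pos_semidef R" and R': "sym_pos_semidef R'" and eq: "R ** R = R' ** R'"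
  shows "R = R'"
proof -
  define D where "D = R - R'"
  have sym: "transpose R = R" "transpose R' = R'" "transpose D = D"
    using R R' by (auto simp: sym_pos_semidef_def D_def transpose_def vec_eq_iff)
  obtain E \<mu> where E: "finite E" "\<And>e. e \<in> E \<Longrightarrow> norm e = 1" "\<And>e. e \<in> E \<Longrightarrow> D *v e = \<mu> e *\<^sub>R e"
      "span E = UNIV"
    using symmetric_matrix_eigenbasis[OF sym(3), of UNIV] by auto
  have "D *v e = 0" if e: "e \<in> E" for e
  proof -
    have Dx: "D *v x = R *v x - R' *v x" for x by (simp add: D_def matrix_vector_mult_diff_rdistrib)
    have sq: "R *v (R *v e) = R' *v (R' *v e)" using eq by (simp add: matrix_vector_mul_assoc)
    have "e \<bullet> (D *v (R *v e)) + e \<bullet> (R' *v (D *v e)) = 0"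
      unfolding Dx by (simp add: sq matrix_vector_mult_diff_distrib inner_diff_right)
    moreover have "e \<bullet> (D *v (R *v e)) = \<mu> e * (e \<bullet> (R *v e))"
      using symmetric_matrix_inner[OF sym(3), of e "R *v e"] E(3)[OF e] by simp
    moreover have "e \<bullet> (R' *v (D *v e)) = \<mu> e * (e \<bullet> (R' *v e))"
      by (simp add: E(3)[OF e] matrix_vector_mult_scaleR)
    ultimately have z: "\<mu> e * (e \<bullet> (R *v e) + e \<bullet> (R' *v e)) = 0" by (simp add: algebra_simps)
    have mu: "e \<bullet> (R *v e) - e \<bullet> (R' *v e) = \<mu> e"
      using E(2)[OF e] arg_cong[OF E(3)[OF e], of "\<lambda>y. e \<bullet> y"] by (simp add: Dx inner_diff_right norm_eq_1)
    have "\<mu> e = 0"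
    proof (rule ccontr)
      assume nz: "\<mu> e \<noteq> 0"
      have "0 \<le> e \<bullet> (R *v e)" "0 \<le> e \<bullet> (R' *v e)" using R R' by (auto simp: sym_pos_semidef_def)
      with z nz mu show False by auto
    qed
    then show ?thesis using E(3)[OF e] by simp
  qed
  then have "D *v x = 0" if "x \<in> span E" for x
    using linear_eq_0_on_span[of "(*v) D" E x] that by auto
  then have "D *v x = 0 *v x" for x using E(4) by auto
  then have "D = 0" by (metis matrix_eq)
  then show ?thesis by (simp add: D_def)
qed

lemma matrix_sqrt:
  fixes Q :: "real^'n^'n"
  assumes "sym_pos_semidef Q"
  shows "sym_pos_semidef (matrix_sqrt Q)" "matrix_sqrt Q ** matrix_sqrt Q = Q"
proof -
  have "\<exists>!R. sym_pos_semidef R \<and> R ** R = Q"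
    using matrix_sqrt_exists[OF assms] matrix_sqrt_unique by metis
  from theI'[OF this, folded matrix_sqrt_def]
  show "sym_pos_semidef (matrix_sqrt Q)" "matrix_sqrt Q ** matrix_sqrt Q = Q" by auto
qed

section \<open>Exponential decay from the spectrum\<close>

lemma norm_vector_scalar_mult: "norm (c *s (v::complex^'n)) = cmod c * norm v"
  by (simp add: norm_vec_def norm_mult L2_set_right_distrib)

lemma bilinear_vector_scalar_mult: "bilinear ((*s) :: complex \<Rightarrow> complex^'n \<Rightarrow> complex^'n)"
  by (auto simp: bilinear_def vec_eq_iff algebra_simps intro!: linearI)

lemmas bounded_bilinear_vector_scalar_mult = bilinear_conv_bounded_bilinear[THEN iffD1, OF bilinear_vector_scalar_mult]

lemma complex_matrix_mult: "complex_matrix (A ** B) = complex_matrix A ** complex_matrix (B::real^'n^'n)"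
  by (simp add: complex_matrix_def matrix_matrix_mult_def vec_eq_iff)

lemma complex_matrix_mat_1: "complex_matrix (mat 1) = mat 1"
  by (simp add: complex_matrix_def mat_def vec_eq_iff)

lemma bounded_linear_complex_matrix_vector:
  "bounded_linear (\<lambda>A::real^'n^'n. complex_matrix A *v v)"
  unfolding linear_conv_bounded_linear[symmetric]
  by (rule linearI)
    (auto simp: complex_matrix_def matrix_vector_mult_def vec_eq_iff sum.distrib algebra_simps
      scaleR_conv_of_real[where 'a=complex] sum_distrib_left)

lemma complex_matrix_sum_scaleR:
  "complex_matrix (\<Sum>k\<in>I. a k *\<^sub>R P k) *v v = (\<Sum>k\<in>I. complex_of_real (a k) *s (complex_matrix (P k :: real^'n^'n) *v v))"
proof -
  interpret bounded_linear "\<lambda>A::real^'n^'n. complex_matrix A *v v"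
    by (rule bounded_linear_complex_matrix_vector)
  have "c *\<^sub>R w = complex_of_real c *s w" for c and w :: "complex^'n"
    by (simp add: vec_eq_iff scaleR_conv_of_real[where 'a=complex])
  then show ?thesis by (simp add: sum scale)
qed

lemma complex_matrix_exp_deriv:
  "((\<lambda>t. complex_matrix (matrix_exp (t *\<^sub>R B)) *v v) has_vector_derivative
     complex_matrix (matrix_exp (t *\<^sub>R B)) *v (complex_matrix (B::real^'n^'n) *v v)) (at t)"
  using bounded_linear.has_vector_derivative[OF bounded_linear_complex_matrix_vector matrix_exp_deriv_right]
  by (simp add: complex_matrix_mult matrix_vector_mul_assoc)

text \<open>The product of the factors A - z, one for each list entry, applied to a vector. Keeping
  the factors as a list lets the decay proof remove one root at a time.\<close>

primrec shifted_product :: "complex^'n^'n \<Rightarrow> complex list \<Rightarrow> complex^'n \<Rightarrow> complex^'n" where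
  "shifted_product A [] v = v"
| "shifted_product A (z # zs) v = shifted_product A zs (A *v v - z *s v)"

lemma matrix_vector_scalar_mult: "(A::complex^'n^'n) *v (c *s v) = c *s (A *v v)"
  by (simp add: matrix_vector_mult_def vec_eq_iff sum_distrib_left mult_ac)

lemma funpow_matrix_linear:
  "(((*v) (A::complex^'n^'n)) ^^ k) (v - c *s w) = (((*v) A) ^^ k) v - c *s (((*v) A) ^^ k) w"
  by (induction k) (simp_all add: matrix_vector_mult_diff_distrib matrix_vector_scalar_mult)

text \<open>Applying (X - z) q to v amounts to applying q to (A - z) v. The degree bound keeps the
  shifted index inside the sum.\<close>

lemma polynomial_action_factor:
  fixes A :: "complex^'n^'n"
  assumes "degree q < N"
  shows "(\<Sum>k<Suc N. coeff ([:-z, 1:] * q) k *s (((*v) A) ^^ k) v) =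
    (\<Sum>k<N. coeff q k *s (((*v) A) ^^ k) (A *v v - z *s v))"
proof -
  have c: "coeff ([:-z, 1:] * q) k = coeff (pCons 0 q) k - z * coeff q k" for k by simp
  have "(\<Sum>k<Suc N. coeff ([:-z, 1:] * q) k *s (((*v) A) ^^ k) v) =
     (\<Sum>k<Suc N. coeff (pCons 0 q) k *s (((*v) A) ^^ k) v) - (\<Sum>k<Suc N. (z * coeff q k) *s (((*v) A) ^^ k) v)"
    unfolding c by (simp only: vector_sub_rdistrib sum_subtractf)
  also have "(\<Sum>k<Suc N. coeff (pCons 0 q) k *s (((*v) A) ^^ k) v) = (\<Sum>k<N. coeff q k *s (((*v) A) ^^ k) (A *v v))"
    by (subst sum.lessThan_Suc_shift) (simp add: funpow_swap1)
  also have "(\<Sum>k<Suc N. (z * coeff q k) *s (((*v) A) ^^ k) v) = (\<Sum>k<N. (z * coeff q k) *s (((*v) A) ^^ k) v)"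
    using assms by (simp add: coeff_eq_0)
  also have "(\<Sum>k<N. coeff q k *s (((*v) A) ^^ k) (A *v v)) - (\<Sum>k<N. (z * coeff q k) *s (((*v) A) ^^ k) v)
     = (\<Sum>k<N. coeff q k *s (((*v) A) ^^ k) (A *v v - z *s v))"
    unfolding funpow_matrix_linear sum_subtractf[symmetric]
    by (intro sum.cong refl) (simp add: vec_eq_iff algebra_simps)
  finally show ?thesis .
qed

text \<open>The fundamental theorem of algebra, read as a statement about polynomials in the matrix
  \<open>A\<close>.\<close>

lemma polynomial_action_split:
  fixes A :: "complex^'n^'n"
  assumes "p \<noteq> 0"
  shows "\<exists>zs c. c \<noteq> 0 \<and> (\<forall>v. (\<Sum>k<Suc (degree p). coeff p k *s (((*v) A) ^^ k) v) = c *s shifted_product A zs v)"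
  using assms
proof (induction "degree p" arbitrary: p)
  case 0
  then obtain a where p: "p = [:a:]" using degree_eq_zeroE by metis
  with 0 show ?case by (intro exI[of _ "[]"] exI[of _ a]) auto
next
  case (Suc d)
  have "degree p > 0" using Suc.hyps(2) by simp
  then have "\<not> (\<exists>a l. a \<noteq> 0 \<and> l = 0 \<and> p = pCons a l)" by auto
  then obtain z where "poly p z = 0" using fundamental_theorem_of_algebra_alt by blast
  then obtain q where p: "p = [:-z, 1:] * q" by (metis dvdE poly_eq_0_iff_dvd)
  have q: "q \<noteq> 0" using Suc.prems p by auto
  then have dq: "degree p = Suc (degree q)" unfolding p by (subst degree_mult_eq) auto
  then have "d = degree q" using Suc.hyps(2) by simp
  from Suc.hyps(1)[OF this q] obtain zs c where
    zs: "c \<noteq> 0" "\<And>v. (\<Sum>k<Suc (degree q). coeff q k *s (((*v) A) ^^ k) v) = c *s shifted_product A zs v" by blast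
  have "(\<Sum>k<Suc (degree p). coeff p k *s (((*v) A) ^^ k) v) = c *s shifted_product A (z # zs) v" for v
    unfolding dq using polynomial_action_factor[OF lessI, where q = q and z = z and A = A and v = v] zs(2)[of "A *v v - z *s v"]
    by (simp only: p[symmetric] shifted_product.simps)
  with zs(1) show ?case by blast
qed

text \<open>More powers than the dimension n^2 of the space of matrices must be dependent; this
  gives an annihilating polynomial without Cayley-Hamilton.\<close>

lemma matrix_powers_dependent:
  fixes B :: "real^'n^'n"
  obtains a :: "nat \<Rightarrow> real" and N where "\<exists>k\<le>N. a k \<noteq> 0" "(\<Sum>k\<le>N. a k *\<^sub>R matrix_power B k) = 0"
proof -
  let ?N = "DIM(real^'n^'n)" and ?P = "matrix_power B"
  show thesis
  \<comment> \<open>Dependence is a property of the set of powers, so a repeated power has to be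
    treated separately.\<close>
  proof (cases "inj_on ?P {..?N}")
    case False
    then obtain i j where ij: "i \<le> ?N" "j \<le> ?N" "i \<noteq> j" "?P i = ?P j" by (auto simp: inj_on_def)
    define a :: "nat \<Rightarrow> real" where "a k = (if k = i then 1 else if k = j then -1 else 0)" for k
    have "(\<Sum>k\<le>?N. a k *\<^sub>R ?P k) = (\<Sum>k\<in>{i, j}. a k *\<^sub>R ?P k)"
      using ij by (intro sum.mono_neutral_right) (auto simp: a_def)
    also have "\<dots> = 0" using ij by (simp add: a_def)
    finally show thesis using ij by (intro that[of ?N a]) (auto simp: a_def)
  next
    case True
    have "card (?P ` {..?N}) > ?N" using True by (simp add: card_image)
    then have "dependent (?P ` {..?N})"
      using independent_bound[of "?P ` {..?N}"] by (meson not_le)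
    then obtain u where u: "\<exists>v\<in>?P ` {..?N}. u v \<noteq> 0" "(\<Sum>v\<in>?P ` {..?N}. u v *\<^sub>R v) = 0"
      by (auto simp: dependent_finite)
    show thesis
      using u True by (intro that[of ?N "\<lambda>k. u (?P k)"]) (auto simp: sum.reindex)
  qed
qed

text \<open>The roots come from some annihilating polynomial, so the list may contain numbers
  outside the spectrum; the decay proof has to cope with them.\<close>

lemma matrix_annihilating_roots:
  fixes B :: "real^'n^'n"
  shows "\<exists>zs. \<forall>v. shifted_product (complex_matrix B) zs v = 0"
proof -
  let ?A = "complex_matrix B"
  obtain a N where a: "\<exists>k\<le>N. a k \<noteq> 0" "(\<Sum>k\<le>N. a k *\<^sub>R matrix_power B k) = 0"
    by (rule matrix_powers_dependent)
  have pw: "(((*v) ?A) ^^ k) v = complex_matrix (matrix_power B k) *v v" for k v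
    by (induction k) (simp_all add: complex_matrix_mat_1 matrix_power_Suc complex_matrix_mult matrix_vector_mul_assoc)
  define p where "p = (\<Sum>k\<le>N. monom (complex_of_real (a k)) k)"
  have cp: "coeff p k = (if k \<le> N then complex_of_real (a k) else 0)" for k
    unfolding p_def by (simp add: coeff_sum)
  have p0: "p \<noteq> 0" using a(1) cp by (metis coeff_0 of_real_eq_0_iff)
  have deg: "degree p \<le> N" by (rule degree_le) (simp add: cp)
  obtain zs c where zs: "c \<noteq> 0" "\<And>v. (\<Sum>k<Suc (degree p). coeff p k *s (((*v) ?A) ^^ k) v) = c *s shifted_product ?A zs v"
    using polynomial_action_split[OF p0, of ?A] by blast
  have "shifted_product ?A zs v = 0" for v
  proof -
    have "(\<Sum>k<Suc (degree p). coeff p k *s (((*v) ?A) ^^ k) v) = (\<Sum>k\<le>N. coeff p k *s (((*v) ?A) ^^ k) v)"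
      using deg by (intro sum.mono_neutral_left) (auto simp: coeff_eq_0)
    also have "\<dots> = (\<Sum>k\<le>N. complex_of_real (a k) *s (complex_matrix (matrix_power B k) *v v))"
      by (simp add: cp pw)
    also have "\<dots> = complex_matrix 0 *v v"
      by (simp only: complex_matrix_sum_scaleR[symmetric] a(2))
    also have "\<dots> = 0" by (simp add: complex_matrix_def matrix_vector_mult_def vec_eq_iff)
    finally have "c *s shifted_product ?A zs v = 0" using zs(2)[of v] by simp
    then show ?thesis using zs(1) by simp
  qed
  then show ?thesis by blast
qed

text \<open>If \<open>u = (B - z) v\<close> has a decaying orbit then \<open>e^(-z t) e^(t B) v\<close> has the derivative
  \<open>e^(-z t) e^(t B) u\<close>, which integrates to a bound for the orbit of \<open>v\<close>.\<close>

lemma decay_step: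
  fixes B :: "real^'n^'n"
  assumes z: "Re z + c < 0"
    and u: "\<And>t. t \<ge> 0 \<Longrightarrow> norm (complex_matrix (matrix_exp (t *\<^sub>R B)) *v (complex_matrix B *v v - z *s v)) \<le> C * exp (- c * t)"
    and t: "t \<ge> 0"
  shows "norm (complex_matrix (matrix_exp (t *\<^sub>R B)) *v v) \<le> (norm v + C / (- Re z - c)) * exp (- c * t)"
proof -
  let ?E = "\<lambda>t. complex_matrix (matrix_exp (t *\<^sub>R B))"
  let ?u = "complex_matrix B *v v - z *s v"
  define a where "a = - Re z - c"
  have a: "a > 0" using z by (simp add: a_def)
  have C: "C \<ge> 0" using order_trans[OF norm_ge_zero u[of 0]] by simp
  define g where "g t = exp (- z * complex_of_real t) *s (?E t *v v)" for t
  have "matrix_exp (0::real^'n^'n) = mat 1" using matrix_exp_0[of B] by simp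
  then have g0: "g 0 = v" by (simp add: g_def complex_matrix_mat_1)
  have gd: "(g has_vector_derivative exp (- z * complex_of_real s) *s (?E s *v ?u)) (at s)" for s
  proof -
    have 1: "((\<lambda>t. exp (- z * complex_of_real t)) has_vector_derivative - z * exp (- z * complex_of_real s)) (at s)"
      by (rule has_vector_derivative_real_field[of "\<lambda>w. exp (- z * w)"]) (auto intro!: derivative_eq_intros)
    have "exp (- z * complex_of_real s) *s (?E s *v (complex_matrix B *v v)) + (- z * exp (- z * complex_of_real s)) *s (?E s *v v)
       = exp (- z * complex_of_real s) *s (?E s *v ?u)"
      by (simp add: matrix_vector_mult_diff_distrib matrix_vector_scalar_mult vec_eq_iff algebra_simps)
    with bounded_bilinear.has_vector_derivative[OF bounded_bilinear_vector_scalar_mult 1 complex_matrix_exp_deriv[of B v s]]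
    show ?thesis unfolding g_def by simp
  qed
  have "norm (g t - g 0) \<le> C / a * exp (a * t) - C / a * exp (a * 0)"
  proof (cases "t = 0")
    case False
    with t have "0 < t" by simp
    then show ?thesis
    proof (rule differentiable_bound_general)
      show "continuous_on {0..t} g"
        using gd by (intro continuous_at_imp_continuous_on) (auto intro: has_vector_derivative_continuous)
      show "continuous_on {0..t} (\<lambda>t. C / a * exp (a * t))" by (intro continuous_intros)
      show "((\<lambda>t. C / a * exp (a * t)) has_vector_derivative C * exp (a * s)) (at s)" for s
        unfolding has_real_derivative_iff_has_vector_derivative[symmetric] using a
        by (auto intro!: derivative_eq_intros)
      show "norm (exp (- z * complex_of_real s) *s (?E s *v ?u)) \<le> C * exp (a * s)" if "0 < s" for s
      proof -
        have "norm (exp (- z * complex_of_real s) *s (?E s *v ?u)) \<le> exp (- Re z * s) * (C * exp (- c * s))"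
          using u[of s] that by (auto simp: norm_vector_scalar_mult norm_exp_eq_Re intro!: mult_left_mono)
        also have "\<dots> = C * exp (a * s)" by (simp add: a_def algebra_simps exp_add[symmetric] flip: exp_add)
        finally show ?thesis .
      qed
    qed (rule gd)
  qed simp
  then have "norm (g t) \<le> norm v + C / a * exp (a * t) - C / a"
    using norm_triangle_ineq2[of "g t" "g 0"] g0 by simp
  also have "\<dots> \<le> norm v + C / a * exp (a * t)" using a C by simp
  also have "\<dots> \<le> norm v * exp (a * t) + C / a * exp (a * t)"
    using a t by (simp add: mult_left_mono[of 1 "exp (a*t)" "norm v", simplified])
  finally have gb: "norm (g t) \<le> (norm v + C / a) * exp (a * t)" by (simp add: algebra_simps)
  have "?E t *v v = exp (z * complex_of_real t) *s g t"
    by (simp add: g_def vec_eq_iff exp_minus field_simps)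
  then have "norm (?E t *v v) = exp (Re z * t) * norm (g t)"
    by (simp add: norm_vector_scalar_mult norm_exp_eq_Re)
  also have "\<dots> \<le> exp (Re z * t) * ((norm v + C / a) * exp (a * t))" by (intro mult_left_mono gb) simp
  also have "\<dots> = (norm v + C / a) * exp (- c * t)"
    by (simp add: a_def algebra_simps flip: exp_add)
  finally show ?thesis by (simp add: a_def)
qed

text \<open>Induction on the roots. A root in the spectrum has real part below -c and is handled by
  \<open>decay_step\<close>. For any other root z - B is invertible and commutes with the
  exponential, so the orbit of \<open>v\<close> is a fixed matrix applied to the orbit of (B - z) v,
  and the rate is kept.\<close>

lemma complex_orbit_decay:
  fixes B :: "real^'n^'n"
  assumes c: "\<And>z. z \<in> set zs \<Longrightarrow> z \<in> matrix_spectrum B \<Longrightarrow> Re z + c < 0"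
    and "shifted_product (complex_matrix B) zs v = 0"
  shows "\<exists>C. \<forall>t\<ge>0. norm (complex_matrix (matrix_exp (t *\<^sub>R B)) *v v) \<le> C * exp (- c * t)"
  using assms
proof (induction zs arbitrary: v)
  case Nil
  then show ?case by (intro exI[of _ 0]) auto
next
  case (Cons z zs)
  let ?A = "complex_matrix B" and ?E = "\<lambda>t. complex_matrix (matrix_exp (t *\<^sub>R B))"
  obtain C where C: "\<And>t. t \<ge> 0 \<Longrightarrow> norm (?E t *v (?A *v v - z *s v)) \<le> C * exp (- c * t)"
    using Cons.IH[of "?A *v v - z *s v"] Cons.prems by auto
  show ?case
  proof (cases "z \<in> matrix_spectrum B")
    case True
    then have "Re z + c < 0" using Cons.prems(1) by simp
    from decay_step[OF this C] show ?thesis by blast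
  next
    case False
    then obtain R where R: "R ** (mat z - ?A) = mat 1"
      unfolding matrix_spectrum_def invertible_def by auto
    have comm: "?A ** ?E t = ?E t ** ?A" for t
      by (simp only: complex_matrix_mult[symmetric] matrix_exp_commute)
    have "?E t *v v = - (R *v (?E t *v (?A *v v - z *s v)))" for t
    proof -
      have mz: "mat z *v w = z *s w" for w :: "complex^'n"
        by (simp add: mat_def matrix_vector_mult_def vec_eq_iff if_distrib[of "\<lambda>x. x * _"] sum.delta cong: if_cong)
      have "(mat z - ?A) *v (?E t *v v) = - (?E t *v (?A *v v - z *s v))"
        using arg_cong[OF comm[of t], of "\<lambda>M. M *v v"]
        by (simp add: matrix_vector_mult_diff_rdistrib matrix_vector_mult_diff_distrib mz matrix_vector_scalar_mult
            matrix_vector_mul_assoc[symmetric])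
      then have "R *v ((mat z - ?A) *v (?E t *v v)) = R *v (- (?E t *v (?A *v v - z *s v)))" by simp
      moreover have "R *v (- w) = - (R *v w)" for w
        by (simp add: matrix_vector_mult_def vec_eq_iff sum_negf)
      moreover have "R *v ((mat z - ?A) *v w) = w" for w
        by (simp only: matrix_vector_mul_assoc R matrix_vector_mul_lid)
      ultimately show ?thesis by (simp only:)
    qed note eq = this
    have "linear ((*v) R)"
      by (rule linearI) (simp add: matrix_vector_right_distrib, simp add: matrix_vector_mult_def vec_eq_iff scaleR_sum_right)
    then obtain K where K: "K > 0" "\<And>w. norm (R *v w) \<le> K * norm w"
      using linear_bounded_pos by metis
    have "norm (?E t *v v) \<le> (K * C) * exp (- c * t)" if "t \<ge> 0" for t
      unfolding eq[of t] norm_minus_cancel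
      using order_trans[OF K(2) mult_left_mono[OF C[OF that], of K]] K(1) by (simp add: mult.assoc)
    then show ?thesis by blast
  qed
qed

lemma matrix_exp_decay:
  fixes B :: "real^'n^'n"
  assumes "matrix_spectrum B \<subseteq> {z. Re z < 0}"
  obtains c C where "c > 0" "C > 0" "\<And>t. t \<ge> 0 \<Longrightarrow> norm (matrix_exp (t *\<^sub>R B)) \<le> C * exp (- c * t)"
proof -
  obtain zs where zs: "\<And>v. shifted_product (complex_matrix B) zs v = 0"
    using matrix_annihilating_roots[of B] by blast
  let ?Z = "set zs \<inter> matrix_spectrum B"
  \<comment> \<open>Half the smallest distance of the relevant roots from the imaginary axis: the
    halving makes the inequality required by \<open>decay_step\<close> strict, and the 1 keeps the
    set nonempty.\<close>
  define c where "c = Min (insert 1 ((\<lambda>z. - Re z) ` ?Z)) / 2"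
  have M0: "Min (insert 1 ((\<lambda>z. - Re z) ` ?Z)) > 0" using assms by (subst Min_gr_iff) auto
  have M: "Min (insert 1 ((\<lambda>z. - Re z) ` ?Z)) \<le> - Re z" if "z \<in> ?Z" for z
    using that by (intro Min_le) auto
  have c0: "c > 0" using M0 by (simp add: c_def)
  have c: "Re z + c < 0" if "z \<in> set zs" "z \<in> matrix_spectrum B" for z
    using M[of z] M0 that unfolding c_def by (smt (verit, best) IntI field_sum_of_halves)
  have "\<exists>C. \<forall>t\<ge>0. norm (complex_matrix (matrix_exp (t *\<^sub>R B)) *v v) \<le> C * exp (- c * t)" for v
    by (rule complex_orbit_decay[OF c zs])
  then obtain D where D: "\<And>v t. t \<ge> 0 \<Longrightarrow> norm (complex_matrix (matrix_exp (t *\<^sub>R B)) *v v) \<le> D v * exp (- c * t)"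
    by metis
  have entry: "\<bar>matrix_exp (t *\<^sub>R B) $ i $ j\<bar> \<le> D (axis j 1) * exp (- c * t)" if "t \<ge> 0" for t i j
  proof -
    have "(complex_matrix (matrix_exp (t *\<^sub>R B)) *v axis j 1) $ i = complex_of_real (matrix_exp (t *\<^sub>R B) $ i $ j)"
      by (simp add: complex_matrix_def matrix_vector_mult_def axis_def if_distrib[of "\<lambda>x. _ * x"] sum.delta cong: if_cong)
    then have "\<bar>matrix_exp (t *\<^sub>R B) $ i $ j\<bar> = norm ((complex_matrix (matrix_exp (t *\<^sub>R B)) *v axis j 1) $ i)" by simp
    also have "\<dots> \<le> norm (complex_matrix (matrix_exp (t *\<^sub>R B)) *v axis j 1)" by (rule Finite_Cartesian_Product.norm_nth_le)
    finally show ?thesis using D[OF that, of "axis j 1"] by linarith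
  qed
  define C where "C = \<bar>\<Sum>i\<in>(UNIV::'n set). \<Sum>j\<in>UNIV. D (axis j 1)\<bar> + 1"
  have "norm (matrix_exp (t *\<^sub>R B)) \<le> C * exp (- c * t)" if "t \<ge> 0" for t
  proof -
    have "norm (matrix_exp (t *\<^sub>R B)) \<le> (\<Sum>i\<in>UNIV. norm (matrix_exp (t *\<^sub>R B) $ i))"
      unfolding norm_vec_def[of "matrix_exp _"] by (rule L2_set_le_sum) simp
    also have "\<dots> \<le> (\<Sum>i\<in>(UNIV::'n set). \<Sum>j\<in>UNIV. D (axis j 1) * exp (- c * t))"
      by (intro sum_mono order_trans[OF norm_le_l1_cart]) (use entry[OF that] in auto)
    also have "\<dots> = (\<Sum>i\<in>(UNIV::'n set). \<Sum>j\<in>UNIV. D (axis j 1)) * exp (- c * t)"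
      by (simp only: sum_distrib_right)
    also have "\<dots> \<le> C * exp (- c * t)" by (intro mult_right_mono) (auto simp: C_def)
    finally show ?thesis .
  qed
  with c0 show thesis by (intro that[of c C]) (auto simp: C_def)
qed

section \<open>Quantitative form of the rank condition\<close>

lemma landau_inequality:
  fixes f f1 f2 :: "real \<Rightarrow> 'b::real_normed_vector"
  assumes f: "\<And>s. (f has_vector_derivative f1 s) (at s)" and f1: "\<And>s. (f1 has_vector_derivative f2 s) (at s)"
    and bf: "\<And>s. 0 \<le> s \<Longrightarrow> s \<le> t \<Longrightarrow> norm (f s) \<le> h\<^sup>2"
    and bf2: "\<And>s. 0 \<le> s \<Longrightarrow> s \<le> t \<Longrightarrow> norm (f2 s) \<le> M"
    and h: "0 < h" "2 * h \<le> t" and s: "0 \<le> s" "s \<le> t"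
  shows "norm (f1 s) \<le> (2 + M) * h"
proof -
  have M: "M \<ge> 0" using order_trans[OF norm_ge_zero bf2[of 0]] h by simp
  \<comment> \<open>A step of length \<open>h\<close> to the side that stays in [0, t]; one side
    always works because 2 h \<le> t.\<close>
  obtain k where k: "0 \<le> s + k" "s + k \<le> t" "\<bar>k\<bar> = h"
  proof (cases "s + h \<le> t")
    case True
    then show ?thesis using that[of h] s h by simp
  next
    case False
    then show ?thesis using that[of "-h"] s h by simp
  qed
  let ?I = "closed_segment s (s + k)"
  have I: "x \<in> ?I \<Longrightarrow> 0 \<le> x \<and> x \<le> t \<and> \<bar>x - s\<bar> \<le> h" for x
    using k s unfolding closed_segment_eq_real_ivl by (auto split: if_splits)
  have 1: "norm (f1 x - f1 s) \<le> M * h" if x: "x \<in> ?I" for x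
  proof -
    have "norm (f1 x - f1 s) \<le> M * norm (x - s)"
    proof (rule differentiable_bound[of ?I f1 "\<lambda>y h. h *\<^sub>R f2 y"])
      show "onorm (\<lambda>h. h *\<^sub>R f2 y) \<le> M" if "y \<in> ?I" for y
        using bf2[of y] I[OF that] M by (intro onorm_le) (auto simp: mult.commute[of M] intro!: mult_left_mono)
    qed (use x f1 in \<open>auto simp: has_vector_derivative_def intro: has_derivative_at_withinI\<close>)
    also have "\<dots> \<le> M * h" using I[OF x] M by (intro mult_left_mono) auto
    finally show ?thesis .
  qed
  \<comment> \<open>Second order Taylor estimate: h |f1| is at most 2 sup |f| + M h^2, and |f| \<le>
    h^2.\<close>
  have "norm ((f (s + k) - (s + k) *\<^sub>R f1 s) - (f s - s *\<^sub>R f1 s)) \<le> (M * h) * norm (s + k - s)"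
  proof (rule differentiable_bound[of ?I "\<lambda>x. f x - x *\<^sub>R f1 s" "\<lambda>y h. h *\<^sub>R (f1 y - f1 s)"])
    have "((\<lambda>x. x *\<^sub>R f1 s) has_vector_derivative f1 s) (at y)" for y
      by (auto intro!: derivative_eq_intros)
    then have "((\<lambda>x. f x - x *\<^sub>R f1 s) has_vector_derivative f1 y - f1 s) (at y)" for y
      by (intro has_vector_derivative_diff f)
    then show "((\<lambda>x. f x - x *\<^sub>R f1 s) has_derivative (\<lambda>h. h *\<^sub>R (f1 y - f1 s))) (at y within ?I)" for y
      unfolding has_vector_derivative_def by (rule has_derivative_at_withinI)
    show "onorm (\<lambda>h. h *\<^sub>R (f1 y - f1 s)) \<le> M * h" if "y \<in> ?I" for y
      using 1[OF that] M h by (intro onorm_le) (auto simp: mult.commute[of "M * h"] intro!: mult_left_mono)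
  qed auto
  then have "norm (f (s + k) - f s - k *\<^sub>R f1 s) \<le> M * h * h" using k by (simp add: algebra_simps)
  moreover have "norm (k *\<^sub>R f1 s) \<le> norm (f (s + k) - f s - k *\<^sub>R f1 s) + norm (f (s + k)) + norm (f s)"
    using norm_triangle_ineq4[of "f (s + k)" "f s"] norm_triangle_ineq2[of "k *\<^sub>R f1 s" "f (s + k) - f s"]
    by (simp add: norm_minus_commute)
  ultimately have "h * norm (f1 s) \<le> M * h * h + h\<^sup>2 + h\<^sup>2"
    using bf[of "s + k"] bf[of s] k s by simp
  also have "\<dots> = h * ((2 + M) * h)" by (simp add: power2_eq_square algebra_simps)
  finally show ?thesis using h by simp
qed

text \<open>After transposition the hypothesis says that \<open>w\<close> is orthogonal to every
  column of the Kalman matrix, and by the rank condition these columns span the space.\<close>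

lemma kalman_injective:
  fixes Q B :: "real^'n^'n"
  assumes rank: "rank (kalman_matrix Q B) = CARD('n)"
    and sym: "transpose (matrix_sqrt Q) = matrix_sqrt Q"
    and w: "\<And>m. m < CARD('n) \<Longrightarrow> matrix_sqrt Q *v (matrix_power (transpose B) m *v w) = 0"
  shows "w = 0"
proof -
  have col: "w \<bullet> c = 0" if cin: "c \<in> columns (kalman_matrix Q B)" for c
  proof -
    obtain m k where m: "m < CARD('n)" "c = column k (matrix_power B m ** matrix_sqrt Q)"
    proof -
      from cin have "c \<in> (\<Union>m<CARD('n). columns (matrix_power B m ** matrix_sqrt Q))"
        by (simp only: columns_kalman_matrix)
      then obtain m where m: "m < CARD('n)" "c \<in> columns (matrix_power B m ** matrix_sqrt Q)" by blast
      then obtain k where "c = column k (matrix_power B m ** matrix_sqrt Q)" unfolding columns_def by blast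
      with m(1) show ?thesis using that by blast
    qed
    have "c = (matrix_power B m ** matrix_sqrt Q) *v axis k 1" using m(2) by (simp add: matrix_vector_mult_basis)
    then have "w \<bullet> c = (transpose (matrix_power B m ** matrix_sqrt Q) *v w) \<bullet> axis k 1"
      by (simp add: dot_lmul_matrix)
    also have "transpose (matrix_power B m ** matrix_sqrt Q) *v w = 0"
      unfolding matrix_transpose_mul sym transpose_matrix_power using w[OF m(1)]
      by (simp only: matrix_vector_mul_assoc)
    finally show ?thesis by simp
  qed
  have "dim (columns (kalman_matrix Q B)) = DIM(real^'n)"
    using rank by (simp add: column_rank_def)
  then have "span (columns (kalman_matrix Q B)) = UNIV" by (simp only: dim_eq_full)
  moreover have "w \<bullet> x = 0" if "x \<in> span (columns (kalman_matrix Q B))" for x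
    using that by (induction rule: span_induct_alt) (auto simp: inner_add_right col)
  ultimately have "w \<bullet> w = 0" by auto
  then show ?thesis by simp
qed

text \<open>Compactness of the unit sphere makes \<open>kalman_injective\<close> uniform. The bound
  is capped at 1 because it serves as the small parameter of the next proof.\<close>

lemma kalman_lower_bound:
  fixes Q B :: "real^'n^'n"
  assumes rank: "rank (kalman_matrix Q B) = CARD('n)"
    and sym: "transpose (matrix_sqrt Q) = matrix_sqrt Q"
  obtains x where "0 < x" "x \<le> 1"
    "\<And>w. norm w = 1 \<Longrightarrow> \<exists>m<CARD('n). x < norm (matrix_sqrt Q *v (matrix_power (transpose B) m *v w))"
proof -
  let ?g = "\<lambda>m w. norm (matrix_sqrt Q *v (matrix_power (transpose B) m *v w))"
  let ?f = "\<lambda>w. \<Sum>m<CARD('n). ?g m w"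
  have cont: "continuous_on (sphere 0 1) ?f"
    unfolding matrix_vector_mul_assoc
    by (intro continuous_intros matrix_vector_mult_linear_continuous_on)
  have ne: "sphere (0::real^'n) 1 \<noteq> {}" by simp
  obtain w0 where w0: "w0 \<in> sphere 0 1" and min: "\<forall>w\<in>sphere 0 1. ?f w0 \<le> ?f w"
    by (rule bexE[OF continuous_attains_inf[OF compact_sphere ne cont]])
  have "?f w0 > 0"
  proof -
    have "?f w0 \<noteq> 0"
    proof
      assume "?f w0 = 0"
      then have "\<forall>m\<in>{..<CARD('n)}. ?g m w0 = 0"
        using sum_nonneg_eq_0_iff[of "{..<CARD('n)}" "\<lambda>m. ?g m w0", OF finite_lessThan norm_ge_zero] by blast
      then have z: "?g m w0 = 0" if "m < CARD('n)" for m
        by (rule bspec) (simp only: lessThan_iff that)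
      have "w0 = 0" by (rule kalman_injective[OF rank sym]) (use z in \<open>simp only: norm_eq_zero\<close>)
      with w0 show False by simp
    qed
    moreover have "?f w0 \<ge> 0" by (intro sum_nonneg) simp
    ultimately show ?thesis by linarith
  qed
  define x where "x = min 1 (?f w0 / (2 * CARD('n)))"
  have "\<exists>m<CARD('n). x < ?g m w" if "norm w = 1" for w
  proof (rule ccontr)
    assume "\<not> ?thesis"
    then have "?f w \<le> (\<Sum>m<CARD('n). x)" by (intro sum_mono) auto
    also have "\<dots> \<le> ?f w0 / 2" by (simp add: x_def min_def field_simps)
    finally show False using bspec[OF min, of w] that \<open>?f w0 > 0\<close> by simp
  qed
  then show thesis using \<open>?f w0 > 0\<close> by (intro that[of x]) (auto simp: x_def)
qed

text \<open>Smallness of the increment of \<open>G\<close> on \<open>[0, t]\<close> propagates, by Landau's inequality, to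
  the derivatives of \<open>R e^(s B^T) w\<close> and contradicts the rank condition.\<close>

lemma gramian_lower_bound:
  fixes Q B :: "real^'n^'n" and G :: "real^'n \<Rightarrow> real \<Rightarrow> real"
  defines "R \<equiv> matrix_sqrt Q"
  assumes rank: "rank (kalman_matrix Q B) = CARD('n)"
    and sym: "transpose R = R"
    and G: "\<And>w s. (G w has_vector_derivative - (norm (R *v (matrix_exp (s *\<^sub>R transpose B) *v w)))\<^sup>2) (at s)"
    and bound: "\<And>s. 0 \<le> s \<Longrightarrow> norm (matrix_exp (s *\<^sub>R transpose B)) \<le> C"
  obtains c k where "0 < c" "\<And>w t. norm w = 1 \<Longrightarrow> 0 < t \<Longrightarrow> t \<le> 1 \<Longrightarrow> c * t ^ k \<le> G w 0 - G w t"
proof -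
  let ?n = "CARD('n)"
  \<comment> \<open>The j-th derivative of the observed adjoint orbit R e^(s B^T) w; at s = 0 it is
    the vector that occurs in the rank condition.\<close>
  define h where "h j w s = R *v (matrix_power (transpose B) j *v (matrix_exp (s *\<^sub>R transpose B) *v w))" for j w s
  have hd: "(h j w has_vector_derivative h (Suc j) w s) (at s)" for j w s
  proof -
    have "bounded_linear (\<lambda>v. R *v (matrix_power (transpose B) j *v v))"
      by (simp only: matrix_vector_mul_assoc matrix_vector_mul_bounded_linear)
    from bounded_linear.has_vector_derivative[OF this matrix_exp_vector_deriv[of "transpose B" w s]]
    show ?thesis unfolding h_def by (simp only: matrix_power_Suc2 matrix_vector_mul_assoc matrix_mul_assoc)
  qed
  obtain M where M: "M > 0" "\<And>j w s. j \<le> Suc ?n \<Longrightarrow> norm w = 1 \<Longrightarrow> 0 \<le> s \<Longrightarrow> norm (h j w s) \<le> M"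
  proof -
    obtain K where K: "K > 0" "\<And>(A::real^'n^'n) w. norm (A *v w) \<le> norm A * norm w * K"
      using bounded_bilinear.pos_bounded[OF bounded_bilinear_matrix_vector_mul] by blast
    define D where "D j = norm (R ** matrix_power (transpose B) j) * (\<bar>C\<bar> * K) * K" for j
    have "norm (h j w s) \<le> D j" if "norm w = 1" "0 \<le> s" for j w s
    proof -
      have "norm (matrix_exp (s *\<^sub>R transpose B) *v w) \<le> \<bar>C\<bar> * K"
      proof -
        have "norm (matrix_exp (s *\<^sub>R transpose B)) \<le> \<bar>C\<bar>" using bound[OF that(2)] by linarith
        then have "norm (matrix_exp (s *\<^sub>R transpose B)) * K \<le> \<bar>C\<bar> * K" using K(1) by (intro mult_right_mono) auto
        with K(2)[of "matrix_exp (s *\<^sub>R transpose B)" w] that(1) show ?thesis by simp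
      qed
      then show ?thesis
        unfolding h_def D_def matrix_vector_mul_assoc[of R]
        by (rule order_trans[OF K(2) mult_right_mono[OF mult_left_mono]]) (use K(1) in auto)
    qed
    moreover have "D j \<le> (\<Sum>j\<le>Suc ?n. D j) + 1" if "j \<le> Suc ?n" for j
      using that K(1) by (intro order_trans[OF member_le_sum[of j "{..Suc ?n}" D]]) (auto simp: D_def)
    moreover have "(\<Sum>j\<le>Suc ?n. D j) + 1 > 0"
      using K(1) by (intro add_nonneg_pos sum_nonneg) (auto simp: D_def)
    ultimately show ?thesis using that[of "(\<Sum>j\<le>Suc ?n. D j) + 1"] by (meson order_trans)
  qed
  \<comment> \<open>Bounds all second derivatives to which Landau's inequality is applied: at most 2
    M^2 for the increment of \<open>G\<close>, and \<open>M\<close> for the functions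
    \<open>h j\<close>.\<close>
  define N where "N = M + 2 * M * M"
  define \<kappa> where "\<kappa> = (1 / (2 * (2 + N)))\<^sup>2"
  have N: "N > 0" "M \<le> N" "2 * M * M \<le> N" using M(1) by (auto simp: N_def add_pos_pos)
  have k1: "0 < \<kappa>" "\<kappa> \<le> 1"
    using N by (auto simp: \<kappa>_def power_le_one_iff divide_le_eq_1)
  have mono: "G w t \<le> G w s" if "s \<le> t" for w s t
    using G by (intro DERIV_nonpos_imp_nonincreasing[OF that])
      (auto simp: has_real_derivative_iff_has_vector_derivative intro!: exI)
  \<comment> \<open>An increment of \<open>G\<close> below a (x t)^m forces |h j| \<le> x on [0, t].
    The size x stays free because the induction step uses the statement with a smaller one.\<close>
  define P where "P j m a \<longleftrightarrow> (\<forall>w t x. norm w = 1 \<longrightarrow> 0 < t \<longrightarrow> t \<le> 1 \<longrightarrow> 0 < x \<longrightarrow> x \<le> 1 \<longrightarrow>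
      G w 0 - G w t \<le> a * (x * t) ^ m \<longrightarrow> (\<forall>s. 0 \<le> s \<longrightarrow> s \<le> t \<longrightarrow> norm (h j w s) \<le> x))" for j m a
  have step: "\<exists>m a. 0 < a \<and> P j m a" if "j \<le> ?n" for j
    using that
  proof (induction j)
    case 0
    show ?case
    \<comment> \<open>With e proportional to x^2 t, Landau gives |h 0|^2 \<le> x^2 from an increment
      below e^2 = \<kappa> x^4 t^2, and this dominates \<kappa> (x t)^4.\<close>
    proof (rule exI[of _ 4], rule exI[of _ \<kappa>], unfold P_def, intro conjI allI impI)
      show "0 < \<kappa>" by (rule k1(1))
    next
      fix w :: "real^'n" and t x s :: real
      assume w: "norm w = 1" and t: "0 < t" "t \<le> 1" and x: "0 < x" "x \<le> 1"
        and le: "G w 0 - G w t \<le> \<kappa> * (x * t) ^ 4" and s: "0 \<le> s" "s \<le> t"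
      define e where "e = x\<^sup>2 * t / (2 * (2 + N))"
      have e: "0 < e" "2 * e \<le> t" "(2 + N) * e \<le> x\<^sup>2"
      proof -
        show "0 < e" using t x N by (simp add: e_def)
        have "2 * e = (x\<^sup>2 / (2 + N)) * t" using N by (simp add: e_def field_simps)
        also have "\<dots> \<le> 1 * t" using x N t by (intro mult_right_mono) (auto simp: divide_le_eq_1 power_le_one intro: order_trans[of _ 1])
        finally show "2 * e \<le> t" by simp
        have "(2 + N) * e = x\<^sup>2 * (t / 2)" using N by (simp add: e_def field_simps)
        also have "\<dots> \<le> x\<^sup>2 * 1" using t by (intro mult_left_mono) auto
        finally show "(2 + N) * e \<le> x\<^sup>2" by simp
      qed
      have "\<kappa> * (x * t) ^ 4 \<le> \<kappa> * (x ^ 4 * t\<^sup>2)"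
        using t x k1 unfolding power_mult_distrib by (intro mult_left_mono power_decreasing) auto
      also have "\<dots> = e\<^sup>2" by (simp add: e_def \<kappa>_def power_divide power_mult_distrib flip: power_mult)
      finally have ge: "G w 0 - G w t \<le> e\<^sup>2" using le by linarith
      have d1: "((\<lambda>s. G w 0 - G w s) has_vector_derivative h 0 w s \<bullet> h 0 w s) (at s)" for s
        using has_vector_derivative_diff[OF has_vector_derivative_const G[of w s], of "G w 0"]
        by (simp add: h_def power2_norm_eq_inner)
      have d2: "((\<lambda>s. h 0 w s \<bullet> h 0 w s) has_vector_derivative h 0 w s \<bullet> h 1 w s + h 1 w s \<bullet> h 0 w s) (at s)" for s
        using bounded_bilinear.has_vector_derivative[OF bounded_bilinear_inner hd[of 0] hd[of 0]] by simp
      have "norm (h 0 w s \<bullet> h 0 w s) \<le> (2 + N) * e"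
      proof (rule landau_inequality[OF d1 d2 _ _ e(1,2) s])
        fix s assume s: "0 \<le> s" "s \<le> t"
        show "norm (G w 0 - G w s) \<le> e\<^sup>2" using mono[of 0 s w] mono[of s t w] s ge by simp
        have "\<bar>h 0 w s \<bullet> h 1 w s\<bar> \<le> M * M"
          using M(2)[of 0 w s] M(2)[of 1 w s] w s M(1)
          by (intro order_trans[OF Cauchy_Schwarz_ineq2] mult_mono) auto
        then show "norm (h 0 w s \<bullet> h 1 w s + h 1 w s \<bullet> h 0 w s) \<le> N"
          using N(3) by (simp add: inner_commute)
      qed
      then have "(norm (h 0 w s))\<^sup>2 \<le> x\<^sup>2" using e(3) by (simp add: power2_norm_eq_inner)
      then show "norm (h 0 w s) \<le> x" using x(1) by (rule power2_le_imp_le[OF _ less_imp_le])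
    qed
  next
    case (Suc j)
    then have "j \<le> ?n" by simp
    from Suc.IH[OF this] obtain m a where a: "0 < a" and "P j m a" by blast
    then have IH: "norm w = 1 \<Longrightarrow> 0 < t \<Longrightarrow> t \<le> 1 \<Longrightarrow> 0 < x \<Longrightarrow> x \<le> 1 \<Longrightarrow>
      G w 0 - G w t \<le> a * (x * t) ^ m \<Longrightarrow> 0 \<le> s \<Longrightarrow> s \<le> t \<Longrightarrow> norm (h j w s) \<le> x" for w t x s
      unfolding P_def by blast
    show ?case
    \<comment> \<open>The bound |h (Suc j)| \<le> x needs |h j| \<le> e^2 with e proportional to x
      t. Hence the exponent triples: a (e^2 t)^m dominates a \<kappa>^m (x t)^(3 m).\<close>
    proof (rule exI[of _ "3 * m"], rule exI[of _ "a * \<kappa> ^ m"], unfold P_def, intro conjI allI impI)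
      show "0 < a * \<kappa> ^ m" using a k1 by simp
      fix w :: "real^'n" and t x s :: real
      assume w: "norm w = 1" and t: "0 < t" "t \<le> 1" and x: "0 < x" "x \<le> 1"
        and le: "G w 0 - G w t \<le> a * \<kappa> ^ m * (x * t) ^ (3 * m)" and s: "0 \<le> s" "s \<le> t"
      define e where "e = x * t / (2 * (2 + N))"
      have xt: "x * t \<le> 1" using x t by (simp add: mult_le_one)
      have e: "0 < e" "2 * e \<le> t" "(2 + N) * e \<le> x"
      proof -
        show "0 < e" using t x N by (simp add: e_def)
        have "2 * e = (x / (2 + N)) * t" using N by (simp add: e_def field_simps)
        also have "\<dots> \<le> 1 * t" using x N t by (intro mult_right_mono) (auto simp: divide_le_eq_1)
        finally show "2 * e \<le> t" by simp
        have "(2 + N) * e = x * (t / 2)" using N by (simp add: e_def field_simps)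
        also have "\<dots> \<le> x * 1" using t x by (intro mult_left_mono) auto
        finally show "(2 + N) * e \<le> x" by simp
      qed
      have e2: "e\<^sup>2 = \<kappa> * (x * t)\<^sup>2" by (simp add: e_def \<kappa>_def power_divide)
      have e21: "0 < e\<^sup>2" "e\<^sup>2 \<le> 1" using e(1) k1 xt x t unfolding e2 by (auto intro!: mult_le_one power_le_one)
      have "(\<kappa> * (x * t) ^ 3) ^ m \<le> (e\<^sup>2 * t) ^ m"
      proof (rule power_mono)
        have "\<kappa> * (x * t) ^ 3 = (\<kappa> * (x * t)\<^sup>2) * (x * t)" by (simp add: power2_eq_square power3_eq_cube)
        also have "\<dots> \<le> e\<^sup>2 * t" unfolding e2 using x t k1 by (intro mult_left_mono) auto
        finally show "\<kappa> * (x * t) ^ 3 \<le> e\<^sup>2 * t" .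
      qed (use k1 x t in auto)
      then have "a * \<kappa> ^ m * (x * t) ^ (3 * m) \<le> a * (e\<^sup>2 * t) ^ m"
        using a by (simp add: power_mult power_mult_distrib mult.assoc)
      with le have le': "G w 0 - G w t \<le> a * (e\<^sup>2 * t) ^ m" by linarith
      have "norm (h (Suc j) w s) \<le> (2 + N) * e"
      proof (rule landau_inequality[OF hd hd _ _ e(1,2) s])
        fix s assume s: "0 \<le> s" "s \<le> t"
        show "norm (h j w s) \<le> e\<^sup>2" by (rule IH[OF w t e21 le' s])
        show "norm (h (Suc (Suc j)) w s) \<le> N" using M(2)[of "Suc (Suc j)" w s] w s Suc.prems N(2) by linarith
      qed
      with e(3) show "norm (h (Suc j) w s) \<le> x" by linarith
    qed
  qed
  then obtain m a where a: "\<And>j. j \<le> ?n \<Longrightarrow> 0 < a j" and P: "\<And>j. j \<le> ?n \<Longrightarrow> P j (m j) (a j)" by metis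
  have ma: "j \<le> ?n \<Longrightarrow> norm w = 1 \<Longrightarrow> 0 < t \<Longrightarrow> t \<le> 1 \<Longrightarrow>
      0 < x \<Longrightarrow> x \<le> 1 \<Longrightarrow> G w 0 - G w t \<le> a j * (x * t) ^ m j \<Longrightarrow> 0 \<le> s \<Longrightarrow> s \<le> t \<Longrightarrow> norm (h j w s) \<le> x" for j w t x s
    using P[of j] unfolding P_def by blast
  obtain x where x: "0 < x" "x \<le> 1"
    "\<And>w. norm w = 1 \<Longrightarrow> \<exists>m<CARD('n). x < norm (matrix_sqrt Q *v (matrix_power (transpose B) m *v w))"
    using kalman_lower_bound[OF rank sym[unfolded R_def]] by metis
  \<comment> \<open>The smallest factor and the largest exponent serve all j at once, because x t
    \<le> 1.\<close>
  define a0 where "a0 = Min (a ` {..?n})"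
  define m0 where "m0 = Max (m ` {..?n})"
  have a0: "0 < a0" "\<And>j. j \<le> ?n \<Longrightarrow> a0 \<le> a j" using a by (auto simp: a0_def)
  have m0: "\<And>j. j \<le> ?n \<Longrightarrow> m j \<le> m0" by (auto simp: m0_def)
  have "a0 * x ^ m0 * t ^ m0 \<le> G w 0 - G w t" if w: "norm w = 1" and t: "0 < t" "t \<le> 1" for w t
  proof (rule ccontr)
    assume "\<not> ?thesis"
    then have less: "G w 0 - G w t \<le> a0 * (x * t) ^ m0" by (simp add: power_mult_distrib mult.assoc)
    obtain j where j: "j < ?n" "x < norm (R *v (matrix_power (transpose B) j *v w))" using x(3)[OF w] unfolding R_def by blast
    have "a0 * (x * t) ^ m0 \<le> a j * (x * t) ^ m j"
      using a0 a[of j] m0[of j] j(1) x t by (intro mult_mono power_decreasing) (auto simp: mult_le_one)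
    with less have "norm (h j w 0) \<le> x" using ma[of j w t x 0] j(1) w t x by simp
    moreover have "h j w 0 = R *v (matrix_power (transpose B) j *v w)"
      using matrix_exp_0[of "transpose B"] by (simp add: h_def)
    ultimately show False using j(2) by simp
  qed
  then show thesis using that[of "a0 * x ^ m0" m0] a0(1) x(1) by simp
qed

section \<open>Uniqueness of orbits\<close>

lemma flat_imp_const:
  fixes r :: "real \<Rightarrow> real"
  assumes t: "0 \<le> t"
    and flat: "\<And>s e. 0 \<le> s \<Longrightarrow> s \<le> t \<Longrightarrow> e > 0 \<Longrightarrow>
      \<exists>d>0. \<forall>s'. 0 \<le> s' \<and> s' \<le> t \<and> \<bar>s' - s\<bar> < d \<longrightarrow> \<bar>r s' - r s\<bar> \<le> e * \<bar>s' - s\<bar>"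
  shows "r t = r 0"
proof -
  have "(r has_derivative (\<lambda>h. 0)) (at s within {0..t})" if "s \<in> {0..t}" for s
    unfolding has_derivative_within_alt
  proof (intro conjI allI impI bounded_linear_zero)
    fix e :: real assume "e > 0"
    then obtain d where "d > 0" "\<And>s'. 0 \<le> s' \<Longrightarrow> s' \<le> t \<Longrightarrow> \<bar>s' - s\<bar> < d \<Longrightarrow> \<bar>r s' - r s\<bar> \<le> e * \<bar>s' - s\<bar>"
      using flat[of s e] \<open>s \<in> {0..t}\<close> by auto
    then show "\<exists>d>0. \<forall>y\<in>{0..t}. norm (y - s) < d \<longrightarrow> norm (r y - r s - 0) \<le> e * norm (y - s)"
      by (intro exI[of _ d]) auto
  qed
  then show ?thesis
    using has_derivative_zero_constant[of "{0..t}" r] t by fastforce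
qed

lemma L2_quotient:
  assumes "f \<in> L2_space M" "g \<in> L2_space M" "h \<noteq> 0"
  shows "(\<lambda>x. f x / complex_of_real h - g x) \<in> L2_space M"
    and "L2_norm M (\<lambda>x. f x - complex_of_real h * g x) = \<bar>h\<bar> * L2_norm M (\<lambda>x. f x / complex_of_real h - g x)"
proof -
  show 1: "(\<lambda>x. f x / complex_of_real h - g x) \<in> L2_space M"
    using L2_diff(1)[OF L2_scale(1)[OF assms(1), of "1 / complex_of_real h"] assms(2)] by simp
  have "(\<lambda>x. f x - complex_of_real h * g x) = (\<lambda>x. complex_of_real h * (f x / complex_of_real h - g x))"
    using assms(3) by (simp add: fun_eq_iff field_simps)
  then show "L2_norm M (\<lambda>x. f x - complex_of_real h * g x) = \<bar>h\<bar> * L2_norm M (\<lambda>x. f x / complex_of_real h - g x)"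
    using L2_scale(2)[OF 1, of "complex_of_real h"] by simp
qed

lemma L2_norm_diff_add_le:
  assumes "a \<in> L2_space M" "b \<in> L2_space M" "c \<in> L2_space M"
    and [measurable]: "f \<in> borel_measurable M"
    and "AE x in M. f x = b x - a x - c x"
  shows "L2_norm M f \<le> L2_norm M a + L2_norm M b + L2_norm M c"
proof -
  note ba = L2_diff[OF assms(2,1)]
  have "L2_norm M f = L2_norm M (\<lambda>x. (b x - a x) - c x)"
    using L2_diff(1)[OF ba(1) assms(3)] assms(5) by (intro L2_norm_cong_AE) (auto simp: L2_space_def)
  then show ?thesis using L2_diff(2)[OF ba(1) assms(3)] ba(2) by linarith
qed

text \<open>The curve y(s) = S(t - s) u(s) joins S(t) u(0) to u(t), and it is constant because its
  increments are of smaller order than the step. Only the distance of y(s) from u(t) is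
  differentiated, which stays within real functions. In this way an explicit solution determines
  every semigroup with the given generator along that solution.\<close>

lemma semigroup_orbit_eq:
  fixes u v :: "real \<Rightarrow> 'a \<Rightarrow> complex"
  assumes S: "strongly_continuous_semigroup M S"
    and gen: "\<And>s. (u s, v s) \<in> infinitesimal_generator M S"
    and der: "\<And>s. ((\<lambda>h. L2_norm M (\<lambda>x. (u (s + h) x - u s x) / complex_of_real h - v s x)) \<longlongrightarrow> 0) (at 0)"
    and t: "t \<ge> 0"
  shows "L2_norm M (\<lambda>x. S t (u 0) x - u t x) = 0"
proof -
  note D = strongly_continuous_semigroupD[OF S]
  have u: "u s \<in> L2_space M" and v: "v s \<in> L2_space M"
    and al: "((\<lambda>h. L2_norm M (\<lambda>x. (S h (u s) x - u s x) / complex_of_real h - v s x)) \<longlongrightarrow> 0) (at_right 0)" for s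
    using gen[of s] by (auto simp: infinitesimal_generator_def)
  obtain K where K: "K \<ge> 1" "\<And>s f. 0 \<le> s \<Longrightarrow> s \<le> t + 1 \<Longrightarrow> f \<in> L2_space M \<Longrightarrow> L2_norm M (S s f) \<le> K * L2_norm M f"
    using semigroup_locally_bounded[OF S, of "t + 1"] by metis
  define y where "y s = S (t - s) (u s)" for s
  have y: "y s \<in> L2_space M" if "s \<le> t" for s using that by (simp add: y_def D(5) u)
  have A: "L2_norm M (\<lambda>x. y (s + h) x - y s x) \<le> K * L2_norm M (\<lambda>x. u (s + h) x - S h (u s) x)"
    if "0 \<le> s" "0 \<le> h" "s + h \<le> t" for s h
  proof -
    let ?r = "t - (s + h)"
    have Sh: "S h (u s) \<in> L2_space M" using that by (simp add: D(5) u)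
    have "L2_norm M (\<lambda>x. y (s + h) x - y s x) = L2_norm M (\<lambda>x. S ?r (u (s + h)) x - S ?r (S h (u s)) x)"
    proof (rule L2_norm_cong_AE)
      show "(\<lambda>x. y (s + h) x - y s x) \<in> borel_measurable M"
        using that by (intro L2_space_measurable L2_diff y) auto
      show "(\<lambda>x. S ?r (u (s + h)) x - S ?r (S h (u s)) x) \<in> borel_measurable M"
        using that by (intro L2_space_measurable L2_diff D(5) u) auto
      have "?r + h = t - s" by simp
      then have "AE x in M. S (t - s) (u s) x = S ?r (S h (u s)) x"
        using D(3)[of ?r h "u s"] that u by simp
      then show "AE x in M. y (s + h) x - y s x = S ?r (u (s + h)) x - S ?r (S h (u s)) x"
        unfolding y_def by eventually_elim simp
    qed
    also have "\<dots> = L2_norm M (S ?r (\<lambda>x. u (s + h) x - S h (u s) x))"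
      using that by (intro L2_bounded_operator_norm_diff D(1) u Sh) auto
    also have "\<dots> \<le> K * L2_norm M (\<lambda>x. u (s + h) x - S h (u s) x)"
      using that by (intro K(2) L2_diff u Sh) auto
    finally show ?thesis .
  qed
  define \<alpha> where "\<alpha> s h = L2_norm M (\<lambda>x. (S h (u s) x - u s x) / complex_of_real h - v s x)" for s h
  define \<beta> where "\<beta> s h = L2_norm M (\<lambda>x. S h (v s) x - v s x)" for s h
  define \<gamma> where "\<gamma> s h = L2_norm M (\<lambda>x. (u (s + h) x - u s x) / complex_of_real h - v s x)" for s h
  have ga: "L2_norm M (\<lambda>x. (u (s + h) x - u s x) - complex_of_real h * v s x) = \<bar>h\<bar> * \<gamma> s h" if "h \<noteq> 0" for s h
    unfolding \<gamma>_def by (rule L2_quotient(2)[OF L2_diff(1)[OF u u] v that])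
  have aa: "L2_norm M (\<lambda>x. (S h (u s) x - u s x) - complex_of_real h * v s x) = h * \<alpha> s h" if "h > 0" for s h
    using L2_quotient(2)[OF L2_diff(1)[OF D(5)[OF _ u] u] v, of h h s s s] that by (simp add: \<alpha>_def)
  \<comment> \<open>Right increment: u(s + h) and S(h) u(s) both equal u(s) + h v(s) up to
    o(h).\<close>
  have R: "L2_norm M (\<lambda>x. u (s + h) x - S h (u s) x) \<le> h * (\<gamma> s h + \<alpha> s h)" if h: "h > 0" for s h
  proof -
    have m: "(\<lambda>x. (u (s + h) x - u s x) - complex_of_real h * v s x) \<in> L2_space M"
      "(\<lambda>x. (S h (u s) x - u s x) - complex_of_real h * v s x) \<in> L2_space M"
      using h by (auto intro!: L2_diff L2_scale D(5) u v)
    have eq: "(\<lambda>x. ((u (s + h) x - u s x) - complex_of_real h * v s x) - ((S h (u s) x - u s x) - complex_of_real h * v s x))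
        = (\<lambda>x. u (s + h) x - S h (u s) x)" by auto
    have "L2_norm M (\<lambda>x. u (s + h) x - S h (u s) x) \<le> \<bar>h\<bar> * \<gamma> s h + h * \<alpha> s h"
      using L2_diff(2)[OF m] ga[of h s] aa[OF h, of s] h unfolding eq by linarith
    then show ?thesis using h by (simp add: algebra_simps)
  qed
  \<comment> \<open>The generator is a one-sided limit, so the left increment is expanded at s: u(s
    - h) = u(s) - h v(s) + o(h) is inserted into S(h), and strong continuity at v(s) accounts for
    the error \<open>\<beta>\<close>.\<close>
  have L: "L2_norm M (\<lambda>x. u s x - S h (u (s - h)) x) \<le> h * (\<alpha> s h + \<beta> s h + K * \<gamma> s (-h))" if h: "h > 0" "h \<le> 1" for s h
  proof -
    let ?e = "\<lambda>x. (u (s - h) x - u s x) + complex_of_real h * v s x"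
    have e: "?e \<in> L2_space M" "L2_norm M ?e = h * \<gamma> s (-h)"
      using ga[of "-h" s] h by (auto intro!: L2_add L2_diff L2_scale u v)
    let ?a = "\<lambda>x. (S h (u s) x - u s x) - complex_of_real h * v s x"
    let ?b = "\<lambda>x. complex_of_real h * (S h (v s) x - v s x)"
    have Sm: "S h f \<in> L2_space M" if "f \<in> L2_space M" for f using D(5) that h by simp
    have hv: "(\<lambda>x. complex_of_real h * v s x) \<in> L2_space M" by (intro L2_scale v)
    have uv: "(\<lambda>x. u s x - complex_of_real h * v s x) \<in> L2_space M" by (intro L2_diff hv u)
    have h0: "0 \<le> h" using h by simp
    have "(\<lambda>x. u (s - h) x) = (\<lambda>x. (u s x - complex_of_real h * v s x) + ?e x)" by auto
    then have "AE x in M. S h (u (s - h)) x = S h (\<lambda>x. u s x - complex_of_real h * v s x) x + S h ?e x"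
      using L2_bounded_operatorD(2)[OF D(1)[OF h0] uv e(1)] by simp
    moreover have "AE x in M. S h (\<lambda>x. u s x - complex_of_real h * v s x) x = S h (u s) x - complex_of_real h * S h (v s) x"
      using L2_bounded_operator_lincomb[OF D(1)[OF h0] u v, of 1 s "- complex_of_real h" s] by simp
    ultimately have ae: "AE x in M. u s x - S h (u (s - h)) x = ?b x - ?a x - S h ?e x"
      by eventually_elim (simp add: algebra_simps)
    have "L2_norm M (\<lambda>x. u s x - S h (u (s - h)) x) \<le> L2_norm M ?a + L2_norm M ?b + L2_norm M (S h ?e)"
      by (rule L2_norm_diff_add_le[OF _ _ _ _ ae])
        (intro L2_diff L2_scale Sm u v e(1) L2_space_measurable)+
    also have "L2_norm M ?b = h * \<beta> s h"
      using L2_scale(2)[OF L2_diff(1)[OF Sm[OF v] v], of "complex_of_real h" s s] h by (simp add: \<beta>_def)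
    also have "L2_norm M (S h ?e) \<le> K * (h * \<gamma> s (-h))"
      using K(2)[OF h0 _ e(1)] h t e(2) by simp
    finally show ?thesis using aa[OF h(1), of s] by (simp add: algebra_simps)
  qed
  define r where "r s = L2_norm M (\<lambda>x. y s x - u t x)" for s
  have rd: "\<bar>r s' - r s\<bar> \<le> L2_norm M (\<lambda>x. y s' x - y s x)" if "s \<le> t" "s' \<le> t" for s s'
    using L2_norm_diff_triangle[OF L2_diff(1)[OF y[OF that(2)] u] L2_diff(1)[OF y[OF that(1)] u], of t t] by (simp add: r_def)
  have "r t = r 0"
  proof (rule flat_imp_const[OF t])
    fix s e :: real assume s: "0 \<le> s" "s \<le> t" and e: "e > 0"
    \<comment> \<open>Chosen such that the outer factor \<open>K\<close> times the 2 + K error terms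
      gives e.\<close>
    define e' where "e' = e / (K * (2 + K))"
    have e': "e' > 0" using e K(1) by (simp add: e'_def)
    have "eventually (\<lambda>h. \<alpha> s h < e') (at_right 0)"
      using order_tendstoD(2)[OF al[of s] e'] by (simp add: \<alpha>_def)
    moreover have "eventually (\<lambda>h. \<beta> s h < e') (at_right 0)"
      using order_tendstoD(2)[OF D(4)[OF v[of s]] e'] by (simp add: \<beta>_def)
    ultimately have "eventually (\<lambda>h. \<alpha> s h < e' \<and> \<beta> s h < e') (at_right 0)" by eventually_elim simp
    then obtain d1 where d1: "d1 > 0" "\<And>h. 0 < h \<Longrightarrow> h < d1 \<Longrightarrow> \<alpha> s h < e' \<and> \<beta> s h < e'"
      by (auto simp: eventually_at_right_field)
    have "eventually (\<lambda>h. \<gamma> s h < e') (at 0)"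
      using order_tendstoD(2)[OF der[of s] e'] by (simp add: \<gamma>_def)
    then obtain d2 where d2: "d2 > 0" "\<And>h. h \<noteq> 0 \<Longrightarrow> \<bar>h\<bar> < d2 \<Longrightarrow> \<gamma> s h < e'"
      by (auto simp: eventually_at dist_real_def)
    define d where "d = min 1 (min d1 d2)"
    have "\<bar>r s' - r s\<bar> \<le> e * \<bar>s' - s\<bar>" if s': "0 \<le> s'" "s' \<le> t" "\<bar>s' - s\<bar> < d" for s'
    proof -
      define h where "h = \<bar>s' - s\<bar>"
      have Ke: "K * (h * ((2 + K) * e')) = e * h" using K(1) by (simp add: e'_def)
      consider "s' = s" | "s' > s" | "s' < s" by linarith
      then show ?thesis
      proof cases
        case 2
        then have h: "h > 0" "s' = s + h" "h < d1" "h < d2" using s'(3) by (auto simp: h_def d_def)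
        have "\<gamma> s h + \<alpha> s h \<le> (2 + K) * e'"
        proof -
          have "0 \<le> K * e'" using K(1) e' by simp
          then show ?thesis using d1(2)[OF h(1,3)] d2(2)[of h] h by (simp add: distrib_right)
        qed
        then have "L2_norm M (\<lambda>x. u (s + h) x - S h (u s) x) \<le> h * ((2 + K) * e')"
          using R[OF h(1), of s] h(1) by (meson mult_left_mono order_trans less_imp_le)
        from order_trans[OF A mult_left_mono[OF this, of K]]
        have "L2_norm M (\<lambda>x. y s' x - y s x) \<le> e * h" using h s s' K(1) Ke by simp
        then show ?thesis using rd[of s s'] s s' unfolding h_def by linarith
      next
        case 3
        then have h: "h > 0" "s' = s - h" "h < d1" "h < d2" "h \<le> 1" using s'(3) by (auto simp: h_def d_def)
        have "K * \<gamma> s (-h) \<le> K * e'" using d2(2)[of "-h"] h K(1) by (intro mult_left_mono) auto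
        then have "\<alpha> s h + \<beta> s h + K * \<gamma> s (-h) \<le> (2 + K) * e'"
          using d1(2)[OF h(1,3)] by (simp add: algebra_simps)
        then have "L2_norm M (\<lambda>x. u s x - S h (u (s - h)) x) \<le> h * ((2 + K) * e')"
          using L[OF h(1,5), of s] h(1) by (meson mult_left_mono order_trans less_imp_le)
        moreover have "L2_norm M (\<lambda>x. y s x - y s' x) \<le> K * L2_norm M (\<lambda>x. u s x - S h (u (s - h)) x)"
          using A[of s' h] h s s' by simp
        moreover have "K * L2_norm M (\<lambda>x. u s x - S h (u (s - h)) x) \<le> K * (h * ((2 + K) * e'))"
          by (rule mult_left_mono[OF calculation(1)]) (use K(1) in simp)
        ultimately have "L2_norm M (\<lambda>x. y s x - y s' x) \<le> e * h"
          using Ke by linarith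
        then show ?thesis using rd[of s' s] s s' unfolding h_def by linarith
      qed simp
    qed
    then show "\<exists>d>0. \<forall>s'. 0 \<le> s' \<and> s' \<le> t \<and> \<bar>s' - s\<bar> < d \<longrightarrow> \<bar>r s' - r s\<bar> \<le> e * \<bar>s' - s\<bar>"
      using d1(1) d2(1) by (intro exI[of _ d]) (auto simp: d_def)
  qed
  moreover have "r t = 0"
  proof -
    have "r t = L2_norm M (\<lambda>x. 0)"
      unfolding r_def using D(2)[OF u[of t]] y[of t]
      by (intro L2_norm_cong_AE) (auto simp: y_def intro!: L2_space_measurable L2_diff u)
    then show ?thesis by (simp add: L2_zero)
  qed
  ultimately show ?thesis by (simp add: r_def y_def)
qed

section \<open>Density of trigonometric polynomials\<close>

text \<open>A list of pairs of amplitude and frequency. Repeated frequencies are allowed, so that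
  sums are concatenations and the product with one mode is a map over the list.\<close>

definition trig_poly :: "(real^'n \<Rightarrow> complex) \<Rightarrow> bool" where
  "trig_poly f \<longleftrightarrow> (\<exists>ps. \<forall>x. f x = (\<Sum>p\<leftarrow>ps. fst p * cis (x \<bullet> snd p)))"

lemma trig_poly_const: "trig_poly (\<lambda>x. c)"
  unfolding trig_poly_def by (rule exI[of _ "[(c, 0)]"]) simp

lemma trig_poly_cis: "trig_poly (\<lambda>x. cis (x \<bullet> w))"
  unfolding trig_poly_def by (rule exI[of _ "[(1, w)]"]) simp

lemma trig_poly_add:
  assumes "trig_poly f" "trig_poly g"
  shows "trig_poly (\<lambda>x. f x + g x)"
proof -
  obtain ps qs where "\<And>x. f x = (\<Sum>p\<leftarrow>ps. fst p * cis (x \<bullet> snd p))" "\<And>x. g x = (\<Sum>p\<leftarrow>qs. fst p * cis (x \<bullet> snd p))"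
    using assms unfolding trig_poly_def by blast
  then show ?thesis unfolding trig_poly_def by (intro exI[of _ "ps @ qs"]) simp
qed

lemma trig_poly_mult:
  assumes "trig_poly f" "trig_poly g"
  shows "trig_poly (\<lambda>x. f x * g x)"
proof -
  obtain ps qs where ps: "\<And>x. f x = (\<Sum>p\<leftarrow>ps. fst p * cis (x \<bullet> snd p))"
    and qs: "\<And>x. g x = (\<Sum>p\<leftarrow>qs. fst p * cis (x \<bullet> snd p))"
    using assms unfolding trig_poly_def by blast
  have mono: "trig_poly (\<lambda>x. (c * cis (x \<bullet> w)) * g x)" for c w
    unfolding trig_poly_def
    by (rule exI[of _ "map (\<lambda>p. (c * fst p, w + snd p)) qs"])
      (simp add: qs o_def sum_list_const_mult[symmetric] inner_add_right cis_mult[symmetric] mult_ac)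
  have "trig_poly (\<lambda>x. (\<Sum>p\<leftarrow>ps. fst p * cis (x \<bullet> snd p)) * g x)"
  proof (induction ps)
    case Nil
    then show ?case using trig_poly_const[of 0] by simp
  next
    case (Cons p ps)
    then show ?case using trig_poly_add[OF mono[of "fst p" "snd p"] Cons] by (simp add: algebra_simps)
  qed
  then show ?thesis by (simp add: ps)
qed

lemma trig_poly_sum:
  assumes "finite I" "\<And>i. i \<in> I \<Longrightarrow> trig_poly (f i)"
  shows "trig_poly (\<lambda>x. \<Sum>i\<in>I. f i x)"
  using assms by (induction I) (auto intro: trig_poly_add trig_poly_const)

lemma trig_poly_bounded:
  assumes "trig_poly f"
  obtains C where "\<And>x. cmod (f x) \<le> C"
proof -
  obtain ps where ps: "\<And>x. f x = (\<Sum>p\<leftarrow>ps. fst p * cis (x \<bullet> snd p))"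
    using assms unfolding trig_poly_def by blast
  have "cmod (\<Sum>p\<leftarrow>ps. fst p * cis (x \<bullet> snd p)) \<le> (\<Sum>p\<leftarrow>ps. cmod (fst p))" for x
    by (induction ps) (auto intro!: norm_triangle_le add_mono simp: norm_mult)
  then show thesis using that ps by metis
qed

lemma trig_poly_continuous:
  assumes "trig_poly f"
  shows "continuous_on UNIV f"
proof -
  obtain ps where ps: "f = (\<lambda>x. \<Sum>p\<leftarrow>ps. fst p * cis (x \<bullet> snd p))"
    using assms unfolding trig_poly_def by blast
  have "continuous_on UNIV (\<lambda>x. \<Sum>p\<leftarrow>ps. fst p * cis (x \<bullet> snd p))"
    by (induction ps) (auto intro!: continuous_intros)
  then show ?thesis by (simp add: ps)
qed

text \<open>Each L sin(x_i / L) is a combination of two plane waves, and trigonometric polynomials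
  form an algebra. These coordinates make Weierstrass approximation by ordinary polynomials
  applicable.\<close>

lemma trig_poly_sin_coordinates:
  fixes g :: "real^'n \<Rightarrow> real"
  assumes "real_polynomial_function g"
  shows "trig_poly (\<lambda>x. complex_of_real (g (\<chi> i. L * sin (x $ i / L))))"
  using assms
proof (induction rule: real_polynomial_function.induct)
  case (linear f)
  have sin: "trig_poly (\<lambda>x. complex_of_real (L * sin (x $ i / L)))" for i :: 'n
  proof -
    have "complex_of_real (L * sin (x $ i / L)) =
      (- \<i> * L / 2) * cis (x \<bullet> axis i (1 / L)) + (\<i> * L / 2) * cis (x \<bullet> axis i (- 1 / L))" for x
      by (simp add: complex_eq_iff inner_axis)
    then show ?thesis by (simp only:) (intro trig_poly_add trig_poly_mult trig_poly_const trig_poly_cis)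
  qed
  have "f y = (\<Sum>i\<in>UNIV. y $ i * f (axis i 1))" for y
  proof -
    have "f y = f (\<Sum>i\<in>UNIV. y $ i *\<^sub>R axis i 1)"
      by (simp add: basis_expansion scalar_mult_eq_scaleR[symmetric])
    then show ?thesis using linear by (simp add: linear_sum linear_scale bounded_linear.linear)
  qed
  note this[of "\<chi> i. L * sin (_ $ i / L)", unfolded vec_lambda_beta]
  then have "complex_of_real (f (\<chi> i. L * sin (x $ i / L))) =
      (\<Sum>i\<in>UNIV. complex_of_real (L * sin (x $ i / L)) * complex_of_real (f (axis i 1)))" for x
    by (simp only: of_real_sum of_real_mult)
  then show ?case by (simp only:) (intro trig_poly_sum trig_poly_mult trig_poly_const sin, simp)
next
  case (const c)
  then show ?case by (rule trig_poly_const)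
next
  case (add f g)
  then show ?case using trig_poly_add by fastforce
next
  case (mult f g)
  then show ?case using trig_poly_mult by fastforce
qed

text \<open>Trigonometric polynomials are dense in L2 of every finite Borel measure; later the
  measure is the Gaussian \<open>\<mu>\<close>.\<close>

locale finite_borel_measure = finite_measure M for M :: "(real^'n) measure" +
  assumes sets_M [measurable_cong]: "sets M = sets borel"
begin

lemma space_M [simp]: "space M = UNIV"
  using sets_eq_imp_space_eq[OF sets_M] by simp

lemma bounded_L2:
  assumes [measurable]: "f \<in> borel_measurable M" and le: "\<And>x. cmod (f x) \<le> C"
  shows "f \<in> L2_space M" "L2_norm M f \<le> C * sqrt (measure M UNIV)"
proof -
  have C: "C \<ge> 0" using order_trans[OF norm_ge_zero le] .
  have int: "integrable M (\<lambda>x. C\<^sup>2)" by simp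
  have le2: "AE x in M. (cmod (f x))\<^sup>2 \<le> C\<^sup>2" by (intro AE_I2 power_mono le norm_ge_zero)
  have i: "integral\<^sup>L M (\<lambda>x. C\<^sup>2) \<le> (C * sqrt (measure M UNIV))\<^sup>2"
    by (simp add: power_mult_distrib mult.commute)
  show "f \<in> L2_space M" "L2_norm M f \<le> C * sqrt (measure M UNIV)"
    using L2_norm_le_integral[OF assms(1) int _ le2 i] C by auto
qed

lemma trig_poly_L2:
  assumes "trig_poly p"
  shows "p \<in> L2_space M"
proof -
  obtain C where C: "\<And>x. cmod (p x) \<le> C" using trig_poly_bounded[OF assms] by blast
  have "p \<in> borel_measurable M"
    unfolding measurable_cong_sets[OF sets_M refl]
    by (rule borel_measurable_continuous_onI[OF trig_poly_continuous[OF assms]])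
  then show ?thesis using bounded_L2(1) C by blast
qed

definition trig_approximable :: "(real^'n \<Rightarrow> complex) \<Rightarrow> bool" where
  "trig_approximable f \<longleftrightarrow> f \<in> L2_space M \<and> (\<forall>e>0. \<exists>p. trig_poly p \<and> L2_norm M (\<lambda>x. f x - p x) < e)"

lemma trig_approximable_L2: "trig_approximable f \<Longrightarrow> f \<in> L2_space M"
  by (simp add: trig_approximable_def)

lemma trig_approximable_trig_poly: "trig_poly p \<Longrightarrow> trig_approximable p"
  unfolding trig_approximable_def using trig_poly_L2 L2_zero(2)[of M] by force

lemma trig_approximable_closure:
  assumes f: "f \<in> L2_space M" and g: "\<And>e. e > 0 \<Longrightarrow> \<exists>g. trig_approximable g \<and> L2_norm M (\<lambda>x. f x - g x) < e"
  shows "trig_approximable f"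
  unfolding trig_approximable_def
proof (intro conjI f allI impI)
  fix e :: real assume "e > 0"
  then obtain g where g: "trig_approximable g" "L2_norm M (\<lambda>x. f x - g x) < e / 2"
    using assms(2)[of "e / 2"] by auto
  then obtain p where p: "trig_poly p" "L2_norm M (\<lambda>x. g x - p x) < e / 2"
    using \<open>e > 0\<close> unfolding trig_approximable_def by (meson half_gt_zero)
  show "\<exists>p. trig_poly p \<and> L2_norm M (\<lambda>x. f x - p x) < e"
    using L2_triangle[OF f trig_approximable_L2[OF g(1)] trig_poly_L2[OF p(1)]] g p
    by (intro exI[of _ p]) auto
qed

lemma trig_approximable_limit:
  assumes f: "f \<in> L2_space M" and g: "\<And>n. trig_approximable (g n)"
    and lim: "(\<lambda>n. L2_norm M (\<lambda>x. g n x - f x)) \<longlonglongrightarrow> 0"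
  shows "trig_approximable f"
proof (rule trig_approximable_closure[OF f])
  fix e :: real assume "e > 0"
  then have "eventually (\<lambda>n. L2_norm M (\<lambda>x. g n x - f x) < e) sequentially"
    using order_tendstoD(2)[OF lim] by simp
  then obtain n where "L2_norm M (\<lambda>x. g n x - f x) < e" unfolding eventually_sequentially by blast
  then show "\<exists>g. trig_approximable g \<and> L2_norm M (\<lambda>x. f x - g x) < e"
    using g[of n] L2_norm_minus_commute[of M f "g n"] by auto
qed

lemma trig_approximable_lincomb:
  assumes f: "trig_approximable f" and g: "trig_approximable g"
  shows "trig_approximable (\<lambda>x. a * f x + b * g x)"
  unfolding trig_approximable_def
proof (intro conjI allI impI)
  note fg = trig_approximable_L2[OF f] trig_approximable_L2[OF g]
  show "(\<lambda>x. a * f x + b * g x) \<in> L2_space M" by (intro L2_add L2_scale fg)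
  fix e :: real assume e: "e > 0"
  define d where "d = e / (cmod a + cmod b + 1)"
  have pos: "cmod a + cmod b + 1 > 0" by (simp add: add_nonneg_pos)
  have d: "d > 0" using e pos by (simp add: d_def)
  obtain p where p: "trig_poly p" "L2_norm M (\<lambda>x. f x - p x) < d" using f d unfolding trig_approximable_def by blast
  obtain q where q: "trig_poly q" "L2_norm M (\<lambda>x. g x - q x) < d" using g d unfolding trig_approximable_def by blast
  note fp = L2_diff(1)[OF fg(1) trig_poly_L2[OF p(1)]] and gq = L2_diff(1)[OF fg(2) trig_poly_L2[OF q(1)]]
  have "(\<lambda>x. (a * f x + b * g x) - (a * p x + b * q x)) = (\<lambda>x. a * (f x - p x) + b * (g x - q x))"
    by (auto simp: algebra_simps)
  then have "L2_norm M (\<lambda>x. (a * f x + b * g x) - (a * p x + b * q x)) \<le>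
     cmod a * L2_norm M (\<lambda>x. f x - p x) + cmod b * L2_norm M (\<lambda>x. g x - q x)"
    using L2_add(2)[OF L2_scale(1)[OF fp, of a] L2_scale(1)[OF gq, of b]] by (simp add: L2_scale(2)[OF fp] L2_scale(2)[OF gq])
  also have "\<dots> \<le> cmod a * d + cmod b * d" using p q by (intro add_mono mult_left_mono) auto
  also have "\<dots> = e * ((cmod a + cmod b) / (cmod a + cmod b + 1))" by (simp add: d_def algebra_simps add_divide_distrib)
  also have "\<dots> < e * 1" using e pos by (intro mult_strict_left_mono) (auto simp: divide_less_eq)
  also have "\<dots> = e" by simp
  finally have "L2_norm M (\<lambda>x. (a * f x + b * g x) - (a * p x + b * q x)) < e" .
  then show "\<exists>p. trig_poly p \<and> L2_norm M (\<lambda>x. a * f x + b * g x - p x) < e"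
    using p q by (intro exI[of _ "\<lambda>x. a * p x + b * q x"] conjI trig_poly_add trig_poly_mult trig_poly_const) auto
qed

lemma trig_approximable_sum:
  assumes "finite I" "\<And>i. i \<in> I \<Longrightarrow> trig_approximable (f i)"
  shows "trig_approximable (\<lambda>x. \<Sum>i\<in>I. c i * f i x)"
  using assms
proof (induction I)
  case empty
  then show ?case using trig_approximable_trig_poly[OF trig_poly_const[of 0]] by simp
next
  case (insert i I)
  then show ?case using trig_approximable_lincomb[of "f i" "\<lambda>x. \<Sum>i\<in>I. c i * f i x" "c i" 1] by simp
qed

text \<open>The maps \<open>x \<mapsto> (L sin (x\<^sub>i / L))\<^sub>i\<close> take values in a cube and converge to the identity; on
  the cube a continuous function is uniformly approximated by polynomials.\<close>

lemma trig_approximable_continuous: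
  fixes h :: "real^'n \<Rightarrow> real"
  assumes h: "continuous_on UNIV h" and bd: "\<And>x. \<bar>h x\<bar> \<le> C"
  shows "trig_approximable (\<lambda>x. complex_of_real (h x))"
proof -
  define s where "s L x = (\<chi> i. L * sin (x $ i / L))" for L :: real and x :: "real^'n"
  have sc: "continuous_on UNIV (s L)" for L
    unfolding s_def divide_inverse by (intro continuous_intros)
  have hs: "continuous_on UNIV (\<lambda>x. h (s L x))" for L
    by (rule continuous_on_compose2[OF h sc]) auto
  have mh: "(\<lambda>x. complex_of_real (h (s L x))) \<in> borel_measurable M" for L
    unfolding measurable_cong_sets[OF sets_M refl]
    by (intro borel_measurable_continuous_onI continuous_on_of_real hs)
  have mh0: "(\<lambda>x. complex_of_real (h x)) \<in> borel_measurable M"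
    unfolding measurable_cong_sets[OF sets_M refl]
    by (intro borel_measurable_continuous_onI continuous_on_of_real h)
  have fin: "trig_approximable (\<lambda>x. complex_of_real (h (s L x)))" if L: "L > 0" for L
    unfolding trig_approximable_def
  proof (intro conjI allI impI)
    show "(\<lambda>x. complex_of_real (h (s L x))) \<in> L2_space M" by (rule bounded_L2(1)[OF mh]) (use bd in \<open>simp only: norm_of_real\<close>)
    fix e :: real assume e: "e > 0"
    let ?K = "cbox (\<chi> i. -L) (\<chi> i. L) :: (real^'n) set"
    define d where "d = e / (sqrt (measure M UNIV) + 1)"
    have d: "d > 0" using e by (simp add: d_def add_nonneg_pos)
    obtain g where g: "real_polynomial_function g" "\<And>x. x \<in> ?K \<Longrightarrow> \<bar>h x - g x\<bar> < d"
      using Stone_Weierstrass_real_polynomial_function[OF compact_cbox continuous_on_subset[OF h] d, of "\<chi> i. -L" "\<chi> i. L"] by auto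
    have "\<bar>L * sin (x $ i / L)\<bar> \<le> L" for x :: "real^'n" and i
      using L mult_left_mono[OF abs_sin_le_one[of "x $ i / L"], of L] by (simp add: abs_mult)
    then have "s L x \<in> ?K" for x
      unfolding s_def mem_box_cart by (simp add: abs_le_iff minus_le_iff)
    then have "cmod (complex_of_real (h (s L x)) - complex_of_real (g (s L x))) \<le> d" for x
      using g(2)[of "s L x"] by (simp flip: of_real_diff)
    moreover have tp: "trig_poly (\<lambda>x. complex_of_real (g (s L x)))"
      unfolding s_def by (rule trig_poly_sin_coordinates[OF g(1)])
    ultimately have "L2_norm M (\<lambda>x. complex_of_real (h (s L x)) - complex_of_real (g (s L x))) \<le> d * sqrt (measure M UNIV)"
      using mh[of L] L2_space_measurable[OF trig_poly_L2[OF tp]] by (intro bounded_L2(2) borel_measurable_diff) auto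
    also have "\<dots> < d * (sqrt (measure M UNIV) + 1)" using d by simp
    also have "\<dots> = e" by (simp add: d_def add_nonneg_eq_0_iff)
    finally show "\<exists>p. trig_poly p \<and> L2_norm M (\<lambda>x. complex_of_real (h (s L x)) - p x) < e"
      using tp by (intro exI[of _ "\<lambda>x. complex_of_real (g (s L x))"]) simp
  qed
  show ?thesis
  proof (rule trig_approximable_limit)
    show "(\<lambda>x. complex_of_real (h x)) \<in> L2_space M" by (rule bounded_L2(1)[OF mh0]) (use bd in \<open>simp only: norm_of_real\<close>)
    show "trig_approximable (\<lambda>x. complex_of_real (h (s (real (Suc n)) x)))" for n by (rule fin) simp
    show "(\<lambda>n. L2_norm M (\<lambda>x. complex_of_real (h (s (real (Suc n)) x)) - complex_of_real (h x))) \<longlonglongrightarrow> 0"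
    proof (rule L2_tendsto_dominated[OF mh mh0])
      show "integrable M (\<lambda>x. (2 * C)\<^sup>2)" by simp
      show "cmod (complex_of_real (h (s (real (Suc n)) x)) - complex_of_real (h x)) \<le> 2 * C" for n x
        using bd[of "s (real (Suc n)) x"] bd[of x] by (simp flip: of_real_diff)
      fix x :: "real^'n"
      have "(\<lambda>n. s (real (Suc n)) x $ i) \<longlonglongrightarrow> x $ i" for i
      proof -
        have "((\<lambda>L. L * sin (x $ i / L)) \<longlongrightarrow> x $ i) at_top" by real_asymp
        from filterlim_compose[OF this filterlim_compose[OF filterlim_real_sequentially filterlim_Suc]]
        show ?thesis by (simp add: s_def)
      qed
      then have "(\<lambda>n. s (real (Suc n)) x) \<longlonglongrightarrow> x" by (rule vec_tendstoI)
      moreover have "isCont h x" using h by (simp add: continuous_on_eq_continuous_at)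
      ultimately have "(\<lambda>n. h (s (real (Suc n)) x)) \<longlonglongrightarrow> h x" by (rule isCont_tendsto_compose[rotated])
      then show "(\<lambda>n. complex_of_real (h (s (real (Suc n)) x))) \<longlonglongrightarrow> complex_of_real (h x)" by (rule tendsto_of_real)
    qed
  qed
qed

text \<open>The continuous functions max(0, 1 - n dist(x, F)) decrease to the indicator.\<close>

lemma trig_approximable_indicator_closed:
  fixes F :: "(real^'n) set"
  assumes F: "closed F"
  shows "trig_approximable (indicator F)"
proof (cases "F = {}")
  case True
  then show ?thesis using trig_approximable_trig_poly[OF trig_poly_const[of 0]] by (simp add: indicator_def[abs_def])
next
  case False
  define g where "g n x = max 0 (1 - real n * infdist x F)" for n and x :: "real^'n"
  have gc: "continuous_on UNIV (g n)" for n unfolding g_def by (intro continuous_intros)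
  have g01: "\<bar>g n x\<bar> \<le> 1" for n x using infdist_nonneg[of x F] by (auto simp: g_def)
  have mi: "(indicator F :: real^'n \<Rightarrow> complex) \<in> borel_measurable M"
    using F by (intro borel_measurable_indicator) (auto simp: sets_M)
  have ib: "cmod (indicator F x) \<le> 1" for x :: "real^'n" by (simp add: indicator_def)
  show ?thesis
  proof (rule trig_approximable_limit)
    show "indicator F \<in> L2_space M" by (rule bounded_L2(1)[OF mi ib])
    show ga: "trig_approximable (\<lambda>x. complex_of_real (g n x))" for n
      by (rule trig_approximable_continuous[OF gc g01])
    show "(\<lambda>n. L2_norm M (\<lambda>x. complex_of_real (g n x) - indicator F x)) \<longlonglongrightarrow> 0"
    proof (rule L2_tendsto_dominated[OF _ mi])
      show "(\<lambda>x. complex_of_real (g n x)) \<in> borel_measurable M" for n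
        by (rule L2_space_measurable[OF trig_approximable_L2[OF ga]])
      show "integrable M (\<lambda>x. 2\<^sup>2)" by simp
      show "cmod (complex_of_real (g n x) - indicator F x) \<le> 2" for n x
        using norm_triangle_ineq4[of "complex_of_real (g n x)" "indicator F x"] g01[of n x] ib[of x] by simp
      fix x :: "real^'n"
      show "(\<lambda>n. complex_of_real (g n x)) \<longlonglongrightarrow> indicator F x"
      proof (cases "x \<in> F")
        case True
        then show ?thesis by (simp add: g_def)
      next
        case False
        then have pos: "infdist x F > 0"
          using in_closed_iff_infdist_zero[OF F \<open>F \<noteq> {}\<close>] infdist_nonneg[of x F] by (metis less_eq_real_def)
        obtain N where N: "1 < real N * infdist x F" using reals_Archimedean3[OF pos] by blast
        have "g n x = 0" if "n \<ge> N" for n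
        proof -
          have "real N * infdist x F \<le> real n * infdist x F" using that pos by (intro mult_right_mono) auto
          then show ?thesis using N by (simp add: g_def)
        qed
        then have "eventually (\<lambda>n. complex_of_real (g n x) = indicator F x) sequentially"
          using False by (auto simp: eventually_sequentially)
        then show ?thesis by (rule tendsto_eventually)
      qed
    qed
  qed
qed

text \<open>Closed sets are stable under intersection and generate the Borel sets, so by the
  \<pi>-\<lambda> theorem it remains to treat complements and countable disjoint unions.\<close>

lemma trig_approximable_indicator:
  assumes "A \<in> sets borel"
  shows "trig_approximable (indicator A)"
proof -
  have sig: "A \<in> sigma_sets UNIV (Collect closed)"
    using assms by (simp add: borel_eq_closed)
  have stable: "Int_stable (Collect (closed :: (real^'n) set \<Rightarrow> bool))" by (auto simp: Int_stable_def)
  have closed_sets: "Collect closed \<subseteq> Pow (UNIV :: (real^'n) set)" by simp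
  from sig show ?thesis
  proof (induction rule: sigma_sets_induct_disjoint[OF stable closed_sets, consumes 1, case_names basic empty compl union])
    case (basic A)
    then show ?case by (simp add: trig_approximable_indicator_closed)
  next
    case empty
    show ?case by (rule trig_approximable_indicator_closed) simp
  next
    case (compl A)
    have "trig_approximable (\<lambda>x. 1 * 1 + (-1) * indicator A x)"
      by (rule trig_approximable_lincomb[OF trig_approximable_trig_poly[OF trig_poly_const] compl(2)])
    moreover have "(\<lambda>x. 1 * 1 + (-1) * indicator A x) = (indicator (UNIV - A) :: real^'n \<Rightarrow> complex)"
      by (auto simp: indicator_def)
    ultimately show ?case by simp
  next
    case (union A)
    have Am: "A i \<in> sets M" for i using union(2) by (auto simp: sets_M borel_eq_closed)
    have mi: "(indicator (\<Union>i. A i) :: real^'n \<Rightarrow> complex) \<in> borel_measurable M"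
      using Am by (intro borel_measurable_indicator sets.countable_UN) auto
    have ib: "cmod (indicator B x) \<le> 1" for x :: "real^'n" and B by (simp add: indicator_def)
    have part: "(\<Sum>i<n. 1 * indicator (A i) x) = (indicator (\<Union>i<n. A i) x :: complex)" for n x
    proof -
      have "(indicator (\<Union>i<n. A i) x :: complex) = (\<Sum>i<n. indicator (A i) x)"
        by (rule indicator_UN_disjoint) (use union(1) in \<open>auto simp: disjoint_family_on_def\<close>)
      then show ?thesis by (simp only: mult_1)
    qed
    show ?case
    proof (rule trig_approximable_limit[of _ "\<lambda>n x. \<Sum>i<n. 1 * indicator (A i) x"])
      show "indicator (\<Union>i. A i) \<in> L2_space M" by (rule bounded_L2(1)[OF mi ib])
      show ap: "trig_approximable (\<lambda>x. \<Sum>i<n. 1 * indicator (A i) x)" for n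
        by (rule trig_approximable_sum) (auto intro: union(3))
      show "(\<lambda>n. L2_norm M (\<lambda>x. (\<Sum>i<n. 1 * indicator (A i) x) - indicator (\<Union>i. A i) x)) \<longlonglongrightarrow> 0"
      proof (rule L2_tendsto_dominated[OF _ mi])
        show "(\<lambda>x. \<Sum>i<n. 1 * indicator (A i) x :: complex) \<in> borel_measurable M" for n
          by (rule L2_space_measurable[OF trig_approximable_L2[OF ap]])
        show "integrable M (\<lambda>x. 2\<^sup>2)" by simp
        show "cmod ((\<Sum>i<n. 1 * indicator (A i) x) - indicator (\<Union>i. A i) x) \<le> 2" for n x
          unfolding part by (rule order_trans[OF norm_triangle_ineq4]) (use ib[of "\<Union>i<n. A i" x] ib[of "\<Union>i. A i" x] in simp)
        fix x :: "real^'n"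
        show "(\<lambda>n. \<Sum>i<n. 1 * indicator (A i) x :: complex) \<longlonglongrightarrow> indicator (\<Union>i. A i) x"
          unfolding part by (rule LIMSEQ_indicator_UN)
      qed
    qed
  qed
qed

text \<open>Simple functions bounded by 2 |f| converge pointwise to f, with a difference dominated
  by 3 |f|.\<close>

lemma trig_poly_dense:
  assumes f: "f \<in> L2_space M"
  shows "trig_approximable f"
proof -
  have fm: "f \<in> borel_measurable M" using f by (rule L2_space_measurable)
  obtain s where s: "\<And>i. simple_function M (s i)" "\<And>x. x \<in> space M \<Longrightarrow> (\<lambda>i. s i x) \<longlonglongrightarrow> f x"
    "\<And>i x. x \<in> space M \<Longrightarrow> dist (s i x) 0 \<le> 2 * dist (f x) 0"
    using borel_measurable_implies_sequence_metric[OF fm, of 0] by blast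
  show ?thesis
  proof (rule trig_approximable_limit[OF f])
    show "trig_approximable (s i)" for i
    proof -
      have fin: "finite (range (s i))" using simple_functionD(1)[OF s(1)[of i]] by simp
      have meas: "s i -` {c} \<in> sets borel" for c
        using simple_functionD(2)[OF s(1)[of i], of "{c}"] by (simp add: sets_M)
      have "trig_approximable (\<lambda>x. \<Sum>c\<in>range (s i). c * indicator (s i -` {c}) x)"
        by (intro trig_approximable_sum fin trig_approximable_indicator meas)
      moreover have "(\<Sum>c\<in>range (s i). c * indicator (s i -` {c}) x) = s i x" for x
        using fin by (subst sum.remove[of _ "s i x"]) (auto simp: indicator_def intro!: sum.neutral)
      ultimately show ?thesis by simp
    qed
    show "(\<lambda>n. L2_norm M (\<lambda>x. s n x - f x)) \<longlonglongrightarrow> 0"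
    proof (rule L2_tendsto_dominated[OF _ fm])
      show "s n \<in> borel_measurable M" for n using s(1) by (rule borel_measurable_simple_function)
      show "integrable M (\<lambda>x. (3 * cmod (f x))\<^sup>2)" using L2_space_integrable[OF f] by (simp add: power_mult_distrib)
      show "cmod (s n x - f x) \<le> 3 * cmod (f x)" for n x
        using s(3)[of x n] norm_triangle_ineq4[of "s n x" "f x"] by simp
    qed (use s(2) in auto)
  qed
qed

end

section \<open>Extrapolation\<close>

text \<open>Up to the mesh size, these are the absolute denominators of the Lagrange weights for
  equidistant nodes.\<close>

lemma prod_distance_nodes:
  assumes "j \<le> m"
  shows "(\<Prod>i\<in>{..<Suc m} - {j}. \<bar>real i - real j\<bar>) = fact j * fact (m - j)"
proof -
  have split: "{..<Suc m} - {j} = {..<j} \<union> {Suc j..m}" using assms by auto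
  have 1: "(\<Prod>i<j. \<bar>real i - real j\<bar>) = fact j"
  proof -
    have "(\<Prod>i<j. \<bar>real i - real j\<bar>) = (\<Prod>i<j. real (Suc (j - Suc i)))"
      by (intro prod.cong) (auto simp: of_nat_diff)
    also have "\<dots> = (\<Prod>i<j. real (Suc i))" by (rule prod.nat_diff_reindex)
    also have "\<dots> = fact j" by (induction j) (auto simp: algebra_simps)
    finally show ?thesis .
  qed
  have 2: "(\<Prod>i\<in>{Suc j..m}. \<bar>real i - real j\<bar>) = fact (m - j)"
    using assms
  proof (induction m rule: dec_induct)
    case (step m)
    then have "{Suc j..Suc m} = insert (Suc m) {Suc j..m}" by auto
    then show ?case using step by (simp add: Suc_diff_le of_nat_diff)
  qed simp
  have "(\<Prod>i\<in>{..<j} \<union> {Suc j..m}. \<bar>real i - real j\<bar>) = (\<Prod>i<j. \<bar>real i - real j\<bar>) * (\<Prod>i\<in>{Suc j..m}. \<bar>real i - real j\<bar>)"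
    by (rule prod.union_disjoint) auto
  then show ?thesis by (simp only: split 1 2)
qed

lemma sum_inverse_fact_product:
  "(\<Sum>j<Suc m. 1 / (fact j * fact (m - j)) :: real) = 2 ^ m / fact m"
proof -
  have "(\<Sum>j<Suc m. 1 / (fact j * fact (m - j)) :: real) = (\<Sum>j\<le>m. real (m choose j) / fact m)"
    by (intro sum.cong) (auto simp: binomial_fact lessThan_Suc_atMost)
  also have "\<dots> = real (\<Sum>j\<le>m. m choose j) / fact m"
    by (simp add: sum_divide_distrib)
  also have "\<dots> = 2 ^ m / fact m"
    by (simp only: choose_row_sum of_nat_power of_nat_numeral)
  finally show ?thesis .
qed

text \<open>One term of the exponential series at n is below its sum.\<close>

lemma power_le_exp_fact: "real n ^ n \<le> exp (real n) * fact n"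
proof -
  have "(\<Sum>k\<in>{n}. inverse (fact k) * real n ^ k) \<le> (\<Sum>k. inverse (fact k) * real n ^ k)"
    by (rule sum_le_suminf[OF summable_exp]) auto
  then have "inverse (fact n) * real n ^ n \<le> exp (real n)"
    by (simp add: exp_def scaleR_conv_of_real)
  then show ?thesis by (simp add: field_simps)
qed

text \<open>The products are the Lagrange basis polynomials evaluated at 0, and interpolation at
  \<open>N\<close> nodes is exact below degree \<open>N\<close>. For k = 0 the right side is
  1.\<close>

lemma lagrange_at_0:
  fixes s :: "nat \<Rightarrow> real"
  assumes inj: "inj_on s {..<N}" and k: "k < N"
  shows "(\<Sum>j<N. (\<Prod>i\<in>{..<N} - {j}. s i / (s i - s j)) * s j ^ k) = 0 ^ k"
proof -
  define L where "L j = (\<Prod>i\<in>{..<N} - {j}. smult (1 / (s j - s i)) [:- s i, 1:])" for j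
  have dist: "s j \<noteq> s i" if "j < N" "i < N" "i \<noteq> j" for i j
    using inj that by (auto simp: inj_on_def)
  have Ls: "poly (L j) (s i) = (if i = j then 1 else 0)" if "j < N" "i < N" for i j
  proof (cases "i = j")
    case True
    have "poly (smult (1 / (s j - s l)) [:- s l, 1:]) (s j) = 1" if "l \<in> {..<N} - {j}" for l
      using dist[OF \<open>j < N\<close>, of l] that by (simp add: diff_divide_distrib[symmetric])
    then have "(\<Prod>l\<in>{..<N} - {j}. poly (smult (1 / (s j - s l)) [:- s l, 1:]) (s j)) = 1"
      by (intro prod.neutral) blast
    with True show ?thesis unfolding L_def poly_prod by simp
  next
    case False
    then have "poly (smult (1 / (s j - s i)) [:- s i, 1:]) (s i) = 0" "i \<in> {..<N} - {j}" using that by auto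
    then show ?thesis unfolding L_def poly_prod using False by (auto intro!: prod_zero)
  qed
  have L0: "poly (L j) 0 = (\<Prod>i\<in>{..<N} - {j}. s i / (s i - s j))" if "j < N" for j
    unfolding L_def poly_prod
    by (intro prod.cong) (use dist[OF that] in \<open>auto simp: divide_simps algebra_simps\<close>)
  have Ld: "degree (L j) < N" if "j < N" for j
  proof -
    have "degree (L j) \<le> (\<Sum>i\<in>{..<N} - {j}. degree (smult (1 / (s j - s i)) [:- s i, 1:]))"
      unfolding L_def using degree_prod_sum_le[of "{..<N} - {j}" "\<lambda>i. smult (1 / (s j - s i)) [:- s i, 1:]"]
      by (simp only: o_def finite_Diff finite_lessThan)
    also have "\<dots> \<le> (\<Sum>i\<in>{..<N} - {j}. 1)" by (intro sum_mono) (auto intro: order_trans[OF degree_smult_le])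
    also have "\<dots> = N - 1" using that by simp
    finally show ?thesis using that by simp
  qed
  \<comment> \<open>The monomial minus its interpolant has degree below \<open>N\<close> but
    vanishes at \<open>N\<close> distinct nodes.\<close>
  define q where "q = monom 1 k - (\<Sum>j<N. smult (s j ^ k) (L j))"
  have dq: "degree q < N"
    unfolding q_def using k Ld
    by (intro degree_diff_less degree_sum_less) (auto simp: degree_monom_eq intro: le_less_trans[OF degree_smult_le])
  have "poly q (s i) = 0" if "i < N" for i
  proof -
    have "(\<Sum>j<N. s j ^ k * poly (L j) (s i)) = (\<Sum>j<N. if j = i then s i ^ k else 0)"
      using that by (intro sum.cong) (auto simp: Ls)
    then show ?thesis using that by (simp add: q_def poly_sum poly_monom)
  qed
  then have sub: "s ` {..<N} \<subseteq> {x. poly q x = 0}" by auto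
  have "q = 0"
  proof (rule ccontr)
    assume q: "q \<noteq> 0"
    have "N = card (s ` {..<N})" using inj by (simp add: card_image)
    also have "\<dots> \<le> card {x. poly q x = 0}" by (rule card_mono[OF poly_roots_finite[OF q] sub])
    also have "\<dots> \<le> degree q" by (rule card_poly_roots_bound[OF q])
    finally show False using dq by simp
  qed
  then have "poly (monom 1 k) 0 = poly (\<Sum>j<N. smult (s j ^ k) (L j)) 0" by (simp add: q_def)
  then show ?thesis by (simp add: poly_sum poly_monom L0 mult.commute)
qed

text \<open>With m = N - 1, the numerators are at most 2^m and the denominators are (\<eta>/N)^m j!
  (m - j)!. Summation over j gives (4 N / \<eta>)^m / m!, and N^N / N! \<le> e^N turns this into a
  geometric bound.\<close>

lemma extrapolation_weights:
  fixes \<eta> :: real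
  assumes \<eta>: "0 < \<eta>" "\<eta> \<le> 1"
  obtains l :: "nat \<Rightarrow> real" where
    "\<And>k. k < N \<Longrightarrow> (\<Sum>j<N. l j * (1 + \<eta> * real j / real N) ^ k) = 0 ^ k"
    "(\<Sum>j<N. \<bar>l j\<bar>) \<le> (4 * exp 1 / \<eta>) ^ N"
proof (cases N)
  case 0
  then show thesis using that[of "\<lambda>_. 0"] by simp
next
  case (Suc m)
  define s where "s j = 1 + \<eta> * real j / real N" for j
  have N: "real N > 0" using Suc by simp
  have inj: "inj_on s {..<N}" using \<eta> N by (auto simp: inj_on_def s_def)
  define l where "l j = (\<Prod>i\<in>{..<N} - {j}. s i / (s i - s j))" for j
  have lb: "\<bar>l j\<bar> \<le> (2 * N / \<eta>) ^ m * (1 / (fact j * fact (m - j)))" if j: "j < N" for j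
  proof -
    have card: "card ({..<N} - {j}) = m" using j Suc by simp
    have s2: "\<bar>s i\<bar> \<le> 2" if "i < N" for i
    proof -
      have "\<eta> * real i / real N \<le> 1 * 1"
        using \<eta> that unfolding times_divide_eq_right[symmetric] by (intro mult_mono) auto
      moreover have "\<eta> * real i / real N \<ge> 0" using \<eta> by simp
      ultimately show ?thesis by (simp add: s_def)
    qed
    have d: "\<bar>s i - s j\<bar> = (\<eta> / N) * \<bar>real i - real j\<bar>" for i
    proof -
      have "s i - s j = (\<eta> / N) * (real i - real j)" by (simp add: s_def algebra_simps diff_divide_distrib)
      then show ?thesis using \<eta> by (simp add: abs_mult)
    qed
    have "\<bar>l j\<bar> = (\<Prod>i\<in>{..<N} - {j}. \<bar>s i\<bar>) / (\<Prod>i\<in>{..<N} - {j}. \<bar>s i - s j\<bar>)"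
      by (simp add: l_def abs_prod prod_dividef)
    also have "(\<Prod>i\<in>{..<N} - {j}. \<bar>s i - s j\<bar>) = (\<eta> / N) ^ m * (fact j * fact (m - j))"
    proof -
      have "(\<Prod>i\<in>{..<N} - {j}. \<bar>s i - s j\<bar>) = (\<eta> / N) ^ m * (\<Prod>i\<in>{..<N} - {j}. \<bar>real i - real j\<bar>)"
        by (simp only: d prod.distrib prod_constant card)
      also have "(\<Prod>i\<in>{..<N} - {j}. \<bar>real i - real j\<bar>) = fact j * fact (m - j)"
        unfolding Suc by (rule prod_distance_nodes) (use j Suc in simp)
      finally show ?thesis .
    qed
    also have "(\<Prod>i\<in>{..<N} - {j}. \<bar>s i\<bar>) / ((\<eta> / N) ^ m * (fact j * fact (m - j))) \<le>
      2 ^ m / ((\<eta> / N) ^ m * (fact j * fact (m - j)))"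
    proof (rule divide_right_mono)
      have "(\<Prod>i\<in>{..<N} - {j}. \<bar>s i\<bar>) \<le> (\<Prod>i\<in>{..<N} - {j}. 2)" by (rule prod_mono) (use s2 in auto)
      then show "(\<Prod>i\<in>{..<N} - {j}. \<bar>s i\<bar>) \<le> 2 ^ m" using card by simp
    qed (use \<eta> in simp)
    also have "\<dots> = (2 * N / \<eta>) ^ m * (1 / (fact j * fact (m - j)))"
      by (simp add: power_divide power_mult_distrib)
    finally show ?thesis .
  qed
  have "(\<Sum>j<N. \<bar>l j\<bar>) \<le> (\<Sum>j<N. (2 * N / \<eta>) ^ m * (1 / (fact j * fact (m - j))))"
    by (intro sum_mono lb) simp
  also have "\<dots> = (2 * N / \<eta>) ^ m * (2 ^ m / fact m)"
    unfolding Suc sum_distrib_left[symmetric] sum_inverse_fact_product ..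
  also have "\<dots> = (4 / \<eta>) ^ m * (real N ^ N / fact N)"
  proof -
    have "real N ^ N / fact N = real N ^ m / fact m" using N by (simp add: Suc)
    moreover have "(2 * N / \<eta>) ^ m * (2 ^ m / fact m) = (4 / \<eta>) ^ m * (real N ^ m / fact m)"
    proof -
      have "(4::real) ^ m = 2 ^ m * 2 ^ m" by (simp flip: power_mult_distrib)
      then show ?thesis by (simp add: power_divide power_mult_distrib)
    qed
    ultimately show ?thesis by simp
  qed
  also have "\<dots> \<le> (4 / \<eta>) ^ N * exp 1 ^ N"
  proof (rule mult_mono)
    show "(4 / \<eta>) ^ m \<le> (4 / \<eta>) ^ N" using \<eta> by (intro power_increasing) (auto simp: Suc field_simps)
    show "real N ^ N / fact N \<le> exp 1 ^ N"
      using power_le_exp_fact[of N] by (simp add: divide_le_eq exp_of_nat_mult[symmetric])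
  qed (use \<eta> in auto)
  also have "\<dots> = (4 * exp 1 / \<eta>) ^ N" by (simp add: power_mult_distrib power_divide)
  finally have b: "(\<Sum>j<N. \<bar>l j\<bar>) \<le> (4 * exp 1 / \<eta>) ^ N" .
  show thesis
    using that[of l] lagrange_at_0[OF inj] b unfolding l_def s_def by blast
qed

text \<open>The variance of \<open>f\<close> under the uniform distribution is nonnegative.\<close>

lemma mean_square_le:
  fixes f :: "real \<Rightarrow> real"
  assumes f: "continuous_on {0..2*pi} f"
  shows "(integral {0..2*pi} f / (2*pi))\<^sup>2 \<le> integral {0..2*pi} (\<lambda>x. (f x)\<^sup>2) / (2*pi)"
proof -
  let ?I = "integral {0..2*pi}"
  define m where "m = ?I f / (2*pi)"
  have i: "f integrable_on {0..2*pi}" "(\<lambda>x. (f x)\<^sup>2) integrable_on {0..2*pi}"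
    using f by (auto intro!: integrable_continuous_interval continuous_intros)
  have "0 \<le> ?I (\<lambda>x. (f x - m)\<^sup>2)"
    by (intro integral_nonneg integrable_continuous_interval continuous_intros f) auto
  also have "?I (\<lambda>x. (f x - m)\<^sup>2) = ?I (\<lambda>x. ((f x)\<^sup>2 - (2 * m) * f x) + m\<^sup>2)"
    by (simp add: power2_eq_square algebra_simps)
  also have "\<dots> = ?I (\<lambda>x. (f x)\<^sup>2 - (2 * m) * f x) + ?I (\<lambda>x. m\<^sup>2)"
    by (intro integral_add integrable_diff integrable_on_mult_right i integrable_const_ivl)
  also have "?I (\<lambda>x. (f x)\<^sup>2 - (2 * m) * f x) = ?I (\<lambda>x. (f x)\<^sup>2) - ?I (\<lambda>x. (2 * m) * f x)"
    by (intro integral_diff integrable_on_mult_right i)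
  also have "?I (\<lambda>x. (2 * m) * f x) = 2 * m * (m * (2 * pi))" by (simp add: m_def)
  finally have "2 * pi * m\<^sup>2 \<le> ?I (\<lambda>x. (f x)\<^sup>2)" by (simp add: power2_eq_square algebra_simps)
  then show ?thesis unfolding m_def[symmetric] by (simp add: field_simps)
qed

text \<open>Cauchy's formula, estimated by the mean square over the circle instead of the maximum. A
  mean square can later be integrated over the base point and exchanged with the integral over the
  circle, where only bounds at each fixed point of the circle are known.\<close>

lemma taylor_coefficient_mean_bound:
  fixes \<phi> :: "complex \<Rightarrow> complex"
  assumes hol: "\<phi> holomorphic_on UNIV" and R: "R > 0"
  shows "(cmod ((deriv ^^ k) \<phi> 0 / fact k) * R ^ k)\<^sup>2
     \<le> integral {0..2*pi} (\<lambda>t. (cmod (\<phi> (R * cis t)))\<^sup>2) / (2 * pi)"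
proof -
  let ?I = "integral {0..2*pi}"
  have cont: "continuous_on A (\<lambda>t. \<phi> (R * cis t))" for A
    by (rule continuous_on_compose2[OF holomorphic_on_imp_continuous_on[OF hol]]) (auto intro!: continuous_intros)
  have "((\<lambda>u. \<phi> u / (u - 0) ^ Suc k) has_contour_integral 2 * pi * \<i> / fact k * (deriv ^^ k) \<phi> 0) (circlepath 0 R)"
    using Cauchy_has_contour_integral_higher_derivative_circlepath[of 0 R \<phi> 0 k] R hol
    by (auto intro: holomorphic_on_imp_continuous_on holomorphic_on_subset)
  then have "contour_integral (part_circlepath 0 R 0 (2*pi)) (\<lambda>u. \<phi> u / u ^ Suc k) = 2 * pi * \<i> / fact k * (deriv ^^ k) \<phi> 0"
    unfolding circlepath_def by (simp add: contour_integral_unique)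
  moreover have "contour_integral (part_circlepath 0 R 0 (2*pi)) (\<lambda>u. \<phi> u / u ^ Suc k)
      = ?I (\<lambda>t. \<phi> (0 + R * cis t) / (0 + R * cis t) ^ Suc k * R * \<i> * cis t)"
    by (rule contour_integral_part_circlepath_eq) simp
  moreover have "\<phi> (0 + R * cis t) / (0 + R * cis t) ^ Suc k * R * \<i> * cis t = \<i> * (\<phi> (R * cis t) / (R * cis t) ^ k)" for t
    using R by (simp add: field_simps)
  ultimately have eq: "2 * pi * \<i> * ((deriv ^^ k) \<phi> 0 / fact k) = ?I (\<lambda>t. \<i> * (\<phi> (R * cis t) / (R * cis t) ^ k))"
    by simp
  have "cmod (?I (\<lambda>t. \<i> * (\<phi> (R * cis t) / (R * cis t) ^ k))) \<le> ?I (\<lambda>t. cmod (\<phi> (R * cis t)) / R ^ k)"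
    using R by (intro integral_norm_bound_integral integrable_continuous_interval continuous_intros cont)
      (auto simp: norm_mult norm_divide norm_power)
  also have "\<dots> = ?I (\<lambda>t. cmod (\<phi> (R * cis t))) / R ^ k" by (rule integral_divide)
  finally have "cmod (2 * pi * \<i> * ((deriv ^^ k) \<phi> 0 / fact k)) \<le> ?I (\<lambda>t. cmod (\<phi> (R * cis t))) / R ^ k"
    by (simp only: eq)
  moreover have "cmod (2 * pi * \<i> * ((deriv ^^ k) \<phi> 0 / fact k)) = 2 * pi * cmod ((deriv ^^ k) \<phi> 0 / fact k)"
    by (subst norm_mult) (simp add: norm_mult)
  ultimately have "2 * pi * cmod ((deriv ^^ k) \<phi> 0 / fact k) \<le> ?I (\<lambda>t. cmod (\<phi> (R * cis t))) / R ^ k" by linarith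
  then have "cmod ((deriv ^^ k) \<phi> 0 / fact k) * R ^ k \<le> ?I (\<lambda>t. cmod (\<phi> (R * cis t))) / (2 * pi)"
    using R by (simp add: field_simps)
  then have "(cmod ((deriv ^^ k) \<phi> 0 / fact k) * R ^ k)\<^sup>2 \<le> (?I (\<lambda>t. cmod (\<phi> (R * cis t))) / (2 * pi))\<^sup>2"
    using R by (intro power_mono) auto
  also have "\<dots> \<le> ?I (\<lambda>t. (cmod (\<phi> (R * cis t)))\<^sup>2) / (2 * pi)"
    by (rule mean_square_le) (intro continuous_intros cont)
  finally show ?thesis .
qed

text \<open>In the Taylor series the exactness of the weights cancels all terms of degree k < N. The
  others are at most m A (2/R)^k, with m the root of the mean square; since R \<ge> 4 they decay
  geometrically with ratio at most 1/2, which explains the factor 2.\<close>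

lemma extrapolation_error:
  fixes l s :: "nat \<Rightarrow> real" and \<phi> :: "complex \<Rightarrow> complex"
  assumes hol: "\<phi> holomorphic_on UNIV" and R: "R \<ge> 4"
    and l: "\<And>k. k < N \<Longrightarrow> (\<Sum>j<N. l j * s j ^ k) = 0 ^ k"
    and lA: "(\<Sum>j<N. \<bar>l j\<bar>) \<le> A" and s: "\<And>j. j < N \<Longrightarrow> \<bar>s j\<bar> \<le> 2"
    and N: "N > 0"
  shows "(cmod (\<phi> 0 - (\<Sum>j<N. l j * \<phi> (s j))))\<^sup>2
    \<le> (2 * A * (2 / R) ^ N)\<^sup>2 * (integral {0..2*pi} (\<lambda>t. (cmod (\<phi> (R * cis t)))\<^sup>2) / (2 * pi))"
proof -
  define m where "m = sqrt (integral {0..2*pi} (\<lambda>t. (cmod (\<phi> (R * cis t)))\<^sup>2) / (2 * pi))"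
  have I0: "0 \<le> integral {0..2*pi} (\<lambda>t. (cmod (\<phi> (R * cis t)))\<^sup>2) / (2 * pi)"
    using order_trans[OF zero_le_power2 taylor_coefficient_mean_bound[OF hol, of R 0]] R by simp
  then have m0: "m \<ge> 0" by (simp add: m_def)
  define a where "a k = (deriv ^^ k) \<phi> 0 / fact k" for k
  have ab: "cmod (a k) \<le> m / R ^ k" for k
  proof -
    have "cmod (a k) * R ^ k \<le> m"
      unfolding m_def a_def using taylor_coefficient_mean_bound[OF hol, of R k] R by (intro real_le_rsqrt) auto
    then show ?thesis using R by (simp add: field_simps)
  qed
  have ser: "(\<lambda>k. a k * w ^ k) sums \<phi> w" for w
    using holomorphic_power_series[of \<phi> 0 "norm w + 1" w] hol
    by (auto simp: a_def intro: holomorphic_on_subset)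
  define c where "c k = (0::real) ^ k - (\<Sum>j<N. l j * s j ^ k)" for k
  have "(\<lambda>k. a k * 0 ^ k - (\<Sum>j<N. complex_of_real (l j) * (a k * complex_of_real (s j) ^ k))) sums
      (\<phi> 0 - (\<Sum>j<N. l j * \<phi> (s j)))"
    by (intro sums_diff sums_sum sums_mult ser)
  moreover have "a k * 0 ^ k - (\<Sum>j<N. complex_of_real (l j) * (a k * complex_of_real (s j) ^ k)) = a k * complex_of_real (c k)" for k
    by (simp add: c_def sum_distrib_left algebra_simps)
  ultimately have sums: "(\<lambda>k. a k * complex_of_real (c k)) sums (\<phi> 0 - (\<Sum>j<N. l j * \<phi> (s j)))" by simp
  have c0: "c k = 0" if "k < N" for k using l[OF that] by (simp add: c_def)
  have A0: "A \<ge> 0" using order_trans[OF sum_nonneg lA] by simp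
  \<comment> \<open>\<open>N > 0\<close> makes 0^k vanish for k \<ge> N.\<close>
  have cb: "\<bar>c k\<bar> \<le> A * 2 ^ k" if "k \<ge> N" for k
  proof -
    have "\<bar>c k\<bar> = \<bar>\<Sum>j<N. l j * s j ^ k\<bar>" using that N by (simp add: c_def power_0_left)
    also have "\<dots> \<le> (\<Sum>j<N. \<bar>l j\<bar> * 2 ^ k)"
      by (rule order_trans[OF sum_abs]) (auto intro!: sum_mono mult_left_mono power_mono s simp: abs_mult power_abs)
    also have "\<dots> \<le> A * 2 ^ k" unfolding sum_distrib_right[symmetric] using lA by (intro mult_right_mono) auto
    finally show ?thesis .
  qed
  have tb: "cmod (a (k + N) * complex_of_real (c (k + N))) \<le> m * A * (2 / R) ^ N * (1 / 2) ^ k" for k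
  proof -
    have "cmod (a (k + N) * complex_of_real (c (k + N))) \<le> (m / R ^ (k + N)) * (A * 2 ^ (k + N))"
      unfolding norm_mult norm_of_real by (rule mult_mono) (use ab[of "k + N"] cb[of "k + N"] R m0 in auto)
    also have "\<dots> = m * A * (2 / R) ^ N * (2 / R) ^ k" using R by (simp add: power_add power_divide field_simps)
    also have "\<dots> \<le> m * A * (2 / R) ^ N * (1 / 2) ^ k"
      using R m0 A0 by (intro mult_left_mono power_mono) (auto simp: field_simps)
    finally show ?thesis .
  qed
  have geo: "summable (\<lambda>k. m * A * (2 / R) ^ N * (1 / 2 :: real) ^ k)"
    by (intro summable_mult summable_geometric) simp
  have "\<phi> 0 - (\<Sum>j<N. l j * \<phi> (s j)) = (\<Sum>k. a (k + N) * complex_of_real (c (k + N)))"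
    using sums_unique[OF sums] suminf_split_initial_segment[OF sums_summable[OF sums], of N] c0 by simp
  also have "cmod \<dots> \<le> (\<Sum>k. m * A * (2 / R) ^ N * (1 / 2) ^ k)"
    by (rule norm_suminf_le[OF tb geo])
  also have "\<dots> = m * A * (2 / R) ^ N * 2"
    by (subst suminf_mult) (auto simp: suminf_geometric)
  finally have "cmod (\<phi> 0 - (\<Sum>j<N. l j * \<phi> (s j))) \<le> (2 * A * (2 / R) ^ N) * m" by (simp add: mult_ac)
  then have "(cmod (\<phi> 0 - (\<Sum>j<N. l j * \<phi> (s j))))\<^sup>2 \<le> ((2 * A * (2 / R) ^ N) * m)\<^sup>2" by (intro power_mono) auto
  also have "\<dots> = (2 * A * (2 / R) ^ N)\<^sup>2 * (integral {0..2*pi} (\<lambda>t. (cmod (\<phi> (R * cis t)))\<^sup>2) / (2 * pi))"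
    using I0 by (simp add: power_mult_distrib m_def)
  finally show ?thesis .
qed

section \<open>The stationary covariance\<close>

locale fokker_planck =
  fixes Q B :: "real^'n^'n"
  assumes psd: "sym_pos_semidef Q"
    and rank: "rank (kalman_matrix Q B) = CARD('n)"
    and spec: "matrix_spectrum B \<subseteq> {z. Re z < 0}"
begin

abbreviation "Qi \<equiv> Q_infinity Q B"
abbreviation "E t \<equiv> matrix_exp (t *\<^sub>R B)"
abbreviation "Et t \<equiv> matrix_exp (t *\<^sub>R transpose B)"

lemma bounded_linear_transpose: "bounded_linear (transpose :: real^'n^'n \<Rightarrow> real^'n^'n)"
  unfolding linear_conv_bounded_linear[symmetric] by (rule linearI) (auto simp: transpose_def vec_eq_iff)

lemma Et_transpose: "Et t = transpose (E t)"
  by (simp add: transpose_matrix_exp)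

lemma sym_Q: "transpose Q = Q"
  using psd by (simp add: sym_pos_semidef_def)

definition flow :: "real \<Rightarrow> real^'n^'n" where
  "flow s = E s ** Q ** Et s"

lemma flow_0: "flow 0 = Q"
  using matrix_exp_0[of B] matrix_exp_0[of "transpose B"] by (simp add: flow_def)

lemma flow_deriv: "(flow has_vector_derivative B ** flow s + flow s ** transpose B) (at s)"
proof -
  have 1: "((\<lambda>s. E s ** Q) has_vector_derivative (B ** E s) ** Q) (at s)"
    using bounded_linear.has_vector_derivative[OF bounded_bilinear.bounded_linear_left[OF bounded_bilinear_matrix_mul] matrix_exp_deriv_left] .
  have 2: "(Et has_vector_derivative Et s ** transpose B) (at s)" by (rule matrix_exp_deriv_right)
  from bounded_bilinear.has_vector_derivative[OF bounded_bilinear_matrix_mul 1 2]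
  show ?thesis unfolding flow_def by (simp add: matrix_mul_assoc add.commute)
qed

lemma flow_continuous: "continuous_on S flow"
  by (intro continuous_at_imp_continuous_on ballI has_vector_derivative_continuous[OF flow_deriv])

text \<open>One rate and one constant serve all three curves; the norms of transposition and
  multiplication are absorbed in the constant.\<close>

lemma exp_bounds:
  obtains c C where "c > 0" "C > 0" "\<And>t. t \<ge> 0 \<Longrightarrow> norm (E t) \<le> C * exp (- c * t)"
    "\<And>t. t \<ge> 0 \<Longrightarrow> norm (Et t) \<le> C * exp (- c * t)" "\<And>t. t \<ge> 0 \<Longrightarrow> norm (flow t) \<le> C * exp (- c * t)"
proof -
  obtain c C where c: "c > 0" "C > 0" and C: "\<And>t. t \<ge> 0 \<Longrightarrow> norm (E t) \<le> C * exp (- c * t)"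
    using matrix_exp_decay[OF spec] by metis
  obtain K1 where K1: "K1 > 0" "\<And>A :: real^'n^'n. norm (transpose A) \<le> norm A * K1"
    using bounded_linear.pos_bounded[OF bounded_linear_transpose] by blast
  obtain K2 where K2: "K2 > 0" "\<And>(X :: real^'n^'n) (Y :: real^'n^'n). norm (X ** Y) \<le> norm X * norm Y * K2"
    using bounded_bilinear.pos_bounded[OF bounded_bilinear_matrix_mul] by blast
  have Eb: "norm (E t) \<le> C" if "t \<ge> 0" for t
  proof -
    have "C * exp (- c * t) \<le> C * 1" using c that by (intro mult_left_mono) auto
    with C[OF that] show ?thesis by simp
  qed
  have b1: "norm (Et t) \<le> (C * K1) * exp (- c * t)" if "t \<ge> 0" for t
  proof -
    have "norm (E t) * K1 \<le> (C * exp (- c * t)) * K1" using C[OF that] K1(1) by (intro mult_right_mono) auto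
    with K1(2)[of "E t"] show ?thesis by (simp add: Et_transpose mult_ac)
  qed
  have b2: "norm (flow t) \<le> (C * norm Q * K2 * (C * K1) * K2) * exp (- c * t)" if "t \<ge> 0" for t
  proof -
    have "norm (E t ** Q) \<le> C * norm Q * K2"
      by (rule order_trans[OF K2(2)]) (intro mult_right_mono Eb that; use K2(1) in simp)
    then have "norm (E t ** Q) * norm (Et t) * K2 \<le> (C * norm Q * K2) * ((C * K1) * exp (- c * t)) * K2"
      by (intro mult_right_mono mult_mono b1 that) (use K2(1) c in auto)
    with K2(2)[of "E t ** Q" "Et t"] show ?thesis unfolding flow_def by (simp add: mult_ac)
  qed
  define D where "D = C + C * K1 + C * norm Q * K2 * (C * K1) * K2"
  have D: "C \<le> D" "C * K1 \<le> D" "C * norm Q * K2 * (C * K1) * K2 \<le> D"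
  proof -
    have "0 \<le> C" "0 \<le> C * K1" "0 \<le> C * norm Q * K2 * (C * K1) * K2"
      using c K1(1) K2(1) by (auto intro!: mult_nonneg_nonneg)
    then show "C \<le> D" "C * K1 \<le> D" "C * norm Q * K2 * (C * K1) * K2 \<le> D" unfolding D_def by linarith+
  qed
  have mono: "X * exp (- c * t) \<le> D * exp (- c * t)" if "X \<le> D" for X t
    using that by (intro mult_right_mono) auto
  show thesis
    by (rule that[of c D]) (use c D(1) order_trans[OF C mono[OF D(1)]] order_trans[OF b1 mono[OF D(2)]]
        order_trans[OF b2 mono[OF D(3)]] in auto)
qed

lemma flow_integrable: "set_integrable lborel {0..} flow"
proof -
  obtain c C where c: "c > 0" "C > 0" and b: "\<And>t. t \<ge> 0 \<Longrightarrow> norm (flow t) \<le> C * exp (- c * t)"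
    using exp_bounds by metis
  have lim: "((\<lambda>x. - (C / c) * exp (- c * x)) \<longlongrightarrow> 0) at_top" using c by real_asymp
  have "(\<integral>\<^sup>+x. ennreal (C * exp (- c * x)) * indicator {0..} x \<partial>lborel) = ennreal (0 - (- (C / c) * exp (- c * 0)))"
    by (rule nn_integral_FTC_atLeast[OF _ _ _ lim]) (use c in \<open>auto intro!: derivative_eq_intros\<close>)
  then have fin: "(\<integral>\<^sup>+x. ennreal (C * exp (- c * x)) * indicator {0..} x \<partial>lborel) < \<infinity>" by simp
  have "integrable lborel (\<lambda>x. indicator {0..} x *\<^sub>R (C * exp (- c * x)))"
  proof (rule integrableI_nonneg)
    have "(\<integral>\<^sup>+x. ennreal (indicator {0..} x *\<^sub>R (C * exp (- c * x))) \<partial>lborel) =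
      (\<integral>\<^sup>+x. ennreal (C * exp (- c * x)) * indicator {0..} x \<partial>lborel)"
      by (intro nn_integral_cong) (auto simp: indicator_def)
    with fin show "(\<integral>\<^sup>+x. ennreal (indicator {0..} x *\<^sub>R (C * exp (- c * x))) \<partial>lborel) < \<infinity>" by simp
  qed (use c in auto)
  then show ?thesis
    unfolding set_integrable_def
  proof (rule Bochner_Integration.integrable_bound)
    show "(\<lambda>x. indicat_real {0..} x *\<^sub>R flow x) \<in> borel_measurable lborel"
      using borel_measurable_continuous_onI[OF flow_continuous] by simp
    show "AE x in lborel. norm (indicat_real {0..} x *\<^sub>R flow x) \<le> norm (indicat_real {0..} x *\<^sub>R (C * exp (- c * x)))"
      using b c by (intro AE_I2) (auto simp: indicator_def)
  qed
qed

lemma Qi_eq: "Qi = (LBINT s:{0..}. flow s)"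
  by (simp add: Q_infinity_def flow_def)

lemma linear_Qi:
  fixes T :: "real^'n^'n \<Rightarrow> real^'n^'n"
  assumes "bounded_linear T"
  shows "T Qi = (LBINT s:{0..}. T (flow s))" "set_integrable lborel {0..} (\<lambda>s. T (flow s))"
proof -
  interpret bounded_linear T by fact
  have eq: "T (indicat_real {0..} x *\<^sub>R flow x) = indicat_real {0..} x *\<^sub>R T (flow x)" for x by (rule scale)
  show "T Qi = (LBINT s:{0..}. T (flow s))"
    using integral_bounded_linear[OF assms flow_integrable[unfolded set_integrable_def]]
    by (simp add: Qi_eq set_lebesgue_integral_def eq)
  show "set_integrable lborel {0..} (\<lambda>s. T (flow s))"
    using integrable_bounded_linear[OF assms flow_integrable[unfolded set_integrable_def]]
    by (simp add: set_integrable_def eq)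
qed

lemma sym_Qi: "transpose Qi = Qi"
proof -
  have "transpose (flow s) = flow s" for s
    by (simp add: flow_def matrix_transpose_mul sym_Q Et_transpose matrix_mul_assoc)
  then show ?thesis using linear_Qi(1)[OF bounded_linear_transpose] by (simp add: Qi_eq)
qed

text \<open>The derivative of \<open>flow\<close> is integrated over the half-line;
  \<open>flow\<close> starts at \<open>Q\<close> and tends to 0.\<close>

lemma lyapunov: "B ** Qi + Qi ** transpose B = - Q"
proof -
  let ?T = "\<lambda>Y. B ** Y + Y ** transpose B"
  have bl: "bounded_linear ?T"
    by (intro bounded_linear_add bounded_bilinear.bounded_linear_left[OF bounded_bilinear_matrix_mul]
        bounded_bilinear.bounded_linear_right[OF bounded_bilinear_matrix_mul])
  have "((\<lambda>b. LBINT s:{0..b}. ?T (flow s)) \<longlongrightarrow> (LBINT s:{0..}. ?T (flow s))) at_top"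
    by (rule tendsto_set_lebesgue_integral_at_top[OF _ linear_Qi(2)[OF bl]]) auto
  then have 1: "((\<lambda>b. LBINT s:{0..b}. ?T (flow s)) \<longlongrightarrow> ?T Qi) at_top"
    using linear_Qi(1)[OF bl] by simp
  have fin: "(LBINT s:{0..b}. ?T (flow s)) = flow b - flow 0" if "b \<ge> 0" for b
    unfolding set_lebesgue_integral_def
  proof (rule integral_FTC_atLeastAtMost[OF that])
    show "(flow has_vector_derivative ?T (flow x)) (at x within {0..b})" for x
      by (rule has_vector_derivative_at_within[OF flow_deriv])
    show "continuous_on {0..b} (\<lambda>s. ?T (flow s))"
      by (rule bounded_linear.continuous_on[OF bl flow_continuous])
  qed
  obtain c C where c: "c > 0" "C > 0" and b: "\<And>t. t \<ge> 0 \<Longrightarrow> norm (flow t) \<le> C * exp (- c * t)"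
    using exp_bounds by metis
  have "(flow \<longlongrightarrow> 0) at_top"
  proof (rule Lim_null_comparison)
    show "eventually (\<lambda>t. norm (flow t) \<le> C * exp (- c * t)) at_top"
      using eventually_ge_at_top[of 0] by eventually_elim (rule b)
    show "((\<lambda>t. C * exp (- c * t)) \<longlongrightarrow> 0) at_top" using c by real_asymp
  qed
  from tendsto_diff[OF this tendsto_const[of Q]]
  have "((\<lambda>b. flow b - flow 0) \<longlongrightarrow> - Q) at_top" by (simp add: flow_0)
  then have "((\<lambda>b. LBINT s:{0..b}. ?T (flow s)) \<longlongrightarrow> - Q) at_top"
    by (rule Lim_transform_eventually) (use eventually_ge_at_top[of 0] in eventually_elim, simp add: fin flow_0)
  from tendsto_unique[OF _ 1 this] show ?thesis by simp
qed

text \<open>By the derivative below, this is the integral of |Q^(1/2) e^(\<sigma> B^T) w|^2 over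
  \<sigma> \<ge> s, so its decrease on [0, t] is the quadratic form of the controllability
  Gramian.\<close>

definition energy :: "real^'n \<Rightarrow> real \<Rightarrow> real" where
  "energy w s = (Et s *v w) \<bullet> (Qi *v (Et s *v w))"

lemma energy_deriv:
  "(energy w has_vector_derivative - (norm (matrix_sqrt Q *v (Et s *v w)))\<^sup>2) (at s)"
proof -
  define y where "y = Et s *v w"
  have d: "((\<lambda>s. Et s *v w) has_vector_derivative transpose B *v y) (at s)"
    unfolding y_def by (rule matrix_exp_vector_deriv)
  have d2: "((\<lambda>s. Qi *v (Et s *v w)) has_vector_derivative Qi *v (transpose B *v y)) (at s)"
    by (rule bounded_linear.has_vector_derivative[OF matrix_vector_mul_bounded_linear d])
  have 1: "(transpose B *v y) \<bullet> (Qi *v y) = y \<bullet> ((B ** Qi) *v y)"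
    by (simp add: dot_lmul_matrix matrix_vector_mul_assoc)
  have 2: "y \<bullet> (Qi *v (transpose B *v y)) = y \<bullet> ((Qi ** transpose B) *v y)"
    by (simp only: matrix_vector_mul_assoc)
  have "y \<bullet> ((B ** Qi) *v y) + y \<bullet> ((Qi ** transpose B) *v y) = y \<bullet> ((- Q) *v y)"
    by (simp only: lyapunov[symmetric] matrix_vector_mult_add_rdistrib inner_add_right)
  also have "\<dots> = - (y \<bullet> (Q *v y))"
    by (simp add: matrix_vector_mult_def inner_vec_def sum_negf)
  also have "y \<bullet> (Q *v y) = (norm (matrix_sqrt Q *v y))\<^sup>2"
  proof -
    have "y \<bullet> (Q *v y) = y \<bullet> (matrix_sqrt Q *v (matrix_sqrt Q *v y))"
      by (simp only: matrix_sqrt(2)[OF psd] matrix_vector_mul_assoc)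
    also have "\<dots> = (matrix_sqrt Q *v y) \<bullet> (matrix_sqrt Q *v y)"
      using matrix_sqrt(1)[OF psd] by (intro symmetric_matrix_inner[symmetric]) (simp add: sym_pos_semidef_def)
    finally show ?thesis by (simp add: power2_norm_eq_inner)
  qed
  finally show ?thesis
    using bounded_bilinear.has_vector_derivative[OF bounded_bilinear_inner d d2] 1 2
    unfolding energy_def y_def by (simp only: add.commute)
qed

lemma energy_antimono: "s \<le> t \<Longrightarrow> energy w t \<le> energy w s"
  by (rule DERIV_nonpos_imp_nonincreasing)
    (use energy_deriv[unfolded has_real_derivative_iff_has_vector_derivative[symmetric]] in \<open>force intro: exI\<close>)+

text \<open>A decreasing function with limit 0. The positivity of \<open>Qi\<close> is deduced from
  this and therefore cannot be used here.\<close>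

lemma energy_nonneg: "0 \<le> energy w s"
proof -
  obtain c C where c: "c > 0" "C > 0" and b: "\<And>t. t \<ge> 0 \<Longrightarrow> norm (Et t) \<le> C * exp (- c * t)"
    using exp_bounds by metis
  have "((\<lambda>t. C * exp (- c * t)) \<longlongrightarrow> 0) at_top" using c by real_asymp
  then have E0: "(Et \<longlongrightarrow> 0) at_top"
    by (rule Lim_null_comparison[rotated]) (rule eventually_mono[OF eventually_ge_at_top[of 0] b])
  have "((\<lambda>t. Et t *v w) \<longlongrightarrow> 0 *v w) at_top"
    by (rule bounded_linear.tendsto[OF bounded_bilinear.bounded_linear_left[OF bounded_bilinear_matrix_vector_mul] E0])
  then have "(energy w \<longlongrightarrow> 0 \<bullet> (Qi *v 0)) at_top"
    unfolding energy_def by (intro tendsto_inner bounded_linear.tendsto[OF matrix_vector_mul_bounded_linear]) simp_all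
  then show ?thesis
    using energy_antimono
    by (intro tendsto_upperbound[of "energy w" 0 at_top "energy w s"])
      (auto intro: eventually_mono[OF eventually_ge_at_top[of s]])
qed

lemma energy_0: "energy w 0 = w \<bullet> (Qi *v w)"
  using matrix_exp_0[of "transpose B"] by (simp add: energy_def)

text \<open>The Gramian bound for unit vectors, extended by homogeneity. The power \<open>k\<close>
  expresses the degeneracy of \<open>Q\<close>; only its existence matters later.\<close>

lemma energy_decrease:
  obtains c k where "c > 0" "\<And>w t. 0 < t \<Longrightarrow> t \<le> 1 \<Longrightarrow> c * t ^ k * (norm w)\<^sup>2 \<le> w \<bullet> (Qi *v w) - energy w t"
proof -
  obtain a C where b: "a > 0" "C > 0" "\<And>t. t \<ge> 0 \<Longrightarrow> norm (Et t) \<le> C * exp (- a * t)"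
    using exp_bounds by metis
  have C: "norm (Et s) \<le> C" if "0 \<le> s" for s
    using order_trans[OF b(3)[OF that], of C] b that by (simp add: mult_left_le)
  have sym: "transpose (matrix_sqrt Q) = matrix_sqrt Q" using matrix_sqrt(1)[OF psd] by (simp add: sym_pos_semidef_def)
  obtain c k where c: "0 < c" "\<And>w t. norm w = 1 \<Longrightarrow> 0 < t \<Longrightarrow> t \<le> 1 \<Longrightarrow> c * t ^ k \<le> energy w 0 - energy w t"
    using gramian_lower_bound[OF rank sym energy_deriv C] by blast
  have M: "c * t ^ k * (norm w)\<^sup>2 \<le> w \<bullet> (Qi *v w) - energy w t" if t: "0 < t" "t \<le> 1" for w t
  proof (cases "w = 0")
    case True
    then show ?thesis by (simp add: energy_def)
  next
    case False
    let ?u = "(1 / norm w) *\<^sub>R w"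
    have sc: "energy ?u s = energy w s / (norm w)\<^sup>2" for s
      by (simp add: energy_def matrix_vector_mult_scaleR power2_eq_square)
    have "c * t ^ k \<le> energy ?u 0 - energy ?u t" using False t by (intro c(2)) auto
    also have "\<dots> = (energy w 0 - energy w t) / (norm w)\<^sup>2" by (simp only: sc diff_divide_distrib)
    finally show ?thesis using False by (simp add: energy_0 pos_le_divide_eq)
  qed
  show thesis by (rule that[OF c(1) M])
qed

text \<open>The decrease over [0, 1] is strict and the energy at time 1 is nonnegative.\<close>

lemma Qi_pos_def: "w \<noteq> 0 \<Longrightarrow> 0 < w \<bullet> (Qi *v w)"
proof -
  assume w: "w \<noteq> 0"
  obtain c k where c: "c > 0" "\<And>w t. 0 < t \<Longrightarrow> t \<le> 1 \<Longrightarrow> c * t ^ k * (norm w)\<^sup>2 \<le> w \<bullet> (Qi *v w) - energy w t"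
    using energy_decrease by metis
  have "0 < c * 1 ^ k * (norm w)\<^sup>2" using c(1) w by simp
  then show ?thesis using c(2)[of 1 w] energy_nonneg[of w 1] by simp
qed

lemma Qi_psd: "sym_pos_semidef Qi"
  using Qi_pos_def sym_Qi unfolding sym_pos_semidef_def by (metis inner_zero_left less_eq_real_def)

text \<open>Conjugation with \<open>K\<close> turns the quadratic form of \<open>Qi\<close> into the
  Euclidean one, so that contraction of this form becomes contraction of the Euclidean norm.\<close>

definition K :: "real^'n^'n" where "K = matrix_sqrt Qi"

lemma K_sym: "transpose K = K" and K_square: "K ** K = Qi"
  using matrix_sqrt[OF Qi_psd] by (auto simp: K_def sym_pos_semidef_def)

lemma matrix_inv_right: "invertible M \<Longrightarrow> M ** matrix_inv M = mat 1"
  and matrix_inv_left: "invertible M \<Longrightarrow> matrix_inv M ** M = mat 1"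
  unfolding matrix_inv_def invertible_def by (metis (mono_tags, lifting) someI_ex)+

lemma invertible_Qi: "invertible Qi"
proof -
  have "w = 0" if "Qi *v w = 0" for w
    using Qi_pos_def[of w] that by fastforce
  then show ?thesis
    using invertible_left_inverse matrix_left_invertible_ker by blast
qed

lemma invertible_K: "invertible K"
proof -
  have "det K * det K = det Qi" using K_square by (metis det_mul)
  then show ?thesis using invertible_Qi by (auto simp: invertible_det_nz)
qed

lemma det_Qi: "det Qi > 0"
proof -
  have "det Qi = det K * det K" using K_square by (metis det_mul)
  moreover have "det K \<noteq> 0" using invertible_K by (simp add: invertible_det_nz)
  ultimately show ?thesis by (simp add: mult_neg_neg zero_less_mult_iff) linarith
qed

definition Ki :: "real^'n^'n" where "Ki = matrix_inv K"

lemma K_Ki: "K ** Ki = mat 1" "Ki ** K = mat 1"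
  using matrix_inv_right[OF invertible_K] matrix_inv_left[OF invertible_K] by (auto simp: Ki_def)

lemma Ki_sym: "transpose Ki = Ki"
proof -
  have "transpose Ki ** K = mat 1" using arg_cong[OF K_Ki(1), of transpose] by (simp add: matrix_transpose_mul K_sym transpose_mat)
  then have "transpose Ki ** (K ** Ki) = Ki" by (simp only: matrix_mul_assoc matrix_mul_lid)
  then show ?thesis by (simp add: K_Ki)
qed

abbreviation "A \<equiv> matrix_inv Qi"

lemma A_eq: "A = Ki ** Ki"
proof -
  have "(Ki ** Ki) ** Qi = Ki ** (Ki ** K) ** K" unfolding K_square[symmetric] by (simp only: matrix_mul_assoc)
  then have "(Ki ** Ki) ** Qi = mat 1" by (simp add: K_Ki)
  then have "(Ki ** Ki) ** (Qi ** A) = A" by (simp only: matrix_mul_assoc matrix_mul_lid)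
  then show ?thesis by (simp add: matrix_inv_right[OF invertible_Qi])
qed

lemma A_Qi: "A ** Qi = mat 1" "Qi ** A = mat 1"
  using matrix_inv_right[OF invertible_Qi] matrix_inv_left[OF invertible_Qi] by auto

lemma A_sym: "transpose A = A"
  by (simp add: A_eq matrix_transpose_mul Ki_sym)

lemma inner_A: "x \<bullet> (A *v y) = (Ki *v x) \<bullet> (Ki *v y)"
  unfolding A_eq using symmetric_matrix_inner[OF Ki_sym, of x "Ki *v y"]
  by (simp only: matrix_vector_mul_assoc[symmetric])

lemma inner_Qi: "x \<bullet> (Qi *v y) = (K *v x) \<bullet> (K *v y)"
  unfolding K_square[symmetric] using symmetric_matrix_inner[OF K_sym, of x "K *v y"]
  by (simp only: matrix_vector_mul_assoc[symmetric])

lemma Ki_K [simp]: "Ki *v (K *v x) = x" "K *v (Ki *v x) = x"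
  by (simp_all only: matrix_vector_mul_assoc K_Ki matrix_vector_mul_lid)

end

section \<open>Gaussian integrals\<close>

text \<open>Lebesgue measure is the image of a product measure indexed by the basis vectors;
  \<open>g\<close> renames the coordinate functions accordingly.\<close>

lemma integrable_lborel_prod:
  fixes f :: "'n::finite \<Rightarrow> real \<Rightarrow> real"
  assumes f: "\<And>i. integrable lborel (f i)"
  shows "integrable lborel (\<lambda>x::real^'n. \<Prod>i\<in>UNIV. f i (x $ i))"
proof -
  interpret product_sigma_finite "\<lambda>b::real^'n. lborel :: real measure" ..
  have inj: "inj (\<lambda>i::'n. axis i (1::real))" by (auto simp: inj_on_def axis_eq_axis)
  define g where "g b = f (inv (\<lambda>i. axis i 1) b)" for b :: "real^'n"
  have gax: "g (axis i 1) = f i" for i unfolding g_def using inv_f_f[OF inj, of i] by simp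
  have Bas: "(Basis :: (real^'n) set) = range (\<lambda>i. axis i 1)" by (auto simp: Basis_vec_def)
  have gi: "integrable lborel (g b)" for b unfolding g_def by (rule f)
  have reindex: "(\<Prod>b\<in>Basis. h b) = (\<Prod>i\<in>UNIV. h (axis i 1))" for h :: "real^'n \<Rightarrow> real"
    unfolding Bas by (simp add: prod.reindex[OF inj])
  let ?P = "\<Pi>\<^sub>M b\<in>(Basis :: (real^'n) set). (lborel :: real measure)"
  let ?T = "\<lambda>f. \<Sum>b\<in>(Basis :: (real^'n) set). f b *\<^sub>R b"
  have comp: "(\<Prod>i\<in>UNIV. f i (?T y $ i)) = (\<Prod>b\<in>Basis. g b (y b))" for y
  proof -
    have "?T y $ i = y (axis i 1)" for i
    proof -
      have "?T y $ i = ?T y \<bullet> axis i 1" by (simp add: inner_axis)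
      also have "\<dots> = y (axis i 1)" by (subst inner_sum_left_Basis) auto
      finally show ?thesis .
    qed
    then show ?thesis by (simp add: reindex gax)
  qed
  have Tm: "?T \<in> measurable ?P borel" by measurable
  have fm: "(\<lambda>x::real^'n. \<Prod>i\<in>UNIV. f i (x $ i)) \<in> borel_measurable borel"
  proof -
    have "(\<lambda>x::real^'n. f i (x $ i)) \<in> borel_measurable borel" for i
      using borel_measurable_integrable[OF f[of i]] by (intro measurable_compose[of "\<lambda>x. x $ i" borel borel "f i"])
        (auto intro!: borel_measurable_continuous_onI continuous_intros)
    then show ?thesis by measurable
  qed
  have int: "integrable ?P (\<lambda>y. \<Prod>b\<in>Basis. g b (y b))"
    by (rule product_integrable_prod) (auto intro: gi)
  show ?thesis
    unfolding lborel_eq[where 'a="real^'n"]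
    by (subst integrable_distr_eq[OF Tm fm]) (use int in \<open>simp only: comp\<close>)
qed

lemma integrable_exp_neg_square:
  assumes "c > 0"
  shows "integrable lborel (\<lambda>x::real. exp (- c * x\<^sup>2))"
proof -
  let ?s = "1 / sqrt (2 * c)"
  have s: "?s > 0" "2 * ?s\<^sup>2 = 1 / c" using assms by (auto simp: power_divide)
  have "integrable lborel (\<lambda>x. sqrt (2 * pi * ?s\<^sup>2) * normal_density 0 ?s x)"
    by (intro integrable_mult_right integrable_normal_density s)
  moreover have "sqrt (2 * pi * ?s\<^sup>2) * normal_density 0 ?s x = exp (- c * x\<^sup>2)" for x
  proof -
    have "sqrt (2 * pi * ?s\<^sup>2) \<noteq> 0" using s(1) by simp
    then show ?thesis unfolding normal_density_def s(2) using assms by (simp add: field_simps)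
  qed
  ultimately show ?thesis by simp
qed

lemma integrable_gaussian:
  assumes "c > 0"
  shows "integrable lborel (\<lambda>x::real^'n. exp (- c * (x \<bullet> x)))"
proof -
  have "integrable lborel (\<lambda>x::real^'n. \<Prod>i\<in>UNIV. exp (- c * (x $ i)\<^sup>2))"
    by (rule integrable_lborel_prod[OF integrable_exp_neg_square[OF assms]])
  moreover have "(\<Prod>i\<in>UNIV. exp (- c * (x $ i)\<^sup>2)) = exp (- c * (x \<bullet> x))" for x :: "real^'n"
    by (simp add: exp_sum[symmetric] inner_vec_def sum_distrib_left sum_negf power2_eq_square)
  ultimately show ?thesis by simp
qed

text \<open>Half of the exponent absorbs the polynomial factor.\<close>

lemma integrable_gaussian_moment:
  assumes "c > 0"
  shows "integrable lborel (\<lambda>x::real^'n. (1 + norm x) ^ 2 * exp (- c * (x \<bullet> x)))"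
proof -
  have bd: "(1 + norm x) ^ 2 * exp (- c * (x \<bullet> x)) \<le> (2 + 4 / c) * exp (- (c / 2) * (x \<bullet> x))" for x :: "real^'n"
  proof -
    define q where "q = (c / 2) * (x \<bullet> x)"
    have "q \<le> exp q" using exp_ge_add_one_self[of q] by linarith
    then have q: "(4 / c) * q \<le> (4 / c) * exp q" using assms by (intro mult_left_mono) auto
    have e: "1 \<le> exp q" using assms by (simp add: q_def)
    have "(1 + norm x)\<^sup>2 \<le> 2 + 2 * (x \<bullet> x)"
      using zero_le_power2[of "1 - norm x"] by (simp add: power2_eq_square algebra_simps flip: power2_norm_eq_inner)
    also have "2 * (x \<bullet> x) = (4 / c) * q" using assms by (simp add: q_def)
    finally have "(1 + norm x)\<^sup>2 \<le> (2 + 4 / c) * exp q" using q e unfolding distrib_right by linarith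
    then have "(1 + norm x)\<^sup>2 \<le> (2 + 4 / c) * exp ((c / 2) * (x \<bullet> x))" by (simp only: q_def)
    then have "(1 + norm x)\<^sup>2 * exp (- c * (x \<bullet> x)) \<le> (2 + 4 / c) * exp ((c / 2) * (x \<bullet> x)) * exp (- c * (x \<bullet> x))"
      by (intro mult_right_mono) auto
    also have "\<dots> = (2 + 4 / c) * exp (- (c / 2) * (x \<bullet> x))"
      by (simp add: mult.assoc flip: exp_add)
    finally show ?thesis .
  qed
  have "integrable lborel (\<lambda>x::real^'n. (2 + 4 / c) * exp (- (c / 2) * (x \<bullet> x)))"
    using assms by (intro integrable_mult_right integrable_gaussian) simp
  then show ?thesis
  proof (rule Bochner_Integration.integrable_bound)
    show "AE x in lborel. norm ((1 + norm (x::real^'n)) ^ 2 * exp (- c * (x \<bullet> x))) \<le> norm ((2 + 4 / c) * exp (- (c / 2) * (x \<bullet> x)))"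
      using bd assms by (intro AE_I2) (simp add: abs_mult)
  qed (auto intro!: borel_measurable_continuous_onI continuous_intros)
qed

lemma lborel_integral_translate:
  fixes f :: "real^'n \<Rightarrow> complex"
  assumes [measurable]: "f \<in> borel_measurable borel"
  shows "(LINT x|lborel. f (c + x)) = (LINT x|lborel. f x)"
    and "integrable lborel (\<lambda>x. f (c + x)) = integrable lborel f"
proof -
  have m: "(+) c \<in> measurable lborel borel" by simp
  show "(LINT x|lborel. f (c + x)) = (LINT x|lborel. f x)"
    using integral_distr[OF m assms] by (simp add: lborel_distr_plus)
  show "integrable lborel (\<lambda>x. f (c + x)) = integrable lborel f"
    using integrable_distr_eq[OF m assms] by (simp add: lborel_distr_plus)
qed

lemma nn_integral_translate:
  fixes f :: "real^'n \<Rightarrow> ennreal"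
  assumes [measurable]: "f \<in> borel_measurable borel"
  shows "(\<integral>\<^sup>+x. f (x + c) \<partial>lborel) = (\<integral>\<^sup>+x. f x \<partial>lborel)"
proof -
  have m: "(+) c \<in> measurable lborel borel" by simp
  show ?thesis using nn_integral_distr[OF m, of f] by (simp add: lborel_distr_plus add.commute)
qed

text \<open>Difference quotients of \<open>F\<close> have integral 0 by translation invariance. The
  majorant bounds the derivative along a whole segment, because the mean value estimate involves all
  points between x and x + s v.\<close>

lemma integral_directional_derivative:
  fixes F G :: "real^'n \<Rightarrow> complex"
  assumes F: "integrable lborel F" and G [measurable]: "G \<in> borel_measurable borel" and w: "integrable lborel w"
    and der: "\<And>x s. ((\<lambda>s. F (x + s *\<^sub>R v)) has_vector_derivative G (x + s *\<^sub>R v)) (at s)"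
    and bd: "\<And>x s. \<bar>s\<bar> \<le> 1 \<Longrightarrow> norm (G (x + s *\<^sub>R v)) \<le> w x"
  shows "(LINT x|lborel. G x) = 0"
proof -
  have [measurable]: "F \<in> borel_measurable borel" using borel_measurable_integrable[OF F] by simp
  define h where "h n = 1 / real (Suc n)" for n
  have h: "0 < h n" "h n \<le> 1" for n by (auto simp: h_def)
  have hlim: "filterlim h (at 0) sequentially"
    unfolding filterlim_at using LIMSEQ_inverse_real_of_nat h by (auto simp: h_def[abs_def] inverse_eq_divide)
  define D where "D n x = (F (h n *\<^sub>R v + x) - F x) / complex_of_real (h n)" for n x
  have Dm: "D n \<in> borel_measurable lborel" for n unfolding D_def[abs_def] by measurable
  have D0: "(LINT x|lborel. D n x) = 0" for n
  proof -
    have "integrable lborel (\<lambda>x. F (h n *\<^sub>R v + x))" using F by (simp add: lborel_integral_translate(2))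
    then show ?thesis using F unfolding D_def by (simp add: lborel_integral_translate(1))
  qed
  have "(\<lambda>n. LINT x|lborel. D n x) \<longlonglongrightarrow> (LINT x|lborel. G x)"
  proof (rule integral_dominated_convergence[OF _ Dm w])
    show "AE x in lborel. (\<lambda>n. D n x) \<longlonglongrightarrow> G x"
    proof (rule AE_I2)
      fix x
      have "((\<lambda>k. norm (F (x + (0 + k) *\<^sub>R v) - F (x + 0 *\<^sub>R v) - k *\<^sub>R G (x + 0 *\<^sub>R v)) / norm k) \<longlongrightarrow> 0) (at 0)"
        using der[of x 0] unfolding has_vector_derivative_def has_derivative_at by blast
      from filterlim_compose[OF this hlim]
      have "(\<lambda>n. norm (F (x + h n *\<^sub>R v) - F x - h n *\<^sub>R G x) / h n) \<longlonglongrightarrow> 0"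
        using h(1) by (simp add: less_imp_le)
      moreover have "norm (F (x + h n *\<^sub>R v) - F x - h n *\<^sub>R G x) / h n = norm (D n x - G x)" for n
      proof -
        have "D n x - G x = (F (x + h n *\<^sub>R v) - F x - h n *\<^sub>R G x) / complex_of_real (h n)"
          using h(1)[of n] by (simp add: D_def add.commute diff_divide_distrib scaleR_conv_of_real)
        then show ?thesis using h(1)[of n] by (simp add: norm_divide)
      qed
      ultimately have "(\<lambda>n. norm (D n x - G x)) \<longlonglongrightarrow> 0" by simp
      then show "(\<lambda>n. D n x) \<longlonglongrightarrow> G x"
        by (rule LIM_zero_cancel[OF tendsto_norm_zero_cancel])
    qed
    show "AE x in lborel. norm (D n x) \<le> w x" for n
    proof (rule AE_I2)
      fix x
      have "norm (F (x + h n *\<^sub>R v) - F (x + 0 *\<^sub>R v)) \<le> w x * norm (h n - 0)"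
      proof (rule differentiable_bound[of "{0..h n}" "\<lambda>s. F (x + s *\<^sub>R v)" "\<lambda>s k. k *\<^sub>R G (x + s *\<^sub>R v)"])
        show "((\<lambda>s. F (x + s *\<^sub>R v)) has_derivative (\<lambda>k. k *\<^sub>R G (x + s *\<^sub>R v))) (at s within {0..h n})" for s
          using der[of x s] unfolding has_vector_derivative_def by (rule has_derivative_at_withinI)
        show "onorm (\<lambda>k. k *\<^sub>R G (x + s *\<^sub>R v)) \<le> w x" if "s \<in> {0..h n}" for s
        proof (rule onorm_le)
          have "norm (G (x + s *\<^sub>R v)) \<le> w x" using that h(2)[of n] by (intro bd) auto
          then show "norm (k *\<^sub>R G (x + s *\<^sub>R v)) \<le> w x * norm k" for k
            by (simp add: mult.commute[of "w x"] mult_left_mono)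
        qed
      qed (use h(1)[of n] in auto)
      then show "norm (D n x) \<le> w x"
        using h(1)[of n] by (simp add: D_def norm_divide add.commute pos_divide_le_eq)
    qed
  qed simp
  then show ?thesis by (simp add: D0 LIMSEQ_const_iff)
qed

section \<open>Integration by parts against test functions\<close>

lemma integrable_compact_support:
  fixes f :: "real^'n \<Rightarrow> complex"
  assumes f: "continuous_on UNIV f" and S: "compact S" and z: "\<And>x. x \<notin> S \<Longrightarrow> f x = 0"
  shows "integrable lborel f"
proof -
  have "integrable lborel (\<lambda>x. indicator S x *\<^sub>R f x)"
    by (rule borel_integrable_compact[OF S continuous_on_subset[OF f]]) simp
  moreover have "indicator S x *\<^sub>R f x = f x" for x using z by (auto simp: indicator_def)
  ultimately show ?thesis by simp
qed

lemma partial_eq: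
  assumes "(f has_derivative f') (at x)"
  shows "partial i f x = f' (axis i 1)"
  using frechet_derivative_at[OF assms] by (simp add: partial_def)

lemma has_derivative_line:
  fixes f :: "real^'n \<Rightarrow> complex"
  assumes "f differentiable_on UNIV"
  shows "((\<lambda>s. f (x + s *\<^sub>R axis i 1)) has_vector_derivative partial i f (x + s *\<^sub>R axis i 1)) (at s)"
proof -
  have "f differentiable (at (x + s *\<^sub>R axis i 1))" using assms by (simp add: differentiable_on_def)
  then have d: "(f has_derivative frechet_derivative f (at (x + s *\<^sub>R axis i 1))) (at (x + s *\<^sub>R axis i 1))"
    by (simp add: frechet_derivative_works)
  have "((\<lambda>s. x + s *\<^sub>R axis i 1) has_derivative (\<lambda>k. k *\<^sub>R axis i 1)) (at s)"
    by (auto intro!: derivative_eq_intros)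
  from has_derivative_compose[OF this d]
  show ?thesis
    unfolding has_vector_derivative_def partial_def
    by (simp add: linear_scale[OF bounded_linear.linear[OF has_derivative_bounded_linear[OF d]]])
qed

lemma partial_support:
  assumes "x \<notin> closure {x. f x \<noteq> 0}"
  shows "partial i f x = 0"
proof -
  have op: "open (- closure {x. f x \<noteq> 0})" and mem: "x \<in> - closure {x. f x \<noteq> 0}" using assms by auto
  have zero: "0 = f y" if "y \<in> - closure {x. f x \<noteq> 0}" for y
    using that closure_subset[of "{x. f x \<noteq> 0}"] by auto
  have "(f has_derivative (\<lambda>_. 0)) (at x)"
    by (rule has_derivative_transform_within_open[OF has_derivative_const[of 0] op mem zero])
  then show ?thesis by (simp add: partial_eq)
qed

text \<open>The derivative of the product g q has integral 0. Compact support is required of q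
  alone, so g can be a Gaussian wave or one of its derivatives.\<close>

lemma integration_by_parts_compact_support:
  fixes g q :: "real^'n \<Rightarrow> complex"
  assumes g: "g differentiable_on UNIV" "continuous_on UNIV (partial i g)"
    and q: "q differentiable_on UNIV" "continuous_on UNIV (partial i q)"
    and supp: "compact (closure {x. q x \<noteq> 0})"
  shows "(LINT x|lborel. g x * partial i q x) = - (LINT x|lborel. partial i g x * q x)"
proof -
  let ?S = "closure {x. q x \<noteq> 0}"
  have gc: "continuous_on UNIV g" and qc: "continuous_on UNIV q"
    using g(1) q(1) by (auto intro: differentiable_imp_continuous_on)
  have z: "q x = 0" "partial i q x = 0" if "x \<notin> ?S" for x
    using that closure_subset[of "{x. q x \<noteq> 0}"] partial_support[OF that] by auto
  define F where "F x = g x * q x" for x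
  define G where "G x = g x * partial i q x + partial i g x * q x" for x
  have Fc: "continuous_on UNIV F" and Gc: "continuous_on UNIV G"
    unfolding F_def G_def by (intro continuous_intros gc qc g(2) q(2))+
  have Fi: "integrable lborel F" by (rule integrable_compact_support[OF Fc supp]) (metis F_def z(1) mult_zero_right)
  obtain C where C: "\<And>x. norm (G x) \<le> C" "C \<ge> 0"
  proof -
    have "bounded (G ` ?S)" by (intro compact_imp_bounded compact_continuous_image continuous_on_subset[OF Gc] supp) auto
    then obtain C where "\<forall>y\<in>G ` ?S. norm y \<le> C" unfolding bounded_iff by blast
    then have "norm (G x) \<le> max C 0" for x
      using z[of x] by (cases "x \<in> ?S") (auto simp: G_def le_max_iff_disj)
    then show thesis using that[of "max C 0"] by simp
  qed
  obtain r where r: "\<And>x. x \<in> ?S \<Longrightarrow> norm x \<le> r"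
    using compact_imp_bounded[OF supp] unfolding bounded_iff by blast
  have "(LINT x|lborel. G x) = 0"
  proof (rule integral_directional_derivative[OF Fi])
    show "G \<in> borel_measurable borel" by (rule borel_measurable_continuous_onI[OF Gc])
    \<comment> \<open>The ball exceeds the support by one unit because the bound must hold along
      segments of length up to 1.\<close>
    show "integrable lborel (\<lambda>x::real^'n. indicator (cball 0 (r + 1)) x * C)"
      using borel_integrable_compact[OF compact_cball continuous_on_const, of "0::real^'n" "r + 1" C] by simp
    show "((\<lambda>s. F (x + s *\<^sub>R axis i 1)) has_vector_derivative G (x + s *\<^sub>R axis i 1)) (at s)" for x s
      unfolding F_def G_def by (intro has_vector_derivative_mult has_derivative_line g q)
    show "norm (G (x + s *\<^sub>R axis i 1)) \<le> indicator (cball 0 (r + 1)) x * C" if "\<bar>s\<bar> \<le> 1" for x s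
    proof (cases "x + s *\<^sub>R axis i 1 \<in> ?S")
      case True
      have "norm x \<le> norm (x + s *\<^sub>R axis i 1) + norm (s *\<^sub>R axis i (1::real))"
        using norm_triangle_ineq4[of "x + s *\<^sub>R axis i 1" "s *\<^sub>R axis i 1"] by simp
      also have "\<dots> \<le> r + 1" using r[OF True] that by (intro add_mono) (auto simp: norm_axis_1)
      finally show ?thesis using C(1) by simp
    next
      case False
      then show ?thesis using z[OF False] C(2) by (simp add: G_def)
    qed
  qed
  moreover have "(LINT x|lborel. G x) = (LINT x|lborel. g x * partial i q x) + (LINT x|lborel. partial i g x * q x)"
    unfolding G_def
    by (intro Bochner_Integration.integral_add integrable_compact_support[OF _ supp] continuous_intros gc qc g(2) q(2))
      (metis z(2) mult_zero_right, metis z(1) mult_zero_right)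
  ultimately show ?thesis by (simp add: eq_neg_iff_add_eq_0)
qed

lemma quadratic_form_sum: "(\<Sum>i\<in>UNIV. \<Sum>j\<in>UNIV. M $ i $ j * (y $ i * z $ j)) = y \<bullet> (M *v (z::real^'n))"
  by (simp add: inner_vec_def matrix_vector_mult_def sum_distrib_left mult_ac)

section \<open>The Gaussian weight and its plane waves\<close>

context fokker_planck
begin

definition gd :: "real^'n \<Rightarrow> real" where "gd x = exp (- (x \<bullet> (A *v x)) / 2)"

definition c0 :: real where "c0 = 1 / ((2 * pi) powr (real CARD('n) / 2) * sqrt (det Qi))"

lemma c0_pos: "c0 > 0" using det_Qi by (simp add: c0_def)

lemma rho_eq: "rho Q B x = c0 * gd x"
  by (simp add: rho_def c0_def gd_def inner_commute)

lemma gd_pos [simp]: "gd x > 0" by (simp add: gd_def)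

lemma gd_continuous: "continuous_on S gd"
  unfolding gd_def by (intro continuous_intros matrix_vector_mult_linear_continuous_on) auto

lemma gd_measurable [measurable]: "gd \<in> borel_measurable borel"
  by (rule borel_measurable_continuous_onI[OF gd_continuous])

text \<open>Since |x| \<le> k |Ki x|, the form of \<open>A\<close> dominates a multiple of |x|^2;
  the isotropic majorant suffices for all integrability questions.\<close>

lemma A_coercive: obtains a where "a > 0" "\<And>x. gd x \<le> exp (- a * (x \<bullet> x))"
proof -
  obtain k where k: "k > 0" "\<And>x. norm (K *v x) \<le> k * norm x"
    using linear_bounded_pos[of "(*v) K"] by auto
  have "x \<bullet> x \<le> k\<^sup>2 * (x \<bullet> (A *v x))" for x
  proof -
    have "norm x \<le> k * norm (Ki *v x)" using k(2)[of "Ki *v x"] by (simp only: Ki_K)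
    then have "(norm x)\<^sup>2 \<le> (k * norm (Ki *v x))\<^sup>2" by (intro power_mono) auto
    then show ?thesis unfolding inner_A by (simp add: power_mult_distrib power2_norm_eq_inner)
  qed
  then have "gd x \<le> exp (- (1 / (2 * k\<^sup>2)) * (x \<bullet> x))" for x
    unfolding gd_def using k(1) by (simp add: field_simps)
  then show thesis using k(1) by (intro that[of "1 / (2 * k\<^sup>2)"]) auto
qed

lemma gd_moment: "integrable lborel (\<lambda>x. (1 + norm x)\<^sup>2 * gd x)"
proof -
  obtain a where a: "a > 0" "\<And>x. gd x \<le> exp (- a * (x \<bullet> x))" by (rule A_coercive) blast
  show ?thesis
  proof (rule Bochner_Integration.integrable_bound[OF integrable_gaussian_moment[OF a(1)]])
    show "AE x in lborel. norm ((1 + norm x)\<^sup>2 * gd x) \<le> norm ((1 + norm x)\<^sup>2 * exp (- a * (x \<bullet> x)))"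
      using a(2) by (intro AE_I2) (auto simp: abs_mult less_imp_le intro!: mult_left_mono)
  qed (auto intro!: borel_measurable_continuous_onI continuous_intros gd_continuous)
qed

lemma gd_integrable: "integrable lborel gd"
proof (rule Bochner_Integration.integrable_bound[OF gd_moment])
  show "AE x in lborel. norm (gd x) \<le> norm ((1 + norm x)\<^sup>2 * gd x)"
  proof (intro AE_I2)
    fix x :: "real^'n"
    have "1 * gd x \<le> (1 + norm x)\<^sup>2 * gd x" by (intro mult_right_mono one_le_power) (auto simp: less_imp_le)
    then show "norm (gd x) \<le> norm ((1 + norm x)\<^sup>2 * gd x)" by (simp add: abs_mult less_imp_le)
  qed
qed auto

definition \<mu> :: "(real^'n) measure" where "\<mu> = density lborel (\<lambda>x. ennreal (gd x))"

abbreviation "W \<equiv> weighted_measure Q B"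

lemma sets_\<mu> [measurable_cong]: "sets \<mu> = sets borel" by (simp add: \<mu>_def)

lemma sets_W [measurable_cong]: "sets W = sets borel" by (simp add: weighted_measure_def)

lemma space_W [simp]: "space W = UNIV" by (simp add: weighted_measure_def)

sublocale mu: finite_borel_measure \<mu>
proof (intro finite_borel_measure.intro finite_measureI finite_borel_measure_axioms.intro)
  have "emeasure \<mu> (space \<mu>) = (\<integral>\<^sup>+x. ennreal (gd x) \<partial>lborel)"
    by (simp add: \<mu>_def emeasure_density)
  also have "\<dots> = ennreal (LINT x|lborel. gd x)"
    by (rule nn_integral_eq_integral[OF gd_integrable]) (simp add: less_imp_le)
  finally show "emeasure \<mu> (space \<mu>) \<noteq> \<infinity>" by simp
qed (rule sets_\<mu>)

text \<open>Since |\<gamma> f|^2 / \<rho> = \<gamma> |f|^2 / c0, division by \<open>gd\<close> is a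
  multiple of an isometry; it replaces the growing weight by the finite measure
  \<open>\<mu>\<close>.\<close>

lemma L2_weighted:
  fixes f :: "real^'n \<Rightarrow> complex"
  assumes f: "f \<in> borel_measurable borel"
  shows "(\<lambda>x. gd x * f x) \<in> L2_space W \<longleftrightarrow> f \<in> L2_space \<mu>"
    and "L2_norm W (\<lambda>x. gd x * f x) = sqrt (1 / c0) * L2_norm \<mu> f"
proof -
  note [measurable] = f
  have rm [measurable]: "(\<lambda>x. 1 / rho Q B x) \<in> borel_measurable borel" unfolding rho_eq by measurable
  have eq: "(cmod (gd x * f x))\<^sup>2 / rho Q B x = (gd x * (cmod (f x))\<^sup>2) / c0" for x
    using c0_pos gd_pos[of x] by (simp add: rho_eq norm_mult power_mult_distrib power2_eq_square field_simps)
  have r0: "0 \<le> rho Q B x" for x using c0_pos by (simp add: rho_eq less_imp_le)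
  have "integrable W (\<lambda>x. (cmod (gd x * f x))\<^sup>2) \<longleftrightarrow> integrable lborel (\<lambda>x. (gd x * (cmod (f x))\<^sup>2) / c0)"
    unfolding weighted_measure_def by (subst integrable_density) (auto simp: r0 eq)
  also have "\<dots> \<longleftrightarrow> integrable lborel (\<lambda>x. gd x * (cmod (f x))\<^sup>2)"
  proof
    assume "integrable lborel (\<lambda>x. (gd x * (cmod (f x))\<^sup>2) / c0)"
    then have "integrable lborel (\<lambda>x. c0 * ((gd x * (cmod (f x))\<^sup>2) / c0))" by (intro integrable_mult_right)
    then show "integrable lborel (\<lambda>x. gd x * (cmod (f x))\<^sup>2)" using c0_pos by simp
  qed (intro integrable_divide)
  also have "\<dots> \<longleftrightarrow> integrable \<mu> (\<lambda>x. (cmod (f x))\<^sup>2)"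
    unfolding \<mu>_def by (subst integrable_density) (auto simp: less_imp_le)
  finally show "(\<lambda>x. gd x * f x) \<in> L2_space W \<longleftrightarrow> f \<in> L2_space \<mu>"
    by (simp add: L2_space_def)
  have "(LINT x|W. (cmod (gd x * f x))\<^sup>2) = (LINT x|lborel. (gd x * (cmod (f x))\<^sup>2) / c0)"
    unfolding weighted_measure_def by (subst integral_density) (auto simp: r0 eq)
  also have "\<dots> = (1 / c0) * (LINT x|\<mu>. (cmod (f x))\<^sup>2)"
    unfolding \<mu>_def by (subst integral_density) (auto simp: less_imp_le)
  finally show "L2_norm W (\<lambda>x. gd x * f x) = sqrt (1 / c0) * L2_norm \<mu> f"
    unfolding L2_norm_def by (simp only: real_sqrt_mult)
qed

text \<open>With this amplitude the integral of \<open>psi w\<close> does not depend on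
  \<open>w\<close>, and the semigroup maps \<open>psi w\<close> to \<open>psi (wpath w t)\<close>
  without a further factor. The waves are the generating functions of Hermite polynomials at
  imaginary arguments.\<close>

definition wave :: "real^'n \<Rightarrow> real^'n \<Rightarrow> complex" where
  "wave w x = exp (complex_of_real (w \<bullet> (Qi *v w) / 2) + \<i> * complex_of_real (x \<bullet> w))"

definition psi :: "real^'n \<Rightarrow> real^'n \<Rightarrow> complex" where
  "psi w x = gd x * wave w x"

text \<open>The factor by which the Fokker-Planck operator acts on \<open>psi w\<close> at x. It
  depends on x, so \<open>psi w\<close> is in general no eigenfunction; the same factor reappears as
  the logarithmic time derivative along \<open>wpath\<close>.\<close>

definition symb :: "real^'n \<Rightarrow> real^'n \<Rightarrow> complex" where
  "symb w x = - complex_of_real (w \<bullet> (Q *v w) / 2) + \<i> * complex_of_real (x \<bullet> (A *v (B *v (Qi *v w))))"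

lemma wave_continuous: "continuous_on S (wave w)"
  unfolding wave_def by (intro continuous_intros)

lemma norm_wave: "cmod (wave w x) = exp (w \<bullet> (Qi *v w) / 2)"
  by (simp add: wave_def norm_exp_eq_Re)

lemma symb_continuous: "continuous_on S (symb w)"
  unfolding symb_def by (intro continuous_intros)

lemma wave_measurable [measurable]: "wave w \<in> borel_measurable borel"
  and symb_measurable [measurable]: "symb w \<in> borel_measurable borel"
  by (auto intro!: borel_measurable_continuous_onI wave_continuous symb_continuous)

lemma norm_symb_le: "cmod (symb w x) \<le> (\<bar>w \<bullet> (Q *v w)\<bar> / 2 + norm (A *v (B *v (Qi *v w)))) * (1 + norm x)"
proof -
  have "cmod (symb w x) \<le> \<bar>w \<bullet> (Q *v w)\<bar> / 2 + \<bar>x \<bullet> (A *v (B *v (Qi *v w)))\<bar>"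
    unfolding symb_def by (rule order_trans[OF norm_triangle_ineq]) (simp add: norm_mult)
  also have "\<dots> \<le> \<bar>w \<bullet> (Q *v w)\<bar> / 2 * (1 + norm x) + norm (A *v (B *v (Qi *v w))) * (1 + norm x)"
  proof (rule add_mono)
    show "\<bar>w \<bullet> (Q *v w)\<bar> / 2 \<le> \<bar>w \<bullet> (Q *v w)\<bar> / 2 * (1 + norm x)" by (simp add: distrib_left)
    show "\<bar>x \<bullet> (A *v (B *v (Qi *v w)))\<bar> \<le> norm (A *v (B *v (Qi *v w))) * (1 + norm x)"
    proof -
      have "norm x * norm (A *v (B *v (Qi *v w))) \<le> (1 + norm x) * norm (A *v (B *v (Qi *v w)))"
        by (intro mult_right_mono) auto
      with Cauchy_Schwarz_ineq2[of x "A *v (B *v (Qi *v w))"] show ?thesis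
        unfolding mult.commute[of "norm (A *v (B *v (Qi *v w)))"] by linarith
    qed
  qed
  finally show ?thesis by (simp only: distrib_right)
qed

lemma moment_L2: "integrable \<mu> (\<lambda>x. (C * (1 + norm x))\<^sup>2)"
proof -
  have "integrable lborel (\<lambda>x. C\<^sup>2 * ((1 + norm x)\<^sup>2 * gd x))" by (intro integrable_mult_right gd_moment)
  then show ?thesis
    unfolding \<mu>_def by (subst integrable_density) (auto simp: less_imp_le power_mult_distrib mult_ac)
qed

lemma psi_L2: "psi w \<in> L2_space W"
  unfolding psi_def[abs_def] L2_weighted(1)[OF wave_measurable]
  by (rule mu.bounded_L2(1)[of _ "exp (w \<bullet> (Qi *v w) / 2)"]) (auto simp: norm_wave)

lemma linear_growth_L2:
  assumes f: "f \<in> borel_measurable borel" and le: "\<And>x. cmod (f x) \<le> C * (1 + norm x)"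
  shows "f \<in> L2_space \<mu>"
proof -
  have fm: "f \<in> borel_measurable \<mu>" using f by (simp add: measurable_cong_sets[OF sets_\<mu> refl])
  have "integrable \<mu> (\<lambda>x. (cmod (f x))\<^sup>2)"
    by (rule Bochner_Integration.integrable_bound[OF moment_L2[of C]]) (use fm le in \<open>auto intro!: AE_I2 power_mono\<close>)
  with fm show ?thesis by (simp add: L2_space_def)
qed

lemma symb_psi_L2: "(\<lambda>x. symb w x * psi w x) \<in> L2_space W"
proof -
  let ?C = "(\<bar>w \<bullet> (Q *v w)\<bar> / 2 + norm (A *v (B *v (Qi *v w)))) * exp (w \<bullet> (Qi *v w) / 2)"
  have "cmod (symb w x * wave w x) \<le> ?C * (1 + norm x)" for x
    using mult_right_mono[OF norm_symb_le[of w x], of "exp (w \<bullet> (Qi *v w) / 2)"]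
    by (simp add: norm_mult norm_wave mult_ac)
  then have "(\<lambda>x. symb w x * wave w x) \<in> L2_space \<mu>" by (intro linear_growth_L2) auto
  then have "(\<lambda>x. gd x * (symb w x * wave w x)) \<in> L2_space W" by (subst L2_weighted(1)) auto
  then show ?thesis by (simp add: psi_def mult_ac)
qed

text \<open>The logarithmic derivative of \<open>psi w\<close> in the i-th coordinate.\<close>

definition slope :: "real^'n \<Rightarrow> 'n \<Rightarrow> real^'n \<Rightarrow> complex" where
  "slope w i x = \<i> * complex_of_real (w $ i) - complex_of_real ((A *v x) $ i)"

lemma psi_has_derivative:
  "(psi w has_derivative (\<lambda>v. (\<i> * complex_of_real (w \<bullet> v) - complex_of_real ((A *v x) \<bullet> v)) * psi w x)) (at x)"
proof -
  have psi: "psi w = (\<lambda>x. exp (complex_of_real (w \<bullet> (Qi *v w) / 2 - (x \<bullet> (A *v x)) / 2) + \<i> * complex_of_real (x \<bullet> w)))"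
    unfolding psi_def[abs_def] wave_def gd_def exp_of_real[symmetric] exp_add[symmetric] by (simp add: algebra_simps)
  have q: "((\<lambda>x. x \<bullet> (A *v x)) has_derivative (\<lambda>v. x \<bullet> (A *v v) + v \<bullet> (A *v x))) (at x)"
    by (intro has_derivative_inner has_derivative_ident bounded_linear_imp_has_derivative matrix_vector_mul_bounded_linear)
  have sy: "x \<bullet> (A *v v) = (A *v x) \<bullet> v" for v using symmetric_matrix_inner[OF A_sym] by metis
  have d1: "((\<lambda>x. w \<bullet> (Qi *v w) / 2 - (x \<bullet> (A *v x)) / 2) has_derivative (\<lambda>v. - ((A *v x) \<bullet> v))) (at x)"
    by (rule has_derivative_eq_rhs[OF has_derivative_diff[OF has_derivative_const
          bounded_linear.has_derivative[OF bounded_linear_divide q]]]) (simp add: sy inner_commute fun_eq_iff)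
  have d2: "((\<lambda>x. x \<bullet> w) has_derivative (\<lambda>v. w \<bullet> v)) (at x)"
    by (rule has_derivative_eq_rhs[OF has_derivative_inner_left[OF has_derivative_ident]]) (simp add: inner_commute)
  have "((\<lambda>x. complex_of_real (w \<bullet> (Qi *v w) / 2 - (x \<bullet> (A *v x)) / 2) + \<i> * complex_of_real (x \<bullet> w)) has_derivative
      (\<lambda>v. complex_of_real (- ((A *v x) \<bullet> v)) + \<i> * complex_of_real (w \<bullet> v))) (at x)"
    by (intro has_derivative_add has_derivative_mult_right has_derivative_of_real d1 d2)
  from has_derivative_compose[OF this DERIV_exp[THEN has_field_derivative_imp_has_derivative]]
  show ?thesis
    unfolding psi by (rule has_derivative_eq_rhs) (simp add: fun_eq_iff algebra_simps)
qed

lemma psi_partial: "partial i (psi w) x = slope w i x * psi w x"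
  using partial_eq[OF psi_has_derivative] by (simp add: slope_def inner_axis)

lemma psi_differentiable: "psi w differentiable_on UNIV"
  using psi_has_derivative by (auto simp: differentiable_on_def differentiable_def intro: has_derivative_at_withinI)

lemma slope_has_derivative: "(slope w i has_derivative (\<lambda>v. - complex_of_real ((A *v v) $ i))) (at x)"
  unfolding slope_def
  by (auto intro!: derivative_eq_intros bounded_linear_imp_has_derivative
      bounded_linear_compose[OF bounded_linear_of_real] bounded_linear_compose[OF bounded_linear_vec_nth] matrix_vector_mul_bounded_linear)

lemma slope_continuous: "continuous_on S (slope w i)"
  using slope_has_derivative by (intro continuous_at_imp_continuous_on ballI has_derivative_continuous)

lemma psi_continuous: "continuous_on S (psi w)"
  using psi_has_derivative by (intro continuous_at_imp_continuous_on ballI has_derivative_continuous)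

lemma slope_psi_has_derivative:
  "((\<lambda>x. slope w i x * psi w x) has_derivative
     (\<lambda>v. slope w i x * ((\<i> * complex_of_real (w \<bullet> v) - complex_of_real ((A *v x) \<bullet> v)) * psi w x) + - complex_of_real ((A *v v) $ i) * psi w x)) (at x)"
  by (rule has_derivative_mult[OF slope_has_derivative psi_has_derivative])

lemma slope_psi_partial:
  "partial j (\<lambda>x. slope w i x * psi w x) x = (slope w i x * slope w j x - complex_of_real (A $ i $ j)) * psi w x"
  unfolding partial_eq[OF slope_psi_has_derivative]
  by (simp add: slope_def inner_axis matrix_vector_mult_basis column_def algebra_simps)

text \<open>With y = A x the Lyapunov equation gives y.(Q y) = -2 (B x).y and Tr(Q A) = -2 Tr B.
  Hence the terms quadratic in x and the trace cancel, and what remains is affine in x.\<close>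

lemma symbol_identity:
  "1/2 * (\<Sum>i\<in>UNIV. \<Sum>j\<in>UNIV. complex_of_real (Q $ i $ j) * (slope w i x * slope w j x - complex_of_real (A $ i $ j)))
    - (\<Sum>i\<in>UNIV. complex_of_real ((B *v x) $ i) * slope w i x) - complex_of_real (trace B) = symb w x"
proof -
  let ?y = "A *v x"
  have Qy: "Q *v v = - (B *v (Qi *v v)) - Qi *v (transpose B *v v)" for v
  proof -
    have "(- Q) *v v = - (Q *v v)" by (simp add: matrix_vector_mult_def vec_eq_iff sum_negf)
    moreover have "(- Q) *v v = B *v (Qi *v v) + Qi *v (transpose B *v v)"
      by (simp only: lyapunov[symmetric] matrix_vector_mult_add_rdistrib matrix_vector_mul_assoc)
    ultimately have e: "- (Q *v v) = B *v (Qi *v v) + Qi *v (transpose B *v v)" by (simp only:)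
    have "Q *v v = - (- (Q *v v))" by (rule minus_minus[symmetric])
    then show ?thesis unfolding e minus_add_distrib by (simp only: diff_conv_add_uminus)
  qed
  have Qiy: "Qi *v ?y = x" by (simp only: matrix_vector_mul_assoc A_Qi matrix_vector_mul_lid)
  have Bt: "u \<bullet> (transpose B *v v) = (B *v u) \<bullet> v" for u v
    by (metis dot_lmul_matrix inner_commute transpose_matrix_vector)
  have Qis: "u \<bullet> (Qi *v v) = (Qi *v u) \<bullet> v" for u v using symmetric_matrix_inner[OF sym_Qi] by metis
  have As: "u \<bullet> (A *v v) = (A *v u) \<bullet> v" for u v using symmetric_matrix_inner[OF A_sym] by metis
  have 1: "?y \<bullet> (Q *v ?y) = - 2 * ((B *v x) \<bullet> ?y)"
    unfolding Qy Qiy inner_diff_right inner_minus_right Qis Bt by (simp add: inner_commute Qiy)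
  have xw: "x \<bullet> (A *v (B *v (Qi *v w))) = w \<bullet> (Qi *v (transpose B *v ?y))"
    by (simp only: Qis As Bt inner_commute[of ?y])
  have 2: "w \<bullet> (Q *v ?y) = - ((B *v x) \<bullet> w) - x \<bullet> (A *v (B *v (Qi *v w)))"
    unfolding Qy Qiy xw by (simp add: inner_diff_right inner_commute)
  have 3: "?y \<bullet> (Q *v w) = w \<bullet> (Q *v ?y)"
    using symmetric_matrix_inner[OF sym_Q, of ?y w] by (simp add: inner_commute)
  have tr: "(\<Sum>i\<in>UNIV. \<Sum>j\<in>UNIV. Q $ i $ j * A $ i $ j) = - 2 * trace B"
  proof -
    have "A $ i $ j = transpose A $ j $ i" for i j by (simp add: transpose_def)
    then have "A $ i $ j = A $ j $ i" for i j by (simp only: A_sym)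
    then have "(\<Sum>i\<in>UNIV. \<Sum>j\<in>UNIV. Q $ i $ j * A $ i $ j) = trace (Q ** A)"
      by (simp add: trace_def matrix_matrix_mult_def)
    also have "Q ** A = - ((B ** Qi) ** A + (Qi ** transpose B) ** A)"
    proof -
      have "Q = - (B ** Qi + Qi ** transpose B)" using lyapunov by simp
      then have "Q ** A = (- (B ** Qi + Qi ** transpose B)) ** A" by (rule arg_cong)
      then show ?thesis
        by (simp only: bounded_bilinear.minus_left[OF bounded_bilinear_matrix_mul] bounded_bilinear.add_left[OF bounded_bilinear_matrix_mul])
    qed
    also have "trace \<dots> = - (trace ((B ** Qi) ** A) + trace ((Qi ** transpose B) ** A))"
    proof -
      have "trace (- (X + Y)) = - (trace X + trace Y)" for X Y :: "real^'n^'n"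
        by (simp add: trace_def sum.distrib[symmetric] sum_negf[symmetric])
      then show ?thesis by blast
    qed
    also have "(B ** Qi) ** A = B" by (simp only: matrix_mul_assoc[symmetric] A_Qi matrix_mul_rid)
    also have "trace ((Qi ** transpose B) ** A) = trace (A ** (Qi ** transpose B))" by (rule trace_mul_sym)
    also have "A ** (Qi ** transpose B) = transpose B" by (simp only: matrix_mul_assoc A_Qi matrix_mul_lid)
    also have "trace (transpose B) = trace B" by (simp add: trace_def transpose_def)
    finally show ?thesis by simp
  qed
  have exp1: "complex_of_real (Q $ i $ j) * (slope w i x * slope w j x - complex_of_real (A $ i $ j)) =
      complex_of_real (Q $ i $ j * (?y $ i * ?y $ j) - Q $ i $ j * (w $ i * w $ j) - Q $ i $ j * A $ i $ j)
      - \<i> * complex_of_real (Q $ i $ j * (w $ i * ?y $ j) + Q $ i $ j * (?y $ i * w $ j))" for i j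
    by (simp add: slope_def complex_eq_iff algebra_simps)
  have "(\<Sum>i\<in>UNIV. \<Sum>j\<in>UNIV. complex_of_real (Q $ i $ j) * (slope w i x * slope w j x - complex_of_real (A $ i $ j))) =
     complex_of_real (?y \<bullet> (Q *v ?y) - w \<bullet> (Q *v w) + 2 * trace B) - \<i> * complex_of_real (w \<bullet> (Q *v ?y) + ?y \<bullet> (Q *v w))"
    unfolding exp1 sum_subtractf sum_distrib_left[symmetric] of_real_sum[symmetric] sum.distrib quadratic_form_sum tr by simp
  moreover have "(\<Sum>i\<in>UNIV. complex_of_real ((B *v x) $ i) * slope w i x) =
      \<i> * complex_of_real ((B *v x) \<bullet> w) - complex_of_real ((B *v x) \<bullet> ?y)"
    by (simp add: slope_def inner_vec_def right_diff_distrib sum_subtractf sum_distrib_left mult_ac)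
  ultimately show ?thesis
    unfolding symb_def 1 3 2 by (simp add: complex_eq_iff algebra_simps)
qed

text \<open>All derivatives are moved back from the test function to the smooth function
  \<open>psi w\<close>, where \<open>symbol_identity\<close> applies. As the function and its image
  both lie in the weighted space, \<open>psi w\<close> is in the maximal domain.\<close>

lemma psi_fokker_planck: "(psi w, \<lambda>x. symb w x * psi w x) \<in> fokker_planck_operator Q B"
  unfolding fokker_planck_operator_def
proof (intro CollectI case_prodI conjI ballI psi_L2 symb_psi_L2)
  fix \<phi> :: "real^'n \<Rightarrow> complex" assume "\<phi> \<in> test_functions"
  then have cd: "\<And>k. continuously_differentiable k \<phi>" and supp: "compact (closure {x. \<phi> x \<noteq> 0})"
    by (auto simp: test_functions_def)
  let ?S = "closure {x. \<phi> x \<noteq> 0}"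
  have d: "\<phi> differentiable_on UNIV" "continuous_on UNIV (partial i \<phi>)"
    "partial i \<phi> differentiable_on UNIV" "continuous_on UNIV (partial j (partial i \<phi>))" for i j
    using cd[of "Suc 0"] cd[of "Suc (Suc 0)"] by auto
  have \<phi>c: "continuous_on UNIV \<phi>" using d(1) by (rule differentiable_imp_continuous_on)
  have z: "\<phi> x = 0" if "x \<notin> ?S" for x using that closure_subset[of "{x. \<phi> x \<noteq> 0}"] by auto
  have supp': "compact (closure {x. partial i \<phi> x \<noteq> 0})" for i
  proof -
    have "{x. partial i \<phi> x \<noteq> 0} \<subseteq> ?S" using partial_support[of _ \<phi> i] by blast
    then show ?thesis unfolding compact_closure by (rule bounded_subset[OF compact_imp_bounded[OF supp]])
  qed
  let ?u = "regular_distribution (psi w)"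
  have int: "integrable lborel (\<lambda>x. f x * psi w x * \<phi> x)" if "continuous_on UNIV f" for f
  proof (rule integrable_compact_support[OF _ supp])
    show "continuous_on UNIV (\<lambda>x. f x * psi w x * \<phi> x)" by (intro continuous_intros that psi_continuous \<phi>c)
    show "f x * psi w x * \<phi> x = 0" if "x \<notin> ?S" for x using z[OF that] by simp
  qed
  have sd: "(\<lambda>x. slope w i x * psi w x) differentiable_on UNIV" for i
    using slope_psi_has_derivative by (auto simp: differentiable_on_def differentiable_def intro: has_derivative_at_withinI)
  have second: "dist_partial j (dist_partial i ?u) \<phi> =
      (LINT x|lborel. (slope w i x * slope w j x - complex_of_real (A $ i $ j)) * psi w x * \<phi> x)" for i j
  proof -
    have "dist_partial j (dist_partial i ?u) \<phi> = (LINT x|lborel. psi w x * partial i (partial j \<phi>) x)"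
      by (simp add: dist_partial_def regular_distribution_def)
    also have "\<dots> = - (LINT x|lborel. partial i (psi w) x * partial j \<phi> x)"
      by (rule integration_by_parts_compact_support[OF psi_differentiable _ d(3,4) supp'])
        (auto simp: psi_partial intro!: continuous_intros slope_continuous psi_continuous)
    also have "\<dots> = - (LINT x|lborel. (slope w i x * psi w x) * partial j \<phi> x)" by (simp add: psi_partial)
    also have "\<dots> = (LINT x|lborel. partial j (\<lambda>x. slope w i x * psi w x) x * \<phi> x)"
      by (subst integration_by_parts_compact_support[OF sd _ d(1,2) supp])
        (auto simp: slope_psi_partial intro!: continuous_intros slope_continuous psi_continuous)
    finally show ?thesis by (simp add: slope_psi_partial)
  qed
  \<comment> \<open>In the distribution the coefficient multiplies the test function and is
    differentiated together with it; integration by parts against this product leaves a derivative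
    of \<open>psi w\<close> only.\<close>
  have first: "dist_mult (\<lambda>x. (B *v x) $ i) (dist_partial i ?u) \<phi> =
      (LINT x|lborel. (complex_of_real ((B *v x) $ i) * slope w i x) * psi w x * \<phi> x)" for i
  proof -
    let ?b = "\<lambda>x. complex_of_real ((B *v x) $ i)"
    have bd: "(?b has_derivative ?b) (at x)" for x
      by (intro bounded_linear_imp_has_derivative bounded_linear_compose[OF bounded_linear_of_real]
          bounded_linear_compose[OF bounded_linear_vec_nth] matrix_vector_mul_bounded_linear)
    have bc: "continuous_on UNIV ?b" using bd by (intro continuous_at_imp_continuous_on ballI has_derivative_continuous)
    have pd: "((\<lambda>x. ?b x * \<phi> x) has_derivative (\<lambda>v. ?b x * frechet_derivative \<phi> (at x) v + ?b v * \<phi> x)) (at x)" for x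
      using d(1) by (intro has_derivative_mult bd) (simp add: differentiable_on_def frechet_derivative_works)
    have pp: "partial i (\<lambda>x. ?b x * \<phi> x) = (\<lambda>x. ?b x * partial i \<phi> x + ?b (axis i 1) * \<phi> x)"
      by (rule ext, subst partial_eq[OF pd]) (simp add: partial_def)
    have "{x. ?b x * \<phi> x \<noteq> 0} \<subseteq> {x. \<phi> x \<noteq> 0}" by auto
    then have cs: "compact (closure {x. ?b x * \<phi> x \<noteq> 0})"
      using supp unfolding compact_closure by (rule bounded_subset[rotated])
    have "dist_mult (\<lambda>x. (B *v x) $ i) (dist_partial i ?u) \<phi> = - (LINT x|lborel. psi w x * partial i (\<lambda>x. ?b x * \<phi> x) x)"
      by (simp add: dist_mult_def dist_partial_def regular_distribution_def)
    also have "\<dots> = (LINT x|lborel. partial i (psi w) x * (?b x * \<phi> x))"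
    proof (subst integration_by_parts_compact_support[OF psi_differentiable _ _ _ cs])
      show "(\<lambda>x. ?b x * \<phi> x) differentiable_on UNIV"
        using pd by (auto simp: differentiable_on_def differentiable_def intro: has_derivative_at_withinI)
      show "continuous_on UNIV (partial i (\<lambda>x. ?b x * \<phi> x))"
        unfolding pp by (intro continuous_intros bc d(2) \<phi>c)
      show "continuous_on UNIV (partial i (psi w))"
        by (auto simp: psi_partial intro!: continuous_intros slope_continuous psi_continuous)
    qed simp
    finally show ?thesis by (simp add: psi_partial mult_ac)
  qed
  let ?s2 = "\<lambda>i j x. slope w i x * slope w j x - complex_of_real (A $ i $ j)"
  let ?s1 = "\<lambda>i x. complex_of_real ((B *v x) $ i) * slope w i x"
  have c2: "continuous_on UNIV (?s2 i j)" for i j by (intro continuous_intros slope_continuous)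
  have c1: "continuous_on UNIV (?s1 i)" for i
    by (intro continuous_intros slope_continuous matrix_vector_mult_linear_continuous_on)
  have tr: "trace (complex_matrix Q ** (\<chi> i j. dist_partial i (dist_partial j ?u) \<phi>)) =
      (LINT x|lborel. (\<Sum>i\<in>UNIV. \<Sum>j\<in>UNIV. complex_of_real (Q $ i $ j) * (?s2 i j x * psi w x * \<phi> x)))"
    by (simp add: trace_def matrix_matrix_mult_def complex_matrix_def second int[OF c2] integrable_mult_right
        Bochner_Integration.integral_sum Bochner_Integration.integrable_sum)
  have "fokker_planck_dist Q B ?u \<phi> = (LINT x|lborel.
      1/2 * (\<Sum>i\<in>UNIV. \<Sum>j\<in>UNIV. complex_of_real (Q $ i $ j) * (?s2 i j x * psi w x * \<phi> x))
      - (\<Sum>i\<in>UNIV. ?s1 i x * psi w x * \<phi> x) - complex_of_real (trace B) * (psi w x * \<phi> x))"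
    unfolding fokker_planck_dist_def tr first regular_distribution_def
    using int[of "\<lambda>x. 1"]
    by (simp add: int[OF c2] int[OF c1] integrable_mult_right
        Bochner_Integration.integral_sum Bochner_Integration.integrable_sum Bochner_Integration.integral_diff Bochner_Integration.integrable_diff)
  also have "\<dots> = (LINT x|lborel. symb w x * psi w x * \<phi> x)"
  proof (rule Bochner_Integration.integral_cong[OF refl])
    fix x
    show "1/2 * (\<Sum>i\<in>UNIV. \<Sum>j\<in>UNIV. complex_of_real (Q $ i $ j) * (?s2 i j x * psi w x * \<phi> x))
      - (\<Sum>i\<in>UNIV. ?s1 i x * psi w x * \<phi> x) - complex_of_real (trace B) * (psi w x * \<phi> x) = symb w x * psi w x * \<phi> x"
    proof -
      have a: "(\<Sum>i\<in>UNIV. \<Sum>j\<in>UNIV. complex_of_real (Q $ i $ j) * (?s2 i j x * psi w x * \<phi> x))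
          = (\<Sum>i\<in>UNIV. \<Sum>j\<in>UNIV. complex_of_real (Q $ i $ j) * ?s2 i j x) * (psi w x * \<phi> x)"
        by (simp only: sum_distrib_right mult.assoc)
      have b: "(\<Sum>i\<in>UNIV. ?s1 i x * psi w x * \<phi> x) = (\<Sum>i\<in>UNIV. ?s1 i x) * (psi w x * \<phi> x)"
        by (simp only: sum_distrib_right mult.assoc)
      show ?thesis
        unfolding symbol_identity[symmetric, of w x] a b by (simp only: left_diff_distrib mult.assoc)
    qed
  qed
  finally show "fokker_planck_dist Q B ?u \<phi> = regular_distribution (\<lambda>x. symb w x * psi w x) \<phi>"
    by (simp add: regular_distribution_def)
qed

end

section \<open>Action of the semigroup on waves\<close>

text \<open>The limit and the uniform bound are the two inputs of dominated convergence, for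
  derivatives under an integral and for derivatives in an L2 norm.\<close>

lemma difference_quotient_limit:
  fixes g :: "real \<Rightarrow> complex"
  assumes g: "\<And>s. (g has_vector_derivative g' s) (at s)" and bd: "\<And>s. \<bar>s - s0\<bar> \<le> 1 \<Longrightarrow> cmod (g' s) \<le> c"
    and h: "h \<longlonglongrightarrow> 0" "\<And>n. h n \<noteq> 0" "\<And>n. \<bar>h n\<bar> \<le> 1"
  shows "(\<lambda>n. (g (s0 + h n) - g s0) / complex_of_real (h n)) \<longlonglongrightarrow> g' s0"
    and "cmod ((g (s0 + h n) - g s0) / complex_of_real (h n)) \<le> c"
proof -
  have hlim: "filterlim h (at 0) sequentially" unfolding filterlim_at using h by auto
  have "((\<lambda>k. norm (g (s0 + k) - g s0 - k *\<^sub>R g' s0) / norm k) \<longlongrightarrow> 0) (at 0)"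
    using g[of s0] unfolding has_vector_derivative_def has_derivative_at by blast
  from filterlim_compose[OF this hlim]
  have "(\<lambda>n. norm (g (s0 + h n) - g s0 - h n *\<^sub>R g' s0) / norm (h n)) \<longlonglongrightarrow> 0" .
  moreover have "norm (g (s0 + h n) - g s0 - h n *\<^sub>R g' s0) / norm (h n)
      = norm ((g (s0 + h n) - g s0) / complex_of_real (h n) - g' s0)" for n
  proof -
    have "(g (s0 + h n) - g s0) / complex_of_real (h n) - g' s0 = (g (s0 + h n) - g s0 - h n *\<^sub>R g' s0) / complex_of_real (h n)"
      using h(2)[of n] by (simp add: diff_divide_distrib scaleR_conv_of_real)
    then show ?thesis by (simp add: norm_divide)
  qed
  ultimately have "(\<lambda>n. norm ((g (s0 + h n) - g s0) / complex_of_real (h n) - g' s0)) \<longlonglongrightarrow> 0" by simp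
  then show "(\<lambda>n. (g (s0 + h n) - g s0) / complex_of_real (h n)) \<longlonglongrightarrow> g' s0"
    by (rule LIM_zero_cancel[OF tendsto_norm_zero_cancel])
  let ?I = "closed_segment s0 (s0 + h n)"
  have I: "\<bar>s - s0\<bar> \<le> 1" if "s \<in> ?I" for s
    using that h(3)[of n] unfolding closed_segment_eq_real_ivl by (auto split: if_splits)
  have "norm (g (s0 + h n) - g s0) \<le> c * norm (s0 + h n - s0)"
  proof (rule differentiable_bound[of ?I g "\<lambda>s k. k *\<^sub>R g' s"])
    show "(g has_derivative (\<lambda>k. k *\<^sub>R g' s)) (at s within ?I)" for s
      using g[of s] unfolding has_vector_derivative_def by (rule has_derivative_at_withinI)
    show "onorm (\<lambda>k. k *\<^sub>R g' s) \<le> c" if "s \<in> ?I" for s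
      using bd[OF I[OF that]] by (intro onorm_le) (simp add: mult.commute[of c] mult_left_mono)
  qed auto
  then show "cmod ((g (s0 + h n) - g s0) / complex_of_real (h n)) \<le> c"
    using h(2)[of n] by (simp add: norm_divide divide_le_eq)
qed

text \<open>Dominated convergence runs along sequences, and steps of length at most 1 suffice;
  majorants are then required only near the base point.\<close>

lemma tendsto_at_0_sequentiallyI:
  fixes f :: "real \<Rightarrow> 'b::topological_space"
  assumes "\<And>h. h \<longlonglongrightarrow> 0 \<Longrightarrow> (\<And>n. h n \<noteq> 0) \<Longrightarrow> (\<And>n. \<bar>h n\<bar> \<le> 1) \<Longrightarrow> (\<lambda>n::nat. f (h n)) \<longlonglongrightarrow> l"
  shows "(f \<longlongrightarrow> l) (at 0)"
  unfolding tendsto_at_iff_sequentially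
proof (intro allI impI)
  fix X :: "nat \<Rightarrow> real" assume X: "\<forall>i. X i \<in> UNIV - {0}" "X \<longlonglongrightarrow> 0"
  have "eventually (\<lambda>n. \<bar>X n\<bar> < 1) sequentially"
    using tendstoD[OF X(2), of 1] by simp
  then obtain N where N: "\<And>n. n \<ge> N \<Longrightarrow> \<bar>X n\<bar> < 1" unfolding eventually_sequentially by blast
  have "(\<lambda>n. f (X (n + N))) \<longlonglongrightarrow> l"
    by (rule assms) (use X N in \<open>auto simp: LIMSEQ_ignore_initial_segment less_imp_le\<close>)
  then have "(\<lambda>n. f (X n)) \<longlonglongrightarrow> l" by (rule LIMSEQ_offset)
  then show "(f \<circ> X) \<longlonglongrightarrow> l" by (simp add: o_def)
qed

lemma has_vector_derivative_integral:
  fixes f f' :: "real \<Rightarrow> 'a \<Rightarrow> complex"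
  assumes f: "\<And>s. integrable M (f s)" and der: "\<And>s x. ((\<lambda>s. f s x) has_vector_derivative f' s x) (at s)"
    and w: "integrable M w" and bd: "\<And>s x. \<bar>s - s0\<bar> \<le> 1 \<Longrightarrow> cmod (f' s x) \<le> w x"
    and f': "f' s0 \<in> borel_measurable M"
  shows "((\<lambda>s. LINT x|M. f s x) has_vector_derivative (LINT x|M. f' s0 x)) (at s0)"
proof -
  let ?F = "\<lambda>s. LINT x|M. f s x"
  have "((\<lambda>h. (?F (s0 + h) - ?F s0) / complex_of_real h) \<longlongrightarrow> (LINT x|M. f' s0 x)) (at 0)"
  proof (rule tendsto_at_0_sequentiallyI)
    fix h :: "nat \<Rightarrow> real" assume h: "h \<longlonglongrightarrow> 0" "\<And>n. h n \<noteq> 0" "\<And>n. \<bar>h n\<bar> \<le> 1"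
    note q = difference_quotient_limit[OF der bd h]
    have "(\<lambda>n. LINT x|M. (f (s0 + h n) x - f s0 x) / complex_of_real (h n)) \<longlonglongrightarrow> (LINT x|M. f' s0 x)"
    proof (rule integral_dominated_convergence[OF f' _ w])
      show "(\<lambda>x. (f (s0 + h n) x - f s0 x) / complex_of_real (h n)) \<in> borel_measurable M" for n
        using borel_measurable_integrable[OF f] by measurable
      show "AE x in M. (\<lambda>n. (f (s0 + h n) x - f s0 x) / complex_of_real (h n)) \<longlonglongrightarrow> f' s0 x"
        by (rule AE_I2) (rule q(1))
      show "AE x in M. norm ((f (s0 + h n) x - f s0 x) / complex_of_real (h n)) \<le> w x" for n
        by (rule AE_I2) (rule q(2))
    qed
    moreover have "(LINT x|M. (f (s0 + h n) x - f s0 x) / complex_of_real (h n)) = (?F (s0 + h n) - ?F s0) / complex_of_real (h n)" for n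
      by (simp only: integral_divide_zero Bochner_Integration.integral_diff[OF f f])
    ultimately show "(\<lambda>n. (?F (s0 + h n) - ?F s0) / complex_of_real (h n)) \<longlonglongrightarrow> (LINT x|M. f' s0 x)" by (simp only:)
  qed
  then have lim0: "((\<lambda>h. norm ((?F (s0 + h) - ?F s0) / complex_of_real h - (LINT x|M. f' s0 x))) \<longlongrightarrow> 0) (at 0)"
    by (intro tendsto_norm_zero LIM_zero)
  have eq: "norm ((?F (s0 + h) - ?F s0) / complex_of_real h - (LINT x|M. f' s0 x))
      = norm (?F (s0 + h) - ?F s0 - h *\<^sub>R (LINT x|M. f' s0 x)) / norm h" if "h \<noteq> 0" for h
  proof -
    have "(?F (s0 + h) - ?F s0) / complex_of_real h - (LINT x|M. f' s0 x) = (?F (s0 + h) - ?F s0 - h *\<^sub>R (LINT x|M. f' s0 x)) / complex_of_real h"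
      using that by (simp add: diff_divide_distrib scaleR_conv_of_real)
    then show ?thesis by (simp add: norm_divide)
  qed
  have "((\<lambda>h. norm (?F (s0 + h) - ?F s0 - h *\<^sub>R (LINT x|M. f' s0 x)) / norm h) \<longlongrightarrow> 0) (at 0)"
    by (rule Lim_transform_eventually[OF lim0]) (use eq in \<open>auto simp: eventually_at intro!: exI[of _ 1]\<close>)
  then show ?thesis
    unfolding has_vector_derivative_def has_derivative_at by (simp add: bounded_linear_scaleR_left)
qed

context fokker_planck
begin

text \<open>The flow of the linear equation w' = A B Qi w. It is the motion of the frequency for
  which the time derivative of the wave is \<open>symb\<close> times the wave.\<close>

definition wpath :: "real^'n \<Rightarrow> real \<Rightarrow> real^'n" where
  "wpath w s = A *v (E s *v (Qi *v w))"

lemma Qi_A [simp]: "Qi *v (A *v x) = x" "A *v (Qi *v x) = x"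
  by (simp_all only: matrix_vector_mul_assoc A_Qi matrix_vector_mul_lid)

lemma wpath_0: "wpath w 0 = w"
proof -
  have "E 0 *v (Qi *v w) = Qi *v w" by (simp only: matrix_exp_0 matrix_vector_mul_lid)
  then show ?thesis unfolding wpath_def by (simp only: Qi_A)
qed

lemma wpath_deriv: "(wpath w has_vector_derivative A *v (B *v (Qi *v wpath w s))) (at s)"
proof -
  have "wpath w = (\<lambda>x. A *v (E x *v (Qi *v w)))" by (simp add: wpath_def fun_eq_iff)
  then show ?thesis
    using bounded_linear.has_vector_derivative[OF matrix_vector_mul_bounded_linear[of A] matrix_exp_vector_deriv[of B "Qi *v w" s]]
    by (simp only: Qi_A)
qed

text \<open>The symmetrised Lyapunov equation; it identifies the derivative of the amplitude
  exponent with the real part of \<open>symb\<close>.\<close>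

lemma inner_B_Qi: "v \<bullet> (B *v (Qi *v v)) = - (v \<bullet> (Q *v v)) / 2"
proof -
  have "v \<bullet> ((B ** Qi) *v v) + v \<bullet> ((Qi ** transpose B) *v v) = v \<bullet> ((- Q) *v v)"
    by (simp only: lyapunov[symmetric] matrix_vector_mult_add_rdistrib inner_add_right)
  moreover have "v \<bullet> ((Qi ** transpose B) *v v) = v \<bullet> ((B ** Qi) *v v)"
  proof -
    have "v \<bullet> ((Qi ** transpose B) *v v) = (transpose (Qi ** transpose B) *v v) \<bullet> v"
      by (simp only: transpose_matrix_vector dot_lmul_matrix)
    also have "transpose (Qi ** transpose B) = B ** Qi" by (simp only: matrix_transpose_mul sym_Qi transpose_transpose)
    finally show ?thesis by (simp only: inner_commute)
  qed
  moreover have "v \<bullet> ((- Q) *v v) = - (v \<bullet> (Q *v v))"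
    by (simp add: matrix_vector_mult_def inner_vec_def sum_negf)
  ultimately have "2 * (v \<bullet> ((B ** Qi) *v v)) = - (v \<bullet> (Q *v v))" by linarith
  then show ?thesis by (simp add: matrix_vector_mul_assoc)
qed

lemma wave_chain:
  assumes p: "(p has_vector_derivative p') (at s)"
  shows "((\<lambda>s. wave (p s) x) has_vector_derivative
    (complex_of_real (p s \<bullet> (Qi *v p')) + \<i> * complex_of_real (x \<bullet> p')) * wave (p s) x) (at s)"
proof -
  have 1: "((\<lambda>s. Qi *v p s) has_vector_derivative Qi *v p') (at s)"
    by (rule bounded_linear.has_vector_derivative[OF matrix_vector_mul_bounded_linear p])
  have e1: "p' \<bullet> (Qi *v p s) = p s \<bullet> (Qi *v p')" using symmetric_matrix_inner[OF sym_Qi] by (metis inner_commute)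
  have 2: "((\<lambda>s. p s \<bullet> (Qi *v p s) / 2) has_vector_derivative p s \<bullet> (Qi *v p')) (at s)"
    using bounded_linear.has_vector_derivative[OF bounded_linear_divide
        bounded_bilinear.has_vector_derivative[OF bounded_bilinear_inner p 1], of 2] by (simp add: e1)
  have 3: "((\<lambda>s. x \<bullet> p s) has_vector_derivative x \<bullet> p') (at s)"
    by (rule bounded_linear.has_vector_derivative[OF bounded_linear_inner_right p])
  have "((\<lambda>s. complex_of_real (p s \<bullet> (Qi *v p s) / 2) + \<i> * complex_of_real (x \<bullet> p s)) has_vector_derivative
      complex_of_real (p s \<bullet> (Qi *v p')) + \<i> * complex_of_real (x \<bullet> p')) (at s)"
    by (intro has_vector_derivative_add has_vector_derivative_mult_right
        bounded_linear.has_vector_derivative[OF bounded_linear_of_real] 2 3)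
  from field_vector_diff_chain_at[OF this DERIV_exp]
  show ?thesis unfolding wave_def by (simp add: o_def)
qed

text \<open>Together with \<open>psi_fokker_planck\<close> this says that
  \<open>psi (wpath w s)\<close> solves the evolution equation pointwise.\<close>

lemma wave_path_deriv:
  "((\<lambda>s. wave (wpath w s) x) has_vector_derivative symb (wpath w s) x * wave (wpath w s) x) (at s)"
  using wave_chain[OF wpath_deriv, where x = x] by (simp add: inner_B_Qi symb_def)

lemma wpath_continuous: "continuous_on S (wpath w)"
  by (intro continuous_at_imp_continuous_on ballI has_vector_derivative_continuous[OF wpath_deriv])

lemma wave_path_bound:
  obtains C where "\<And>s x. \<bar>s - s0\<bar> \<le> 1 \<Longrightarrow> cmod (symb (wpath w s) x * wave (wpath w s) x) \<le> C * (1 + norm x)"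
proof -
  let ?g = "\<lambda>v. (\<bar>v \<bullet> (Q *v v)\<bar> / 2 + norm (A *v (B *v (Qi *v v)))) * exp (v \<bullet> (Qi *v v) / 2)"
  have gc: "continuous_on UNIV ?g"
    by (simp only: matrix_vector_mul_assoc) (intro continuous_intros matrix_vector_mult_linear_continuous_on; simp)
  have "continuous_on {s0 - 1..s0 + 1} (\<lambda>s. ?g (wpath w s))"
    by (rule continuous_on_compose2[OF gc wpath_continuous]) auto
  then have "bounded ((\<lambda>s. ?g (wpath w s)) ` {s0 - 1..s0 + 1})"
    by (intro compact_imp_bounded compact_continuous_image) auto
  then obtain C where C: "\<And>s. s \<in> {s0 - 1..s0 + 1} \<Longrightarrow> norm (?g (wpath w s)) \<le> C" unfolding bounded_iff by blast
  have "cmod (symb (wpath w s) x * wave (wpath w s) x) \<le> C * (1 + norm x)" if "\<bar>s - s0\<bar> \<le> 1" for s x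
  proof -
    have "cmod (symb (wpath w s) x * wave (wpath w s) x) \<le> ?g (wpath w s) * (1 + norm x)"
      using mult_right_mono[OF norm_symb_le[of "wpath w s" x], of "exp (wpath w s \<bullet> (Qi *v wpath w s) / 2)"]
      by (simp only: norm_mult norm_wave mult_ac) simp
    also have "\<dots> \<le> C * (1 + norm x)"
    proof (rule mult_right_mono)
      have "?g (wpath w s) \<le> norm (?g (wpath w s))" by (rule order_trans[OF abs_ge_self]) simp
      also have "\<dots> \<le> C" using that by (intro C) auto
      finally show "?g (wpath w s) \<le> C" .
    qed simp
    finally show ?thesis .
  qed
  then show thesis by (rule that)
qed

text \<open>The pointwise derivative holds in norm, because the difference quotients of the waves
  grow at most linearly in x and linear growth is square-integrable for
  \<open>\<mu>\<close>.\<close>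

lemma psi_path_deriv:
  "((\<lambda>h. L2_norm W (\<lambda>x. (psi (wpath w (s + h)) x - psi (wpath w s) x) / complex_of_real h
      - symb (wpath w s) x * psi (wpath w s) x)) \<longlongrightarrow> 0) (at 0)"
proof -
  obtain C where C: "\<And>s' x. \<bar>s' - s\<bar> \<le> 1 \<Longrightarrow> cmod (symb (wpath w s') x * wave (wpath w s') x) \<le> C * (1 + norm x)"
    using wave_path_bound[of s w] by blast
  define q where "q h x = (wave (wpath w (s + h)) x - wave (wpath w s) x) / complex_of_real h" for h x
  define d where "d x = symb (wpath w s) x * wave (wpath w s) x" for x
  have qm [measurable]: "q h \<in> borel_measurable borel" "d \<in> borel_measurable borel" for h
    unfolding q_def[abs_def] d_def[abs_def] by measurable
  have eq: "L2_norm W (\<lambda>x. (psi (wpath w (s + h)) x - psi (wpath w s) x) / complex_of_real h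
      - symb (wpath w s) x * psi (wpath w s) x) = sqrt (1 / c0) * L2_norm \<mu> (\<lambda>x. q h x - d x)" for h
  proof -
    have "(\<lambda>x. (psi (wpath w (s + h)) x - psi (wpath w s) x) / complex_of_real h - symb (wpath w s) x * psi (wpath w s) x)
       = (\<lambda>x. gd x * (q h x - d x))"
      by (simp add: psi_def q_def d_def fun_eq_iff right_diff_distrib mult_ac)
    then show ?thesis by (simp only:) (rule L2_weighted(2), measurable)
  qed
  have "((\<lambda>h. L2_norm \<mu> (\<lambda>x. q h x - d x)) \<longlongrightarrow> 0) (at 0)"
  proof (rule tendsto_at_0_sequentiallyI)
    fix h :: "nat \<Rightarrow> real" assume h: "h \<longlonglongrightarrow> 0" "\<And>n. h n \<noteq> 0" "\<And>n. \<bar>h n\<bar> \<le> 1"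
    note ql = difference_quotient_limit[OF wave_path_deriv C h]
    show "(\<lambda>n. L2_norm \<mu> (\<lambda>x. q (h n) x - d x)) \<longlonglongrightarrow> 0"
    proof (rule L2_tendsto_dominated[of _ \<mu> _ "\<lambda>x. (2 * C) * (1 + norm x)"])
      show "q (h n) \<in> borel_measurable \<mu>" "d \<in> borel_measurable \<mu>" for n
        by (simp_all only: measurable_cong_sets[OF sets_\<mu> refl] qm)
      show "integrable \<mu> (\<lambda>x. ((2 * C) * (1 + norm x))\<^sup>2)" by (rule moment_L2)
      show "(\<lambda>n. q (h n) x) \<longlonglongrightarrow> d x" for x unfolding q_def d_def by (rule ql(1))
      show "cmod (q (h n) x - d x) \<le> (2 * C) * (1 + norm x)" for n x
      proof -
        have "cmod (q (h n) x) \<le> C * (1 + norm x)" unfolding q_def by (rule ql(2))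
        moreover have "cmod (d x) \<le> C * (1 + norm x)" unfolding d_def by (rule C) simp
        ultimately show ?thesis using norm_triangle_ineq4[of "q (h n) x" "d x"] by linarith
      qed
    qed
  qed
  from tendsto_mult_left[OF this, of "sqrt (1 / c0)"] show ?thesis unfolding eq by simp
qed

text \<open>Uniqueness of orbits applied to the explicit solution. The identity is stated through
  the norm, since elements of L2 are functions up to null sets.\<close>

lemma semigroup_psi:
  assumes S: "strongly_continuous_semigroup W S" and gen: "infinitesimal_generator W S = fokker_planck_operator Q B"
    and t: "t \<ge> 0"
  shows "L2_norm W (\<lambda>x. S t (psi w) x - psi (wpath w t) x) = 0"
  using semigroup_orbit_eq[OF S _ psi_path_deriv t, of w] psi_fokker_planck by (simp only: gen wpath_0)

section \<open>The Fourier transform of the Gaussian\<close>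

definition Z0 :: real where "Z0 = (LINT x|lborel. gd x)"

lemma Z0_pos: "Z0 > 0"
proof -
  have "0 \<le> Z0" unfolding Z0_def by (intro Bochner_Integration.integral_nonneg) (auto simp: less_imp_le)
  moreover have "Z0 \<noteq> 0"
  proof
    assume "Z0 = 0"
    then have "AE x in lborel. gd x = 0"
      unfolding Z0_def using integral_nonneg_eq_0_iff_AE[OF gd_integrable] by (auto simp: less_imp_le)
    then have "emeasure lborel (UNIV :: (real^'n) set) = 0"
      using AE_iff_measurable[of UNIV lborel "\<lambda>x. gd x = 0"] by (auto simp: less_imp_neq[symmetric])
    then show False using emeasure_lborel_UNIV by simp
  qed
  ultimately show ?thesis by linarith
qed

lemma measure_\<mu>: "measure \<mu> UNIV = Z0"
proof -
  have "emeasure \<mu> UNIV = (\<integral>\<^sup>+x. ennreal (gd x) \<partial>lborel)" by (simp add: \<mu>_def emeasure_density)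
  also have "\<dots> = ennreal Z0"
    unfolding Z0_def by (rule nn_integral_eq_integral[OF gd_integrable]) (simp add: less_imp_le)
  finally show ?thesis using Z0_pos by (simp add: measure_def)
qed

lemma integrable_mu_bounded:
  fixes f :: "real^'n \<Rightarrow> complex"
  assumes "f \<in> borel_measurable borel" "\<And>x. cmod (f x) \<le> C"
  shows "integrable \<mu> f"
  using assms by (intro mu.integrable_const_bound[of _ C]) (auto simp: measurable_cong_sets[OF sets_\<mu> refl])

lemma integrable_psi_growth:
  assumes f: "f \<in> borel_measurable borel" and le: "\<And>x. cmod (f x) \<le> C * (1 + norm x)"
  shows "integrable lborel (\<lambda>x. f x * psi w x)"
proof (rule Bochner_Integration.integrable_bound)
  show "integrable lborel (\<lambda>x. C * exp (w \<bullet> (Qi *v w) / 2) * ((1 + norm x)\<^sup>2 * gd x))"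
    by (intro integrable_mult_right gd_moment)
  show "(\<lambda>x. f x * psi w x) \<in> borel_measurable lborel" unfolding psi_def using f by measurable
  show "AE x in lborel. norm (f x * psi w x) \<le> norm (C * exp (w \<bullet> (Qi *v w) / 2) * ((1 + norm x)\<^sup>2 * gd x))"
  proof (rule AE_I2)
    fix x :: "real^'n"
    have C: "C \<ge> 0" using order_trans[OF norm_ge_zero le[of 0]] by simp
    have "C * (1 + norm x) * 1 \<le> C * (1 + norm x) * (1 + norm x)" using C by (intro mult_left_mono) auto
    with le[of x] have "cmod (f x) \<le> C * (1 + norm x)\<^sup>2" by (simp add: power2_eq_square mult.assoc)
    then have "cmod (f x) * (gd x * exp (w \<bullet> (Qi *v w) / 2)) \<le> C * (1 + norm x)\<^sup>2 * (gd x * exp (w \<bullet> (Qi *v w) / 2))"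
      by (intro mult_right_mono) (auto simp: less_imp_le)
    then show "norm (f x * psi w x) \<le> norm (C * exp (w \<bullet> (Qi *v w) / 2) * ((1 + norm x)\<^sup>2 * gd x))"
      using C by (simp add: psi_def norm_mult norm_wave less_imp_le abs_mult mult_ac)
  qed
qed

lemma integrable_psi: "integrable lborel (psi w)"
  using integrable_psi_growth[of "\<lambda>x. 1" 1 w] by simp

text \<open>Gaussian integration by parts: the derivative of \<open>psi w\<close> along Qi a has
  integral 0, and (A x).(Qi a) = x.a.\<close>

lemma integral_inner_psi:
  "(LINT x|lborel. complex_of_real (x \<bullet> a) * psi w x) = \<i> * complex_of_real (w \<bullet> (Qi *v a)) * (LINT x|lborel. psi w x)"
proof -
  let ?v = "Qi *v a"
  have Av: "(A *v x) \<bullet> ?v = x \<bullet> a" for x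
    using symmetric_matrix_inner[OF A_sym, of x ?v] by (simp only: Qi_A)
  define G where "G x = (\<i> * complex_of_real (w \<bullet> ?v) - complex_of_real (x \<bullet> a)) * psi w x" for x
  have cm: "\<bar>x \<bullet> a\<bar> \<le> norm a * (1 + norm x)" for x
  proof -
    have "norm x * norm a \<le> (1 + norm x) * norm a" by (intro mult_right_mono) auto
    with Cauchy_Schwarz_ineq2[of x a] show ?thesis by (simp add: mult.commute)
  qed
  have i1: "integrable lborel (\<lambda>x. complex_of_real (x \<bullet> a) * psi w x)"
    by (rule integrable_psi_growth[of _ "norm a"]) (use cm in auto)
  let ?c = "\<bar>w \<bullet> ?v\<bar> + norm a"
  let ?e = "exp (w \<bullet> (Qi *v w) / 2)"
  obtain al where al: "al > 0" "\<And>x. gd x \<le> exp (- al * (x \<bullet> x))" by (rule A_coercive) blast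
  \<comment> \<open>The Gaussian at x + s v is compared with one of half the rate at x, by |x|^2
    \<le> 2 |x + s v|^2 + 2 |v|^2 for |s| \<le> 1.\<close>
  define dom where "dom x = ?c * ?e * ((1 + norm ?v) * ((1 + norm x)\<^sup>2 * exp (- (al / 2) * (x \<bullet> x)) * exp (al * (?v \<bullet> ?v))))" for x :: "real^'n"
  have "(LINT x|lborel. G x) = 0"
  proof (rule integral_directional_derivative[OF integrable_psi, where v = ?v and w = dom])
    show "G \<in> borel_measurable borel" unfolding G_def psi_def by measurable
    show "integrable lborel dom"
      unfolding dom_def using al(1)
      by (intro integrable_mult_right integrable_mult_left integrable_gaussian_moment) simp
    show "((\<lambda>s. psi w (x + s *\<^sub>R ?v)) has_vector_derivative G (x + s *\<^sub>R ?v)) (at s)" for x s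
    proof -
      have "((\<lambda>s. x + s *\<^sub>R ?v) has_derivative (\<lambda>k. k *\<^sub>R ?v)) (at s)" by (auto intro!: derivative_eq_intros)
      from has_derivative_compose[OF this psi_has_derivative]
      show ?thesis
        unfolding has_vector_derivative_def G_def
        by (rule has_derivative_eq_rhs)
          (simp add: fun_eq_iff inner_scaleR_right Av scaleR_conv_of_real[where 'a=complex] right_diff_distrib mult_ac)
    qed
    show "norm (G (x + s *\<^sub>R ?v)) \<le> dom x" if s: "\<bar>s\<bar> \<le> 1" for x s
    proof -
      let ?y = "x + s *\<^sub>R ?v"
      have ny: "cmod (\<i> * complex_of_real (w \<bullet> ?v) - complex_of_real (?y \<bullet> a)) \<le> ?c * (1 + norm ?y)"
      proof -
        have "cmod (\<i> * complex_of_real (w \<bullet> ?v) - complex_of_real (?y \<bullet> a)) \<le> \<bar>w \<bullet> ?v\<bar> + \<bar>?y \<bullet> a\<bar>"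
          by (rule order_trans[OF norm_triangle_ineq4]) (simp add: norm_mult)
        also have "\<dots> \<le> \<bar>w \<bullet> ?v\<bar> * (1 + norm ?y) + norm a * (1 + norm ?y)"
          by (intro add_mono cm) (simp add: distrib_left)
        finally show ?thesis by (simp only: distrib_right)
      qed
      have key: "(1 + norm ?y) * exp (- al * (?y \<bullet> ?y)) \<le> (1 + norm ?v) * ((1 + norm x)\<^sup>2 * exp (- (al / 2) * (x \<bullet> x)) * exp (al * (?v \<bullet> ?v)))"
      proof -
        have nsv: "norm (s *\<^sub>R ?v) \<le> norm ?v" using s by (simp add: mult_left_le_one_le)
        have "norm ?y \<le> norm x + norm ?v" using norm_triangle_ineq[of x "s *\<^sub>R ?v"] nsv by linarith
        moreover have "(1 + norm ?v) * (1 + norm x) = 1 + norm x + norm ?v + norm ?v * norm x" by (simp add: algebra_simps)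
        moreover have "0 \<le> norm ?v * norm x" by simp
        ultimately have "1 + norm ?y \<le> (1 + norm ?v) * (1 + norm x)" by linarith
        also have "\<dots> \<le> (1 + norm ?v) * (1 + norm x)\<^sup>2"
          using power_increasing[of 1 2 "1 + norm x"] by (intro mult_left_mono) auto
        finally have 1: "1 + norm ?y \<le> (1 + norm ?v) * (1 + norm x)\<^sup>2" .
        have "norm x \<le> norm ?y + norm ?v" using norm_triangle_ineq4[of ?y "s *\<^sub>R ?v"] nsv by simp
        then have "(norm x)\<^sup>2 \<le> (norm ?y + norm ?v)\<^sup>2" by (intro power_mono) auto
        also have "\<dots> \<le> 2 * (norm ?y)\<^sup>2 + 2 * (norm ?v)\<^sup>2"
          using zero_le_power2[of "norm ?y - norm ?v"] by (simp add: power2_eq_square algebra_simps)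
        finally have "x \<bullet> x \<le> 2 * (?y \<bullet> ?y) + 2 * (?v \<bullet> ?v)" by (simp only: power2_norm_eq_inner)
        from mult_left_mono[OF this, of "al / 2"]
        have "- al * (?y \<bullet> ?y) \<le> - (al / 2) * (x \<bullet> x) + al * (?v \<bullet> ?v)"
          using al(1) by (simp only: distrib_left) simp
        then have 2: "exp (- al * (?y \<bullet> ?y)) \<le> exp (- (al / 2) * (x \<bullet> x)) * exp (al * (?v \<bullet> ?v))"
          by (simp only: exp_add[symmetric] exp_le_cancel_iff)
        show ?thesis using mult_mono[OF 1 2] by (simp add: mult.assoc)
      qed
      have "norm (G ?y) = cmod (\<i> * complex_of_real (w \<bullet> ?v) - complex_of_real (?y \<bullet> a)) * (gd ?y * ?e)"
        by (simp add: G_def psi_def norm_mult norm_wave less_imp_le)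
      also have "\<dots> \<le> (?c * (1 + norm ?y)) * (exp (- al * (?y \<bullet> ?y)) * ?e)"
        by (intro mult_mono ny mult_right_mono al(2)) (auto simp: less_imp_le)
      also have "\<dots> = ?c * ?e * ((1 + norm ?y) * exp (- al * (?y \<bullet> ?y)))" by (simp add: mult_ac)
      also have "\<dots> \<le> dom x" unfolding dom_def by (intro mult_left_mono key) auto
      finally show ?thesis .
    qed
  qed
  moreover have "(LINT x|lborel. G x) = \<i> * complex_of_real (w \<bullet> ?v) * (LINT x|lborel. psi w x) - (LINT x|lborel. complex_of_real (x \<bullet> a) * psi w x)"
    unfolding G_def using i1 integrable_psi[of w] by (simp add: left_diff_distrib)
  ultimately show ?thesis by simp
qed

text \<open>By \<open>integral_inner_psi\<close> the integral of \<open>psi (s *\<^sub>R a)\<close>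
  has derivative 0 in s, so the amplitude of the wave exactly compensates the Gaussian decay. This
  avoids both diagonalisation and a contour shift.\<close>

lemma integral_psi: "(LINT x|lborel. psi a x) = complex_of_real Z0"
proof -
  let ?J = "\<lambda>s. LINT x|lborel. psi (s *\<^sub>R a) x"
  have der: "((\<lambda>s. psi (s *\<^sub>R a) x) has_vector_derivative
     (complex_of_real (s * (a \<bullet> (Qi *v a))) + \<i> * complex_of_real (x \<bullet> a)) * psi (s *\<^sub>R a) x) (at s)" for s x
  proof -
    have "((\<lambda>s. s *\<^sub>R a) has_vector_derivative a) (at s)" by (auto intro!: derivative_eq_intros)
    from has_vector_derivative_mult_right[OF wave_chain[OF this, of x], of "complex_of_real (gd x)"]
    show ?thesis unfolding psi_def by (simp add: mult_ac)
  qed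
  have "(?J has_vector_derivative 0) (at s)" for s
  proof -
    let ?q = "\<bar>a \<bullet> (Qi *v a)\<bar>"
    let ?D = "((\<bar>s\<bar> + 1) * ?q + norm a) * exp ((\<bar>s\<bar> + 1)\<^sup>2 * ?q / 2)"
    have "(?J has_vector_derivative (LINT x|lborel. (complex_of_real (s * (a \<bullet> (Qi *v a))) + \<i> * complex_of_real (x \<bullet> a)) * psi (s *\<^sub>R a) x)) (at s)"
    proof (rule has_vector_derivative_integral[OF integrable_psi der])
      show "integrable lborel (\<lambda>x. ?D * ((1 + norm x)\<^sup>2 * gd x))" by (intro integrable_mult_right gd_moment)
      show "(\<lambda>x. (complex_of_real (s * (a \<bullet> (Qi *v a))) + \<i> * complex_of_real (x \<bullet> a)) * psi (s *\<^sub>R a) x) \<in> borel_measurable lborel"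
        unfolding psi_def by measurable
      fix s' x assume s': "\<bar>s' - s\<bar> \<le> 1"
      have sb: "\<bar>s'\<bar> \<le> \<bar>s\<bar> + 1" using s' by linarith
      have "cmod (complex_of_real (s' * (a \<bullet> (Qi *v a))) + \<i> * complex_of_real (x \<bullet> a)) \<le> \<bar>s'\<bar> * ?q + \<bar>x \<bullet> a\<bar>"
        by (rule order_trans[OF norm_triangle_ineq]) (simp add: norm_mult abs_mult)
      also have "\<dots> \<le> (\<bar>s\<bar> + 1) * ?q + norm x * norm a"
        using sb by (intro add_mono mult_right_mono Cauchy_Schwarz_ineq2) auto
      also have "\<dots> \<le> ((\<bar>s\<bar> + 1) * ?q + norm a) * (1 + norm x)"
        by (simp add: algebra_simps)
      also have "\<dots> \<le> ((\<bar>s\<bar> + 1) * ?q + norm a) * (1 + norm x)\<^sup>2"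
        using power_increasing[of 1 2 "1 + norm x"] by (intro mult_left_mono) auto
      finally have 1: "cmod (complex_of_real (s' * (a \<bullet> (Qi *v a))) + \<i> * complex_of_real (x \<bullet> a)) \<le> ((\<bar>s\<bar> + 1) * ?q + norm a) * (1 + norm x)\<^sup>2" .
      have 2: "cmod (psi (s' *\<^sub>R a) x) \<le> gd x * exp ((\<bar>s\<bar> + 1)\<^sup>2 * ?q / 2)"
      proof -
        have "s'\<^sup>2 \<le> (\<bar>s\<bar> + 1)\<^sup>2" using sb by (metis abs_ge_zero power2_abs power_mono)
        then have "s'\<^sup>2 * (a \<bullet> (Qi *v a)) \<le> (\<bar>s\<bar> + 1)\<^sup>2 * ?q" using Qi_psd by (intro mult_mono) (auto simp: sym_pos_semidef_def)
        then show ?thesis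
          by (simp add: psi_def norm_mult norm_wave less_imp_le matrix_vector_mult_scaleR power2_eq_square mult.assoc mult_left_mono)
      qed
      show "cmod ((complex_of_real (s' * (a \<bullet> (Qi *v a))) + \<i> * complex_of_real (x \<bullet> a)) * psi (s' *\<^sub>R a) x) \<le> ?D * ((1 + norm x)\<^sup>2 * gd x)"
        unfolding norm_mult using mult_mono[OF 1 2] by (simp add: mult_ac)
    qed
    moreover have "(LINT x|lborel. (complex_of_real (s * (a \<bullet> (Qi *v a))) + \<i> * complex_of_real (x \<bullet> a)) * psi (s *\<^sub>R a) x) = 0"
    proof -
      have cm: "\<bar>x \<bullet> a\<bar> \<le> norm a * (1 + norm x)" for x
      proof -
        have "norm x * norm a \<le> (1 + norm x) * norm a" by (intro mult_right_mono) auto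
        with Cauchy_Schwarz_ineq2[of x a] show ?thesis by (simp add: mult.commute)
      qed
      have i1: "integrable lborel (\<lambda>x. complex_of_real (x \<bullet> a) * psi (s *\<^sub>R a) x)"
        by (rule integrable_psi_growth[of _ "norm a"]) (use cm in auto)
      have "(LINT x|lborel. (complex_of_real (s * (a \<bullet> (Qi *v a))) + \<i> * complex_of_real (x \<bullet> a)) * psi (s *\<^sub>R a) x)
         = (LINT x|lborel. complex_of_real (s * (a \<bullet> (Qi *v a))) * psi (s *\<^sub>R a) x + \<i> * (complex_of_real (x \<bullet> a) * psi (s *\<^sub>R a) x))"
        by (simp only: distrib_right mult.assoc)
      also have "\<dots> = complex_of_real (s * (a \<bullet> (Qi *v a))) * ?J s + \<i> * (LINT x|lborel. complex_of_real (x \<bullet> a) * psi (s *\<^sub>R a) x)"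
        by (subst Bochner_Integration.integral_add) (auto intro!: integrable_mult_right i1 integrable_psi)
      also have "\<dots> = 0" unfolding integral_inner_psi by (simp add: algebra_simps)
      finally show ?thesis .
    qed
    ultimately show ?thesis by simp
  qed
  then obtain c where "\<And>s. ?J s = c"
    using has_vector_derivative_zero_constant[of UNIV ?J] by auto
  from this[of 1] this[of 0] have "(LINT x|lborel. psi a x) = (LINT x|lborel. psi 0 x)" by simp
  also have "\<dots> = complex_of_real Z0" by (simp add: psi_def wave_def Z0_def)
  finally show ?thesis .
qed

lemma integral_mu_cis: "(LINT x|\<mu>. cis (x \<bullet> a)) = complex_of_real (Z0 * exp (- (a \<bullet> (Qi *v a)) / 2))"
proof -
  have cm: "(\<lambda>x. cis (x \<bullet> a)) \<in> borel_measurable borel"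
    by (intro borel_measurable_continuous_onI continuous_intros)
  have "(LINT x|\<mu>. cis (x \<bullet> a)) = (LINT x|lborel. gd x *\<^sub>R cis (x \<bullet> a))"
    unfolding \<mu>_def by (subst integral_density) (use cm in \<open>auto simp: less_imp_le\<close>)
  also have "\<dots> = (LINT x|lborel. complex_of_real (exp (- (a \<bullet> (Qi *v a)) / 2)) * psi a x)"
  proof (rule Bochner_Integration.integral_cong[OF refl])
    fix x
    have "wave a x = complex_of_real (exp (a \<bullet> (Qi *v a) / 2)) * cis (x \<bullet> a)"
      by (simp only: wave_def exp_add exp_of_real cis_conv_exp)
    then show "gd x *\<^sub>R cis (x \<bullet> a) = complex_of_real (exp (- (a \<bullet> (Qi *v a)) / 2)) * psi a x"
      by (simp add: psi_def scaleR_conv_of_real exp_minus field_simps flip: of_real_mult)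
  qed
  also have "\<dots> = complex_of_real (exp (- (a \<bullet> (Qi *v a)) / 2)) * complex_of_real Z0"
    by (simp add: integral_psi)
  finally show ?thesis by (simp add: mult.commute)
qed

end

section \<open>Imaginary translations\<close>

lemma integral_sum_list:
  fixes f :: "'b \<Rightarrow> 'a \<Rightarrow> complex"
  assumes "\<And>p. p \<in> set ps \<Longrightarrow> integrable M (f p)"
  shows "integrable M (\<lambda>x. \<Sum>p\<leftarrow>ps. f p x)" "(LINT x|M. (\<Sum>p\<leftarrow>ps. f p x)) = (\<Sum>p\<leftarrow>ps. LINT x|M. f p x)"
  using assms by (induction ps) auto

lemma trig_poly_cnj:
  assumes "trig_poly f"
  shows "trig_poly (\<lambda>x. cnj (f x))"
proof -
  obtain ps where ps: "\<And>x. f x = (\<Sum>p\<leftarrow>ps. fst p * cis (x \<bullet> snd p))"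
    using assms unfolding trig_poly_def by blast
  have "cnj (\<Sum>p\<leftarrow>ps. fst p * cis (x \<bullet> snd p)) = (\<Sum>p\<leftarrow>map (\<lambda>p. (cnj (fst p), - snd p)) ps. fst p * cis (x \<bullet> snd p))" for x
    by (induction ps) (auto simp: cis_cnj)
  then show ?thesis unfolding trig_poly_def ps by blast
qed

text \<open>Again nonnegativity of a variance: Cauchy-Schwarz against the constant 1.\<close>

lemma (in finite_borel_measure) norm_integral_square_le:
  fixes g :: "real^'n \<Rightarrow> complex"
  assumes g: "g \<in> borel_measurable borel" and bd: "\<And>x. cmod (g x) \<le> C" and pos: "measure M UNIV > 0"
  shows "(cmod (LINT x|M. g x))\<^sup>2 \<le> measure M UNIV * (LINT x|M. (cmod (g x))\<^sup>2)"
proof -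
  let ?z = "measure M UNIV"
  have gm: "g \<in> borel_measurable M" using g by (simp add: measurable_cong_sets[OF sets_M refl])
  have i1: "integrable M (\<lambda>x. cmod (g x))" using gm bd by (intro integrable_const_bound[of _ C]) auto
  have i2: "integrable M (\<lambda>x. (cmod (g x))\<^sup>2)"
    using gm bd by (intro integrable_const_bound[of _ "C\<^sup>2"] AE_I2) (auto intro!: power_mono simp del: power_mono_iff)
  define m where "m = (LINT x|M. cmod (g x)) / ?z"
  have "0 \<le> (LINT x|M. (cmod (g x) - m)\<^sup>2)" by (intro Bochner_Integration.integral_nonneg) simp
  also have "\<dots> = (LINT x|M. ((cmod (g x))\<^sup>2 - (2 * m) * cmod (g x)) + m\<^sup>2)"
    by (simp add: power2_eq_square algebra_simps)
  also have "\<dots> = (LINT x|M. (cmod (g x))\<^sup>2) - (2 * m) * (LINT x|M. cmod (g x)) + m\<^sup>2 * ?z"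
    using i1 i2 by simp
  also have "\<dots> = (LINT x|M. (cmod (g x))\<^sup>2) - m\<^sup>2 * ?z"
    using pos by (simp add: m_def power2_eq_square field_simps)
  finally have "m\<^sup>2 * ?z * ?z \<le> (LINT x|M. (cmod (g x))\<^sup>2) * ?z" using pos by (intro mult_right_mono) auto
  then have "(LINT x|M. cmod (g x))\<^sup>2 \<le> ?z * (LINT x|M. (cmod (g x))\<^sup>2)"
    using pos by (simp add: m_def power2_eq_square mult.commute)
  moreover have "(cmod (LINT x|M. g x))\<^sup>2 \<le> (LINT x|M. cmod (g x))\<^sup>2"
    by (intro power_mono integral_norm_bound) simp
  ultimately show ?thesis by linarith
qed

context fokker_planck
begin

lemma cis_affine_integrable: "integrable \<mu> (\<lambda>z. c * cis ((u + V *v z) \<bullet> p))"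
  by (rule integrable_mu_bounded[of _ "cmod c"])
    (auto simp: norm_mult intro!: borel_measurable_continuous_onI continuous_intros matrix_vector_mult_linear_continuous_on)

text \<open>If X and Z are independent with the normalised law of \<open>\<mu>\<close>, the
  hypothesis says that the covariances of U X and V Z add up to \<open>Qi\<close>, so U X + V Z has
  the same law. It suffices to compare characters; the factor \<open>Z0\<close> is the mass of
  \<open>\<mu>\<close>.\<close>

lemma mehler_invariance:
  fixes U V :: "real^'n^'n"
  assumes UV: "\<And>p. (transpose U *v p) \<bullet> (Qi *v (transpose U *v p)) + (transpose V *v p) \<bullet> (Qi *v (transpose V *v p)) = p \<bullet> (Qi *v p)"
    and g: "trig_poly g"
  shows "integrable \<mu> (\<lambda>x. LINT z|\<mu>. g (U *v x + V *v z))"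
    and "(LINT x|\<mu>. LINT z|\<mu>. g (U *v x + V *v z)) = complex_of_real Z0 * (LINT x|\<mu>. g x)"
proof -
  obtain ps where ps: "\<And>x. g x = (\<Sum>p\<leftarrow>ps. fst p * cis (x \<bullet> snd p))"
    using g unfolding trig_poly_def by blast
  let ?G = "\<lambda>M p. complex_of_real (Z0 * exp (- ((transpose M *v p) \<bullet> (Qi *v (transpose M *v p))) / 2))"
  have tr: "(M *v x) \<bullet> p = x \<bullet> (transpose M *v p)" for M :: "real^'n^'n" and x p
    by (metis dot_lmul_matrix inner_commute transpose_matrix_vector)
  have inner: "(LINT z|\<mu>. g (U *v x + V *v z)) = (\<Sum>p\<leftarrow>ps. (fst p * ?G V (snd p)) * cis (x \<bullet> (transpose U *v snd p)))" for x
  proof -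
    have "(LINT z|\<mu>. g (U *v x + V *v z)) = (\<Sum>p\<leftarrow>ps. LINT z|\<mu>. fst p * cis ((U *v x + V *v z) \<bullet> snd p))"
      unfolding ps by (intro integral_sum_list(2) cis_affine_integrable)
    also have "(\<lambda>p. LINT z|\<mu>. fst p * cis ((U *v x + V *v z) \<bullet> snd p)) = (\<lambda>p. (fst p * ?G V (snd p)) * cis (x \<bullet> (transpose U *v snd p)))"
    proof (rule ext)
      fix p :: "complex \<times> (real^'n)"
      have "(LINT z|\<mu>. fst p * cis ((U *v x + V *v z) \<bullet> snd p)) = (LINT z|\<mu>. (fst p * cis (x \<bullet> (transpose U *v snd p))) * cis (z \<bullet> (transpose V *v snd p)))"
        by (simp only: inner_add_left tr cis_mult[symmetric] mult.assoc)
      also have "\<dots> = (fst p * cis (x \<bullet> (transpose U *v snd p))) * ?G V (snd p)"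
        by (simp only: integral_mult_right_zero integral_mu_cis)
      finally show "(LINT z|\<mu>. fst p * cis ((U *v x + V *v z) \<bullet> snd p)) = (fst p * ?G V (snd p)) * cis (x \<bullet> (transpose U *v snd p))"
        by (simp only: mult_ac)
    qed
    finally show ?thesis .
  qed
  have ci: "integrable \<mu> (\<lambda>x. c * cis (x \<bullet> q))" for c q
    using cis_affine_integrable[of c 0 "mat 1" q] by simp
  show "integrable \<mu> (\<lambda>x. LINT z|\<mu>. g (U *v x + V *v z))"
    unfolding inner by (intro integral_sum_list(1) ci)
  have "(LINT x|\<mu>. LINT z|\<mu>. g (U *v x + V *v z)) = (\<Sum>p\<leftarrow>ps. (fst p * ?G V (snd p)) * ?G U (snd p))"
    unfolding inner by (subst integral_sum_list(2)) (simp_all only: ci integral_mult_right_zero integral_mu_cis)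
  also have "\<dots> = (\<Sum>p\<leftarrow>ps. complex_of_real Z0 * (fst p * complex_of_real (Z0 * exp (- (snd p \<bullet> (Qi *v snd p)) / 2))))"
  proof -
    have "?G V q * ?G U q = complex_of_real Z0 * complex_of_real (Z0 * exp (- (q \<bullet> (Qi *v q)) / 2))" for q
    proof -
      have "exp (- ((transpose V *v q) \<bullet> (Qi *v (transpose V *v q))) / 2) * exp (- ((transpose U *v q) \<bullet> (Qi *v (transpose U *v q))) / 2)
        = exp (- (q \<bullet> (Qi *v q)) / 2)"
        unfolding UV[of q, symmetric] exp_add[symmetric] by (simp add: add_divide_distrib)
      then show ?thesis by (metis (no_types, lifting) mult.assoc mult.left_commute of_real_mult)
    qed
    then show ?thesis by (simp only: mult.assoc mult.left_commute[of "complex_of_real Z0"])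
  qed
  also have "\<dots> = complex_of_real Z0 * (LINT x|\<mu>. g x)"
    unfolding ps by (subst integral_sum_list(2)) (simp_all only: ci integral_mult_right_zero integral_mu_cis sum_list_const_mult)
  finally show "(LINT x|\<mu>. LINT z|\<mu>. g (U *v x + V *v z)) = complex_of_real Z0 * (LINT x|\<mu>. g x)" .
qed

text \<open>The propagator in the coordinates in which \<open>Qi\<close> becomes the
  identity.\<close>

definition Em :: "real \<Rightarrow> real^'n^'n" where "Em t = Ki ** E t ** K"

lemma transpose_Em: "transpose (Em t) = K ** Et t ** Ki"
  by (simp add: Em_def matrix_transpose_mul K_sym Ki_sym Et_transpose matrix_mul_assoc)

lemma K_wpath: "K *v wpath w t = Em t *v (K *v w)"
  unfolding wpath_def Em_def A_eq unfolding K_square[symmetric] by (simp only: matrix_vector_mul_assoc[symmetric] Ki_K)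

lemma inner_transpose: "((M::real^'n^'n) *v x) \<bullet> p = x \<bullet> (transpose M *v p)"
  by (metis dot_lmul_matrix inner_commute transpose_matrix_vector)

text \<open>The decrease of \<open>energy\<close> is a contraction of the transpose. A matrix and
  its transpose have the same operator norm, which gives the other bound with the same
  constants.\<close>

lemma Em_contraction:
  obtains c k where "c > 0" "\<And>t. 0 < t \<Longrightarrow> t \<le> 1 \<Longrightarrow> c * t ^ k \<le> 1"
    "\<And>t x. 0 < t \<Longrightarrow> t \<le> 1 \<Longrightarrow> (norm (transpose (Em t) *v x))\<^sup>2 \<le> (1 - c * t ^ k) * (norm x)\<^sup>2"
    "\<And>t x. 0 < t \<Longrightarrow> t \<le> 1 \<Longrightarrow> (norm (Em t *v x))\<^sup>2 \<le> (1 - c * t ^ k) * (norm x)\<^sup>2"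
proof -
  obtain c k where c: "c > 0" "\<And>w t. 0 < t \<Longrightarrow> t \<le> 1 \<Longrightarrow> c * t ^ k * (norm w)\<^sup>2 \<le> w \<bullet> (Qi *v w) - energy w t"
    using energy_decrease by metis
  obtain b where b: "b > 0" "\<And>x. norm (K *v x) \<le> b * norm x" using linear_bounded_pos[of "(*v) K"] by auto
  define c' where "c' = c / b\<^sup>2"
  have c': "c' > 0" using b c by (simp add: c'_def)
  have T: "(norm (transpose (Em t) *v x))\<^sup>2 \<le> (1 - c' * t ^ k) * (norm x)\<^sup>2" if t: "0 < t" "t \<le> 1" for t x
  proof -
    have "energy (Ki *v x) t = (norm (K *v (Et t *v (Ki *v x))))\<^sup>2"
      by (simp only: energy_def inner_Qi power2_norm_eq_inner)
    also have "K *v (Et t *v (Ki *v x)) = transpose (Em t) *v x"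
      unfolding transpose_Em by (simp only: matrix_vector_mul_assoc matrix_mul_assoc)
    finally have e: "energy (Ki *v x) t = (norm (transpose (Em t) *v x))\<^sup>2" .
    have q: "(Ki *v x) \<bullet> (Qi *v (Ki *v x)) = (norm x)\<^sup>2" by (simp only: inner_Qi Ki_K power2_norm_eq_inner)
    have "norm x \<le> b * norm (Ki *v x)" using b(2)[of "Ki *v x"] by (simp only: Ki_K)
    then have "(norm x)\<^sup>2 \<le> (b * norm (Ki *v x))\<^sup>2" by (intro power_mono) auto
    then have "c' * t ^ k * (norm x)\<^sup>2 \<le> c' * t ^ k * (b\<^sup>2 * (norm (Ki *v x))\<^sup>2)"
      using c' t by (intro mult_left_mono) (auto simp: power_mult_distrib)
    also have "\<dots> = c * t ^ k * (norm (Ki *v x))\<^sup>2" using b by (simp add: c'_def)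
    also have "\<dots> \<le> (norm x)\<^sup>2 - (norm (transpose (Em t) *v x))\<^sup>2" using c(2)[OF t, of "Ki *v x"] by (simp only: e q)
    finally show ?thesis by (simp add: algebra_simps)
  qed
  \<comment> \<open>Duality: |M x|^2 = x.(M^T M x) \<le> |x| |M^T (M x)|, and the bound for the
    transpose is applied to the vector M x.\<close>
  have M: "(norm (Em t *v x))\<^sup>2 \<le> (1 - c' * t ^ k) * (norm x)\<^sup>2" if t: "0 < t" "t \<le> 1" for t x
  proof (cases "Em t *v x = 0")
    case True
    then show ?thesis using order_trans[OF zero_le_power2 T[OF t, of x]] by simp
  next
    case False
    let ?y = "Em t *v x"
    have "(norm ?y)\<^sup>2 = x \<bullet> (transpose (Em t) *v ?y)" by (simp only: power2_norm_eq_inner inner_transpose)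
    also have "\<dots> \<le> norm x * norm (transpose (Em t) *v ?y)" by (rule norm_cauchy_schwarz)
    finally have "((norm ?y)\<^sup>2)\<^sup>2 \<le> (norm x * norm (transpose (Em t) *v ?y))\<^sup>2" by (intro power_mono) auto
    also have "\<dots> \<le> (norm x)\<^sup>2 * ((1 - c' * t ^ k) * (norm ?y)\<^sup>2)"
      unfolding power_mult_distrib by (intro mult_left_mono T t) auto
    finally have "(norm ?y)\<^sup>2 * (norm ?y)\<^sup>2 \<le> ((1 - c' * t ^ k) * (norm x)\<^sup>2) * (norm ?y)\<^sup>2"
      by (simp add: power2_eq_square mult_ac)
    then show ?thesis by (rule mult_right_le_imp_le) (use False in simp)
  qed
  have le1: "c' * t ^ k \<le> 1" if t: "0 < t" "t \<le> 1" for t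
  proof -
    obtain i :: 'n where True by simp
    have "0 \<le> (1 - c' * t ^ k) * (norm (axis i (1::real)))\<^sup>2" using order_trans[OF zero_le_power2 T[OF t]] .
    then show ?thesis by (simp add: norm_axis_1)
  qed
  show thesis by (rule that[OF c' le1 T M])
qed

lemma wave_cis: "wave w u = complex_of_real (exp (w \<bullet> (Qi *v w) / 2)) * cis (u \<bullet> w)"
  by (simp only: wave_def exp_add exp_of_real cis_conv_exp)

lemma trig_poly_wave_sum:
  fixes m :: nat
  shows "trig_poly (\<lambda>x. \<Sum>j<m. c j * wave (w j) x)"
  unfolding wave_cis by (intro trig_poly_sum trig_poly_mult trig_poly_const trig_poly_cis) simp

text \<open>\<open>cwave y w x\<close> is the value of the entire function \<open>wave w\<close> at \<open>x + i y\<close>.\<close>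

definition cwave :: "real^'n \<Rightarrow> real^'n \<Rightarrow> real^'n \<Rightarrow> complex" where
  "cwave y w x = wave w x * complex_of_real (exp (- (y \<bullet> w)))"

text \<open>The imaginary translation is absorbed by the Gaussian variable \<open>z\<close> of Mehler's formula.\<close>

lemma complex_translation_bound_aux:
  fixes w :: "nat \<Rightarrow> real^'n"
  assumes t: "0 < t" "t \<le> 1" and ct: "0 < ct"
    and M: "\<And>x. (norm (Em t *v x))\<^sup>2 \<le> (1 - ct) * (norm x)\<^sup>2"
    and MT: "\<And>x. (norm (transpose (Em t) *v x))\<^sup>2 \<le> (norm x)\<^sup>2"
  shows "(LINT x|\<mu>. (cmod (\<Sum>j<m. c j * cwave y (wpath (w j) t) x))\<^sup>2)
    \<le> exp ((norm (Ki *v y))\<^sup>2 / ct) * (LINT x|\<mu>. (cmod (\<Sum>j<m. c j * wave (w j) x))\<^sup>2)"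
proof -
  let ?M = "Em t"
  \<comment> \<open>In normalised coordinates Mehler's formula averages over M^T x + D z with D^2 =
    1 - M^T M: the noise supplies the covariance that the propagator loses. By the contraction bound
    \<open>M\<close> this loss is at least \<open>ct\<close>, so \<open>D\<close> is
    invertible.\<close>
  define P where "P = mat 1 - transpose ?M ** ?M"
  have Pq: "x \<bullet> (P *v x) = (norm x)\<^sup>2 - (norm (?M *v x))\<^sup>2" for x
  proof -
    have "x \<bullet> ((transpose ?M ** ?M) *v x) = (norm (?M *v x))\<^sup>2"
      by (simp only: matrix_vector_mul_assoc[symmetric] inner_transpose[symmetric] power2_norm_eq_inner)
    then show ?thesis by (simp add: P_def matrix_vector_mult_diff_rdistrib inner_diff_right power2_norm_eq_inner)
  qed
  have Plow: "ct * (norm x)\<^sup>2 \<le> x \<bullet> (P *v x)" for x using M[of x] unfolding Pq by (simp add: algebra_simps)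
  have "transpose P = P"
  proof -
    have "transpose (X - Y) = transpose X - transpose Y" for X Y :: "real^'n^'n" by (simp add: transpose_def vec_eq_iff)
    then show ?thesis by (simp add: P_def matrix_transpose_mul transpose_mat)
  qed
  moreover have "0 \<le> x \<bullet> (P *v x)" for x using order_trans[OF _ Plow[of x], of 0] ct by simp
  ultimately have Ppsd: "sym_pos_semidef P" by (simp add: sym_pos_semidef_def)
  define D where "D = matrix_sqrt P"
  have D: "transpose D = D" "D ** D = P" using matrix_sqrt[OF Ppsd] by (auto simp: D_def sym_pos_semidef_def)
  have Dn: "(norm (D *v x))\<^sup>2 = (norm x)\<^sup>2 - (norm (?M *v x))\<^sup>2" for x
  proof -
    have "(norm (D *v x))\<^sup>2 = x \<bullet> (transpose D *v (D *v x))" by (simp only: power2_norm_eq_inner inner_transpose)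
    also have "\<dots> = x \<bullet> (P *v x)" by (simp only: D(1) matrix_vector_mul_assoc D(2))
    finally show ?thesis by (simp only: Pq)
  qed
  have Dlow: "ct * (norm x)\<^sup>2 \<le> (norm (D *v x))\<^sup>2" for x using Plow[of x] unfolding Pq Dn .
  have "inj ((*v) D)"
  proof (rule injI)
    fix x y assume "D *v x = D *v y"
    then have "D *v (x - y) = 0" by (simp add: matrix_vector_mult_diff_distrib)
    then have "ct * (norm (x - y))\<^sup>2 \<le> 0" using Dlow[of "x - y"] by simp
    then have "(norm (x - y))\<^sup>2 \<le> 0" using ct by (simp add: mult_le_0_iff)
    then show "x = y" by simp
  qed
  then have "surj ((*v) D)" using linear_injective_imp_surjective[OF matrix_vector_mul_linear] by blast
  \<comment> \<open>The shift of the noise that absorbs the translation. The lower bound for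
    \<open>D\<close> controls it by |Ki y|^2 / ct, which is the origin of the exponent in the
    conclusion.\<close>
  then obtain ka where ka: "D *v ka = transpose ?M *v (Ki *v y)" by (metis surjD)
  have kan: "(norm ka)\<^sup>2 \<le> (norm (Ki *v y))\<^sup>2 / ct"
  proof -
    have "ct * (norm ka)\<^sup>2 \<le> (norm (Ki *v y))\<^sup>2" using Dlow[of ka] MT[of "Ki *v y"] unfolding ka by linarith
    then show ?thesis using ct by (simp add: pos_le_divide_eq mult.commute)
  qed
  define U where "U = K ** transpose ?M ** Ki"
  define V where "V = K ** D ** Ki"
  define b where "b = Ki *v ka"
  have UT: "transpose U *v p = Ki *v (?M *v (K *v p))" for p
  proof -
    have "transpose U = Ki ** ?M ** K" by (simp add: U_def matrix_transpose_mul K_sym Ki_sym matrix_mul_assoc)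
    then show ?thesis by (simp only: matrix_vector_mul_assoc matrix_mul_assoc)
  qed
  have VT: "transpose V *v p = Ki *v (D *v (K *v p))" for p
  proof -
    have "transpose V = Ki ** D ** K" by (simp add: V_def matrix_transpose_mul K_sym Ki_sym D(1) matrix_mul_assoc)
    then show ?thesis by (simp only: matrix_vector_mul_assoc matrix_mul_assoc)
  qed
  have UV: "(transpose U *v p) \<bullet> (Qi *v (transpose U *v p)) + (transpose V *v p) \<bullet> (Qi *v (transpose V *v p)) = p \<bullet> (Qi *v p)" for p
    unfolding UT VT inner_Qi Ki_K using Dn[of "K *v p"] by (simp only: power2_norm_eq_inner)
  let ?f = "\<lambda>x. \<Sum>j<m. c j * wave (w j) x"
  let ?F = "\<lambda>x. \<Sum>j<m. c j * cwave y (wpath (w j) t) x"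
  \<comment> \<open>The modulation \<open>cis (z \<bullet> b)\<close> has modulus one, but
    completing the square in the Gaussian integral produces from it the cross term (D K v).ka, equal
    to the inner product of y with \<open>wpath v t\<close>: the real exponent of the imaginary
    translation.\<close>
  have one: "(LINT z|\<mu>. wave v (U *v x + V *v z) * cis (z \<bullet> b)) =
      complex_of_real (Z0 * exp (- (norm ka)\<^sup>2 / 2)) * cwave y (wpath v t) x" for v x
  proof -
    let ?a = "K *v v"
    have Uv: "transpose U *v v = wpath v t" unfolding UT K_wpath[symmetric] Ki_K ..
    have "wave v (U *v x + V *v z) * cis (z \<bullet> b) =
       (complex_of_real (exp (v \<bullet> (Qi *v v) / 2)) * cis (x \<bullet> wpath v t)) * cis (z \<bullet> (transpose V *v v + b))" for z
      unfolding wave_cis inner_add_left inner_add_right inner_transpose Uv by (simp only: cis_mult[symmetric] mult.assoc)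
    then have "(LINT z|\<mu>. wave v (U *v x + V *v z) * cis (z \<bullet> b)) =
       (complex_of_real (exp (v \<bullet> (Qi *v v) / 2)) * cis (x \<bullet> wpath v t)) *
       complex_of_real (Z0 * exp (- ((transpose V *v v + b) \<bullet> (Qi *v (transpose V *v v + b))) / 2))"
      by (simp only: integral_mult_right_zero integral_mu_cis)
    also have "(transpose V *v v + b) \<bullet> (Qi *v (transpose V *v v + b)) = (norm (D *v ?a))\<^sup>2 + 2 * (y \<bullet> wpath v t) + (norm ka)\<^sup>2"
    proof -
      have "K *v (transpose V *v v + b) = D *v ?a + ka"
        unfolding matrix_vector_right_distrib VT b_def Ki_K ..
      moreover have "(D *v ?a) \<bullet> ka = y \<bullet> wpath v t"
      proof -
        have "(D *v ?a) \<bullet> ka = ?a \<bullet> (transpose ?M *v (Ki *v y))" by (simp only: inner_transpose D(1) ka)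
        also have "\<dots> = (?M *v ?a) \<bullet> (Ki *v y)" by (simp only: inner_transpose)
        also have "\<dots> = wpath v t \<bullet> (K *v (Ki *v y))" by (simp only: K_wpath[symmetric] inner_transpose K_sym)
        finally show ?thesis by (simp only: Ki_K inner_commute)
      qed
      ultimately show ?thesis
        unfolding inner_Qi by (simp add: inner_add_left inner_add_right power2_norm_eq_inner inner_commute)
    qed
    also have "(complex_of_real (exp (v \<bullet> (Qi *v v) / 2)) * cis (x \<bullet> wpath v t)) *
       complex_of_real (Z0 * exp (- ((norm (D *v ?a))\<^sup>2 + 2 * (y \<bullet> wpath v t) + (norm ka)\<^sup>2) / 2)) =
       complex_of_real (Z0 * exp (- (norm ka)\<^sup>2 / 2)) * cwave y (wpath v t) x"
    proof -
      have perm: "(p * z) * q = r * ((s * z) * u)" if "p * q = r * (s * u)" for p q r s u z :: complex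
        using arg_cong[OF that, of "\<lambda>a. a * z"] by (simp only: mult_ac)
      have q1: "v \<bullet> (Qi *v v) = (norm ?a)\<^sup>2" by (simp only: inner_Qi power2_norm_eq_inner)
      have q2: "wpath v t \<bullet> (Qi *v wpath v t) = (norm (?M *v ?a))\<^sup>2" by (simp only: inner_Qi K_wpath power2_norm_eq_inner)
      have "exp (v \<bullet> (Qi *v v) / 2) * (Z0 * exp (- ((norm (D *v ?a))\<^sup>2 + 2 * (y \<bullet> wpath v t) + (norm ka)\<^sup>2) / 2))
         = (Z0 * exp (- (norm ka)\<^sup>2 / 2)) * (exp (wpath v t \<bullet> (Qi *v wpath v t) / 2) * exp (- (y \<bullet> wpath v t)))"
      proof -
        have "exp (v \<bullet> (Qi *v v) / 2) * exp (- ((norm (D *v ?a))\<^sup>2 + 2 * (y \<bullet> wpath v t) + (norm ka)\<^sup>2) / 2)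
          = exp (- (norm ka)\<^sup>2 / 2) * (exp (wpath v t \<bullet> (Qi *v wpath v t) / 2) * exp (- (y \<bullet> wpath v t)))"
          unfolding exp_add[symmetric] q1 q2 Dn by (rule arg_cong[of _ _ exp]) (simp add: field_simps)
        then show ?thesis by (simp only: mult.assoc mult.left_commute[of _ Z0])
      qed
      then have "complex_of_real (exp (v \<bullet> (Qi *v v) / 2)) * complex_of_real (Z0 * exp (- ((norm (D *v ?a))\<^sup>2 + 2 * (y \<bullet> wpath v t) + (norm ka)\<^sup>2) / 2))
         = complex_of_real (Z0 * exp (- (norm ka)\<^sup>2 / 2)) * (complex_of_real (exp (wpath v t \<bullet> (Qi *v wpath v t) / 2)) * complex_of_real (exp (- (y \<bullet> wpath v t))))"
        by (simp only: of_real_mult[symmetric])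
      then show ?thesis unfolding cwave_def wave_cis by (rule perm)
    qed
    finally show ?thesis .
  qed
  have wi: "integrable \<mu> (\<lambda>z. wave v (U *v x + V *v z) * cis (z \<bullet> b))" for v x
    by (rule integrable_mu_bounded[of _ "exp (v \<bullet> (Qi *v v) / 2)"])
      (auto simp: norm_mult norm_wave intro!: borel_measurable_continuous_onI continuous_intros
        continuous_on_compose2[OF wave_continuous[of UNIV]] matrix_vector_mult_linear_continuous_on)
  have rep: "(LINT z|\<mu>. ?f (U *v x + V *v z) * cis (z \<bullet> b)) = complex_of_real (Z0 * exp (- (norm ka)\<^sup>2 / 2)) * ?F x" for x
  proof -
    have "(LINT z|\<mu>. ?f (U *v x + V *v z) * cis (z \<bullet> b)) = (LINT z|\<mu>. (\<Sum>j<m. c j * (wave (w j) (U *v x + V *v z) * cis (z \<bullet> b))))"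
      by (simp only: sum_distrib_right mult.assoc)
    also have "\<dots> = (\<Sum>j<m. c j * (LINT z|\<mu>. wave (w j) (U *v x + V *v z) * cis (z \<bullet> b)))"
      by (subst Bochner_Integration.integral_sum) (simp_all only: integral_mult_right_zero integrable_mult_right wi)
    finally show ?thesis unfolding one sum_distrib_left by (simp only: mult.left_commute)
  qed
  have tf: "trig_poly ?f" by (rule trig_poly_wave_sum)
  obtain C where C: "\<And>x. cmod (?f x) \<le> C" using trig_poly_bounded[OF tf] by metis
  let ?g = "\<lambda>x. ?f x * cnj (?f x)"
  have tg: "trig_poly ?g" by (intro trig_poly_mult tf trig_poly_cnj)
  have gq: "?g x = complex_of_real ((cmod (?f x))\<^sup>2)" for x by (rule complex_norm_square[symmetric])
  let ?I = "\<lambda>x. LINT z|\<mu>. (cmod (?f (U *v x + V *v z)))\<^sup>2"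
  have gI: "(LINT z|\<mu>. ?g (U *v x + V *v z)) = complex_of_real (?I x)" for x
    unfolding gq by (rule integral_complex_of_real)
  \<comment> \<open>Invariance of the Gaussian is applied to |f|^2, again a trigonometric
    polynomial.\<close>
  note mehler = mehler_invariance[OF UV tg]
  have Ii: "integrable \<mu> ?I" using mehler(1) unfolding gI by (simp only: complex_of_real_integrable_eq)
  have Iv: "(LINT x|\<mu>. ?I x) = Z0 * (LINT x|\<mu>. (cmod (?f x))\<^sup>2)"
  proof -
    have "complex_of_real (LINT x|\<mu>. ?I x) = complex_of_real Z0 * complex_of_real (LINT x|\<mu>. (cmod (?f x))\<^sup>2)"
      using mehler(2) unfolding gI unfolding gq by (simp only: integral_complex_of_real)
    then show ?thesis by (simp only: of_real_mult[symmetric] of_real_eq_iff)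
  qed
  have fc: "continuous_on UNIV (\<lambda>z. ?f (U *v x + V *v z) * cis (z \<bullet> b))" for x
    by (intro continuous_intros continuous_on_compose2[OF wave_continuous[of UNIV]] matrix_vector_mult_linear_continuous_on) auto
  \<comment> \<open>Cauchy-Schwarz in z, after which the modulation disappears because its modulus
    is one.\<close>
  have pw: "(cmod (?F x))\<^sup>2 \<le> (exp ((norm ka)\<^sup>2) / Z0) * ?I x" for x
  proof -
    have "(Z0 * exp (- (norm ka)\<^sup>2 / 2))\<^sup>2 * (cmod (?F x))\<^sup>2 = (cmod (LINT z|\<mu>. ?f (U *v x + V *v z) * cis (z \<bullet> b)))\<^sup>2"
      unfolding rep by (simp only: norm_mult norm_of_real power_mult_distrib power2_abs)
    also have "\<dots> \<le> measure \<mu> UNIV * (LINT z|\<mu>. (cmod (?f (U *v x + V *v z) * cis (z \<bullet> b)))\<^sup>2)"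
    proof (rule mu.norm_integral_square_le)
      show "(\<lambda>z. ?f (U *v x + V *v z) * cis (z \<bullet> b)) \<in> borel_measurable borel" by (rule borel_measurable_continuous_onI[OF fc])
      show "cmod (?f (U *v x + V *v z) * cis (z \<bullet> b)) \<le> C" for z using C by (simp only: norm_mult norm_cis mult_1_right)
      show "measure \<mu> UNIV > 0" using Z0_pos by (simp only: measure_\<mu>)
    qed
    also have "\<dots> = Z0 * ?I x" by (simp only: measure_\<mu> norm_mult norm_cis mult_1_right)
    finally have le: "(Z0 * exp (- (norm ka)\<^sup>2 / 2))\<^sup>2 * (cmod (?F x))\<^sup>2 \<le> Z0 * ?I x" .
    have "(Z0 * exp (- (norm ka)\<^sup>2 / 2))\<^sup>2 = Z0 * Z0 * exp (- (norm ka)\<^sup>2)"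
      by (simp add: power_mult_distrib power2_eq_square[of Z0] exp_double[symmetric])
    with le have "Z0 * (Z0 * (exp (- (norm ka)\<^sup>2) * (cmod (?F x))\<^sup>2)) \<le> Z0 * ?I x" by (simp only: mult.assoc)
    then have "Z0 * (exp (- (norm ka)\<^sup>2) * (cmod (?F x))\<^sup>2) \<le> ?I x" using Z0_pos by (simp only: mult_le_cancel_left_pos)
    then show ?thesis using Z0_pos by (simp add: exp_minus field_simps)
  qed
  have "(LINT x|\<mu>. (cmod (?F x))\<^sup>2) \<le> (LINT x|\<mu>. (exp ((norm ka)\<^sup>2) / Z0) * ?I x)"
  proof (rule integral_mono')
    show "integrable \<mu> (\<lambda>x. (exp ((norm ka)\<^sup>2) / Z0) * ?I x)" by (intro integrable_mult_right Ii)
    show "(cmod (?F x))\<^sup>2 \<le> (exp ((norm ka)\<^sup>2) / Z0) * ?I x" for x by (rule pw)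
    show "0 \<le> (exp ((norm ka)\<^sup>2) / Z0) * ?I x" for x by (rule order_trans[OF zero_le_power2 pw])
  qed
  also have "\<dots> = exp ((norm ka)\<^sup>2) * (LINT x|\<mu>. (cmod (?f x))\<^sup>2)"
    unfolding integral_mult_right_zero Iv using Z0_pos by simp
  also have "\<dots> \<le> exp ((norm (Ki *v y))\<^sup>2 / ct) * (LINT x|\<mu>. (cmod (?f x))\<^sup>2)"
    using kan by (intro mult_right_mono Bochner_Integration.integral_nonneg) auto
  finally show ?thesis .
qed

text \<open>\<open>C\<close> comes from comparing |Ki y| with |y| and from the contraction rate.
  Neither depends on the number of waves, which later permits a passage to the limit.\<close>

lemma complex_translation_bound:
  obtains C k where "C > 0" "\<And>t y c (w :: nat \<Rightarrow> real^'n) m. 0 < t \<Longrightarrow> t \<le> 1 \<Longrightarrow>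
    (LINT x|\<mu>. (cmod (\<Sum>j<m. c j * cwave y (wpath (w j) t) x))\<^sup>2)
    \<le> exp (C * (norm y)\<^sup>2 / t ^ k) * (LINT x|\<mu>. (cmod (\<Sum>j<m. c j * wave (w j) x))\<^sup>2)"
proof -
  obtain c0 k where c: "c0 > 0" "\<And>t. 0 < t \<Longrightarrow> t \<le> 1 \<Longrightarrow> c0 * t ^ k \<le> 1"
    "\<And>t x. 0 < t \<Longrightarrow> t \<le> 1 \<Longrightarrow> (norm (transpose (Em t) *v x))\<^sup>2 \<le> (1 - c0 * t ^ k) * (norm x)\<^sup>2"
    "\<And>t x. 0 < t \<Longrightarrow> t \<le> 1 \<Longrightarrow> (norm (Em t *v x))\<^sup>2 \<le> (1 - c0 * t ^ k) * (norm x)\<^sup>2"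
    using Em_contraction by metis
  obtain b where b: "b > 0" "\<And>x. norm (Ki *v x) \<le> b * norm x" using linear_bounded_pos[of "(*v) Ki"] by auto
  have "(LINT x|\<mu>. (cmod (\<Sum>j<m. a j * cwave y (wpath (w j) t) x))\<^sup>2)
    \<le> exp ((b\<^sup>2 / c0) * (norm y)\<^sup>2 / t ^ k) * (LINT x|\<mu>. (cmod (\<Sum>j<m. a j * wave (w j) x))\<^sup>2)"
    if t: "0 < t" "t \<le> 1" for t y a and w :: "nat \<Rightarrow> real^'n" and m
  proof -
    have ct: "0 < c0 * t ^ k" using c(1) t by simp
    have MT: "(norm (transpose (Em t) *v x))\<^sup>2 \<le> (norm x)\<^sup>2" for x
    proof -
      have "(1 - c0 * t ^ k) * (norm x)\<^sup>2 \<le> 1 * (norm x)\<^sup>2" using ct by (intro mult_right_mono) auto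
      with c(3)[OF t, of x] show ?thesis by linarith
    qed
    have "(norm (Ki *v y))\<^sup>2 \<le> (b * norm y)\<^sup>2" by (intro power_mono b(2)) auto
    then have "(norm (Ki *v y))\<^sup>2 / (c0 * t ^ k) \<le> (b * norm y)\<^sup>2 / (c0 * t ^ k)" using ct by (intro divide_right_mono) auto
    also have "\<dots> = (b\<^sup>2 / c0) * (norm y)\<^sup>2 / t ^ k" by (simp add: power_mult_distrib)
    finally have "exp ((norm (Ki *v y))\<^sup>2 / (c0 * t ^ k)) \<le> exp ((b\<^sup>2 / c0) * (norm y)\<^sup>2 / t ^ k)" by simp
    then have "exp ((norm (Ki *v y))\<^sup>2 / (c0 * t ^ k)) * (LINT x|\<mu>. (cmod (\<Sum>j<m. a j * wave (w j) x))\<^sup>2)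
      \<le> exp ((b\<^sup>2 / c0) * (norm y)\<^sup>2 / t ^ k) * (LINT x|\<mu>. (cmod (\<Sum>j<m. a j * wave (w j) x))\<^sup>2)"
      by (intro mult_right_mono Bochner_Integration.integral_nonneg) auto
    with complex_translation_bound_aux[OF t ct c(4)[OF t] MT] show ?thesis by (rule order_trans)
  qed
  then show thesis using b(1) c(1) by (intro that[of "b\<^sup>2 / c0" k]) auto
qed

end

section \<open>Telescoping\<close>

text \<open>Multiplying the single-time inequality on \<open>[T lam^(m+1), T lam^m]\<close> by \<open>w m\<close> makes the resulting
  inequalities telescope.  The witnesses are \<open>N m\<close> proportional to \<open>\<mu>^m\<close> and \<open>w m = exp (- \<beta> \<mu>^m)\<close>,
  where \<open>\<mu> = lam^(-(k+1))\<close> is close to \<open>1\<close>.\<close>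

lemma telescoping_parameters:
  fixes T c1 c2 a q :: real and k :: nat
  assumes T: "0 < T" "T \<le> 1" and c: "c1 \<ge> 1" "c2 \<ge> 1" and a: "a > 1" and q: "0 < q" "q < 1"
  obtains lam C :: real and w :: "nat \<Rightarrow> real" and N :: "nat \<Rightarrow> nat" where
    "0 < lam" "lam < 1" "C > 0" "\<And>m. 0 < w m" "w \<longlonglongrightarrow> 0" "\<And>m. 0 < N m"
    "\<And>m. w m * (c1 * a ^ N m) \<le> C * (T * lam ^ m * (1 - lam) / 2)"
    "\<And>m. w m * (c1 * q ^ N m * exp (c2 / (T * lam ^ m * (1 - lam) / 2) ^ k)) \<le> w (Suc m)"
proof -
  define La where "La = ln a"
  define Lq where "Lq = - ln q"
  have L: "La > 0" "Lq > 0" using a q by (auto simp: La_def Lq_def)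
  define k' where "k' = Suc k"
  \<comment> \<open>the loss per step of the geometric grid has to be smaller than the gain \<open>Lq\<close>\<close>
  define \<theta> where "\<theta> = min 1 (Lq / (4 * (La + 2)))"
  have \<theta>: "0 < \<theta>" "\<theta> \<le> 1" "2 * (\<theta> * La) \<le> Lq / 2"
  proof -
    show "0 < \<theta>" "\<theta> \<le> 1" using L by (auto simp: \<theta>_def)
    have "\<theta> * (La + 2) \<le> Lq / (4 * (La + 2)) * (La + 2)" using L by (intro mult_right_mono) (auto simp: \<theta>_def)
    also have "\<dots> = Lq / 4"
    proof -
      have "Lq / (4 * u) * u = Lq / 4" if "u > 0" for u :: real using that by simp
      from this[of "La + 2"] show ?thesis using L by simp
    qed
    finally show "2 * (\<theta> * La) \<le> Lq / 2" using \<open>0 < \<theta>\<close> by (simp add: distrib_left)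
  qed
  define \<mu> where "\<mu> = 1 + \<theta>"
  define lam where "lam = root k' (1 / \<mu>)"
  have \<mu>: "\<mu> > 1" using \<theta> by (simp add: \<mu>_def)
  have k': "0 < k'" by (simp add: k'_def)
  have lam: "0 < lam" "lam < 1" "lam ^ k' = 1 / \<mu>"
    using \<mu> k' by (auto simp: lam_def real_root_lt_1_iff)
  define d where "d m = T * lam ^ m * (1 - lam) / 2" for m
  have d: "0 < d m" "d m \<le> 1" for m
  proof -
    show "0 < d m" using T lam by (simp add: d_def)
    have "T * lam ^ m * (1 - lam) \<le> 1 * 1 * 1" using T lam by (intro mult_mono power_le_one) auto
    then show "d m \<le> 1" by (simp add: d_def)
  qed
  define X where "X = T * (1 - lam) / 2"
  have X: "X > 0" using T lam by (simp add: X_def)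
  define D where "D = (1 / X) ^ k'"
  have D: "D > 0" using X by (simp add: D_def)
  have dk: "1 / d m ^ k' = D * \<mu> ^ m" for m
  proof -
    have "(lam ^ m) ^ k' = (1 / \<mu>) ^ m" by (metis lam(3) mult.commute power_mult)
    moreover have "d m = X * lam ^ m" by (simp add: d_def X_def)
    ultimately have "d m ^ k' = X ^ k' * (1 / \<mu>) ^ m" by (simp add: power_mult_distrib)
    then show ?thesis using X \<mu> by (simp only: D_def power_one_over) (simp add: divide_simps)
  qed
  \<comment> \<open>The exponent k + 1 of the grid dominates both powers that occur: the first from
    averaging over an interval of length \<open>d m\<close>, the k-th from the cost of the
    extrapolation.\<close>
  have dk1: "1 / d m \<le> D * \<mu> ^ m" and dkk: "1 / d m ^ k \<le> D * \<mu> ^ m" for m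
    unfolding dk[symmetric] using d[of m] power_decreasing[of 1 k' "d m"] power_decreasing[of k k' "d m"] k'
    by (auto simp: k'_def intro!: divide_left_mono)
  define E where "E = ln c1 + c2 * D + D + 1"
  have E: "E \<ge> 1" using c D by (simp add: E_def)
  \<comment> \<open>So many nodes that the gain \<open>Lq * \<nu>\<close> is at least four times the
    losses collected in \<open>E\<close>.\<close>
  define \<nu> where "\<nu> = max 1 (4 * E / Lq)"
  have \<nu>: "\<nu> \<ge> 1" "\<nu> * Lq \<ge> 4 * E" using L by (auto simp: \<nu>_def max_def field_simps)
  define N where "N m = nat \<lceil>\<nu> * \<mu> ^ m\<rceil>" for m
  have pm: "\<mu> ^ m \<ge> 1" for m using \<mu> by (intro one_le_power) auto
  have np: "\<nu> * \<mu> ^ m \<ge> 1" for m using \<nu>(1) pm[of m] mult_mono[of 1 \<nu> 1 "\<mu> ^ m"] by simp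
  have N: "\<nu> * \<mu> ^ m \<le> real (N m)" "real (N m) \<le> 2 * (\<nu> * \<mu> ^ m)" "0 < N m" for m
    using np[of m] unfolding N_def by linarith+
  \<comment> \<open>The weight has to cancel a^N, where N \<le> 2 \<nu> \<mu>^m, and the remaining
    factors, which \<open>E\<close> covers.\<close>
  define \<beta> where "\<beta> = 2 * \<nu> * La + E"
  have \<beta>: "\<beta> > 0" using \<nu> L E by (simp add: \<beta>_def add_nonneg_pos)
  define w where "w m = exp (- \<beta> * \<mu> ^ m)" for m
  have aN: "a ^ n = exp (La * real n)" "q ^ n = exp (- Lq * real n)" for n
    using a q by (simp_all add: La_def Lq_def exp_of_nat2_mult)
  have c1: "c1 = exp (ln c1)" using c by simp
  show thesis
  proof (rule that[of lam 1 w N])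
    show "0 < lam" "lam < 1" by (rule lam)+
    show "w \<longlonglongrightarrow> 0"
      unfolding w_def[abs_def] using \<beta> \<mu> by real_asymp
    fix m
    show "0 < w m" by (simp add: w_def)
    show "0 < N m" by (rule N(3))
    have "w m * (c1 * a ^ N m) * (1 / d m) \<le> w m * (c1 * a ^ N m) * exp (D * \<mu> ^ m)"
    proof (rule mult_left_mono)
      show "1 / d m \<le> exp (D * \<mu> ^ m)" using dk1[of m] exp_ge_add_one_self[of "D * \<mu> ^ m"] by linarith
    qed (use c a in \<open>simp add: w_def\<close>)
    also have "\<dots> = exp (- \<beta> * \<mu> ^ m + (ln c1 + La * real (N m)) + D * \<mu> ^ m)"
      unfolding w_def aN exp_add using c1 by simp
    also have "\<dots> \<le> exp 0"
    proof (subst exp_le_cancel_iff)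
      have "La * real (N m) \<le> La * (2 * (\<nu> * \<mu> ^ m))" using N(2)[of m] L by (intro mult_left_mono) auto
      moreover have "ln c1 \<le> ln c1 * \<mu> ^ m" using c pm[of m] by (simp add: mult_le_cancel_left1)
      moreover have "0 \<le> (c2 * D + 1) * \<mu> ^ m" using c D \<mu> by simp
      ultimately show "- \<beta> * \<mu> ^ m + (ln c1 + La * real (N m)) + D * \<mu> ^ m \<le> 0"
        unfolding \<beta>_def E_def by (simp add: algebra_simps)
    qed
    finally show "w m * (c1 * a ^ N m) \<le> 1 * (T * lam ^ m * (1 - lam) / 2)"
      unfolding d_def[symmetric] using d(1)[of m] by (simp add: divide_le_eq)
    have "w m * (c1 * q ^ N m * exp (c2 / d m ^ k)) = exp (- \<beta> * \<mu> ^ m + (ln c1 - Lq * real (N m) + c2 / d m ^ k))"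
      unfolding w_def aN exp_add exp_diff using c1 by (simp add: exp_minus field_simps)
    also have "\<dots> \<le> exp (- \<beta> * \<mu> ^ Suc m)"
    proof (subst exp_le_cancel_iff)
      have 1: "Lq * (\<nu> * \<mu> ^ m) \<le> Lq * real (N m)" using N(1)[of m] L by (intro mult_left_mono) auto
      have 2: "c2 / d m ^ k \<le> c2 * D * \<mu> ^ m" using mult_left_mono[OF dkk[of m], of c2] c by simp
      have 3: "ln c1 \<le> ln c1 * \<mu> ^ m" using c pm[of m] by (simp add: mult_le_cancel_left1)
      \<comment> \<open>The change of the weight costs \<beta> \<theta>. Its main part 2 \<nu> La
        \<theta> is at most half of the gain by the choice of \<theta>; the other half pays for the
        rest, at most 2 E.\<close>
      have 4: "\<beta> * \<theta> + ln c1 + c2 * D \<le> Lq * \<nu>"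
      proof -
        have "\<beta> * \<theta> = \<nu> * (2 * (\<theta> * La)) + E * \<theta>" by (simp add: \<beta>_def algebra_simps)
        also have "E * \<theta> \<le> E * 1" using \<theta> E by (intro mult_left_mono) auto
        finally have "\<beta> * \<theta> \<le> \<nu> * (2 * (\<theta> * La)) + E" by simp
        moreover have "\<nu> * (2 * (\<theta> * La)) \<le> \<nu> * (Lq / 2)"
          using \<theta>(3) \<nu> by (intro mult_left_mono) auto
        moreover have "ln c1 + c2 * D \<le> E" using D by (simp add: E_def)
        ultimately show ?thesis using \<nu>(2) by (simp add: mult.commute)
      qed
      have "(\<beta> * \<theta> + ln c1 + c2 * D) * \<mu> ^ m \<le> (Lq * \<nu>) * \<mu> ^ m"
        using 4 \<mu> by (intro mult_right_mono) auto
      then show "- \<beta> * \<mu> ^ m + (ln c1 - Lq * real (N m) + c2 / d m ^ k) \<le> - \<beta> * \<mu> ^ Suc m"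
        using 1 2 3 unfolding \<mu>_def[symmetric] power_Suc by (simp add: \<mu>_def algebra_simps)
    qed
    finally show "w m * (c1 * q ^ N m * exp (c2 / (T * lam ^ m * (1 - lam) / 2) ^ k)) \<le> w (Suc m)"
      unfolding d_def[symmetric] w_def .
  qed simp
qed

section \<open>Observability at a single time\<close>

lemma L2_mono:
  assumes g: "g \<in> L2_space M" and f: "f \<in> borel_measurable M" and le: "\<And>x. x \<in> space M \<Longrightarrow> cmod (f x) \<le> cmod (g x)"
  shows "f \<in> L2_space M" "L2_norm M f \<le> L2_norm M g"
proof -
  have ae: "AE x in M. (cmod (f x))\<^sup>2 \<le> (cmod (g x))\<^sup>2" by (intro AE_I2 power_mono le) auto
  have i: "integral\<^sup>L M (\<lambda>x. (cmod (g x))\<^sup>2) \<le> (L2_norm M g)\<^sup>2" by (simp add: L2_norm_sq)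
  show "f \<in> L2_space M" "L2_norm M f \<le> L2_norm M g"
    using L2_norm_le_integral[OF f L2_space_integrable[OF g] L2_norm_nonneg ae i] by blast+
qed

lemma L2_indicator:
  assumes f: "f \<in> L2_space M" and A: "A \<in> sets M"
  shows "(\<lambda>x. indicator A x * f x) \<in> L2_space M" "L2_norm M (\<lambda>x. indicator A x * f x) \<le> L2_norm M f"
proof -
  have [measurable]: "f \<in> borel_measurable M" "A \<in> sets M" using A L2_space_measurable[OF f] by auto
  have m: "(\<lambda>x. indicator A x * f x) \<in> borel_measurable M" by measurable
  have "cmod (indicator A x * f x) \<le> cmod (f x)" for x by (simp add: indicator_def)
  then show "(\<lambda>x. indicator A x * f x) \<in> L2_space M" "L2_norm M (\<lambda>x. indicator A x * f x) \<le> L2_norm M f"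
    using L2_mono[OF f m] by blast+
qed

lemma L2_norm_restrict_space:
  assumes "A \<in> sets M"
  shows "L2_norm (restrict_space M A) f = L2_norm M (\<lambda>x. indicator A x * f x)"
proof -
  have "(LINT x|restrict_space M A. (cmod (f x))\<^sup>2) = (LINT x|M. indicator A x *\<^sub>R (cmod (f x))\<^sup>2)"
    using assms by (intro integral_restrict_space) (simp add: sets.Int_space_eq2)
  also have "(\<lambda>x. indicator A x *\<^sub>R (cmod (f x))\<^sup>2) = (\<lambda>x. (cmod (indicator A x * f x))\<^sup>2)"
    by (auto simp: indicator_def fun_eq_iff)
  finally show ?thesis by (simp add: L2_norm_def)
qed

lemma L2_norm_le_sum_cover:
  assumes f: "f \<in> L2_space M" and D: "finite D" and Y: "\<And>d. d \<in> D \<Longrightarrow> Y d \<in> sets M" and cover: "\<And>x. x \<in> space M \<Longrightarrow> \<exists>d\<in>D. x \<in> Y d"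
  shows "L2_norm M f \<le> (\<Sum>d\<in>D. L2_norm M (\<lambda>x. indicator (Y d) x * f x))"
proof -
  let ?h = "\<lambda>d x. complex_of_real (cmod (indicator (Y d) x * f x))"
  have fm: "f \<in> borel_measurable M" using L2_space_measurable[OF f] .
  have h: "?h d \<in> L2_space M" "L2_norm M (?h d) = L2_norm M (\<lambda>x. indicator (Y d) x * f x)" if "d \<in> D" for d
  proof -
    have "(\<lambda>x. indicator (Y d) x * f x) \<in> borel_measurable M"
      using L2_space_measurable[OF L2_indicator(1)[OF f Y[OF that]]] .
    then have "?h d \<in> borel_measurable M" by measurable
    then show "?h d \<in> L2_space M" by (rule L2_mono(1)[OF L2_indicator(1)[OF f Y[OF that]]]) simp
    show "L2_norm M (?h d) = L2_norm M (\<lambda>x. indicator (Y d) x * f x)" by (simp add: L2_norm_def)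
  qed
  have "L2_norm M f \<le> L2_norm M (\<lambda>x. \<Sum>d\<in>D. ?h d x)"
  proof (rule L2_mono(2)[OF L2_sum(1)[OF D h(1)] fm])
    fix x assume "x \<in> space M"
    then obtain d where d: "d \<in> D" "x \<in> Y d" using cover by blast
    have "cmod (f x) = cmod (indicator (Y d) x * f x)" using d by simp
    also have "\<dots> \<le> (\<Sum>d\<in>D. cmod (indicator (Y d) x * f x))"
      using D d by (intro member_le_sum[of d D "\<lambda>d. cmod (indicator (Y d) x * f x)"]) auto
    also have "\<dots> = cmod (\<Sum>d\<in>D. ?h d x)"
      unfolding of_real_sum[symmetric] norm_of_real by (subst abs_of_nonneg) (auto intro: sum_nonneg)
    finally show "cmod (f x) \<le> cmod (\<Sum>d\<in>D. ?h d x)" .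
  qed
  also have "\<dots> \<le> (\<Sum>d\<in>D. L2_norm M (?h d))" by (rule L2_sum(2)[OF D h(1)])
  finally show ?thesis using h(2) by simp
qed

text \<open>\<open>D\<close> is a finite r/2-net of the ball of radius \<delta>, and
  \<open>Y d\<close> consists of the points that d carries to within r/2 of the centre of a ball of
  radius r contained in \<open>\<omega>\<close>. Prolonging the step by a factor up to 1 + \<eta>
  adds at most \<eta> \<delta> \<le> r/2, so all nodes stay in that ball.\<close>

lemma thick_set_cover:
  fixes \<omega> :: "(real^'n) set"
  assumes \<delta>: "\<delta> > 0" and r: "r > 0" and thick: "\<And>y. \<exists>y'\<in>\<omega>. ball y' r \<subseteq> \<omega> \<and> norm (y - y') < \<delta>"
  obtains D :: "(real^'n) set" and Y :: "real^'n \<Rightarrow> (real^'n) set" and \<eta> where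
    "finite D" "\<And>d. d \<in> D \<Longrightarrow> norm d \<le> \<delta>" "\<And>d. open (Y d)" "\<And>x. \<exists>d\<in>D. x \<in> Y d" "0 < \<eta>" "\<eta> \<le> 1"
    "\<And>d x s. d \<in> D \<Longrightarrow> x \<in> Y d \<Longrightarrow> 1 \<le> s \<Longrightarrow> s \<le> 1 + \<eta> \<Longrightarrow> x + s *\<^sub>R d \<in> \<omega>"
proof -
  have "\<exists>k. finite k \<and> k \<subseteq> cball (0::real^'n) \<delta> \<and> cball 0 \<delta> \<subseteq> (\<Union>x\<in>k. ball x (r / 2))"
    using seq_compact_imp_totally_bounded[OF compact_imp_seq_compact[OF compact_cball[of "0::real^'n" \<delta>]]] r
    by (auto dest: spec[of _ "r / 2"])
  then obtain D where D: "finite D" "D \<subseteq> cball (0::real^'n) \<delta>" "cball 0 \<delta> \<subseteq> (\<Union>x\<in>D. ball x (r / 2))" by blast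
  define Y where "Y d = (\<Union>y'\<in>{y'. ball y' r \<subseteq> \<omega>}. ball (y' - d) (r / 2))" for d
  define \<eta> where "\<eta> = min 1 (r / (2 * \<delta>))"
  show thesis
  proof (rule that[of D Y \<eta>])
    show "finite D" by (rule D(1))
    show nd: "norm d \<le> \<delta>" if "d \<in> D" for d using D(2) that by auto
    show "open (Y d)" for d unfolding Y_def by auto
    show "0 < \<eta>" "\<eta> \<le> 1" using r \<delta> by (auto simp: \<eta>_def)
    show "\<exists>d\<in>D. x \<in> Y d" for x
    proof -
      obtain y' where y': "ball y' r \<subseteq> \<omega>" "norm (x - y') < \<delta>" using thick[of x] by blast
      then have "y' - x \<in> cball 0 \<delta>" by (simp add: norm_minus_commute)
      then obtain d where d: "d \<in> D" "y' - x \<in> ball d (r / 2)" using D(3) by blast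
      then have "x \<in> ball (y' - d) (r / 2)" by (simp add: dist_norm norm_minus_commute algebra_simps)
      then show ?thesis using d(1) y'(1) unfolding Y_def by blast
    qed
    show "x + s *\<^sub>R d \<in> \<omega>" if d: "d \<in> D" and x: "x \<in> Y d" and s: "1 \<le> s" "s \<le> 1 + \<eta>" for d x s
    proof -
      obtain y' where y': "ball y' r \<subseteq> \<omega>" "x \<in> ball (y' - d) (r / 2)" using x unfolding Y_def by blast
      have n: "norm (y' - d - x) < r / 2" using y'(2) by (simp add: dist_norm)
      have "norm (y' - (x + s *\<^sub>R d)) \<le> norm (y' - d - x) + norm ((s - 1) *\<^sub>R d)"
        using norm_triangle_ineq4[of "y' - d - x" "(s - 1) *\<^sub>R d"] by (simp add: algebra_simps)
      moreover have "norm ((s - 1) *\<^sub>R d) \<le> r / 2"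
      proof -
        have "norm ((s - 1) *\<^sub>R d) = (s - 1) * norm d" using s by simp
        also have "\<dots> \<le> \<eta> * \<delta>" using s nd[OF d] by (intro mult_mono) auto
        also have "\<dots> \<le> r / (2 * \<delta>) * \<delta>" using \<delta> by (intro mult_right_mono) (auto simp: \<eta>_def)
        also have "\<dots> = r / 2" using \<delta> by simp
        finally show ?thesis .
      qed
      ultimately have "x + s *\<^sub>R d \<in> ball y' r" using n by (simp add: dist_norm)
      then show ?thesis using y'(1) by blast
    qed
  qed
qed

text \<open>The pointwise extrapolation error is integrated over x. Its bound is a mean over the
  circle |\<zeta>| = R, and Fubini reduces it to the hypothesis \<open>bound\<close> at each
  \<zeta>. For x in \<open>Y\<close> all nodes lie in \<open>\<Omega>\<close>, and translation does
  not increase the norm of v restricted to \<open>\<Omega>\<close>.\<close>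

lemma extrapolation_L2:
  fixes \<Phi> :: "real^'n \<Rightarrow> complex \<Rightarrow> complex" and v :: "real^'n \<Rightarrow> complex" and l s :: "nat \<Rightarrow> real"
  assumes hol: "\<And>x. \<Phi> x holomorphic_on UNIV" and cont: "continuous_on UNIV (\<lambda>p. \<Phi> (fst p) (snd p))"
    and real: "\<And>x a. \<Phi> x (complex_of_real a) = v (x + a *\<^sub>R d)"
    and bound: "\<And>\<zeta>. cmod \<zeta> \<le> R \<Longrightarrow> (\<integral>\<^sup>+x. ennreal ((cmod (\<Phi> x \<zeta>))\<^sup>2) \<partial>lborel) \<le> ennreal (K\<^sup>2)"
    and K: "K \<ge> 0" and R: "R \<ge> 4"
    and l: "\<And>k. k < N \<Longrightarrow> (\<Sum>j<N. l j * s j ^ k) = 0 ^ k"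
    and lA: "(\<Sum>j<N. \<bar>l j\<bar>) \<le> A" and s: "\<And>j. j < N \<Longrightarrow> \<bar>s j\<bar> \<le> 2"
    and N: "N > 0"
    and Y: "Y \<in> sets borel" and \<Omega>: "\<Omega> \<in> sets borel" and shift: "\<And>x j. x \<in> Y \<Longrightarrow> j < N \<Longrightarrow> x + s j *\<^sub>R d \<in> \<Omega>"
  shows "L2_norm lborel (\<lambda>x. indicator Y x * v x) \<le> A * L2_norm lborel (\<lambda>x. indicator \<Omega> x * v x) + 2 * A * (2 / R) ^ N * K"
proof -
  have A0: "A \<ge> 0" using order_trans[OF sum_nonneg lA] by simp
  have \<Phi>x: "continuous_on UNIV (\<lambda>x. \<Phi> x \<zeta>)" for \<zeta>
    using continuous_on_compose2[OF cont, of UNIV "\<lambda>x. (x, \<zeta>)"] by (simp add: continuous_on_Pair)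
  have vm [measurable]: "v \<in> borel_measurable borel"
    using borel_measurable_continuous_onI[OF \<Phi>x[of 0]] real[of _ 0] by simp
  have vL: "v \<in> L2_space lborel"
    using bound[of 0] real[of _ 0] R K by (intro L2_norm_le_nn_integral(1)[of _ _ K]) auto
  note [measurable] = Y \<Omega>
  define e where "e x = v x - (\<Sum>j<N. complex_of_real (l j) * v (x + s j *\<^sub>R d))" for x
  have em [measurable]: "e \<in> borel_measurable borel" unfolding e_def by measurable
  define P where "P x \<tau> = (cmod (\<Phi> x (complex_of_real R * cis \<tau>)))\<^sup>2" for x \<tau>
  have Pc: "continuous_on UNIV (\<lambda>p. P (fst p) (snd p))"
  proof -
    have "continuous_on UNIV (\<lambda>p :: (real^'n) \<times> real. (fst p, complex_of_real R * cis (snd p)))"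
      by (intro continuous_intros)
    from continuous_on_compose2[OF cont this] show ?thesis unfolding P_def by (intro continuous_intros) auto
  qed
  have Pm [measurable]: "case_prod P \<in> borel_measurable (borel \<Otimes>\<^sub>M borel)"
    unfolding borel_prod case_prod_beta' by (rule borel_measurable_continuous_onI[OF Pc])
  have Pcx: "continuous_on {0..2*pi} (P x)" for x
    using continuous_on_compose2[OF Pc, of "{0..2*pi}" "\<lambda>\<tau>. (x, \<tau>)"] by (simp add: continuous_on_Pair)
  have P0: "0 \<le> P x \<tau>" for x \<tau> by (simp add: P_def)
  have e_le: "(cmod (e x))\<^sup>2 \<le> (2 * A * (2 / R) ^ N)\<^sup>2 * (integral {0..2*pi} (P x) / (2 * pi))" for x
    using extrapolation_error[OF hol[of x] R l lA s N] real[of x 0] by (simp add: e_def real P_def[abs_def])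
  have Pnn: "ennreal (integral {0..2*pi} (P x)) = (\<integral>\<^sup>+\<tau>. ennreal (P x \<tau>) * indicator {0..2*pi} \<tau> \<partial>lborel)" for x
  proof -
    have h: "(P x has_integral integral {0..2*pi} (P x)) {0..2*pi}"
      using integrable_continuous_interval[OF Pcx] by (rule integrable_integral)
    have "(\<integral>\<^sup>+\<tau>. ennreal (indicator {0..2*pi} \<tau> * P x \<tau>) \<partial>lborel) = ennreal (integral {0..2*pi} (P x))"
      by (rule nn_integral_has_integral_lebesgue[OF _ h]) (simp add: P_def)
    moreover have "ennreal (indicator {0..2*pi} \<tau> * P x \<tau>) = ennreal (P x \<tau>) * indicator {0..2*pi} \<tau>" for \<tau>
      by (simp add: indicator_def)
    ultimately show ?thesis by simp
  qed
  have "(\<integral>\<^sup>+x. ennreal (integral {0..2*pi} (P x)) \<partial>lborel) = (\<integral>\<^sup>+x. (\<integral>\<^sup>+\<tau>. ennreal (P x \<tau>) * indicator {0..2*pi} \<tau> \<partial>lborel) \<partial>lborel)"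
    by (simp only: Pnn)
  also have "\<dots> = (\<integral>\<^sup>+\<tau>. (\<integral>\<^sup>+x. ennreal (P x \<tau>) * indicator {0..2*pi} \<tau> \<partial>lborel) \<partial>lborel)"
    by (rule lborel_pair.Fubini') measurable
  also have "\<dots> = (\<integral>\<^sup>+\<tau>. (\<integral>\<^sup>+x. ennreal (P x \<tau>) \<partial>lborel) * indicator {0..2*pi} \<tau> \<partial>lborel)"
    by (intro nn_integral_cong nn_integral_multc) measurable
  also have "\<dots> \<le> (\<integral>\<^sup>+\<tau>. ennreal (K\<^sup>2) * indicator {0..2*pi} \<tau> \<partial>lborel)"
    unfolding P_def using R by (intro nn_integral_mono mult_right_mono bound) (auto simp: norm_mult)
  also have "\<dots> = ennreal (K\<^sup>2) * ennreal (2 * pi)"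
    by (subst nn_integral_cmult_indicator) auto
  finally have Pint: "(\<integral>\<^sup>+x. ennreal (integral {0..2*pi} (P x)) \<partial>lborel) \<le> ennreal (K\<^sup>2 * (2 * pi))"
    by (simp add: ennreal_mult)
  have eL: "e \<in> L2_space lborel" "L2_norm lborel e \<le> 2 * A * (2 / R) ^ N * K"
  proof -
    let ?q = "(2 * A * (2 / R) ^ N)\<^sup>2 / (2 * pi)"
    have Im: "(\<lambda>x. ennreal (integral {0..2*pi} (P x))) \<in> borel_measurable lborel"
      unfolding Pnn by measurable
    have "(\<integral>\<^sup>+x. ennreal ((cmod (e x))\<^sup>2) \<partial>lborel) \<le> (\<integral>\<^sup>+x. ennreal ?q * ennreal (integral {0..2*pi} (P x)) \<partial>lborel)"
    proof (rule nn_integral_mono)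
      fix x
      have "(cmod (e x))\<^sup>2 \<le> ?q * integral {0..2*pi} (P x)" using e_le[of x] by simp
      then show "ennreal ((cmod (e x))\<^sup>2) \<le> ennreal ?q * ennreal (integral {0..2*pi} (P x))"
        by (subst ennreal_mult''[symmetric]) (auto intro!: ennreal_leI integral_nonneg integrable_continuous_interval Pcx simp: P0)
    qed
    also have "\<dots> = ennreal ?q * (\<integral>\<^sup>+x. ennreal (integral {0..2*pi} (P x)) \<partial>lborel)"
      by (rule nn_integral_cmult[OF Im])
    also have "\<dots> \<le> ennreal ?q * ennreal (K\<^sup>2 * (2 * pi))" by (rule mult_left_mono[OF Pint]) simp
    also have "\<dots> = ennreal ((2 * A * (2 / R) ^ N * K)\<^sup>2)"
      by (subst ennreal_mult''[symmetric]) (auto simp: power_mult_distrib)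
    finally have le: "(\<integral>\<^sup>+x. ennreal ((cmod (e x))\<^sup>2) \<partial>lborel) \<le> ennreal ((2 * A * (2 / R) ^ N * K)\<^sup>2)" .
    have c: "0 \<le> 2 * A * (2 / R) ^ N * K" using A0 K R by simp
    have "e \<in> borel_measurable lborel" by simp
    from L2_norm_le_nn_integral[OF this c le] show "e \<in> L2_space lborel" "L2_norm lborel e \<le> 2 * A * (2 / R) ^ N * K" by blast+
  qed
  let ?u = "\<lambda>x. indicator \<Omega> x * v x"
  have uL: "?u \<in> L2_space lborel" using L2_indicator(1)[OF vL] \<Omega> by simp
  have tr: "(\<lambda>x. ?u (x + c)) \<in> L2_space lborel" "L2_norm lborel (\<lambda>x. ?u (x + c)) \<le> L2_norm lborel ?u" for c
  proof -
    have m: "(\<lambda>x. ?u (x + c)) \<in> borel_measurable lborel" by measurable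
    have "(\<integral>\<^sup>+x. ennreal ((cmod (?u (x + c)))\<^sup>2) \<partial>lborel) = (\<integral>\<^sup>+x. ennreal ((cmod (?u x))\<^sup>2) \<partial>lborel)"
      by (rule nn_integral_translate[of "\<lambda>x. ennreal ((cmod (?u x))\<^sup>2)" c]) measurable
    also have "\<dots> = ennreal ((L2_norm lborel ?u)\<^sup>2)" by (rule nn_integral_L2[OF uL])
    finally have "(\<integral>\<^sup>+x. ennreal ((cmod (?u (x + c)))\<^sup>2) \<partial>lborel) \<le> ennreal ((L2_norm lborel ?u)\<^sup>2)" by simp
    from L2_norm_le_nn_integral[OF m L2_norm_nonneg this]
    show "(\<lambda>x. ?u (x + c)) \<in> L2_space lborel" "L2_norm lborel (\<lambda>x. ?u (x + c)) \<le> L2_norm lborel ?u" by blast+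
  qed
  let ?S = "\<lambda>x. \<Sum>j<N. complex_of_real (l j) * ?u (x + s j *\<^sub>R d)"
  have SL: "?S \<in> L2_space lborel" by (intro L2_sum(1) L2_scale(1) tr(1)) simp
  have Sn: "L2_norm lborel ?S \<le> A * L2_norm lborel ?u"
  proof -
    have "L2_norm lborel ?S \<le> (\<Sum>j<N. L2_norm lborel (\<lambda>x. complex_of_real (l j) * ?u (x + s j *\<^sub>R d)))"
      by (intro L2_sum(2) L2_scale(1) tr(1)) simp
    also have "\<dots> \<le> (\<Sum>j<N. \<bar>l j\<bar> * L2_norm lborel ?u)"
    proof (rule sum_mono)
      fix j
      show "L2_norm lborel (\<lambda>x. complex_of_real (l j) * ?u (x + s j *\<^sub>R d)) \<le> \<bar>l j\<bar> * L2_norm lborel ?u"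
        unfolding L2_scale(2)[OF tr(1)] norm_of_real by (intro mult_left_mono tr(2)) auto
    qed
    also have "\<dots> \<le> A * L2_norm lborel ?u" unfolding sum_distrib_right[symmetric] by (intro mult_right_mono lA) auto
    finally show ?thesis .
  qed
  have "L2_norm lborel (\<lambda>x. indicator Y x * v x) \<le> L2_norm lborel (\<lambda>x. ?S x + e x)"
  proof (rule L2_mono(2)[OF L2_add(1)[OF SL eL(1)]])
    show "(\<lambda>x. indicator Y x * v x) \<in> borel_measurable lborel" by measurable
    fix x
    show "cmod (indicator Y x * v x) \<le> cmod (?S x + e x)"
    \<comment> \<open>On \<open>Y\<close> the samples do not change when v is cut off to
      \<open>\<Omega>\<close>; off \<open>Y\<close> the left side is 0.\<close>
    proof (cases "x \<in> Y")
      case True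
      then have "?S x = (\<Sum>j<N. complex_of_real (l j) * v (x + s j *\<^sub>R d))" by (intro sum.cong) (auto simp: shift)
      then show ?thesis using True by (simp add: e_def)
    qed simp
  qed
  also have "\<dots> \<le> L2_norm lborel ?S + L2_norm lborel e" by (rule L2_add(2)[OF SL eL(1)])
  finally show ?thesis using Sn eL(2) by linarith
qed

section \<open>Observation at one time, for wave sums and for general data\<close>

context fokker_planck
begin

text \<open>Half of the weight is moved to the function, so that Lebesgue measure remains and
  translations become isometries.\<close>

lemma L2_norm_W_lborel:
  fixes f :: "real^'n \<Rightarrow> complex"
  assumes f: "f \<in> borel_measurable borel"
  shows "L2_norm W (\<lambda>x. gd x * f x) = sqrt (1 / c0) * L2_norm lborel (\<lambda>x. sqrt (gd x) * f x)"
proof -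
  have "(LINT x|\<mu>. (cmod (f x))\<^sup>2) = (LINT x|lborel. (cmod (sqrt (gd x) * f x))\<^sup>2)"
    unfolding \<mu>_def using f by (subst integral_density) (auto simp: less_imp_le norm_mult power_mult_distrib)
  then show ?thesis unfolding L2_weighted(2)[OF f] by (simp add: L2_norm_def)
qed

text \<open>The entire extension of \<open>s \<mapsto> sqrt (gd (x + s d)) * wave w (x + s d)\<close>.\<close>

definition wave_ext :: "real^'n \<Rightarrow> real^'n \<Rightarrow> real^'n \<Rightarrow> complex \<Rightarrow> complex" where
  "wave_ext d w x \<zeta> = exp (complex_of_real (w \<bullet> (Qi *v w) / 2) + \<i> * (complex_of_real (x \<bullet> w) + \<zeta> * complex_of_real (d \<bullet> w))
     - (complex_of_real (x \<bullet> (A *v x)) + 2 * \<zeta> * complex_of_real (d \<bullet> (A *v x)) + \<zeta>\<^sup>2 * complex_of_real (d \<bullet> (A *v d))) / 4)"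

lemma wave_ext_holomorphic: "wave_ext d w x holomorphic_on S"
  unfolding wave_ext_def[abs_def] by (intro holomorphic_intros) auto

lemma wave_ext_continuous: "continuous_on S (\<lambda>p. wave_ext d w (fst p) (snd p))"
  unfolding wave_ext_def
  by (intro continuous_intros continuous_on_compose2[OF matrix_vector_mult_linear_continuous_on[of UNIV A]]) auto

lemma quadratic_shift: "(x + s *\<^sub>R d) \<bullet> (A *v (x + s *\<^sub>R d)) = x \<bullet> (A *v x) + 2 * s * (d \<bullet> (A *v x)) + s\<^sup>2 * (d \<bullet> (A *v d))"
proof -
  have "x \<bullet> (A *v d) = d \<bullet> (A *v x)" using symmetric_matrix_inner[OF A_sym, of x d] by (simp only: inner_commute)
  then show ?thesis
    by (simp add: matrix_vector_right_distrib matrix_vector_mult_scaleR inner_add_left inner_add_right power2_eq_square algebra_simps)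
qed

text \<open>Separates modulus, phase and imaginary translation. In the imaginary direction the
  Gaussian half-density contributes exp(\<tau>^2 d.(A d) / 4), which is bounded on a disc of fixed
  radius.\<close>

lemma wave_ext_eq:
  "wave_ext d w x (Complex s \<tau>) =
    (complex_of_real (exp (- ((x + s *\<^sub>R d) \<bullet> (A *v (x + s *\<^sub>R d))) / 4 + \<tau>\<^sup>2 * (d \<bullet> (A *v d)) / 4)) * cis (- \<tau> * (d \<bullet> (A *v (x + s *\<^sub>R d))) / 2))
     * cwave (\<tau> *\<^sub>R d) w (x + s *\<^sub>R d)"
proof -
  have "d \<bullet> (A *v (x + s *\<^sub>R d)) = d \<bullet> (A *v x) + s * (d \<bullet> (A *v d))"
    by (simp add: matrix_vector_right_distrib matrix_vector_mult_scaleR inner_add_right)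
  then have d2: "(d \<bullet> (A *v (x + s *\<^sub>R d))) = d \<bullet> (A *v x) + s * (d \<bullet> (A *v d))" .
  show ?thesis
    unfolding wave_ext_def cwave_def wave_def cis_conv_exp exp_of_real[symmetric] exp_add[symmetric] quadratic_shift d2
    by (rule arg_cong[of _ _ exp]) (simp add: complex_eq_iff power2_eq_square inner_add_left algebra_simps add_divide_distrib diff_divide_distrib)
qed

lemma sqrt_gd: "sqrt (gd x) = exp (- (x \<bullet> (A *v x)) / 4)"
proof -
  have "gd x = (exp (- (x \<bullet> (A *v x)) / 4))\<^sup>2" by (simp add: gd_def exp_double[symmetric])
  then show ?thesis by simp
qed

lemma wave_ext_real: "wave_ext d w x (complex_of_real a) = sqrt (gd (x + a *\<^sub>R d)) * wave w (x + a *\<^sub>R d)"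
  using wave_ext_eq[of d w x a 0] by (simp add: sqrt_gd cwave_def Complex_eq)

lemma norm_wave_ext_sum:
  fixes m :: nat
  shows "(cmod (\<Sum>j<m. c j * wave_ext d (w j) x (Complex s \<tau>)))\<^sup>2 =
    exp (\<tau>\<^sup>2 * (d \<bullet> (A *v d)) / 2) * (gd (x + s *\<^sub>R d) * (cmod (\<Sum>j<m. c j * cwave (\<tau> *\<^sub>R d) (w j) (x + s *\<^sub>R d)))\<^sup>2)"
proof -
  let ?y = "x + s *\<^sub>R d"
  let ?e = "- (?y \<bullet> (A *v ?y)) / 4 + \<tau>\<^sup>2 * (d \<bullet> (A *v d)) / 4"
  let ?p = "complex_of_real (exp ?e) * cis (- \<tau> * (d \<bullet> (A *v ?y)) / 2)"
  have "(\<Sum>j<m. c j * wave_ext d (w j) x (Complex s \<tau>)) = ?p * (\<Sum>j<m. c j * cwave (\<tau> *\<^sub>R d) (w j) ?y)"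
    unfolding wave_ext_eq sum_distrib_left by (intro sum.cong refl) (simp only: mult_ac)
  then have "(cmod (\<Sum>j<m. c j * wave_ext d (w j) x (Complex s \<tau>)))\<^sup>2 = (exp ?e)\<^sup>2 * (cmod (\<Sum>j<m. c j * cwave (\<tau> *\<^sub>R d) (w j) ?y))\<^sup>2"
    by (simp only: norm_mult norm_cis mult_1_right norm_of_real abs_exp_cancel power_mult_distrib)
  also have "(exp ?e)\<^sup>2 = exp (\<tau>\<^sup>2 * (d \<bullet> (A *v d)) / 2) * gd ?y"
    unfolding gd_def exp_double[symmetric] exp_add[symmetric] by (rule arg_cong[of _ _ exp]) (simp add: field_simps)
  finally show ?thesis by (simp only: mult.assoc)
qed

lemma cwave_continuous: "continuous_on S (cwave y w)"
  unfolding cwave_def[abs_def] by (intro continuous_intros wave_continuous)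

text \<open>The real part s drops out because real translations preserve Lebesgue measure; only the
  imaginary part has a cost.\<close>

lemma nn_integral_wave_ext:
  fixes m :: nat
  shows "(\<integral>\<^sup>+x. ennreal ((cmod (\<Sum>j<m. c j * wave_ext d (w j) x (Complex s \<tau>)))\<^sup>2) \<partial>lborel) =
    ennreal (exp (\<tau>\<^sup>2 * (d \<bullet> (A *v d)) / 2) * (LINT x|\<mu>. (cmod (\<Sum>j<m. c j * cwave (\<tau> *\<^sub>R d) (w j) x))\<^sup>2))"
proof -
  let ?H = "\<lambda>x. \<Sum>j<m. c j * cwave (\<tau> *\<^sub>R d) (w j) x"
  have Hc: "continuous_on UNIV ?H" by (intro continuous_intros cwave_continuous)
  have Hm [measurable]: "?H \<in> borel_measurable borel" by (rule borel_measurable_continuous_onI[OF Hc])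
  have Hb: "cmod (?H x) \<le> (\<Sum>j<m. cmod (c j) * (exp (w j \<bullet> (Qi *v w j) / 2) * exp (- ((\<tau> *\<^sub>R d) \<bullet> w j))))" for x
    by (rule sum_norm_le) (simp add: cwave_def norm_mult norm_wave)
  have HL: "?H \<in> L2_space \<mu>"
    by (rule mu.bounded_L2(1)[OF _ Hb]) (simp add: measurable_cong_sets[OF sets_\<mu> refl] Hm)
  let ?e = "exp (\<tau>\<^sup>2 * (d \<bullet> (A *v d)) / 2)"
  have "(\<integral>\<^sup>+x. ennreal ((cmod (\<Sum>j<m. c j * wave_ext d (w j) x (Complex s \<tau>)))\<^sup>2) \<partial>lborel)
      = (\<integral>\<^sup>+x. ennreal ?e * ennreal (gd (x + s *\<^sub>R d) * (cmod (?H (x + s *\<^sub>R d)))\<^sup>2) \<partial>lborel)"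
    unfolding norm_wave_ext_sum by (intro nn_integral_cong ennreal_mult) (auto simp: less_imp_le)
  also have "\<dots> = (\<integral>\<^sup>+x. ennreal ?e * ennreal (gd x * (cmod (?H x))\<^sup>2) \<partial>lborel)"
    by (rule nn_integral_translate[of "\<lambda>x. ennreal ?e * ennreal (gd x * (cmod (?H x))\<^sup>2)" "s *\<^sub>R d"]) measurable
  also have "\<dots> = ennreal ?e * (\<integral>\<^sup>+x. ennreal (gd x) * ennreal ((cmod (?H x))\<^sup>2) \<partial>lborel)"
    by (subst nn_integral_cmult) (auto simp: ennreal_mult'' less_imp_le)
  also have "(\<integral>\<^sup>+x. ennreal (gd x) * ennreal ((cmod (?H x))\<^sup>2) \<partial>lborel) = (\<integral>\<^sup>+x. ennreal ((cmod (?H x))\<^sup>2) \<partial>\<mu>)"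
    unfolding \<mu>_def by (rule nn_integral_density[symmetric]) auto
  also have "\<dots> = ennreal (LINT x|\<mu>. (cmod (?H x))\<^sup>2)" unfolding nn_integral_L2[OF HL] L2_norm_sq ..
  finally show ?thesis by (simp add: ennreal_mult'')
qed

text \<open>The constants do not depend on the number of waves, nor on \<open>t\<close> and
  \<open>N\<close>; the first permits approximation, the others the choice of \<open>N\<close> as a
  function of time.\<close>

lemma wave_sum_observability:
  fixes \<omega> :: "(real^'n) set"
  assumes op: "open \<omega>" and \<delta>: "\<delta> > 0" and r: "r > 0"
    and thick: "\<And>y. \<exists>y'\<in>\<omega>. ball y' r \<subseteq> \<omega> \<and> norm (y - y') < \<delta>"
  obtains a C1 C2 k where "a > 1" "C1 \<ge> 1" "C2 \<ge> 1"
    "\<And>t N c (w :: nat \<Rightarrow> real^'n) (m :: nat). 0 < t \<Longrightarrow> t \<le> 1 \<Longrightarrow> N > 0 \<Longrightarrow>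
      L2_norm W (\<lambda>x. \<Sum>j<m. c j * psi (wpath (w j) t) x)
      \<le> C1 * a ^ N * L2_norm W (\<lambda>x. indicator \<omega> x * (\<Sum>j<m. c j * psi (wpath (w j) t) x))
        + C1 * (1/2) ^ N * exp (C2 / t ^ k) * L2_norm W (\<lambda>x. \<Sum>j<m. c j * psi (w j) x)"
proof -
  obtain D :: "(real^'n) set" and Y and \<eta> where D: "finite D" "\<And>d. d \<in> D \<Longrightarrow> norm d \<le> \<delta>" "\<And>d. open (Y d)" "\<And>x. \<exists>d\<in>D. x \<in> Y d"
    and \<eta>: "0 < \<eta>" "\<eta> \<le> 1" and shift: "\<And>d x s. d \<in> D \<Longrightarrow> x \<in> Y d \<Longrightarrow> 1 \<le> s \<Longrightarrow> s \<le> 1 + \<eta> \<Longrightarrow> x + s *\<^sub>R d \<in> \<omega>"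
    by (rule thick_set_cover[OF \<delta> r thick]) blast
  obtain C k where C: "C > 0" "\<And>t y c (w :: nat \<Rightarrow> real^'n) m. 0 < t \<Longrightarrow> t \<le> 1 \<Longrightarrow>
    (LINT x|\<mu>. (cmod (\<Sum>j<m. c j * cwave y (wpath (w j) t) x))\<^sup>2)
    \<le> exp (C * (norm y)\<^sup>2 / t ^ k) * (LINT x|\<mu>. (cmod (\<Sum>j<m. c j * wave (w j) x))\<^sup>2)"
    by (rule complex_translation_bound) blast
  obtain b where b: "b > 0" "\<And>x. norm (A *v x) \<le> b * norm x" using linear_bounded_pos[of "(*v) A"] by auto
  define a where "a = 4 * exp 1 / \<eta>"
  have a: "a > 1"
  proof -
    have "\<eta> < 4 * exp (1::real)" using \<eta>(2) exp_ge_add_one_self[of "1::real"] by linarith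
    then show ?thesis using \<eta>(1) by (simp add: a_def)
  qed
  \<comment> \<open>The weights sum to at most a^N, and a^N (2/R)^N is 2^-N for this radius. As
    \<open>R\<close> is fixed, the cost of the imaginary translation does not grow with
    \<open>N\<close>.\<close>
  define R where "R = 4 * a"
  have R: "R \<ge> 4" using a by (simp add: R_def)
  define C1 where "C1 = 2 * real (card D) + 1"
  \<comment> \<open>Collects the Gaussian exponent and the translation exponent for |Im \<zeta>|
    \<le> R and |d| \<le> \<delta>; the outer halving is there because \<open>K\<close> bounds a
    norm and not its square.\<close>
  define C2 where "C2 = max 1 ((R\<^sup>2 * (b * \<delta>\<^sup>2) / 2 + C * (R * \<delta>)\<^sup>2) / 2)"
  show thesis
  proof (rule that[of a C1 C2 k])
    show "a > 1" "C1 \<ge> 1" "C2 \<ge> 1" using a by (auto simp: C1_def C2_def)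
    fix t :: real and N :: nat and c and w :: "nat \<Rightarrow> real^'n" and m :: nat
    assume t: "0 < t" "t \<le> 1" and N: "N > 0"
    let ?f = "\<lambda>x. \<Sum>j<m. c j * wave (wpath (w j) t) x"
    let ?g = "\<lambda>x. \<Sum>j<m. c j * wave (w j) x"
    let ?v = "\<lambda>x. sqrt (gd x) * ?f x"
    have fm: "?f \<in> borel_measurable borel" and gm: "?g \<in> borel_measurable borel" by measurable
    define K where "K = exp (C2 / t ^ k) * L2_norm \<mu> ?g"
    have tk: "0 < t ^ k" "t ^ k \<le> 1" using t by (auto simp: power_le_one)
    obtain l where l: "\<And>k. k < N \<Longrightarrow> (\<Sum>j<N. l j * (1 + \<eta> * real j / real N) ^ k) = 0 ^ k"
      and lA: "(\<Sum>j<N. \<bar>l j\<bar>) \<le> a ^ N"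
      using extrapolation_weights[OF \<eta>, where N = N] unfolding a_def by blast
    let ?s = "\<lambda>j. 1 + \<eta> * real j / real N"
    have sb: "1 \<le> ?s j" "?s j \<le> 1 + \<eta>" if "j < N" for j
      using \<eta> that N by (auto simp: field_simps)
    have s2: "\<bar>?s j\<bar> \<le> 2" if "j < N" for j using sb[OF that] \<eta> by linarith
    let ?\<Phi> = "\<lambda>d x \<zeta>. \<Sum>j<m. c j * wave_ext d (wpath (w j) t) x \<zeta>"
    have bound: "(\<integral>\<^sup>+x. ennreal ((cmod (?\<Phi> d x \<zeta>))\<^sup>2) \<partial>lborel) \<le> ennreal (K\<^sup>2)" if d: "d \<in> D" and \<zeta>: "cmod \<zeta> \<le> R" for d \<zeta>
    proof -
      have \<zeta>': "(Im \<zeta>)\<^sup>2 \<le> R\<^sup>2" using order_trans[OF abs_Im_le_cmod \<zeta>] R by (intro abs_le_square_iff[THEN iffD1]) simp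
      have nd: "(norm d)\<^sup>2 \<le> \<delta>\<^sup>2" using D(2)[OF d] by (intro power_mono) auto
      have e1: "(Im \<zeta>)\<^sup>2 * (d \<bullet> (A *v d)) \<le> R\<^sup>2 * (b * \<delta>\<^sup>2)"
      proof (rule mult_mono[OF \<zeta>'])
        have "d \<bullet> (A *v d) \<le> norm d * (b * norm d)"
          by (rule order_trans[OF norm_cauchy_schwarz mult_left_mono[OF b(2)]]) simp
        also have "\<dots> \<le> b * \<delta>\<^sup>2" using mult_left_mono[OF nd less_imp_le[OF b(1)]] by (simp add: power2_eq_square mult_ac)
        finally show "d \<bullet> (A *v d) \<le> b * \<delta>\<^sup>2" .
        show "0 \<le> d \<bullet> (A *v d)" by (simp only: inner_A[of d d] inner_ge_zero)
      qed simp
      have e2: "(norm (Im \<zeta> *\<^sub>R d))\<^sup>2 \<le> (R * \<delta>)\<^sup>2"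
        using mult_mono[OF \<zeta>' nd] by (simp add: power_mult_distrib)
      have "(Im \<zeta>)\<^sup>2 * (d \<bullet> (A *v d)) / 2 + C * (norm (Im \<zeta> *\<^sub>R d))\<^sup>2 / t ^ k \<le> 2 * (C2 / t ^ k)"
      proof -
        have "R\<^sup>2 * (b * \<delta>\<^sup>2) / 2 * t ^ k \<le> R\<^sup>2 * (b * \<delta>\<^sup>2) / 2 * 1"
          using b(1) tk by (intro mult_left_mono) auto
        then have "R\<^sup>2 * (b * \<delta>\<^sup>2) / 2 \<le> R\<^sup>2 * (b * \<delta>\<^sup>2) / 2 / t ^ k" using tk by (simp add: pos_le_divide_eq)
        then have "(Im \<zeta>)\<^sup>2 * (d \<bullet> (A *v d)) / 2 + C * (norm (Im \<zeta> *\<^sub>R d))\<^sup>2 / t ^ k \<le> R\<^sup>2 * (b * \<delta>\<^sup>2) / 2 / t ^ k + C * (R * \<delta>)\<^sup>2 / t ^ k"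
          using e1 divide_right_mono[OF mult_left_mono[OF e2 less_imp_le[OF C(1)]] less_imp_le[OF tk(1)]] by linarith
        also have "\<dots> = (R\<^sup>2 * (b * \<delta>\<^sup>2) / 2 + C * (R * \<delta>)\<^sup>2) / t ^ k" by (simp only: add_divide_distrib)
        also have "\<dots> \<le> (2 * C2) / t ^ k"
        proof (rule divide_right_mono)
          have "(R\<^sup>2 * (b * \<delta>\<^sup>2) / 2 + C * (R * \<delta>)\<^sup>2) / 2 \<le> C2" unfolding C2_def by (rule max.cobounded2)
          moreover have "y \<le> 2 * z" if "y / 2 \<le> z" for y z :: real using that by linarith
          ultimately show "R\<^sup>2 * (b * \<delta>\<^sup>2) / 2 + C * (R * \<delta>)\<^sup>2 \<le> 2 * C2" by blast
        qed (use tk in simp)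
        finally show ?thesis by simp
      qed
      then have ex: "exp ((Im \<zeta>)\<^sup>2 * (d \<bullet> (A *v d)) / 2) * exp (C * (norm (Im \<zeta> *\<^sub>R d))\<^sup>2 / t ^ k) \<le> (exp (C2 / t ^ k))\<^sup>2"
        by (simp only: exp_add[symmetric] exp_double[symmetric] exp_le_cancel_iff)
      have "exp ((Im \<zeta>)\<^sup>2 * (d \<bullet> (A *v d)) / 2) * (LINT x|\<mu>. (cmod (\<Sum>j<m. c j * cwave (Im \<zeta> *\<^sub>R d) (wpath (w j) t) x))\<^sup>2)
         \<le> exp ((Im \<zeta>)\<^sup>2 * (d \<bullet> (A *v d)) / 2) * (exp (C * (norm (Im \<zeta> *\<^sub>R d))\<^sup>2 / t ^ k) * (L2_norm \<mu> ?g)\<^sup>2)"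
        unfolding L2_norm_sq by (intro mult_left_mono C(2) t) auto
      also have "\<dots> \<le> (exp (C2 / t ^ k))\<^sup>2 * (L2_norm \<mu> ?g)\<^sup>2"
        unfolding mult.assoc[symmetric] by (intro mult_right_mono ex) auto
      also have "\<dots> = K\<^sup>2" by (simp add: K_def power_mult_distrib)
      finally show ?thesis
        using nn_integral_wave_ext[where m = m and c = c and d = d and w = "\<lambda>j. wpath (w j) t" and s = "Re \<zeta>" and \<tau> = "Im \<zeta>"] by (simp add: ennreal_leI)
    qed
    have piece: "L2_norm lborel (\<lambda>x. indicator (Y d) x * ?v x)
        \<le> a ^ N * L2_norm lborel (\<lambda>x. indicator \<omega> x * ?v x) + 2 * a ^ N * (2 / R) ^ N * K" if d: "d \<in> D" for d
    proof (rule extrapolation_L2[where \<Phi> = "?\<Phi> d" and d = d and l = l and s = ?s])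
      show "?\<Phi> d x holomorphic_on UNIV" for x by (intro holomorphic_intros wave_ext_holomorphic)
      show "continuous_on UNIV (\<lambda>p. ?\<Phi> d (fst p) (snd p))" by (intro continuous_intros wave_ext_continuous)
      show "?\<Phi> d x (complex_of_real a) = ?v (x + a *\<^sub>R d)" for x a
        unfolding wave_ext_real sum_distrib_left by (intro sum.cong refl) (simp only: mult_ac)
      show "(\<integral>\<^sup>+x. ennreal ((cmod (?\<Phi> d x \<zeta>))\<^sup>2) \<partial>lborel) \<le> ennreal (K\<^sup>2)" if "cmod \<zeta> \<le> R" for \<zeta> by (rule bound[OF d that])
      show "Y d \<in> sets borel" "\<omega> \<in> sets borel" using D(3) op by auto
      show "x + ?s j *\<^sub>R d \<in> \<omega>" if "x \<in> Y d" "j < N" for x j by (rule shift[OF d that(1) sb[OF that(2)]])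
      show "K \<ge> 0" by (simp add: K_def)
    qed (use R l lA s2 N in auto)
    have small: "2 * a ^ N * (2 / R) ^ N = 2 * (1/2) ^ N"
      using a by (simp add: R_def power_divide power_mult_distrib)
    have vL: "?v \<in> L2_space lborel"
    proof -
      obtain d where d: "d \<in> D" using D(4) by blast
      have eq: "?\<Phi> d x 0 = ?v x" for x
        using wave_ext_real[of d _ x 0] by (simp add: sum_distrib_left mult_ac)
      have m: "?v \<in> borel_measurable lborel" using fm by simp
      have "(\<integral>\<^sup>+x. ennreal ((cmod (?v x))\<^sup>2) \<partial>lborel) \<le> ennreal (K\<^sup>2)" using bound[OF d, of 0] R unfolding eq by simp
      from L2_norm_le_nn_integral(1)[OF m _ this] show ?thesis by (simp add: K_def)
    qed
    have "L2_norm lborel ?v \<le> (\<Sum>d\<in>D. L2_norm lborel (\<lambda>x. indicator (Y d) x * ?v x))"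
      by (rule L2_norm_le_sum_cover[OF vL D(1)]) (use D in auto)
    also have "\<dots> \<le> (\<Sum>d\<in>D. a ^ N * L2_norm lborel (\<lambda>x. indicator \<omega> x * ?v x) + 2 * (1/2) ^ N * K)"
      using piece unfolding small by (rule sum_mono)
    also have "\<dots> = real (card D) * (a ^ N * L2_norm lborel (\<lambda>x. indicator \<omega> x * ?v x) + 2 * (1/2) ^ N * K)" by simp
    also have "\<dots> \<le> C1 * a ^ N * L2_norm lborel (\<lambda>x. indicator \<omega> x * ?v x) + C1 * (1/2) ^ N * exp (C2 / t ^ k) * L2_norm \<mu> ?g"
    proof -
      let ?A = "a ^ N * L2_norm lborel (\<lambda>x. indicator \<omega> x * ?v x)" and ?B = "(1/2) ^ N * K"
      have "0 \<le> ?A" "0 \<le> ?B" using a by (auto simp: K_def)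
      then have "real (card D) * ?A \<le> C1 * ?A" "(real (card D) * 2) * ?B \<le> C1 * ?B"
        by (intro mult_right_mono; simp add: C1_def)+
      then have "real (card D) * ?A + (real (card D) * 2) * ?B \<le> C1 * ?A + C1 * ?B" by (rule add_mono)
      then show ?thesis unfolding K_def by (simp only: distrib_left mult.assoc)
    qed
    finally have main: "L2_norm lborel ?v \<le> C1 * a ^ N * L2_norm lborel (\<lambda>x. indicator \<omega> x * ?v x) + C1 * (1/2) ^ N * exp (C2 / t ^ k) * L2_norm \<mu> ?g" .
    let ?z = "sqrt (1 / c0)"
    have z: "0 \<le> ?z" using c0_pos by simp
    have F: "(\<lambda>x. \<Sum>j<m. c j * psi (wpath (w j) t) x) = (\<lambda>x. gd x * ?f x)"
      and G: "(\<lambda>x. \<Sum>j<m. c j * psi (w j) x) = (\<lambda>x. gd x * ?g x)"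
      by (auto simp: psi_def sum_distrib_left mult_ac intro!: sum.cong)
    have n1: "L2_norm W (\<lambda>x. \<Sum>j<m. c j * psi (wpath (w j) t) x) = ?z * L2_norm lborel ?v"
      unfolding F by (rule L2_norm_W_lborel[OF fm])
    have n2: "L2_norm W (\<lambda>x. \<Sum>j<m. c j * psi (w j) x) = ?z * L2_norm \<mu> ?g"
      unfolding G by (rule L2_weighted(2)[OF gm])
    have n3: "L2_norm W (\<lambda>x. indicator \<omega> x * (\<Sum>j<m. c j * psi (wpath (w j) t) x)) = ?z * L2_norm lborel (\<lambda>x. indicator \<omega> x * ?v x)"
    proof -
      have im: "(\<lambda>x. indicator \<omega> x * ?f x) \<in> borel_measurable borel" using fm op by (intro borel_measurable_times borel_measurable_indicator) auto
      have e: "indicator \<omega> x * (\<Sum>j<m. c j * psi (wpath (w j) t) x) = gd x * (indicator \<omega> x * ?f x)" for x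
        using fun_cong[OF F, of x] by (simp only: mult_ac)
      show ?thesis unfolding e L2_norm_W_lborel[OF im] by (simp only: mult_ac)
    qed
    show "L2_norm W (\<lambda>x. \<Sum>j<m. c j * psi (wpath (w j) t) x)
      \<le> C1 * a ^ N * L2_norm W (\<lambda>x. indicator \<omega> x * (\<Sum>j<m. c j * psi (wpath (w j) t) x))
        + C1 * (1/2) ^ N * exp (C2 / t ^ k) * L2_norm W (\<lambda>x. \<Sum>j<m. c j * psi (w j) x)"
      using mult_left_mono[OF main z] unfolding n1 n2 n3 by (simp only: distrib_left mult_ac)
  qed
qed

text \<open>Frequencies may repeat, so the sum runs over list positions; the positive amplitude of
  \<open>wave\<close> is divided out.\<close>

lemma trig_poly_as_wave_sum:
  assumes "trig_poly p"
  obtains c w and m :: nat where "p = (\<lambda>x. \<Sum>j<m. c j * wave (w j) x)"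
proof -
  obtain ps where ps: "\<And>x. p x = (\<Sum>q\<leftarrow>ps. fst q * cis (x \<bullet> snd q))"
    using assms unfolding trig_poly_def by blast
  let ?w = "\<lambda>j. snd (ps ! j)" and ?c = "\<lambda>j. fst (ps ! j) / complex_of_real (exp (snd (ps ! j) \<bullet> (Qi *v snd (ps ! j)) / 2))"
  have "p = (\<lambda>x. \<Sum>j<length ps. ?c j * wave (?w j) x)"
    by (rule ext) (simp add: ps wave_cis sum_list_sum_nth atLeast0LessThan)
  then show thesis by (rule that)
qed

text \<open>Density: g / \<gamma> is approximated by a trigonometric polynomial in L2 of
  \<open>\<mu>\<close>, and every term of the inequality is continuous in g, because
  \<open>S t\<close> is bounded and restriction does not increase the norm.\<close>

lemma single_time_observability:
  fixes \<omega> :: "(real^'n) set"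
  assumes S: "strongly_continuous_semigroup W S" and gen: "infinitesimal_generator W S = fokker_planck_operator Q B"
    and op: "open \<omega>" and \<delta>: "\<delta> > 0" and r: "r > 0"
    and thick: "\<And>y. \<exists>y'\<in>\<omega>. ball y' r \<subseteq> \<omega> \<and> norm (y - y') < \<delta>"
  obtains a C1 C2 k where "a > 1" "C1 \<ge> 1" "C2 \<ge> 1"
    "\<And>t N g. 0 < t \<Longrightarrow> t \<le> 1 \<Longrightarrow> N > 0 \<Longrightarrow> g \<in> L2_space W \<Longrightarrow>
      L2_norm W (S t g) \<le> C1 * a ^ N * L2_norm (restrict_space W \<omega>) (S t g) + C1 * (1/2) ^ N * exp (C2 / t ^ k) * L2_norm W g"
proof -
  obtain a C1 C2 k where a: "a > 1" and C: "C1 \<ge> 1" "C2 \<ge> 1" and main: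
    "\<And>t N c (w :: nat \<Rightarrow> real^'n) (m :: nat). 0 < t \<Longrightarrow> t \<le> 1 \<Longrightarrow> N > 0 \<Longrightarrow>
      L2_norm W (\<lambda>x. \<Sum>j<m. c j * psi (wpath (w j) t) x)
      \<le> C1 * a ^ N * L2_norm W (\<lambda>x. indicator \<omega> x * (\<Sum>j<m. c j * psi (wpath (w j) t) x))
        + C1 * (1/2) ^ N * exp (C2 / t ^ k) * L2_norm W (\<lambda>x. \<Sum>j<m. c j * psi (w j) x)"
    by (rule wave_sum_observability[OF op \<delta> r thick]) blast
  show thesis
  proof (rule that[OF a C])
    fix t :: real and N :: nat and g assume t: "0 < t" "t \<le> 1" and N: "N > 0" and g: "g \<in> L2_space W"
    note SD = strongly_continuous_semigroupD[OF S]
    have U: "L2_bounded_operator W (S t)" using SD(1) t by simp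
    obtain K where K: "K \<ge> 0" "\<And>f. f \<in> L2_space W \<Longrightarrow> L2_norm W (S t f) \<le> K * L2_norm W f"
      using L2_bounded_operatorD(4)[OF U] by blast
    have Ug: "S t g \<in> L2_space W" by (rule L2_bounded_operatorD(1)[OF U g])
    have om: "\<omega> \<in> sets W" using op by (simp add: sets_W)
    define X where "X = C1 * a ^ N"
    define Y where "Y = C1 * (1/2) ^ N * exp (C2 / t ^ k)"
    have X: "X \<ge> 0" "Y \<ge> 0" using a C by (auto simp: X_def Y_def)
    let ?I = "\<lambda>f. L2_norm W (\<lambda>x. indicator \<omega> x * f x)"
    have "L2_norm W (S t g) \<le> X * ?I (S t g) + Y * L2_norm W g + e" if e: "e > 0" for e
    proof -
      \<comment> \<open>The approximation errors enter with the factors K, X K and Y; the summand 1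
        makes the denominator positive.\<close>
      define e' where "e' = e / (K + X * K + Y + 1)"
      have den: "0 < K + X * K + Y + 1" using K(1) X by (intro add_nonneg_pos add_nonneg_nonneg mult_nonneg_nonneg) auto
      have e': "e' > 0" "(K + X * K + Y + 1) * e' = e" using e den by (auto simp: e'_def)
      define h where "h x = g x / complex_of_real (gd x)" for x
      have gh: "g = (\<lambda>x. gd x * h x)" using gd_pos by (auto simp: h_def fun_eq_iff less_imp_neq[OF gd_pos, symmetric])
      have gm: "g \<in> borel_measurable borel" using L2_space_measurable[OF g] by (simp add: measurable_cong_sets[OF sets_W refl])
      have hm: "h \<in> borel_measurable borel" unfolding h_def using gm by measurable
      have hL: "h \<in> L2_space \<mu>" using g gh L2_weighted(1)[OF hm] by simp
      have z: "sqrt (1 / c0) > 0" using c0_pos by simp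
      obtain p where p: "trig_poly p" "L2_norm \<mu> (\<lambda>x. h x - p x) < e' / sqrt (1 / c0)"
        using mu.trig_poly_dense[OF hL] e'(1) z unfolding mu.trig_approximable_def by (meson divide_pos_pos)
      obtain c w and m :: nat where pw: "p = (\<lambda>x. \<Sum>j<m. c j * wave (w j) x)" by (rule trig_poly_as_wave_sum[OF p(1)])
      let ?G = "\<lambda>x. \<Sum>j<m. c j * psi (w j) x" and ?F = "\<lambda>x. \<Sum>j<m. c j * psi (wpath (w j) t) x"
      have GL: "?G \<in> L2_space W" and FL: "?F \<in> L2_space W" by (intro L2_sum(1) L2_scale(1) psi_L2 finite_lessThan)+
      have pm: "p \<in> borel_measurable borel" by (rule borel_measurable_continuous_onI[OF trig_poly_continuous[OF p(1)]])
      have hpm: "(\<lambda>x. h x - p x) \<in> borel_measurable borel" using hm pm by measurable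
      have gG: "g x - ?G x = gd x * (h x - p x)" for x
        using fun_cong[OF gh, of x] by (simp add: pw psi_def sum_distrib_left right_diff_distrib mult_ac)
      have d1: "L2_norm W (\<lambda>x. g x - ?G x) \<le> e'"
        unfolding gG L2_weighted(2)[OF hpm] using p(2) z by (simp add: pos_less_divide_eq mult.commute less_imp_le)
      \<comment> \<open>A vanishing norm is turned into equality almost everywhere, which survives
        finite sums.\<close>
      have psiF: "AE x in W. S t (psi v) x = psi (wpath v t) x" for v
      proof -
        have L: "S t (psi v) \<in> L2_space W" by (rule L2_bounded_operatorD(1)[OF U psi_L2])
        have d: "(\<lambda>x. S t (psi v) x - psi (wpath v t) x) \<in> L2_space W" by (rule L2_diff(1)[OF L psi_L2])
        have "(\<integral>\<^sup>+x. ennreal ((cmod (S t (psi v) x - psi (wpath v t) x))\<^sup>2) \<partial>W) = 0"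
          unfolding nn_integral_L2[OF d] using semigroup_psi[OF S gen, of t v] t by simp
        then have "AE x in W. ennreal ((cmod (S t (psi v) x - psi (wpath v t) x))\<^sup>2) = 0"
          using L2_space_measurable[OF d] by (subst (asm) nn_integral_0_iff_AE) auto
        then show ?thesis by eventually_elim simp
      qed
      have AEF: "AE x in W. S t ?G x = ?F x"
      proof -
        have "AE x in W. \<forall>j\<in>{..<m}. S t (psi (w j)) x = psi (wpath (w j) t) x" by (intro AE_finite_allI psiF) simp
        moreover have "AE x in W. S t ?G x = (\<Sum>j<m. c j * S t (psi (w j)) x)" by (rule L2_bounded_operator_sum[OF U psi_L2])
        ultimately show ?thesis by eventually_elim simp
      qed
      let ?d = "\<lambda>x. S t g x - ?F x"
      have dL: "?d \<in> L2_space W" by (rule L2_diff(1)[OF Ug FL])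
      have d2: "L2_norm W ?d \<le> K * e'"
      proof -
        have UG: "S t ?G \<in> L2_space W" by (rule L2_bounded_operatorD(1)[OF U GL])
        have "L2_norm W ?d = L2_norm W (\<lambda>x. S t g x - S t ?G x)"
          by (rule L2_norm_cong_AE[OF L2_space_measurable[OF dL] L2_space_measurable[OF L2_diff(1)[OF Ug UG]]])
            (use AEF in eventually_elim, simp)
        also have "\<dots> = L2_norm W (S t (\<lambda>x. g x - ?G x))" by (rule L2_bounded_operator_norm_diff[OF U g GL])
        also have "\<dots> \<le> K * L2_norm W (\<lambda>x. g x - ?G x)" by (rule K(2)[OF L2_diff(1)[OF g GL]])
        also have "\<dots> \<le> K * e'" by (rule mult_left_mono[OF d1 K(1)])
        finally show ?thesis .
      qed
      have b1: "L2_norm W (S t g) \<le> L2_norm W ?F + K * e'" using L2_norm_le_add_diff[OF Ug FL] d2 by linarith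
      have b2: "?I ?F \<le> ?I (S t g) + K * e'"
      proof -
        have "?I ?F \<le> ?I (S t g) + L2_norm W (\<lambda>x. indicator \<omega> x * ?F x - indicator \<omega> x * S t g x)"
          by (rule L2_norm_le_add_diff[OF L2_indicator(1)[OF FL om] L2_indicator(1)[OF Ug om]])
        also have "L2_norm W (\<lambda>x. indicator \<omega> x * ?F x - indicator \<omega> x * S t g x) = ?I ?d"
          unfolding L2_norm_minus_commute[of W "\<lambda>x. indicator \<omega> x * ?F x"] by (simp only: right_diff_distrib)
        also have "?I ?d \<le> L2_norm W ?d" by (rule L2_indicator(2)[OF dL om])
        finally show ?thesis using d2 by linarith
      qed
      have b3: "L2_norm W ?G \<le> L2_norm W g + e'"
        using L2_norm_le_add_diff[OF GL g] d1 L2_norm_minus_commute[of W g ?G] by linarith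
      have "L2_norm W (S t g) \<le> (X * ?I ?F + Y * L2_norm W ?G) + K * e'" using b1 main[OF t N, where m = m and c = c and w = w] unfolding X_def Y_def by linarith
      also have "\<dots> \<le> (X * (?I (S t g) + K * e') + Y * (L2_norm W g + e')) + K * e'"
        by (intro add_mono mult_left_mono b2 b3 X order_refl)
      also have "\<dots> \<le> X * ?I (S t g) + Y * L2_norm W g + (K + X * K + Y + 1) * e'"
        using e'(1) by (simp add: algebra_simps)
      finally show ?thesis by (simp only: e'(2))
    qed
    then have "L2_norm W (S t g) \<le> X * ?I (S t g) + Y * L2_norm W g" by (rule field_le_epsilon)
    then show "L2_norm W (S t g) \<le> C1 * a ^ N * L2_norm (restrict_space W \<omega>) (S t g) + C1 * (1/2) ^ N * exp (C2 / t ^ k) * L2_norm W g"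
      unfolding L2_norm_restrict_space[OF om] X_def Y_def .
  qed
qed

end

section \<open>From single times to a time integral\<close>

lemma semigroup_compose:
  assumes S: "strongly_continuous_semigroup M S" and g: "g \<in> L2_space M" and st: "0 \<le> s" "s \<le> t" and A: "A \<in> sets M"
  shows "L2_norm M (\<lambda>x. indicator A x * S t g x) = L2_norm M (\<lambda>x. indicator A x * S (t - s) (S s g) x)"
    and "L2_norm M (S t g) = L2_norm M (S (t - s) (S s g))"
proof -
  note D = strongly_continuous_semigroupD[OF S]
  have L: "S t g \<in> L2_space M" "S (t - s) (S s g) \<in> L2_space M"
    using L2_bounded_operatorD(1)[OF D(1)] g st by auto
  have ae: "AE x in M. S t g x = S (t - s) (S s g) x" using D(3)[of "t - s" s g] st g by simp
  show "L2_norm M (S t g) = L2_norm M (S (t - s) (S s g))"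
    by (rule L2_norm_cong_AE[OF L2_space_measurable[OF L(1)] L2_space_measurable[OF L(2)] ae])
  show "L2_norm M (\<lambda>x. indicator A x * S t g x) = L2_norm M (\<lambda>x. indicator A x * S (t - s) (S s g) x)"
    by (rule L2_norm_cong_AE[OF L2_space_measurable[OF L2_indicator(1)[OF L(1) A]] L2_space_measurable[OF L2_indicator(1)[OF L(2) A]]])
      (use ae in eventually_elim, simp)
qed

text \<open>Strong continuity is given at 0 from the right; writing S(t) - S(s) as S(s) (S(t - s) -
  1) and using the local bound gives continuity from both sides. The observed quantity is thus
  integrable in time.\<close>

lemma semigroup_norm_continuous:
  assumes S: "strongly_continuous_semigroup M S" and g: "g \<in> L2_space M" and A: "A \<in> sets M"
  shows "continuous_on {0..T} (\<lambda>t. L2_norm M (\<lambda>x. indicator A x * S t g x))"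
proof -
  note D = strongly_continuous_semigroupD[OF S]
  obtain K where K: "K \<ge> 1" "\<And>t f. 0 \<le> t \<Longrightarrow> t \<le> T \<Longrightarrow> f \<in> L2_space M \<Longrightarrow> L2_norm M (S t f) \<le> K * L2_norm M f"
    using semigroup_locally_bounded[OF S] by metis
  have SL: "S t f \<in> L2_space M" if "t \<ge> 0" "f \<in> L2_space M" for t f by (rule L2_bounded_operatorD(1)[OF D(1)[OF that(1)] that(2)])
  let ?n = "\<lambda>t. L2_norm M (\<lambda>x. indicator A x * S t g x)"
  have le: "\<bar>?n t - ?n s\<bar> \<le> K * L2_norm M (\<lambda>x. S (t - s) g x - g x)" if st: "0 \<le> s" "s \<le> t" "t \<le> T" for s t
  proof -
    have Lt: "S t g \<in> L2_space M" and Ls: "S s g \<in> L2_space M" and Ld: "S (t - s) g \<in> L2_space M" using SL g st by auto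
    have U: "L2_bounded_operator M (S s)" using D(1) st by simp
    have LU: "S s (S (t - s) g) \<in> L2_space M" using SL[OF st(1) Ld] .
    have ae: "AE x in M. S t g x = S s (S (t - s) g) x" using D(3)[of s "t - s" g] st g by simp
    have "\<bar>?n t - ?n s\<bar> \<le> L2_norm M (\<lambda>x. indicator A x * S t g x - indicator A x * S s g x)"
      by (rule L2_norm_diff_triangle[OF L2_indicator(1)[OF Lt A] L2_indicator(1)[OF Ls A]])
    also have "\<dots> = L2_norm M (\<lambda>x. indicator A x * (S t g x - S s g x))" by (simp only: right_diff_distrib)
    also have "\<dots> \<le> L2_norm M (\<lambda>x. S t g x - S s g x)" by (rule L2_indicator(2)[OF L2_diff(1)[OF Lt Ls] A])
    also have "\<dots> = L2_norm M (\<lambda>x. S s (S (t - s) g) x - S s g x)"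
      by (rule L2_norm_cong_AE[OF L2_space_measurable[OF L2_diff(1)[OF Lt Ls]] L2_space_measurable[OF L2_diff(1)[OF LU Ls]]])
        (use ae in eventually_elim, simp)
    also have "\<dots> = L2_norm M (S s (\<lambda>x. S (t - s) g x - g x))" by (rule L2_bounded_operator_norm_diff[OF U Ld g])
    also have "\<dots> \<le> K * L2_norm M (\<lambda>x. S (t - s) g x - g x)" using K(2) st L2_diff(1)[OF Ld g] by simp
    finally show ?thesis .
  qed
  show ?thesis
    unfolding continuous_on_iff
  proof (intro ballI allI impI)
    fix s e :: real assume s: "s \<in> {0..T}" and e: "e > 0"
    have "eventually (\<lambda>h. L2_norm M (\<lambda>x. S h g x - g x) < e / K) (at_right 0)"
      using order_tendstoD(2)[OF D(4)[OF g], of "e / K"] e K(1) by simp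
    then obtain d where d: "d > 0" "\<And>h. 0 < h \<Longrightarrow> h < d \<Longrightarrow> L2_norm M (\<lambda>x. S h g x - g x) < e / K"
      unfolding eventually_at_right_field by auto
    show "\<exists>d>0. \<forall>t\<in>{0..T}. dist t s < d \<longrightarrow> dist (?n t) (?n s) < e"
    proof (intro exI[of _ d] conjI ballI impI d(1))
      fix t assume t: "t \<in> {0..T}" "dist t s < d"
      have Ke: "K * L2_norm M (\<lambda>x. S h g x - g x) < e" if "0 < h" "h < d" for h
        using d(2)[OF that] K(1) by (simp add: pos_less_divide_eq mult.commute)
      show "dist (?n t) (?n s) < e"
      proof (cases s t rule: linorder_cases)
        case less
        then show ?thesis using le[of s t] Ke[of "t - s"] s t by (simp add: dist_real_def)
      next
        case equal
        then show ?thesis using e by simp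
      next
        case greater
        then show ?thesis using le[of t s] Ke[of "s - t"] s t by (simp add: dist_real_def abs_minus_commute)
      qed
    qed
  qed
qed

text \<open>On the upper half of [\<tau> (m + 1), \<tau> m] the inequality is started from time
  \<tau> (m + 1), so the elapsed time is at least \<open>d m\<close>, half the interval, and the
  exponential cost is uniform. Averaging over this half replaces the observation at one time by an
  integral.\<close>

lemma observability_from_single_time:
  fixes S :: "real \<Rightarrow> ('a \<Rightarrow> complex) \<Rightarrow> 'a \<Rightarrow> complex"
  assumes S: "strongly_continuous_semigroup M S" and A: "A \<in> sets M" and T: "T > 0"
    and a: "a > 1" and C1: "C1 \<ge> 1" and C2: "C2 \<ge> 1"
    and ineq: "\<And>t N g. 0 < t \<Longrightarrow> t \<le> 1 \<Longrightarrow> N > 0 \<Longrightarrow> g \<in> L2_space M \<Longrightarrow>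
      L2_norm M (S t g) \<le> C1 * a ^ N * L2_norm (restrict_space M A) (S t g) + C1 * (1/2) ^ N * exp (C2 / t ^ k) * L2_norm M g"
  shows "\<exists>C>0. \<forall>g\<in>L2_space M. (L2_norm M (S T g))\<^sup>2 \<le> C * (LBINT t:{0..T}. (L2_norm (restrict_space M A) (S t g))\<^sup>2)"
proof -
  note D = strongly_continuous_semigroupD[OF S]
  obtain K where K: "K \<ge> 1" "\<And>t f. 0 \<le> t \<Longrightarrow> t \<le> T \<Longrightarrow> f \<in> L2_space M \<Longrightarrow> L2_norm M (S t f) \<le> K * L2_norm M f"
    using semigroup_locally_bounded[OF S] by metis
  have SL: "S t f \<in> L2_space M" if "t \<ge> 0" "f \<in> L2_space M" for t f by (rule L2_bounded_operatorD(1)[OF D(1)[OF that(1)] that(2)])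
  \<comment> \<open>The single-time inequality is restricted to times up to 1; between
    \<open>T0\<close> and \<open>T\<close> only the local bound \<open>K\<close> is lost.\<close>
  define T0 where "T0 = min T 1"
  have T0: "0 < T0" "T0 \<le> 1" "T0 \<le> T" using T by (auto simp: T0_def)
  \<comment> \<open>\<open>K\<close> carries the solution from the observation time t on to \<tau>
    m, and 2 C1^2 comes from squaring a sum of two terms.\<close>
  define c1 where "c1 = K\<^sup>2 * (2 * C1\<^sup>2)"
  have c1: "c1 \<ge> 1"
  proof -
    have "1 \<le> K\<^sup>2" "1 \<le> C1\<^sup>2" using K(1) C1 by (auto intro: one_le_power)
    then have "1 * 1 \<le> K\<^sup>2 * (2 * C1\<^sup>2)" by (intro mult_mono) auto
    then show ?thesis by (simp add: c1_def)
  qed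
  have c2: "2 * C2 \<ge> 1" using C2 by simp
  have quarter: "0 < (1/4::real)" "(1/4::real) < 1" by auto
  have a2: "a\<^sup>2 > 1" using a by (simp add: one_less_power)
  \<comment> \<open>Squaring turns a, 1/2 and C2 into a^2, 1/4 and 2 C2.\<close>
  obtain lam C :: real and w :: "nat \<Rightarrow> real" and N :: "nat \<Rightarrow> nat" where lam: "0 < lam" "lam < 1" and C: "C > 0"
    and w: "\<And>m. 0 < w m" "w \<longlonglongrightarrow> 0" and N: "\<And>m. 0 < N m"
    and par1: "\<And>m. w m * (c1 * (a\<^sup>2) ^ N m) \<le> C * (T0 * lam ^ m * (1 - lam) / 2)"
    and par2: "\<And>m. w m * (c1 * (1/4) ^ N m * exp (2 * C2 / (T0 * lam ^ m * (1 - lam) / 2) ^ k)) \<le> w (Suc m)"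
    by (rule telescoping_parameters[OF T0(1,2) c1 c2 a2 quarter, of k]) blast
  define \<tau> where "\<tau> m = T0 * lam ^ m" for m
  have \<tau>: "0 < \<tau> m" "\<tau> m \<le> T0" "\<tau> (Suc m) \<le> \<tau> m" for m
    using T0 lam by (auto simp: \<tau>_def power_le_one mult_left_le_one_le mult_le_cancel_left)
  define d where "d m = T0 * lam ^ m * (1 - lam) / 2" for m
  have d: "d m > 0" "\<tau> m = \<tau> (Suc m) + 2 * d m" for m
    using T0 lam by (auto simp: d_def \<tau>_def field_simps)
  show ?thesis
  proof (intro exI[of _ "K\<^sup>2 * C / w 0"] conjI ballI)
    show "0 < K\<^sup>2 * C / w 0" using K(1) C w(1)[of 0] by simp
    fix g assume g: "g \<in> L2_space M"
    define G where "G m = (L2_norm M (S (\<tau> m) g))\<^sup>2" for m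
    define F where "F t = (L2_norm (restrict_space M A) (S t g))\<^sup>2" for t
    have Fc: "continuous_on {0..T} F"
      unfolding F_def L2_norm_restrict_space[OF A] by (intro continuous_intros semigroup_norm_continuous[OF S g A])
    have F0: "0 \<le> F t" for t by (simp add: F_def)
    have Fi: "F integrable_on {u..v}" if "0 \<le> u" "v \<le> T" for u v
      by (rule integrable_continuous_interval[OF continuous_on_subset[OF Fc]]) (use that in auto)
    have step: "w m * G m - w (Suc m) * G (Suc m) \<le> (w m * (c1 * (a\<^sup>2) ^ N m)) * F t"
      if t: "t \<in> {\<tau> (Suc m) + d m..\<tau> m}" for m t
    proof -
      let ?s = "t - \<tau> (Suc m)" and ?g = "S (\<tau> (Suc m)) g"
      have s: "d m \<le> ?s" "0 < ?s" "?s \<le> 1" using t d(1)[of m] \<tau>[of m] \<tau>(1)[of "Suc m"] T0 by auto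
      have t0: "0 \<le> t" "t \<le> \<tau> m" "\<tau> (Suc m) \<le> t" using t d(1)[of m] \<tau>(1)[of "Suc m"] by auto
      have gL: "?g \<in> L2_space M" using SL[OF less_imp_le[OF \<tau>(1)] g] .
      let ?x = "L2_norm (restrict_space M A) (S t g)" and ?y = "L2_norm M ?g"
      have eq: "L2_norm (restrict_space M A) (S ?s ?g) = ?x" "L2_norm M (S ?s ?g) = L2_norm M (S t g)"
        unfolding L2_norm_restrict_space[OF A]
        using semigroup_compose[OF S g less_imp_le[OF \<tau>(1)] t0(3) A] by simp_all
      have ex: "exp (C2 / ?s ^ k) \<le> exp (C2 / d m ^ k)"
        using s d(1)[of m] C2 by (auto intro!: divide_left_mono power_mono mult_pos_pos)
      have "L2_norm M (S t g) \<le> C1 * a ^ N m * ?x + C1 * (1/2) ^ N m * exp (C2 / ?s ^ k) * ?y"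
        using ineq[OF s(2,3) N gL] unfolding eq .
      also have "\<dots> \<le> C1 * a ^ N m * ?x + C1 * (1/2) ^ N m * exp (C2 / d m ^ k) * ?y"
        using ex C1 by (intro add_left_mono mult_right_mono mult_left_mono) auto
      finally have 1: "L2_norm M (S t g) \<le> C1 * a ^ N m * ?x + C1 * (1/2) ^ N m * exp (C2 / d m ^ k) * ?y" .
      have "L2_norm M (S (\<tau> m) g) = L2_norm M (S (\<tau> m - t) (S t g))"
        using semigroup_compose(2)[OF S g t0(1,2) A] .
      also have "\<dots> \<le> K * L2_norm M (S t g)"
        by (rule K(2)) (use t0 \<tau>(2)[of m] T0 SL[OF t0(1) g] in auto)
      also have "\<dots> \<le> K * (C1 * a ^ N m * ?x + C1 * (1/2) ^ N m * exp (C2 / d m ^ k) * ?y)"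
        by (rule mult_left_mono[OF 1]) (use K(1) in simp)
      finally have "G m \<le> (K * (C1 * a ^ N m * ?x + C1 * (1/2) ^ N m * exp (C2 / d m ^ k) * ?y))\<^sup>2"
        unfolding G_def by (intro power_mono) auto
      also have "\<dots> \<le> K\<^sup>2 * (2 * (C1 * a ^ N m * ?x)\<^sup>2 + 2 * (C1 * (1/2) ^ N m * exp (C2 / d m ^ k) * ?y)\<^sup>2)"
      proof -
        have "(u + v)\<^sup>2 \<le> 2 * u\<^sup>2 + 2 * v\<^sup>2" for u v :: real
          using zero_le_power2[of "u - v"] unfolding power2_sum power2_diff by linarith
        then show ?thesis unfolding power_mult_distrib[of K] by (intro mult_left_mono) auto
      qed
      also have "\<dots> = (c1 * (a\<^sup>2) ^ N m) * F t + (c1 * (1/4) ^ N m * exp (2 * C2 / d m ^ k)) * G (Suc m)"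
      proof -
        have e1: "(C1 * a ^ N m * ?x)\<^sup>2 = C1\<^sup>2 * (a\<^sup>2) ^ N m * F t"
          by (simp only: power_mult_distrib F_def power_mult[symmetric] mult.commute[of 2])
        have "((1/2::real) ^ N m)\<^sup>2 = (1/4) ^ N m"
          unfolding power_mult[symmetric] mult.commute[of _ 2] unfolding power_mult by (simp add: power2_eq_square)
        moreover have "(exp (C2 / d m ^ k))\<^sup>2 = exp (2 * C2 / d m ^ k)" by (simp add: exp_double[symmetric])
        ultimately have e2: "(C1 * (1/2) ^ N m * exp (C2 / d m ^ k) * ?y)\<^sup>2 = C1\<^sup>2 * (1/4) ^ N m * exp (2 * C2 / d m ^ k) * G (Suc m)"
          by (simp only: power_mult_distrib G_def)
        show ?thesis unfolding e1 e2 c1_def by (simp add: algebra_simps)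
      qed
      finally have "w m * G m \<le> w m * ((c1 * (a\<^sup>2) ^ N m) * F t + (c1 * (1/4) ^ N m * exp (2 * C2 / d m ^ k)) * G (Suc m))"
        by (rule mult_left_mono) (use w(1)[of m] in simp)
      also have "\<dots> = (w m * (c1 * (a\<^sup>2) ^ N m)) * F t + (w m * (c1 * (1/4) ^ N m * exp (2 * C2 / d m ^ k))) * G (Suc m)"
        by (simp only: distrib_left mult.assoc)
      also have "(w m * (c1 * (1/4) ^ N m * exp (2 * C2 / d m ^ k))) * G (Suc m) \<le> w (Suc m) * G (Suc m)"
        by (rule mult_right_mono[OF par2[of m, folded d_def]]) (simp add: G_def)
      finally show ?thesis by linarith
    qed
    \<comment> \<open>Integration of \<open>step\<close> over a set of length \<open>d m\<close>
      gives a factor \<open>d m\<close> on the left; \<open>par1\<close> provides the same factor on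
      the right.\<close>
    have piece: "w m * G m - w (Suc m) * G (Suc m) \<le> C * integral {\<tau> (Suc m)..\<tau> m} F" for m
    proof -
      let ?p = "\<tau> (Suc m) + d m" and ?b = "w m * (c1 * (a\<^sup>2) ^ N m)"
      have b: "0 \<le> ?b" using w(1)[of m] c1 by (intro mult_nonneg_nonneg) auto
      have p: "0 \<le> ?p" "\<tau> m \<le> T" using \<tau>(1)[of "Suc m"] \<tau>(2)[of m] d(1)[of m] T0 by auto
      have Fp: "F integrable_on {?p..\<tau> m}" by (rule Fi[OF p])
      have "integral {?p..\<tau> m} (\<lambda>t. w m * G m - w (Suc m) * G (Suc m)) \<le> integral {?p..\<tau> m} (\<lambda>t. ?b * F t)"
        by (rule integral_le[OF _ integrable_on_mult_right[OF Fp] step]) auto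
      then have "d m * (w m * G m - w (Suc m) * G (Suc m)) \<le> ?b * integral {?p..\<tau> m} F"
        using d(1)[of m] d(2)[of m] by simp
      also have "\<dots> \<le> ?b * integral {\<tau> (Suc m)..\<tau> m} F"
        using b d(1)[of m] \<tau>(1)[of "Suc m"] p Fp
        by (intro mult_left_mono integral_subset_le Fi) (auto simp: F0)
      also have "\<dots> \<le> (C * d m) * integral {\<tau> (Suc m)..\<tau> m} F"
        by (rule mult_right_mono[OF par1[of m, folded d_def]]) (use F0 \<tau>(1)[of "Suc m"] p in \<open>auto intro!: integral_nonneg Fi\<close>)
      finally have "d m * (w m * G m - w (Suc m) * G (Suc m)) \<le> d m * (C * integral {\<tau> (Suc m)..\<tau> m} F)" by (simp only: mult_ac)
      then show ?thesis using d(1)[of m] by (rule mult_left_le_imp_le)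
    qed
    have tele: "w 0 * G 0 \<le> C * integral {\<tau> n..\<tau> 0} F + w n * G n \<and> \<tau> n \<le> \<tau> 0" for n
    proof (induction n)
      case (Suc n)
      have "integral {\<tau> (Suc n)..\<tau> n} F + integral {\<tau> n..\<tau> 0} F = integral {\<tau> (Suc n)..\<tau> 0} F"
        using Suc \<tau>[of n] \<tau>(1)[of "Suc n"] \<tau>(2)[of 0] T0 by (intro Henstock_Kurzweil_Integration.integral_combine Fi) auto
      then have "C * integral {\<tau> (Suc n)..\<tau> 0} F = C * integral {\<tau> (Suc n)..\<tau> n} F + C * integral {\<tau> n..\<tau> 0} F"
        by (simp only: distrib_left[symmetric])
      then show ?case using Suc piece[of n] \<tau>(3)[of n] by linarith
    qed simp
    \<comment> \<open>As n grows, \<open>G n\<close> stays bounded by the local bound and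
      \<open>w n\<close> tends to 0, so the remainder of the telescoping sum disappears.\<close>
    have main: "w 0 * G 0 \<le> C * integral {0..T} F"
    proof (rule field_le_epsilon)
      fix e :: real assume e: "e > 0"
      let ?B = "(K * L2_norm M g)\<^sup>2"
      have "(\<lambda>n. w n * ?B) \<longlonglongrightarrow> 0 * ?B" by (intro tendsto_intros w(2))
      then have "eventually (\<lambda>n. w n * ?B < e) sequentially" using e by (intro order_tendstoD(2)) auto
      then obtain n where n: "w n * ?B < e" by (auto simp: eventually_sequentially)
      have "G n \<le> ?B"
        unfolding G_def by (intro power_mono K(2) g) (use \<tau>(1,2)[of n] T0 in auto)
      then have "w n * G n \<le> w n * ?B" using w(1)[of n] by (intro mult_left_mono) auto
      moreover have "C * integral {\<tau> n..\<tau> 0} F \<le> C * integral {0..T} F"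
        using C \<tau>(1)[of n] \<tau>(2)[of 0] T0 by (intro mult_left_mono integral_subset_le Fi) (auto simp: F0)
      ultimately show "w 0 * G 0 \<le> C * integral {0..T} F + e" using tele[of n] n by linarith
    qed
    have \<tau>0: "\<tau> 0 = T0" by (simp add: \<tau>_def)
    have "L2_norm M (S T g) = L2_norm M (S (T - T0) (S T0 g))"
      using semigroup_compose(2)[OF S g _ T0(3) A] T0 by simp
    also have "\<dots> \<le> K * L2_norm M (S T0 g)" by (rule K(2)) (use T0 SL g in auto)
    finally have "(L2_norm M (S T g))\<^sup>2 \<le> (K * L2_norm M (S T0 g))\<^sup>2" by (intro power_mono) auto
    also have "\<dots> = K\<^sup>2 * G 0" by (simp add: G_def \<tau>0 power_mult_distrib)
    also have "\<dots> \<le> K\<^sup>2 * (C * integral {0..T} F / w 0)"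
      using main w(1)[of 0] by (intro mult_left_mono) (auto simp: pos_le_divide_eq mult.commute)
    also have "integral {0..T} F = (LBINT t:{0..T}. F t)"
      by (rule set_borel_integral_eq_integral(2)[OF borel_integrable_atLeastAtMost'[OF Fc], symmetric])
    finally show "(L2_norm M (S T g))\<^sup>2 \<le> K\<^sup>2 * C / w 0 * (LBINT t:{0..T}. (L2_norm (restrict_space M A) (S t g))\<^sup>2)"
      by (simp add: F_def)
  qed
qed

theorem corollary1p9:
  fixes Q B :: "real^'n^'n"
    and S :: "real \<Rightarrow> (real^'n \<Rightarrow> complex) \<Rightarrow> (real^'n \<Rightarrow> complex)"
    and T :: real
    and \<omega> :: "(real^'n) set"
  assumes "sym_pos_semidef Q"
    and "rank (kalman_matrix Q B) = CARD('n)"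
    and "matrix_spectrum B \<subseteq> {z. Re z < 0}"
    and "strongly_continuous_semigroup (weighted_measure Q B) S"
    and "infinitesimal_generator (weighted_measure Q B) S = fokker_planck_operator Q B"
    and "T > 0"
    and "open \<omega>"
    and "\<exists>\<delta>>0. \<exists>r>0. \<forall>y. \<exists>y'\<in>\<omega>. ball y' r \<subseteq> \<omega> \<and> norm (y - y') < \<delta>"
  shows "\<exists>C>0. \<forall>g\<in>L2_space (weighted_measure Q B).
    (L2_norm (weighted_measure Q B) (S T g))\<^sup>2
      \<le> C * (LBINT t:{0..T}. (L2_norm (restrict_space (weighted_measure Q B) \<omega>) (S t g))\<^sup>2)"
proof -
  interpret fokker_planck Q B using assms(1-3) by unfold_locales
  obtain \<delta> r where "\<delta> > 0" "r > 0" "\<And>y. \<exists>y'\<in>\<omega>. ball y' r \<subseteq> \<omega> \<and> norm (y - y') < \<delta>" using assms(8) by blast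
  from single_time_observability[OF assms(4,5,7) this]
  obtain a C1 C2 k where "a > 1" "C1 \<ge> 1" "C2 \<ge> 1"
    "\<And>t N g. 0 < t \<Longrightarrow> t \<le> 1 \<Longrightarrow> N > 0 \<Longrightarrow> g \<in> L2_space W \<Longrightarrow>
      L2_norm W (S t g) \<le> C1 * a ^ N * L2_norm (restrict_space W \<omega>) (S t g) + C1 * (1/2) ^ N * exp (C2 / t ^ k) * L2_norm W g"
    by metis
  moreover have "\<omega> \<in> sets W" using assms(7) by (simp add: sets_W)
  ultimately show ?thesis using observability_from_single_time[OF assms(4) _ assms(6)] by blast
qed

end
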